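(* Let $n\ge 2$ and let $M=(M^{4n-2},J)$ be the Bigalke--Rollenske manifold, i.e. the compact complex nilmanifold of complex dimension $4n-2$ defined in the context. Then: 1) $M$ does not admit any geometrically-Bott-Chern-formal Hermitian metric; 2) $M$ has no astheno-Kähler metrics; 3) the Kodaira dimension of $M$ is $\kappa^J(M)=0$.
   Context: Bigalke--Rollenske manifold. For $n\ge 2$ let $G_n\subset GL(2n+2;\mathbb{C})$ be the real nilpotent Lie group of upper triangular matrices with $1$'s on the diagonal, depending on parameters $x_1,\dots,x_{n-1},y_1,\dots,y_n,z_1,\dots,z_{n-1},w_1,\dots,w_n\in\mathbb{C}$, whose only possibly nonzero off-diagonal entries are: row $1$: $\bar y_1$ in column $2n+1$ and $w_1$ in column $2n+2$; row $i+1$ ($1\le i\le n-1$): $\bar z_i$ in column $n+i$, $-x_i$ in column $n+i+1$, $w_{i+1}$ in column $2n+2$; row $n+k$ ($1\le k\le n$): $y_k$ in column $2n+2$; row $2n+1$: $z_1$ in column $2n+2$. Let $\Gamma=G_n\cap GL(2n+2;\mathbb{Z}[\sqrt{-1}])$, a lattice in $G_n$, and $M^{4n-2}=\Gamma\backslash G_n$. The complex-valued $1$-forms $\phi^i=dx_i$ ($1\le i\le n-1$), $\phi^{n-1+i}=dy_i$ ($1\le i\le n$), $\phi^{2n-1+i}=dz_i$ ($1\le i\le n-1$), $\phi^{3n-1}=dw_1-\bar y_1dz_1$, $\phi^{3n-1+i}=dw_{i+1}-\bar z_i\,dy_i+x_i\,dy_{i+1}$ ($1\le i\le n-1$) are left-invariant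 on $G_n$ and satisfy $d\phi^j=0$ for $1\le j\le 3n-2$, $d\phi^{3n-1}=\phi^{2n}\wedge\bar\phi^{n}$, and $d\phi^j=\phi^{j-3n+1}\wedge\phi^{j-2n+1}+\phi^{j-2n}\wedge\bar\phi^{j-n}$ for $3n\le j\le 4n-2$. $J$ is the (integrable) left-invariant complex structure on $M^{4n-2}$ whose $(1,0)$-forms are spanned by $\phi^1,\dots,\phi^{4n-2}$. Geometrically-Bott-Chern-formal metrics. On a compact complex manifold $X$ of complex dimension $N$ with Hermitian metric $g$, let $*:\mathcal{A}^{p,q}(X)\to\mathcal{A}^{N-p,N-q}(X)$ be the $\mathbb{C}$-antilinear Hodge star operator. A $(p,q)$-form $\alpha$ is Bott--Chern harmonic with respect to $g$ if $\partial\alpha=0$, $\bar\partial\alpha=0$ and $\partial\bar\partial{*}\alpha=0$ (equivalently, it lies in the kernel of the Bott--Chern Laplacian). The metric $g$ is geometrically-Bott-Chern-formal if the space $\bigoplus_{p,q}\mathcal{H}^{p,q}_{\Delta_{BC}}(X)$ of Bott--Chern harmonic forms is closed under the wedge product. Astheno-Kähler metrics. A Hermitian metric with fundamental form $\omega(U,V)=g(JU,V)$ on a complex manifold of complex dimension $N$ is astheno-Kähler if $\partial\bar\partial\,\omega^{N-2}=0$. Kodaira dimension. For a complex manifold $(X,J)$ of complex dimension $N$, with canonical bundle $\Lambda^{N,0}(X)$, put $P_r(X,J)=\dim H^0(X,(\Lambda^{N,0}(X))^{\otimes r})$ (holomorphic sections); $\kappa^J(X)=-\infty$ if $P_r(X,J)=0$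 for all $r\ge1$, and $\kappa^J(X)=\limsup_{r\to\infty}\frac{\log P_r(X,J)}{\log r}$ otherwise. *)

theory Defs
  imports
    "HOL-Analysis.Analysis"
    "HOL-Library.Function_Algebras"
    "Jordan_Normal_Form.Matrix"
begin

section \<open>Complex-valued exterior algebra of a real vector space\<close>

text \<open>
  A (possibly inhomogeneous) complex-valued exterior form on a real vector space is a function on
  lists of vectors: its value on lists of length \<open>k\<close> is its component of degree \<open>k\<close>.
  Forms and form fields are added pointwise, through the function space instances of
  \<^theory>\<open>HOL-Library.Function_Algebras\<close>.
\<close>

type_synonym 'a ext_form = "'a list \<Rightarrow> complex"

definition ext_form :: "'a::real_vector ext_form \<Rightarrow> bool" where
  "ext_form \<alpha> \<longleftrightarrow>
     (\<forall>vs. \<forall>i<length vs. linear (\<lambda>v. \<alpha> (vs[i := v]))) \<and>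
     (\<forall>vs. \<not> distinct vs \<longrightarrow> \<alpha> vs = 0)"

definition form_scale :: "complex \<Rightarrow> 'a ext_form \<Rightarrow> 'a ext_form" where
  "form_scale c \<alpha> = (\<lambda>vs. c * \<alpha> vs)"

text \<open>The sign of the shuffle of \<open>{..<n}\<close> that lists first \<open>I\<close>, then its complement, both
  increasingly.\<close>

definition shuffle_sign :: "nat \<Rightarrow> nat set \<Rightarrow> complex" where
  "shuffle_sign n I = (- 1) ^ card {(i, j). i \<in> I \<and> j \<in> {..<n} - I \<and> j < i}"

text \<open>The wedge product by shuffles, i.e. normalised so that
  \<open>(a \<and> b)(u, v) = a(u) b(v) - a(v) b(u)\<close> for covectors.\<close>

definition wedge :: "'a ext_form \<Rightarrow> 'a ext_form \<Rightarrow> 'a ext_form" where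
  "wedge \<alpha> \<beta> = (\<lambda>vs. \<Sum>I\<in>Pow {..<length vs}.
     shuffle_sign (length vs) I * \<alpha> (nths vs I) * \<beta> (nths vs (- I)))"

definition unit_form :: "'a ext_form" where
  "unit_form = (\<lambda>vs. if vs = [] then 1 else 0)"

definition one_form :: "('a \<Rightarrow> complex) \<Rightarrow> 'a ext_form" where
  "one_form a = (\<lambda>vs. case vs of [v] \<Rightarrow> a v | _ \<Rightarrow> 0)"

definition wedge_list :: "'a ext_form list \<Rightarrow> 'a ext_form" where
  "wedge_list \<alpha>s = foldr wedge \<alpha>s unit_form"

section \<open>Bidegree with respect to an almost complex structure\<close>

text \<open>Here \<open>J\<close> is a complex structure on one tangent space.\<close>

definition covectors10 :: "('a::real_vector \<Rightarrow> 'a) \<Rightarrow> ('a \<Rightarrow> complex) set" where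
  "covectors10 J = {a. linear a \<and> (\<forall>v. a (J v) = \<i> * a v)}"

definition covectors01 :: "('a::real_vector \<Rightarrow> 'a) \<Rightarrow> ('a \<Rightarrow> complex) set" where
  "covectors01 J = {a. linear a \<and> (\<forall>v. a (J v) = - \<i> * a v)}"

definition pq_covectors :: "('a::real_vector \<Rightarrow> 'a) \<Rightarrow> nat \<Rightarrow> nat \<Rightarrow> 'a ext_form set" where
  "pq_covectors J p q = module.span form_scale
     {wedge_list (map one_form (as @ bs)) | as bs.
        length as = p \<and> set as \<subseteq> covectors10 J \<and> length bs = q \<and> set bs \<subseteq> covectors01 J}"

abbreviation cdim :: "'a::euclidean_space itself \<Rightarrow> nat" where
  "cdim T \<equiv> DIM('a) div 2"

text \<open>The \<open>(p,q)\<close>-component of a form.\<close>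

definition pq_part :: "('a::euclidean_space \<Rightarrow> 'a) \<Rightarrow> nat \<Rightarrow> nat \<Rightarrow> 'a ext_form \<Rightarrow> 'a ext_form" where
  "pq_part J p q \<alpha> = (THE \<beta>. \<exists>c. (\<forall>r s. c r s \<in> pq_covectors J r s) \<and>
     \<alpha> = (\<Sum>r\<le>cdim TYPE('a). \<Sum>s\<le>cdim TYPE('a). c r s) \<and> \<beta> = c p q)"

section \<open>Differential forms on a quotient manifold\<close>

text \<open>
  The manifold is \<open>X = D \ 'a\<close>, where \<open>'a\<close> is a Euclidean space (used as a global chart) and \<open>D\<close> a
  set of diffeomorphisms of \<open>'a\<close>, the deck group.  Objects on \<open>X\<close> (functions, forms, metrics,
  complex structures, sections of tensor bundles) are identified, by pulling back along the
  covering \<open>'a \<rightarrow> X\<close>, with the \<open>D\<close>-invariant objects on \<open>'a\<close>.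
\<close>

primrec Ck_on :: "nat \<Rightarrow> 'a::real_normed_vector set \<Rightarrow> ('a \<Rightarrow> 'b::real_normed_vector) \<Rightarrow> bool" where
  "Ck_on 0 S f \<longleftrightarrow> continuous_on S f"
| "Ck_on (Suc k) S f \<longleftrightarrow> (\<forall>p\<in>S. f differentiable at p) \<and>
     (\<forall>v. Ck_on k S (\<lambda>p. frechet_derivative f (at p) v))"

text \<open>Only meant for open \<open>S\<close>.\<close>

definition smooth_on :: "'a::real_normed_vector set \<Rightarrow> ('a \<Rightarrow> 'b::real_normed_vector) \<Rightarrow> bool" where
  "smooth_on S f \<longleftrightarrow> (\<forall>k. Ck_on k S f)"

type_synonym 'a form_field = "'a \<Rightarrow> 'a ext_form"

definition smooth_form_on :: "'a::euclidean_space set \<Rightarrow> 'a form_field \<Rightarrow> bool" where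
  "smooth_form_on S \<alpha> \<longleftrightarrow> (\<forall>p\<in>S. ext_form (\<alpha> p)) \<and> (\<forall>vs. smooth_on S (\<lambda>p. \<alpha> p vs))"

definition pq_forms ::
  "('a::euclidean_space \<Rightarrow> 'a) set \<Rightarrow> ('a \<Rightarrow> 'a \<Rightarrow> 'a) \<Rightarrow> nat \<Rightarrow> nat \<Rightarrow> 'a form_field set" where
  "pq_forms D J p q = {\<alpha>. smooth_form_on UNIV \<alpha> \<and> (\<forall>x. \<alpha> x \<in> pq_covectors (J x) p q) \<and>
     (\<forall>\<gamma>\<in>D. \<forall>x vs. \<alpha> (\<gamma> x) (map (frechet_derivative \<gamma> (at x)) vs) = \<alpha> x vs)}"

text \<open>The exterior derivative; the usual terms with Lie brackets are absent because it is evaluated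
  on constant vector fields of the chart.\<close>

definition ext_deriv :: "'a::euclidean_space form_field \<Rightarrow> 'a form_field" where
  "ext_deriv \<alpha> = (\<lambda>x vs. \<Sum>i<length vs. (- 1) ^ i *
     frechet_derivative (\<lambda>y. \<alpha> y (take i vs @ drop (Suc i) vs)) (at x) (vs ! i))"

definition dolbeault ::
  "('a::euclidean_space \<Rightarrow> 'a \<Rightarrow> 'a) \<Rightarrow> 'a form_field \<Rightarrow> 'a form_field" where
  "dolbeault J \<alpha> = (\<lambda>x. \<Sum>p\<le>cdim TYPE('a). \<Sum>q\<le>cdim TYPE('a).
     pq_part (J x) (Suc p) q (ext_deriv (\<lambda>y. pq_part (J y) p q (\<alpha> y)) x))"

definition dolbeault_bar ::
  "('a::euclidean_space \<Rightarrow> 'a \<Rightarrow> 'a) \<Rightarrow> 'a form_field \<Rightarrow> 'a form_field" where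
  "dolbeault_bar J \<alpha> = (\<lambda>x. \<Sum>p\<le>cdim TYPE('a). \<Sum>q\<le>cdim TYPE('a).
     pq_part (J x) p (Suc q) (ext_deriv (\<lambda>y. pq_part (J y) p q (\<alpha> y)) x))"

section \<open>Hermitian metrics\<close>

definition hermitian_metric ::
  "('a::euclidean_space \<Rightarrow> 'a) set \<Rightarrow> ('a \<Rightarrow> 'a \<Rightarrow> 'a) \<Rightarrow> ('a \<Rightarrow> 'a \<Rightarrow> 'a \<Rightarrow> real) \<Rightarrow> bool" where
  "hermitian_metric D J g \<longleftrightarrow>
     (\<forall>x. bilinear (g x)) \<and>
     (\<forall>x u v. g x u v = g x v u) \<and>
     (\<forall>x u. u \<noteq> 0 \<longrightarrow> g x u u > 0) \<and>
     (\<forall>x u v. g x (J x u) (J x v) = g x u v) \<and>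
     (\<forall>u v. smooth_on UNIV (\<lambda>x. g x u v)) \<and>
     (\<forall>\<gamma>\<in>D. \<forall>x u v.
        g (\<gamma> x) (frechet_derivative \<gamma> (at x) u) (frechet_derivative \<gamma> (at x) v) = g x u v)"

text \<open>In this part \<open>J\<close> and \<open>G\<close> are a complex structure and a compatible inner product on one
  tangent space.\<close>

definition fundamental_form :: "('a \<Rightarrow> 'a) \<Rightarrow> ('a \<Rightarrow> 'a \<Rightarrow> real) \<Rightarrow> 'a ext_form" where
  "fundamental_form J G = (\<lambda>vs. case vs of [u, v] \<Rightarrow> complex_of_real (G (J u) v) | _ \<Rightarrow> 0)"

definition wedge_power :: "'a ext_form \<Rightarrow> nat \<Rightarrow> 'a ext_form" where
  "wedge_power \<alpha> k = wedge_list (replicate k \<alpha>)"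

definition volume_form :: "('a::euclidean_space \<Rightarrow> 'a) \<Rightarrow> ('a \<Rightarrow> 'a \<Rightarrow> real) \<Rightarrow> 'a ext_form" where
  "volume_form J G = form_scale (1 / fact (cdim TYPE('a)))
     (wedge_power (fundamental_form J G) (cdim TYPE('a)))"

definition orthonormal_frame :: "('a::euclidean_space \<Rightarrow> 'a \<Rightarrow> real) \<Rightarrow> 'a list \<Rightarrow> bool" where
  "orthonormal_frame G es \<longleftrightarrow> length es = DIM('a) \<and>
     (\<forall>i<DIM('a). \<forall>j<DIM('a). G (es ! i) (es ! j) = (if i = j then 1 else 0))"

text \<open>The Hermitian inner product induced by \<open>G\<close> on complex-valued forms (linear in the first
  argument); it does not depend on the orthonormal frame.\<close>

definition form_inner ::
  "('a::euclidean_space \<Rightarrow> 'a \<Rightarrow> real) \<Rightarrow> 'a ext_form \<Rightarrow> 'a ext_form \<Rightarrow> complex" where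
  "form_inner G \<alpha> \<beta> = (let es = (SOME es. orthonormal_frame G es) in
     \<Sum>I\<in>Pow {..<DIM('a)}. \<alpha> (nths es I) * cnj (\<beta> (nths es I)))"

text \<open>The antilinear Hodge star, determined by \<open>\<psi> \<and> *\<alpha> = \<langle>\<psi>, \<alpha>\<rangle> vol\<close>; only the components of top
  degree are compared because \<open>\<psi>\<close> and \<open>\<alpha>\<close> may be inhomogeneous.\<close>

definition hodge_star ::
  "('a::euclidean_space \<Rightarrow> 'a) \<Rightarrow> ('a \<Rightarrow> 'a \<Rightarrow> real) \<Rightarrow> 'a ext_form \<Rightarrow> 'a ext_form" where
  "hodge_star J G \<alpha> = (THE \<beta>. ext_form \<beta> \<and>
     (\<forall>\<psi> vs. ext_form \<psi> \<and> length vs = DIM('a) \<longrightarrow>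
        wedge \<psi> \<beta> vs = form_inner G \<psi> \<alpha> * volume_form J G vs))"

definition bc_harmonic ::
  "('a::euclidean_space \<Rightarrow> 'a) set \<Rightarrow> ('a \<Rightarrow> 'a \<Rightarrow> 'a) \<Rightarrow> ('a \<Rightarrow> 'a \<Rightarrow> 'a \<Rightarrow> real) \<Rightarrow>
     nat \<Rightarrow> nat \<Rightarrow> 'a form_field set" where
  "bc_harmonic D J g p q = {\<alpha> \<in> pq_forms D J p q.
     dolbeault J \<alpha> = 0 \<and> dolbeault_bar J \<alpha> = 0 \<and>
     dolbeault J (dolbeault_bar J (\<lambda>x. hodge_star (J x) (g x) (\<alpha> x))) = 0}"

definition bc_harmonic_space ::
  "('a::euclidean_space \<Rightarrow> 'a) set \<Rightarrow> ('a \<Rightarrow> 'a \<Rightarrow> 'a) \<Rightarrow> ('a \<Rightarrow> 'a \<Rightarrow> 'a \<Rightarrow> real) \<Rightarrow>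
     'a form_field set" where
  "bc_harmonic_space D J g =
     {\<Sum>p\<le>cdim TYPE('a). \<Sum>q\<le>cdim TYPE('a). h p q | h. \<forall>p q. h p q \<in> bc_harmonic D J g p q}"

definition geometrically_bc_formal ::
  "('a::euclidean_space \<Rightarrow> 'a) set \<Rightarrow> ('a \<Rightarrow> 'a \<Rightarrow> 'a) \<Rightarrow> ('a \<Rightarrow> 'a \<Rightarrow> 'a \<Rightarrow> real) \<Rightarrow> bool" where
  "geometrically_bc_formal D J g \<longleftrightarrow>
     (\<forall>\<alpha>\<in>bc_harmonic_space D J g. \<forall>\<beta>\<in>bc_harmonic_space D J g.
        (\<lambda>x. wedge (\<alpha> x) (\<beta> x)) \<in> bc_harmonic_space D J g)"

definition astheno_kaehler ::
  "('a::euclidean_space \<Rightarrow> 'a \<Rightarrow> 'a) \<Rightarrow> ('a \<Rightarrow> 'a \<Rightarrow> 'a \<Rightarrow> real) \<Rightarrow> bool" where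
  "astheno_kaehler J g \<longleftrightarrow>
     dolbeault J (dolbeault_bar J
       (\<lambda>x. wedge_power (fundamental_form (J x) (g x)) (cdim TYPE('a) - 2))) = 0"

section \<open>Kodaira dimension\<close>

text \<open>
  An element of the \<open>r\<close>-th tensor power of the line of \<open>(N,0)\<close>-forms at a point is a function on
  lists of \<open>r\<close> lists of vectors.
\<close>

type_synonym 'a pluri_section = "'a \<Rightarrow> 'a list list \<Rightarrow> complex"

definition tensor_power :: "nat \<Rightarrow> 'a ext_form \<Rightarrow> 'a list list \<Rightarrow> complex" where
  "tensor_power r \<sigma> = (\<lambda>Vs. if length Vs = r then prod_list (map \<sigma> Vs) else 0)"

definition holomorphic_fun_on ::
  "('a::euclidean_space \<Rightarrow> 'a \<Rightarrow> 'a) \<Rightarrow> 'a set \<Rightarrow> ('a \<Rightarrow> complex) \<Rightarrow> bool" where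
  "holomorphic_fun_on J U f \<longleftrightarrow> smooth_on U f \<and>
     (\<forall>x\<in>U. dolbeault_bar J (\<lambda>y. form_scale (f y) unit_form) x = 0)"

definition canonical_frame_on ::
  "('a::euclidean_space \<Rightarrow> 'a \<Rightarrow> 'a) \<Rightarrow> 'a set \<Rightarrow> 'a form_field \<Rightarrow> bool" where
  "canonical_frame_on J U \<sigma> \<longleftrightarrow> smooth_form_on U \<sigma> \<and>
     (\<forall>x\<in>U. \<sigma> x \<in> pq_covectors (J x) (cdim TYPE('a)) 0 \<and> \<sigma> x \<noteq> 0 \<and> dolbeault_bar J \<sigma> x = 0)"

definition pluricanonical_sections ::
  "('a::euclidean_space \<Rightarrow> 'a) set \<Rightarrow> ('a \<Rightarrow> 'a \<Rightarrow> 'a) \<Rightarrow> nat \<Rightarrow> 'a pluri_section set" where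
  "pluricanonical_sections D J r = {s.
     (\<forall>x. \<exists>U \<sigma> f. open U \<and> x \<in> U \<and> canonical_frame_on J U \<sigma> \<and> holomorphic_fun_on J U f \<and>
        (\<forall>y\<in>U. \<forall>Vs. s y Vs = f y * tensor_power r (\<sigma> y) Vs)) \<and>
     (\<forall>\<gamma>\<in>D. \<forall>x Vs. s (\<gamma> x) (map (map (frechet_derivative \<gamma> (at x))) Vs) = s x Vs)}"

definition section_scale :: "complex \<Rightarrow> 'a pluri_section \<Rightarrow> 'a pluri_section" where
  "section_scale c s = (\<lambda>x Vs. c * s x Vs)"

definition plurigenus ::
  "('a::euclidean_space \<Rightarrow> 'a) set \<Rightarrow> ('a \<Rightarrow> 'a \<Rightarrow> 'a) \<Rightarrow> nat \<Rightarrow> enat" where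
  "plurigenus D J r =
     (if \<exists>B. finite B \<and> pluricanonical_sections D J r \<subseteq> module.span section_scale B
      then enat (vector_space.dim section_scale (pluricanonical_sections D J r)) else \<infinity>)"

definition ln_enat :: "enat \<Rightarrow> ereal" where
  "ln_enat m = (case m of enat k \<Rightarrow> if k = 0 then - \<infinity> else ereal (ln (real k)) | \<infinity> \<Rightarrow> \<infinity>)"

definition kodaira_dimension ::
  "('a::euclidean_space \<Rightarrow> 'a) set \<Rightarrow> ('a \<Rightarrow> 'a \<Rightarrow> 'a) \<Rightarrow> ereal" where
  "kodaira_dimension D J =
     (if \<forall>r\<ge>1. plurigenus D J r = 0 then - \<infinity>
      else limsup (\<lambda>r. ln_enat (plurigenus D J r) / ereal (ln (real r))))"

section \<open>The Bigalke--Rollenske manifold\<close>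

text \<open>
  The chart of \<open>G\<^sub>n\<close> is \<open>complex^'d\<close> with \<open>CARD('d) = 4n - 2\<close>; \<open>ix\<close> enumerates \<open>'d\<close> by
  \<open>{1..4n-2}\<close> and the parameters are taken in the order
  \<open>x\<^sub>1,\<dots>,x\<^sub>n\<^sub>-\<^sub>1, y\<^sub>1,\<dots>,y\<^sub>n, z\<^sub>1,\<dots>,z\<^sub>n\<^sub>-\<^sub>1, w\<^sub>1,\<dots>,w\<^sub>n\<close>.
\<close>

definition br_x :: "(nat \<Rightarrow> 'd::finite) \<Rightarrow> nat \<Rightarrow> complex^'d \<Rightarrow> complex" where
  "br_x ix i v = vec_nth v (ix i)"

definition br_y :: "nat \<Rightarrow> (nat \<Rightarrow> 'd::finite) \<Rightarrow> nat \<Rightarrow> complex^'d \<Rightarrow> complex" where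
  "br_y n ix i v = vec_nth v (ix (n - 1 + i))"

definition br_z :: "nat \<Rightarrow> (nat \<Rightarrow> 'd::finite) \<Rightarrow> nat \<Rightarrow> complex^'d \<Rightarrow> complex" where
  "br_z n ix i v = vec_nth v (ix (2 * n - 1 + i))"

definition br_w :: "nat \<Rightarrow> (nat \<Rightarrow> 'd::finite) \<Rightarrow> nat \<Rightarrow> complex^'d \<Rightarrow> complex" where
  "br_w n ix i v = vec_nth v (ix (3 * n - 2 + i))"

text \<open>Rows and columns are counted from 1 here, and from 0 in the matrix.\<close>

definition br_entry ::
  "nat \<Rightarrow> (nat \<Rightarrow> 'd::finite) \<Rightarrow> complex^'d \<Rightarrow> nat \<Rightarrow> nat \<Rightarrow> complex" where
  "br_entry n ix a r c =
     (if r = c then 1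
      else if r = 1 \<and> c = 2 * n + 1 then cnj (br_y n ix 1 a)
      else if r = 1 \<and> c = 2 * n + 2 then br_w n ix 1 a
      else if 2 \<le> r \<and> r \<le> n \<and> c = n + (r - 1) then cnj (br_z n ix (r - 1) a)
      else if 2 \<le> r \<and> r \<le> n \<and> c = n + (r - 1) + 1 then - br_x ix (r - 1) a
      else if 2 \<le> r \<and> r \<le> n \<and> c = 2 * n + 2 then br_w n ix r a
      else if n + 1 \<le> r \<and> r \<le> 2 * n \<and> c = 2 * n + 2 then br_y n ix (r - n) a
      else if r = 2 * n + 1 \<and> c = 2 * n + 2 then br_z n ix 1 a
      else 0)"

definition br_matrix :: "nat \<Rightarrow> (nat \<Rightarrow> 'd::finite) \<Rightarrow> complex^'d \<Rightarrow> complex Matrix.mat" where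
  "br_matrix n ix a =
     Matrix.mat (2 * n + 2) (2 * n + 2) (\<lambda>(r, c). br_entry n ix a (r + 1) (c + 1))"

definition br_group :: "nat \<Rightarrow> (nat \<Rightarrow> 'd::finite) \<Rightarrow> complex Matrix.mat set" where
  "br_group n ix = range (br_matrix n ix)"

definition gaussian_ints :: "complex set" where
  "gaussian_ints = {z. Re z \<in> \<int> \<and> Im z \<in> \<int>}"

definition GL_gaussian :: "nat \<Rightarrow> complex Matrix.mat set" where
  "GL_gaussian m = {A \<in> carrier_mat m m. elements_mat A \<subseteq> gaussian_ints \<and>
     (\<exists>B \<in> carrier_mat m m. elements_mat B \<subseteq> gaussian_ints \<and> A * B = 1\<^sub>m m \<and> B * A = 1\<^sub>m m)}"

definition br_lattice :: "nat \<Rightarrow> (nat \<Rightarrow> 'd::finite) \<Rightarrow> complex Matrix.mat set" where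
  "br_lattice n ix = br_group n ix \<inter> GL_gaussian (2 * n + 2)"

text \<open>Left translation by a group element, read in the chart.\<close>

definition br_translation ::
  "nat \<Rightarrow> (nat \<Rightarrow> 'd::finite) \<Rightarrow> complex Matrix.mat \<Rightarrow> complex^'d \<Rightarrow> complex^'d" where
  "br_translation n ix A a = (THE b. br_matrix n ix b = A * br_matrix n ix a)"

definition br_deck :: "nat \<Rightarrow> (nat \<Rightarrow> 'd::finite) \<Rightarrow> (complex^'d \<Rightarrow> complex^'d) set" where
  "br_deck n ix = br_translation n ix ` br_lattice n ix"

text \<open>The left-invariant coframe \<open>\<phi>\<^sup>1,\<dots>,\<phi>\<^sup>4\<^sup>n\<^sup>-\<^sup>2\<close> at the point \<open>a\<close>, evaluated at the tangent
  vector \<open>v\<close>; the coordinate functionals applied to \<open>v\<close> are the differentials of the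
  coordinates.\<close>

definition br_phi ::
  "nat \<Rightarrow> (nat \<Rightarrow> 'd::finite) \<Rightarrow> nat \<Rightarrow> complex^'d \<Rightarrow> complex^'d \<Rightarrow> complex" where
  "br_phi n ix j a v =
     (if j \<le> n - 1 then br_x ix j v
      else if j \<le> 2 * n - 1 then br_y n ix (j - (n - 1)) v
      else if j \<le> 3 * n - 2 then br_z n ix (j - (2 * n - 1)) v
      else if j = 3 * n - 1 then br_w n ix 1 v - cnj (br_y n ix 1 a) * br_z n ix 1 v
      else let i = j - (3 * n - 1) in
        br_w n ix (i + 1) v - cnj (br_z n ix i a) * br_y n ix i v
          + br_x ix i a * br_y n ix (i + 1) v)"

text \<open>The almost complex structure for which the \<open>\<phi>\<^sup>j\<close> span the \<open>(1,0)\<close>-forms.\<close>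

definition br_J ::
  "nat \<Rightarrow> (nat \<Rightarrow> 'd::finite) \<Rightarrow> complex^'d \<Rightarrow> complex^'d \<Rightarrow> complex^'d" where
  "br_J n ix a v = (THE u. \<forall>j\<in>{1..4 * n - 2}. br_phi n ix j a u = \<i> * br_phi n ix j a v)"

end

theory Submission
  imports Defs "HOL-Complex_Analysis.Cauchy_Integral_Formula"
begin

text \<open>
  On the manifold \<open>dw\<^sub>1 - \<bar>y\<bar>\<^sub>1 dz\<^sub>1\<close> is an invariant \<open>(1,0)\<close>-form \<open>\<phi>\<close> with
  \<open>d\<phi> = dz\<^sub>1 \<and> d\<bar>y\<bar>\<^sub>1\<close>, so that \<open>\<theta> = dz\<^sub>1 \<and> d\<bar>z\<bar>\<^sub>1 \<and> dy\<^sub>1 \<and> d\<bar>y\<bar>\<^sub>1\<close>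
  is, up to a factor, \<open>\<partial>\<bar>\<partial>(\<phi> \<and> \<bar>\<phi>\<bar>)\<close>.  By Stokes \<open>\<theta> \<and> \<Psi>\<close> has integral zero for every form
  \<open>\<Psi>\<close> with \<open>\<partial>\<bar>\<partial>\<Psi> = 0\<close>; it cannot be a nowhere vanishing real multiple of a volume form.
  With \<open>N = 4n - 2\<close>, an astheno-Kaehler metric contradicts this for \<open>\<Psi> = \<omega>\<^sup>N\<^sup>-\<^sup>2\<close>.  The four factors of
  \<open>\<theta>\<close> are Bott--Chern harmonic for every Hermitian metric, for reasons of bidegree; for a
  geometrically-Bott--Chern-formal metric so is \<open>\<theta>\<close>, and \<open>\<Psi> = *\<theta>\<close> gives the contradiction.

  Integration over the compact quotient is replaced by averaging along lines in the universal
  covering, on which invariant functions are bounded.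

  The holomorphic form \<open>dx\<^sub>1 \<and> \<dots> \<and> dw\<^sub>n\<close> is invariant and vanishes nowhere.  Dividing a pluricanonical
  section by a power of it leaves a bounded holomorphic function on the covering, which is constant
  by Liouville's theorem, so all plurigenera are one.
\<close>

section \<open>The exterior algebra through contractions\<close>

text \<open>The \<phi>^j and the coordinate differentials span the same covectors of type (1,0), so
  the chart is holomorphic: the complex structure is the constant multiplication by
  \<open>\<i>\<close>, and the Dolbeault operators are given by Wirtinger derivatives. Bidegree
  becomes a weight under rotation of all arguments by a unit complex number, which is easier to
  check than membership in a span. The obstacle to averaging is that the coefficients of an
  invariant form in the coordinate coframe are not invariant functions: deck transformations fix dx,
  dy, dz but change dw by multiples of dy and dz. The coefficients in the integration by parts are
  therefore regrouped around \<phi> and its conjugate. Each one is then either invariant, hence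
  bounded, or differentiated along a w-direction, in which the deck group contains translations, so
  that it is periodic. Either property makes the average of the derivative small. Hodge stars are
  needed only for products of constant covectors; these are written as iterated contractions of the
  volume form, from which smoothness, bidegree and invariance can be read off.\<close>

definition contract :: "'a \<Rightarrow> 'a ext_form \<Rightarrow> 'a ext_form" where
  "contract v \<beta> = (\<lambda>vs. \<beta> (v # vs))"

text \<open>The grading automorphism. It carries the sign (-1)^deg of the graded Leibniz rule, so
  that the rule also holds for forms without a fixed degree.\<close>

definition grade_inv :: "'a ext_form \<Rightarrow> 'a ext_form" where
  "grade_inv \<beta> = (\<lambda>vs. (- 1) ^ length vs * \<beta> vs)"

definition covec_wedge :: "('a \<Rightarrow> complex) \<Rightarrow> 'a ext_form \<Rightarrow> 'a ext_form" where
  "covec_wedge a \<beta> = wedge (one_form a) \<beta>"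

lemma sum_fun_apply: "(\<Sum>i\<in>A. f i) x = (\<Sum>i\<in>A. f i x)"
  for f :: "'i \<Rightarrow> 'b \<Rightarrow> 'c::comm_monoid_add"
  by (induction A rule: infinite_finite_induct) auto

text \<open>Shuffles are split by the factor that receives the first vector: a set of positions
  either contains 0 or does not, and the other positions are shifted down by one.\<close>

lemma sum_Pow_Suc:
  fixes f :: "nat set \<Rightarrow> 'b::comm_monoid_add"
  shows "(\<Sum>I\<in>Pow {..<Suc m}. f I) =
    (\<Sum>K\<in>Pow {..<m}. f (insert 0 (Suc ` K))) + (\<Sum>K\<in>Pow {..<m}. f (Suc ` K))"
proof -
  have 1: "Pow {..<Suc m} = insert 0 ` image Suc ` Pow {..<m} \<union> image Suc ` Pow {..<m}"
    by (subst lessThan_Suc_eq_insert_0, subst Pow_insert) (auto simp: image_Pow_surj)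
  have 2: "insert 0 ` image Suc ` Pow {..<m} \<inter> image Suc ` Pow {..<m} = {}"
    by auto
  have i1: "inj_on (image Suc) (Pow {..<m})"
    by (rule inj_on_image_Pow) simp
  have i2: "inj_on (insert 0) (image Suc ` Pow {..<m})"
    by (rule inj_onI) (auto simp: insert_ident)
  show ?thesis
    unfolding 1
    by (subst sum.union_disjoint[OF _ _ 2])
      (auto simp: sum.reindex[OF i1] sum.reindex[OF i2] sum.reindex[OF i1, unfolded o_def] o_def)
qed

lemma shuffle_sign_insert_0: "shuffle_sign (Suc m) (insert 0 (Suc ` K)) = shuffle_sign m K"
proof -
  have "{(i, j). i \<in> insert 0 (Suc ` K) \<and> j \<in> {..<Suc m} - insert 0 (Suc ` K) \<and> j < i} =
    map_prod Suc Suc ` {(i, j). i \<in> K \<and> j \<in> {..<m} - K \<and> j < i}" (is "?A = ?B")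
  proof
    show "?A \<subseteq> ?B"
    proof
      fix p assume "p \<in> ?A"
      then obtain i j where p: "p = (i, j)" "i \<in> insert 0 (Suc ` K)" "j < Suc m"
        "j \<notin> insert 0 (Suc ` K)" "j < i" by auto
      then obtain i' j' where "i = Suc i'" "j = Suc j'" by (metis not0_implies_Suc not_less0 insertCI)
      with p show "p \<in> ?B" by (intro image_eqI[of _ _ "(i', j')"]) auto
    qed
  qed auto
  moreover have "card (map_prod Suc Suc ` S) = card S" for S
    by (rule card_image) (auto simp: inj_on_def)
  ultimately show ?thesis by (simp add: shuffle_sign_def)
qed

text \<open>Position 0 now belongs to the second factor and is overtaken by every element of the
  first, which adds \<open>card K\<close> inversions.\<close>

lemma shuffle_sign_Suc:
  assumes "K \<subseteq> {..<m}"
  shows "shuffle_sign (Suc m) (Suc ` K) = (- 1) ^ card K * shuffle_sign m K"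
proof -
  let ?P = "{(i, j). i \<in> K \<and> j \<in> {..<m} - K \<and> j < i}"
  have fK: "finite K" using assms finite_subset by blast
  have "?P \<subseteq> K \<times> {..<m}" by auto
  then have fP: "finite ?P" using fK by (meson finite_SigmaI finite_lessThan finite_subset)
  have "{(i, j). i \<in> Suc ` K \<and> j \<in> {..<Suc m} - Suc ` K \<and> j < i} =
    map_prod Suc Suc ` ?P \<union> (\<lambda>i. (Suc i, 0)) ` K" (is "?A = ?B")
  proof
    show "?A \<subseteq> ?B"
    proof
      fix p assume "p \<in> ?A"
      then obtain i j where p: "p = (Suc i, j)" "i \<in> K" "j < Suc m" "j \<notin> Suc ` K" "j < Suc i"
        by auto
      show "p \<in> ?B"
      proof (cases j)
        case 0
        with p show ?thesis by auto
      next
        case (Suc j')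
        with p show ?thesis by (intro UnI1 image_eqI[of _ _ "(i, j')"]) auto
      qed
    qed
  qed auto
  moreover have "card (map_prod Suc Suc ` ?P) = card ?P"
    by (rule card_image) (auto simp: inj_on_def)
  moreover have "card ((\<lambda>i. (Suc i, 0::nat)) ` K) = card K"
    by (rule card_image) (auto simp: inj_on_def)
  moreover have "map_prod Suc Suc ` ?P \<inter> (\<lambda>i. (Suc i, 0)) ` K = {}" by auto
  ultimately have "card {(i, j). i \<in> Suc ` K \<and> j \<in> {..<Suc m} - Suc ` K \<and> j < i} = card ?P + card K"
    using fK fP by (simp add: card_Un_disjoint)
  then show ?thesis by (simp add: shuffle_sign_def power_add)
qed

lemma wedge_Nil: "wedge \<alpha> \<beta> [] = \<alpha> [] * \<beta> []"
  by (simp add: wedge_def shuffle_sign_def)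

text \<open>The wedge product is determined by this recursion: contraction is an antiderivation.\<close>

lemma wedge_Cons:
  "wedge \<alpha> \<beta> (v # vs) = wedge (contract v \<alpha>) \<beta> vs + wedge (grade_inv \<alpha>) (contract v \<beta>) vs"
proof -
  have c1: "{j. Suc j \<in> insert 0 (Suc ` K)} = K" "{j. Suc j \<in> - insert 0 (Suc ` K)} = - K"
    "{j. Suc j \<in> Suc ` K} = K" "{j. Suc j \<in> - Suc ` K} = - K" for K by auto
  have s1: "shuffle_sign (length (v # vs)) (insert 0 (Suc ` K)) *
        \<alpha> (nths (v # vs) (insert 0 (Suc ` K))) * \<beta> (nths (v # vs) (- insert 0 (Suc ` K)))
      = shuffle_sign (length vs) K * contract v \<alpha> (nths vs K) * \<beta> (nths vs (- K))" for K
    by (simp add: nths_Cons c1 shuffle_sign_insert_0 contract_def del: Compl_iff Compl_insert)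
      (simp add: c1 nths_Cons)
  have s2: "shuffle_sign (length (v # vs)) (Suc ` K) *
        \<alpha> (nths (v # vs) (Suc ` K)) * \<beta> (nths (v # vs) (- Suc ` K))
      = shuffle_sign (length vs) K * grade_inv \<alpha> (nths vs K) * contract v \<beta> (nths vs (- K))"
    if "K \<in> Pow {..<length vs}" for K
  proof -
    have "{i. i < length vs \<and> i \<in> K} = K" using that by auto
    then have "length (nths vs K) = card K" by (simp add: length_nths)
    moreover have "0 \<notin> Suc ` K" "0 \<in> - Suc ` K" by auto
    ultimately show ?thesis using that
      by (simp add: nths_Cons c1 shuffle_sign_Suc contract_def grade_inv_def del: Compl_iff)
  qed
  show ?thesis
    unfolding wedge_def list.size add.right_neutral add_Suc_right sum_Pow_Suc
    using s1 s2 by (simp add: wedge_def)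
qed

lemma contract_wedge:
  "contract v (wedge \<alpha> \<beta>) = wedge (contract v \<alpha>) \<beta> + wedge (grade_inv \<alpha>) (contract v \<beta>)"
  by (auto simp: contract_def wedge_Cons plus_fun_def)

lemma contract_add: "contract v (\<alpha> + \<beta>) = contract v \<alpha> + contract v \<beta>"
  and contract_scale: "contract v (form_scale c \<alpha>) = form_scale c (contract v \<alpha>)"
  by (auto simp: contract_def form_scale_def)

lemma grade_inv_add: "grade_inv (\<alpha> + \<beta>) = grade_inv \<alpha> + grade_inv \<beta>"
  and grade_inv_scale: "grade_inv (form_scale c \<alpha>) = form_scale c (grade_inv \<alpha>)"
  by (auto simp: grade_inv_def form_scale_def algebra_simps)

lemma grade_inv_grade_inv [simp]: "grade_inv (grade_inv \<alpha>) = \<alpha>"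
  by (auto simp: grade_inv_def simp flip: mult.assoc power_mult_distrib)

lemma contract_grade_inv: "contract v (grade_inv \<alpha>) = - grade_inv (contract v \<alpha>)"
  by (auto simp: contract_def grade_inv_def)

lemma wedge_add_left: "wedge (\<alpha> + \<beta>) \<gamma> = wedge \<alpha> \<gamma> + wedge \<beta> \<gamma>"
  and wedge_add_right: "wedge \<gamma> (\<alpha> + \<beta>) = wedge \<gamma> \<alpha> + wedge \<gamma> \<beta>"
  by (auto simp: wedge_def algebra_simps sum.distrib)

lemma wedge_scale_left: "wedge (form_scale c \<alpha>) \<gamma> = form_scale c (wedge \<alpha> \<gamma>)"
  and wedge_scale_right: "wedge \<gamma> (form_scale c \<alpha>) = form_scale c (wedge \<gamma> \<alpha>)"
  by (auto simp: wedge_def algebra_simps sum_distrib_left form_scale_def)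

lemma wedge_uminus_left: "wedge (- \<alpha>) \<gamma> = - wedge \<alpha> \<gamma>"
  and wedge_uminus_right: "wedge \<gamma> (- \<alpha>) = - wedge \<gamma> \<alpha>"
  by (auto simp: wedge_def sum_negf)

lemma wedge_zero_left [simp]: "wedge 0 \<gamma> = 0"
  and wedge_zero_right [simp]: "wedge \<gamma> 0 = 0"
  by (auto simp: wedge_def)

lemma grade_inv_wedge: "grade_inv (wedge \<alpha> \<beta>) = wedge (grade_inv \<alpha>) (grade_inv \<beta>)"
proof
  fix vs
  show "grade_inv (wedge \<alpha> \<beta>) vs = wedge (grade_inv \<alpha>) (grade_inv \<beta>) vs"
  proof (induction vs arbitrary: \<alpha> \<beta>)
    case Nil
    then show ?case by (simp add: grade_inv_def wedge_Nil)
  next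
    case (Cons v vs)
    have "grade_inv (wedge \<alpha> \<beta>) (v # vs) =
      - grade_inv (wedge (contract v \<alpha>) \<beta>) vs - grade_inv (wedge (grade_inv \<alpha>) (contract v \<beta>)) vs"
      by (simp add: grade_inv_def wedge_Cons algebra_simps)
    then show ?case
      by (simp add: Cons wedge_Cons contract_grade_inv wedge_uminus_left wedge_uminus_right)
  qed
qed

text \<open>Both sides satisfy the recursion of \<open>wedge_Cons\<close>. The induction runs over
  the arguments with all three forms generalised, since a contraction replaces them.\<close>

lemma wedge_assoc: "wedge (wedge \<alpha> \<beta>) \<gamma> = wedge \<alpha> (wedge \<beta> \<gamma>)"
proof
  fix vs
  show "wedge (wedge \<alpha> \<beta>) \<gamma> vs = wedge \<alpha> (wedge \<beta> \<gamma>) vs"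
  proof (induction vs arbitrary: \<alpha> \<beta> \<gamma>)
    case Nil
    then show ?case by (simp add: wedge_Nil)
  next
    case (Cons v vs)
    show ?case
      by (simp add: Cons wedge_Cons contract_wedge wedge_add_left wedge_add_right grade_inv_wedge)
  qed
qed

lemma contract_unit_form [simp]: "contract v unit_form = 0"
  by (auto simp: contract_def unit_form_def)

lemma grade_inv_unit_form [simp]: "grade_inv unit_form = unit_form"
  by (auto simp: grade_inv_def unit_form_def)

lemma wedge_unit_form_left [simp]: "wedge unit_form \<beta> = \<beta>"
proof
  fix vs show "wedge unit_form \<beta> vs = \<beta> vs"
    by (induction vs arbitrary: \<beta>) (simp_all add: wedge_Nil wedge_Cons, auto simp: unit_form_def contract_def)
qed

lemma wedge_unit_form_right [simp]: "wedge \<beta> unit_form = \<beta>"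
proof
  fix vs show "wedge \<beta> unit_form vs = \<beta> vs"
    by (induction vs arbitrary: \<beta>) (simp_all add: wedge_Nil wedge_Cons, auto simp: unit_form_def contract_def)
qed

lemma contract_one_form: "contract v (one_form a) = form_scale (a v) unit_form"
  by (auto simp: contract_def one_form_def form_scale_def unit_form_def split: list.splits)

lemma grade_inv_one_form: "grade_inv (one_form a) = - one_form a"
  by (auto simp: grade_inv_def one_form_def split: list.splits)

lemma covec_wedge_Nil [simp]: "covec_wedge a \<beta> [] = 0"
  by (simp add: covec_wedge_def wedge_Nil one_form_def)

lemma covec_wedge_Cons: "covec_wedge a \<beta> (v # vs) = a v * \<beta> vs - covec_wedge a (contract v \<beta>) vs"
  by (simp add: covec_wedge_def wedge_Cons contract_one_form grade_inv_one_form wedge_scale_left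
      wedge_uminus_left) (simp add: form_scale_def)

lemma contract_covec_wedge:
  "contract v (covec_wedge a \<beta>) = form_scale (a v) \<beta> - covec_wedge a (contract v \<beta>)"
  by (auto simp: contract_def covec_wedge_Cons form_scale_def)

lemma covec_wedge_add: "covec_wedge a (\<alpha> + \<beta>) = covec_wedge a \<alpha> + covec_wedge a \<beta>"
  and covec_wedge_uminus: "covec_wedge a (- \<beta>) = - covec_wedge a \<beta>"
  and covec_wedge_diff: "covec_wedge a (\<alpha> - \<beta>) = covec_wedge a \<alpha> - covec_wedge a \<beta>"
  and covec_wedge_scale: "covec_wedge a (form_scale c \<beta>) = form_scale c (covec_wedge a \<beta>)"
  and covec_wedge_zero [simp]: "covec_wedge a 0 = 0"
  using wedge_add_right[of "one_form a" \<alpha> "- \<beta>"]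
  by (auto simp: covec_wedge_def wedge_add_right wedge_uminus_right wedge_scale_right)

lemma covec_wedge_sum: "covec_wedge a (\<Sum>i\<in>A. f i) = (\<Sum>i\<in>A. covec_wedge a (f i))"
  by (rule sum_comp_morphism[of "covec_wedge a" f A, OF covec_wedge_zero covec_wedge_add,
    unfolded o_def, symmetric])

lemma one_form_add: "one_form (\<lambda>v. a v + b v) = one_form a + one_form b"
  and one_form_scale: "one_form (\<lambda>v. c * a v) = form_scale c (one_form a)"
  by (auto simp: one_form_def form_scale_def split: list.splits)

lemma covec_wedge_add_left: "covec_wedge (\<lambda>v. a v + b v) \<beta> = covec_wedge a \<beta> + covec_wedge b \<beta>"
  and covec_wedge_scale_left: "covec_wedge (\<lambda>v. c * a v) \<beta> = form_scale c (covec_wedge a \<beta>)"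
  by (auto simp: covec_wedge_def one_form_add wedge_add_left one_form_scale wedge_scale_left)

lemma covec_wedge_zero_left: "covec_wedge (\<lambda>v. 0) \<beta> = 0"
  using covec_wedge_scale_left[of 0 "\<lambda>v. 0" \<beta>] by (auto simp: form_scale_def)

lemma covec_wedge_sum_left:
  "covec_wedge (\<lambda>v. \<Sum>i\<in>A. a i v) \<beta> = (\<Sum>i\<in>A. covec_wedge (a i) \<beta>)"
  by (induction A rule: infinite_finite_induct)
    (auto simp: covec_wedge_add_left covec_wedge_zero_left)

lemma covec_wedge_anticomm: "covec_wedge a (covec_wedge b \<beta>) = - covec_wedge b (covec_wedge a \<beta>)"
proof
  fix vs
  show "covec_wedge a (covec_wedge b \<beta>) vs = (- covec_wedge b (covec_wedge a \<beta>)) vs"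
  proof (induction vs arbitrary: \<beta>)
    case (Cons v vs)
    show ?case
      by (simp add: Cons covec_wedge_Cons contract_covec_wedge covec_wedge_diff covec_wedge_scale)
        (simp add: form_scale_def Cons)
  qed simp
qed

lemma covec_wedge_self [simp]: "covec_wedge a (covec_wedge a \<beta>) = 0"
proof
  fix vs
  show "covec_wedge a (covec_wedge a \<beta>) vs = 0 vs"
    using fun_cong[OF covec_wedge_anticomm[of a a \<beta>], of vs] by simp
qed

lemma wedge_covec_wedge: "wedge (covec_wedge a \<alpha>) \<beta> = covec_wedge a (wedge \<alpha> \<beta>)"
  by (simp add: covec_wedge_def wedge_assoc)

text \<open>The expanded recursion has the shape of the definition of \<open>ext_deriv\<close>; this
  is what turns the exterior derivative into a sum of covectors wedged with derivatives.\<close>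

lemma covec_wedge_nths:
  "covec_wedge a \<beta> vs =
    (\<Sum>i<length vs. (- 1) ^ i * a (vs ! i) * \<beta> (take i vs @ drop (Suc i) vs))"
proof (induction vs arbitrary: \<beta>)
  case (Cons v vs)
  have "(\<Sum>i<length (v # vs). (- 1) ^ i * a ((v # vs) ! i) * \<beta> (take i (v # vs) @ drop (Suc i) (v # vs)))
     = a v * \<beta> vs + (\<Sum>i<length vs. - ((- 1) ^ i * a (vs ! i) * contract v \<beta> (take i vs @ drop (Suc i) vs)))"
    unfolding list.size add.right_neutral add_Suc_right sum.lessThan_Suc_shift
    by (simp add: contract_def algebra_simps)
  then show ?case by (simp add: covec_wedge_Cons Cons sum_negf)
qed simp

lemma wedge_list_one_forms:
  "wedge_list (map one_form as) = foldr covec_wedge as unit_form"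
  by (induction as) (auto simp: wedge_list_def covec_wedge_def)

lemma wedge_map: "wedge \<alpha> \<beta> (map T vs) = wedge (\<lambda>ws. \<alpha> (map T ws)) (\<lambda>ws. \<beta> (map T ws)) vs"
  by (simp add: wedge_def nths_map)

lemma covec_wedge_map:
  "covec_wedge a \<beta> (map T vs) = covec_wedge (a \<circ> T) (\<lambda>ws. \<beta> (map T ws)) vs"
proof -
  have "(\<lambda>ws. one_form a (map T ws)) = one_form (a \<circ> T)"
    by (auto simp: one_form_def split: list.splits)
  then show ?thesis by (simp add: covec_wedge_def wedge_map)
qed

text \<open>The outer copy of \<open>a\<close> is moved inwards, at the cost of a sign, until it
  meets the inner one.\<close>

lemma covec_wedge_foldr_mem:
  assumes "a \<in> set as"
  shows "foldr covec_wedge as (covec_wedge a \<beta>) = 0"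
  using assms
proof (induction as arbitrary: \<beta>)
  case (Cons b as)
  have swap: "covec_wedge c (foldr covec_wedge cs \<gamma>) =
      form_scale ((- 1) ^ length cs) (foldr covec_wedge cs (covec_wedge c \<gamma>))"
    for c :: "'a \<Rightarrow> complex" and cs \<gamma>
    by (induction cs arbitrary: \<gamma>)
      (auto simp: form_scale_def covec_wedge_anticomm[of c] covec_wedge_scale[unfolded form_scale_def])
  show ?case
  proof (cases "a \<in> set as")
    case True
    then show ?thesis using Cons by (simp only: foldr.simps o_apply covec_wedge_zero)
  next
    case False
    then have "a = b" using Cons by simp
    then have "foldr covec_wedge (b # as) (covec_wedge a \<beta>) =
      form_scale ((- 1) ^ length as) (foldr covec_wedge as (covec_wedge b (covec_wedge b \<beta>)))"
      using swap[of b as "covec_wedge a \<beta>"] by simp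
    moreover have "foldr covec_wedge as 0 = 0"
      by (induction as) (simp_all only: foldr.simps o_apply id_apply covec_wedge_zero)
    ultimately show ?thesis by (auto simp: form_scale_def)
  qed
qed simp

section \<open>Alternating forms\<close>

lemma linear_listI:
  fixes f :: "'a::real_vector \<Rightarrow> complex"
  assumes "\<And>x y. f (x + y) = f x + f y" "\<And>r x. f (r *\<^sub>R x) = of_real r * f x"
  shows "linear f"
  using assms by (intro linearI) (auto simp: scaleR_conv_of_real)

text \<open>Alternation tested on neighbouring arguments only. This form passes through recursions
  over the argument list, where \<open>distinct\<close> does not.\<close>

definition adjacent_alt :: "'a::real_vector ext_form \<Rightarrow> bool" where
  "adjacent_alt \<beta> \<longleftrightarrow> (\<forall>us ws. linear (\<lambda>v. \<beta> (us @ v # ws))) \<and>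
     (\<forall>us v ws. \<beta> (us @ v # v # ws) = 0)"

lemma ext_form_linear_mid:
  assumes "ext_form \<beta>"
  shows "linear (\<lambda>v. \<beta> (us @ v # ws))"
proof -
  have "\<forall>vs i. i < length vs \<longrightarrow> linear (\<lambda>v. \<beta> (vs[i := v]))"
    using assms by (auto simp: ext_form_def)
  from this[rule_format, of "length us" "us @ undefined # ws"] show ?thesis by simp
qed

lemma ext_form_linear_head:
  assumes "ext_form \<beta>" shows "linear (\<lambda>v. \<beta> (v # ws))"
  using ext_form_linear_mid[OF assms, of "[]"] by simp

lemma ext_form_not_distinct: "ext_form \<beta> \<Longrightarrow> \<not> distinct vs \<Longrightarrow> \<beta> vs = 0"
  by (auto simp: ext_form_def)

text \<open>Polarisation at two neighbouring positions gives the sign change under a transposition;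
  transpositions then carry two equal arguments next to each other.\<close>

lemma adjacent_alt_iff_ext_form: "adjacent_alt \<beta> \<longleftrightarrow> ext_form \<beta>"
proof
  assume "ext_form \<beta>"
  then show "adjacent_alt \<beta>"
    by (auto simp: adjacent_alt_def ext_form_linear_mid intro!: ext_form_not_distinct)
next
  assume alt: "adjacent_alt \<beta>"
  have lin: "linear (\<lambda>v. \<beta> (us @ v # ws))" for us ws using alt by (auto simp: adjacent_alt_def)
  have swap: "\<beta> (us @ x # y # ws) = - \<beta> (us @ y # x # ws)" for us x y ws
  proof -
    have "0 = \<beta> (us @ (x + y) # (x + y) # ws)" using alt by (auto simp: adjacent_alt_def)
    also have "\<dots> = \<beta> (us @ x # (x + y) # ws) + \<beta> (us @ y # (x + y) # ws)"
      by (rule linear_add[OF lin])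
    also have "\<beta> (us @ x # (x + y) # ws) = \<beta> (us @ x # x # ws) + \<beta> (us @ x # y # ws)"
      using linear_add[OF lin[of "us @ [x]" ws], of x y] by simp
    also have "\<beta> (us @ y # (x + y) # ws) = \<beta> (us @ y # x # ws) + \<beta> (us @ y # y # ws)"
      using linear_add[OF lin[of "us @ [y]" ws], of x y] by simp
    finally show ?thesis using alt by (auto simp: adjacent_alt_def eq_neg_iff_add_eq_0 add.commute)
  qed
  have far: "\<beta> (us @ x # ys @ x # zs) = 0" for us x ys zs
  proof (induction ys arbitrary: us)
    case Nil
    then show ?case using alt by (auto simp: adjacent_alt_def)
  next
    case (Cons y ys)
    have "\<beta> (us @ x # y # (ys @ x # zs)) = - \<beta> (us @ y # x # (ys @ x # zs))" by (rule swap)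
    also have "\<beta> (us @ y # x # (ys @ x # zs)) = 0" using Cons[of "us @ [y]"] by simp
    finally show ?case by simp
  qed
  show "ext_form \<beta>"
    unfolding ext_form_def
  proof (intro conjI allI impI)
    fix vs :: "'a list" and i assume "i < length vs"
    then show "linear (\<lambda>v. \<beta> (vs[i := v]))"
      using lin[of "take i vs" "drop (Suc i) vs"] by (simp add: upd_conv_take_nth_drop)
  next
    fix vs :: "'a list" assume "\<not> distinct vs"
    then obtain xs ys zs y where "vs = xs @ [y] @ ys @ [y] @ zs" using not_distinct_decomp by blast
    then show "\<beta> vs = 0" using far by simp
  qed
qed

lemma ext_form_contract: "ext_form \<beta> \<Longrightarrow> ext_form (contract v \<beta>)"
  unfolding adjacent_alt_iff_ext_form[symmetric] adjacent_alt_def contract_def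
  by (simp flip: append_Cons)

lemma linear_const_mult: "linear f \<Longrightarrow> linear (\<lambda>v. c * f v)" for f :: "'a::real_vector \<Rightarrow> complex"
  by (auto simp: linear_iff algebra_simps scaleR_conv_of_real)

lemma ext_form_add: "ext_form \<alpha> \<Longrightarrow> ext_form \<beta> \<Longrightarrow> ext_form (\<alpha> + \<beta>)"
  unfolding ext_form_def by (auto intro!: linear_compose_add)

lemma ext_form_scale: "ext_form \<beta> \<Longrightarrow> ext_form (form_scale c \<beta>)"
  unfolding ext_form_def form_scale_def by (auto intro!: linear_const_mult)

lemma ext_form_zero: "ext_form 0"
  unfolding ext_form_def by (auto simp: linear_iff)

lemma ext_form_uminus: "ext_form \<beta> \<Longrightarrow> ext_form (- \<beta>)"
proof -
  have "- \<beta> = form_scale (- 1) \<beta>" by (simp add: form_scale_def fun_eq_iff)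
  then show "ext_form (- \<beta>)" if "ext_form \<beta>" using ext_form_scale[OF that, of "- 1"] by simp
qed

lemma ext_form_diff: "ext_form \<alpha> \<Longrightarrow> ext_form \<beta> \<Longrightarrow> ext_form (\<alpha> - \<beta>)"
  by (metis diff_conv_add_uminus ext_form_add ext_form_uminus)

lemma ext_form_sum: "(\<And>i. i \<in> A \<Longrightarrow> ext_form (f i)) \<Longrightarrow> ext_form (\<Sum>i\<in>A. f i)"
proof (induction A rule: infinite_finite_induct)
  case (insert x F)
  then show ?case by (metis ext_form_add insertI1 insertI2 sum.insert)
qed (simp_all add: ext_form_zero)

lemma ext_form_grade_inv: "ext_form \<beta> \<Longrightarrow> ext_form (grade_inv \<beta>)"
  unfolding ext_form_def grade_inv_def by (auto intro!: linear_const_mult)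

lemma ext_form_unit_form: "ext_form unit_form"
  unfolding ext_form_def unit_form_def by (auto simp: linear_iff)

lemma ext_form_one_form: "linear a \<Longrightarrow> ext_form (one_form a)"
proof -
  assume a: "linear a"
  have "one_form a (us @ v # ws) = (if us = [] \<and> ws = [] then a v else 0)" for us v ws
    by (cases us; cases ws; cases "tl us") (auto simp: one_form_def split: list.splits)
  then show ?thesis
    unfolding adjacent_alt_iff_ext_form[symmetric] adjacent_alt_def
    using a by (auto simp: linear_iff)
qed

lemma contract_add_left: "ext_form \<beta> \<Longrightarrow> contract (x + y) \<beta> = contract x \<beta> + contract y \<beta>"
  by (rule ext) (simp add: contract_def linear_add[OF ext_form_linear_head])

lemma contract_scaleR_left:
  "ext_form \<beta> \<Longrightarrow> contract (r *\<^sub>R x) \<beta> = form_scale (of_real r) (contract x \<beta>)"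
  by (rule ext)
    (simp add: contract_def form_scale_def linear_scale[OF ext_form_linear_head] scaleR_conv_of_real)

lemma contract_zero_left: "ext_form \<beta> \<Longrightarrow> contract 0 \<beta> = 0"
  by (rule ext) (simp add: contract_def linear_0[OF ext_form_linear_head])

lemma contract_self: "ext_form \<beta> \<Longrightarrow> contract v (contract v \<beta>) = 0"
  by (auto simp: contract_def fun_eq_iff intro!: ext_form_not_distinct)

lemma contract_anticomm:
  assumes "ext_form \<beta>" shows "contract v (contract u \<beta>) = - contract u (contract v \<beta>)"
proof -
  have "0 = contract (u + v) (contract (u + v) \<beta>)" using contract_self[OF assms] by metis
  also have "\<dots> = contract u (contract v \<beta>) + contract v (contract u \<beta>)"
    using assms contract_self[OF assms]
    by (simp add: contract_add_left contract_add ext_form_contract ext_form_add)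
  finally show ?thesis by (metis add.commute eq_neg_iff_add_eq_0)
qed

text \<open>Contractions consume the prefix. At \<open>v # v # ws\<close> the two mixed terms
  cancel, because contraction anticommutes with \<open>grade_inv\<close>, and the other two vanish
  by \<open>contract_self\<close>.\<close>

lemma ext_form_wedge:
  assumes "ext_form \<alpha>" "ext_form \<beta>"
  shows "ext_form (wedge \<alpha> \<beta>)"
proof -
  have "linear (\<lambda>v. wedge \<alpha> \<beta> (us @ v # ws))" for us ws
    using assms
  proof (induction us arbitrary: \<alpha> \<beta>)
    case Nil
    then show ?case
      by (auto simp: linear_iff wedge_Cons contract_add_left contract_scaleR_left wedge_add_left
          wedge_add_right wedge_scale_left wedge_scale_right scaleR_conv_of_real algebra_simps)
        (auto simp: form_scale_def algebra_simps)
  next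
    case (Cons u us)
    then show ?case
      by (auto simp: wedge_Cons intro!: linear_compose_add ext_form_contract ext_form_grade_inv)
  qed
  moreover have "wedge \<alpha> \<beta> (us @ v # v # ws) = 0" for us v ws
    using assms
  proof (induction us arbitrary: \<alpha> \<beta>)
    case Nil
    then show ?case
      by (simp add: wedge_Cons contract_self contract_grade_inv wedge_uminus_left ext_form_grade_inv)
  next
    case (Cons u us)
    then show ?case by (simp add: wedge_Cons ext_form_contract ext_form_grade_inv)
  qed
  ultimately show ?thesis
    unfolding adjacent_alt_iff_ext_form[symmetric] adjacent_alt_def by blast
qed

lemma ext_form_covec_wedge: "linear a \<Longrightarrow> ext_form \<beta> \<Longrightarrow> ext_form (covec_wedge a \<beta>)"
  by (simp add: covec_wedge_def ext_form_wedge ext_form_one_form)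

section \<open>Homogeneous parts and forms determined by their values on a frame\<close>

definition degree_part :: "nat \<Rightarrow> 'a ext_form \<Rightarrow> 'a ext_form" where
  "degree_part k \<beta> = (\<lambda>vs. if length vs = k then \<beta> vs else 0)"

lemma ext_form_degree_part: "ext_form \<beta> \<Longrightarrow> ext_form (degree_part k \<beta>)"
  unfolding ext_form_def degree_part_def by (auto simp: linear_iff)

definition homogeneous :: "nat \<Rightarrow> 'a ext_form \<Rightarrow> bool" where
  "homogeneous k \<beta> \<longleftrightarrow> (\<forall>vs. length vs \<noteq> k \<longrightarrow> \<beta> vs = 0)"

lemma homogeneous_degree_part: "homogeneous k (degree_part k \<beta>)"
  by (auto simp: homogeneous_def degree_part_def)

lemma homogeneous_contract: "homogeneous (Suc k) \<beta> \<Longrightarrow> homogeneous k (contract v \<beta>)"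
  by (auto simp: homogeneous_def contract_def)

lemma homogeneous_covec_wedge: "homogeneous k \<beta> \<Longrightarrow> homogeneous (Suc k) (covec_wedge a \<beta>)"
  unfolding homogeneous_def covec_wedge_nths by (auto intro!: sum.neutral)

lemma homogeneous_unit_form: "homogeneous 0 unit_form"
  by (auto simp: homogeneous_def unit_form_def)

lemma homogeneous_add: "homogeneous k \<alpha> \<Longrightarrow> homogeneous k \<beta> \<Longrightarrow> homogeneous k (\<alpha> + \<beta>)"
  and homogeneous_scale: "homogeneous k \<alpha> \<Longrightarrow> homogeneous k (form_scale c \<alpha>)"
  and homogeneous_zero: "homogeneous k 0"
  by (auto simp: homogeneous_def form_scale_def)

text \<open>Induction over the spanning list. An argument is split into a multiple of
  \<open>e\<close> and a vector in the span of the remaining list; the first leads to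
  \<open>contract e\<close>, the second to lists over the smaller span. So the increasing sublists
  of a spanning list determine a form.\<close>

lemma ext_form_zero_on_span:
  assumes "ext_form \<beta>" "\<And>I. \<beta> (nths es I) = 0" "set vs \<subseteq> span (set es)"
  shows "\<beta> vs = 0"
  using assms
proof (induction es arbitrary: \<beta> vs)
  case Nil
  show ?case
  proof (cases vs)
    case Nil
    then show ?thesis using Nil.prems(2) by simp
  next
    case (Cons v ws)
    then have "v = 0" using Nil.prems(3) by simp
    then show ?thesis using Cons linear_0[OF ext_form_linear_head[OF Nil.prems(1)]] by simp
  qed
next
  case (Cons e es)
  let ?S = "span (set es)"
  \<comment> \<open>Reduces arguments from the larger span to the smaller one: besides lists over
    \<open>?S\<close>, only lists headed by one copy of \<open>e\<close> have to be checked, since a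
    second copy gives zero.\<close>
  have sub: "\<gamma> ws = 0" if g: "ext_form \<gamma>" and 0: "\<And>ws. set ws \<subseteq> ?S \<Longrightarrow> \<gamma> ws = 0 \<and> \<gamma> (e # ws) = 0"
    and ws: "set ws \<subseteq> span (set (e # es))" for \<gamma> ws
    using g 0 ws
  proof (induction ws arbitrary: \<gamma>)
    case Nil
    then show ?case by simp
  next
    case (Cons v ws)
    from Cons.prems(3) have "v \<in> span (insert e (set es))" by simp
    then obtain k where k: "v - k *\<^sub>R e \<in> ?S" using span_breakdown_eq by blast
    let ?u = "v - k *\<^sub>R e"
    have "v = k *\<^sub>R e + ?u" by simp
    then have "\<gamma> (v # ws) = k *\<^sub>R contract e \<gamma> ws + contract ?u \<gamma> ws"
      unfolding contract_def
      using linear_add[OF ext_form_linear_head[OF Cons.prems(1), of ws], of "k *\<^sub>R e" ?u]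
        linear_scale[OF ext_form_linear_head[OF Cons.prems(1), of ws], of k e] by simp
    moreover have "contract e \<gamma> ws = 0"
    proof (rule Cons.IH)
      show "ext_form (contract e \<gamma>)" by (rule ext_form_contract[OF Cons.prems(1)])
      show "contract e \<gamma> ws = 0 \<and> contract e \<gamma> (e # ws) = 0" if "set ws \<subseteq> ?S" for ws
        using Cons.prems(2)[OF that] ext_form_not_distinct[OF Cons.prems(1), of "e # e # ws"]
        by (simp add: contract_def)
      show "set ws \<subseteq> span (set (e # es))" using Cons.prems(3) by simp
    qed
    moreover have "contract ?u \<gamma> ws = 0"
    proof (rule Cons.IH)
      show "ext_form (contract ?u \<gamma>)" by (rule ext_form_contract[OF Cons.prems(1)])
      show "contract ?u \<gamma> ws = 0 \<and> contract ?u \<gamma> (e # ws) = 0" if "set ws \<subseteq> ?S" for ws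
      proof
        show "contract ?u \<gamma> ws = 0"
          using Cons.prems(2)[of "?u # ws"] that k by (simp add: contract_def)
        have "contract ?u \<gamma> (e # ws) = contract e (contract ?u \<gamma>) ws" by (simp add: contract_def)
        also have "\<dots> = - \<gamma> (e # ?u # ws)"
          using contract_anticomm[OF Cons.prems(1), of e ?u] by (simp add: contract_def)
        finally show "contract ?u \<gamma> (e # ws) = 0"
          using Cons.prems(2)[of "?u # ws"] that k by simp
      qed
      show "set ws \<subseteq> span (set (e # es))" using Cons.prems(3) by simp
    qed
    ultimately show ?case by simp
  qed
  have n1: "\<beta> (nths es I) = 0" for I
    using Cons.prems(2)[of "Suc ` I"] by (simp add: nths_Cons inj_image_mem_iff)
  have n2: "contract e \<beta> (nths es I) = 0" for I
    using Cons.prems(2)[of "insert 0 (Suc ` I)"] by (simp add: nths_Cons contract_def inj_image_mem_iff)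
  show ?case
  proof (rule sub[OF Cons.prems(1) _ Cons.prems(3)])
    fix ws assume "set ws \<subseteq> ?S"
    then show "\<beta> ws = 0 \<and> \<beta> (e # ws) = 0"
      using Cons.IH[OF Cons.prems(1) n1] Cons.IH[OF ext_form_contract[OF Cons.prems(1)] n2]
      by (auto simp: contract_def)
  qed
qed

lemma basis_list_exists: "\<exists>es::'a::euclidean_space list. distinct es \<and> set es = Basis \<and> length es = DIM('a)"
  by (metis distinct_card finite_Basis finite_distinct_list)

lemma ext_form_long:
  fixes \<beta> :: "'a::euclidean_space ext_form"
  assumes "ext_form \<beta>" "length vs > DIM('a)"
  shows "\<beta> vs = 0"
proof -
  obtain es :: "'a list" where es: "set es = Basis" "length es = DIM('a)"
    using basis_list_exists by blast
  have "length (nths es I) \<le> DIM('a)" for I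
    using es(2) card_mono[of "{..<length es}" "{i. i < length es \<and> i \<in> I}"]
    by (auto simp: length_nths)
  then have "degree_part (length vs) \<beta> (nths es I) = 0" for I
    using assms(2) by (metis degree_part_def leD)
  then have "degree_part (length vs) \<beta> vs = 0"
    by (rule ext_form_zero_on_span[OF ext_form_degree_part[OF assms(1)]]) (auto simp: es)
  then show ?thesis by (simp add: degree_part_def)
qed

lemma nths_eq_if_length:
  assumes "length (nths es I) = length es" shows "nths es I = es"
proof -
  have "card {i. i < length es \<and> i \<in> I} = card {..<length es}" using assms by (simp add: length_nths)
  then have "{i. i < length es \<and> i \<in> I} = {..<length es}"
    by (intro card_subset_eq) auto
  then show ?thesis by (intro nths_all) auto
qed

text \<open>Top degree is a line: among the sublists of \<open>es\<close> only \<open>es\<close>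
  itself has full length. Values on one frame thereby control the values on every other.\<close>

lemma ext_form_top_zero:
  fixes \<beta> :: "'a::euclidean_space ext_form"
  assumes "ext_form \<beta>" "span (set es) = UNIV" "\<beta> es = 0" "length vs = length es"
  shows "\<beta> vs = 0"
proof -
  have "degree_part (length es) \<beta> (nths es I) = 0" for I
    using assms nths_eq_if_length[of es I] by (auto simp: degree_part_def)
  then have "degree_part (length es) \<beta> vs = 0"
    by (rule ext_form_zero_on_span[OF ext_form_degree_part[OF assms(1)]]) (auto simp: assms)
  then show ?thesis using assms by (simp add: degree_part_def)
qed

lemma covec_wedge_vanish: "(\<And>v. v \<in> set vs \<Longrightarrow> a v = 0) \<Longrightarrow> covec_wedge a \<beta> vs = 0"
  unfolding covec_wedge_nths by (intro sum.neutral) auto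

text \<open>Every covector sees only its own dual vector, so in the recursion only the term that
  pairs the first covector with the first vector survives.\<close>

lemma foldr_covec_wedge_dual:
  assumes "distinct js" "\<And>i j. i \<in> set js \<Longrightarrow> j \<in> set js \<Longrightarrow> f i (e j) = (if i = j then 1 else 0)"
    "\<And>i w. i \<in> set js \<Longrightarrow> w \<in> set ws \<Longrightarrow> f i w = 0"
  shows "foldr covec_wedge (map f js) \<beta> (map e js @ ws) = \<beta> ws"
  using assms
proof (induction js)
  case (Cons j js)
  have "covec_wedge (f j) (contract (e j) (foldr covec_wedge (map f js) \<beta>)) (map e js @ ws) = 0"
    using Cons.prems by (intro covec_wedge_vanish) auto
  then show ?case using Cons by (simp add: covec_wedge_Cons)
qed simp

text \<open>Contracting with a basis vector and wedging with its dual covector, summed over the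
  basis, is the degree operator. It recovers a form of positive degree from forms of one degree
  less, which is the induction step of the bidegree decomposition.\<close>

lemma number_operator:
  fixes \<beta> :: "'a::euclidean_space ext_form"
  assumes "ext_form \<beta>"
  shows "(\<Sum>b\<in>Basis. covec_wedge (\<lambda>v. of_real (inner v b)) (contract b \<beta>)) vs = of_nat (length vs) * \<beta> vs"
  using assms
proof (induction vs arbitrary: \<beta>)
  case Nil
  then show ?case by (simp add: sum_fun_apply)
next
  case (Cons v vs)
  have lin: "linear (\<lambda>v. \<beta> (v # vs))" by (rule ext_form_linear_head[OF Cons.prems])
  have "\<beta> (v # vs) = \<beta> ((\<Sum>b\<in>Basis. inner v b *\<^sub>R b) # vs)" by (simp add: euclidean_representation)
  also have "\<dots> = (\<Sum>b\<in>Basis. of_real (inner v b) * \<beta> (b # vs))"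
    by (simp add: linear_sum[OF lin] linear_scale[OF lin] scaleR_conv_of_real)
  finally have 1: "(\<Sum>b\<in>Basis. of_real (inner v b) * \<beta> (b # vs)) = \<beta> (v # vs)" ..
  have "(\<Sum>b\<in>Basis. covec_wedge (\<lambda>v. of_real (inner v b)) (contract b \<beta>)) (v # vs)
     = (\<Sum>b\<in>Basis. of_real (inner v b) * \<beta> (b # vs)) +
       (\<Sum>b\<in>Basis. covec_wedge (\<lambda>v. of_real (inner v b)) (contract b (contract v \<beta>))) vs"
    using contract_anticomm[OF Cons.prems, of v]
    by (simp add: sum_fun_apply covec_wedge_Cons covec_wedge_uminus sum.distrib)
      (simp add: contract_def)
  also have "\<dots> = \<beta> (v # vs) + of_nat (length vs) * contract v \<beta> vs"
    using Cons.IH[OF ext_form_contract[OF Cons.prems]] 1 by simp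
  finally show ?case by (simp add: contract_def algebra_simps)
qed

section \<open>Bidegree on complex coordinate space\<close>

lemmas cvec_eq_iff = Finite_Cartesian_Product.vec_eq_iff

lemma scaleR_complex: "r *\<^sub>R (z::complex) = of_real r * z"
  by (rule scaleR_conv_of_real)

abbreviation mult_i :: "complex^'d \<Rightarrow> complex^'d" where
  "mult_i \<equiv> (*s) \<i>"

definition dz :: "'d \<Rightarrow> complex^'d \<Rightarrow> complex" where
  "dz j v = vec_nth v j"

definition dzbar :: "'d \<Rightarrow> complex^'d \<Rightarrow> complex" where
  "dzbar j v = cnj (vec_nth v j)"

lemma linear_dz: "linear (dz j)" and linear_dzbar: "linear (dzbar j)"
  by (auto simp: linear_iff dz_def dzbar_def scaleR_complex)

lemma cdim_vec: "cdim TYPE(complex^'d::finite) = CARD('d)"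
  by simp

lemma vector_scalar_split: "\<zeta> *s v = Re \<zeta> *\<^sub>R v + Im \<zeta> *\<^sub>R mult_i v"
  by (auto simp: cvec_eq_iff complex_eq_iff)

lemma linear_vector_scalar: "linear ((*s) \<zeta> :: complex^'d \<Rightarrow> complex^'d)"
  by (auto simp: linear_iff cvec_eq_iff algebra_simps scaleR_complex)

lemma vec_complex_basis_expansion:
  fixes v :: "complex^'d::finite"
  shows "v = (\<Sum>j\<in>UNIV. Re (vec_nth v j) *\<^sub>R axis j 1 + Im (vec_nth v j) *\<^sub>R axis j \<i>)"
  by (auto simp: cvec_eq_iff axis_def complex_eq_iff sum.distrib sum.delta' if_distrib[of Re]
      if_distrib[of Im] if_distrib[of "\<lambda>x. _ * x"] cong: if_cong)

text \<open>The Wirtinger combination of the values on 1 and \<open>\<i>\<close>; applied to a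
  derivative it becomes \<open>wirt\<close>, and likewise \<open>dzbar_coeff\<close> becomes
  \<open>wirt_bar\<close>.\<close>

definition dz_coeff :: "(complex^'d \<Rightarrow> complex) \<Rightarrow> 'd \<Rightarrow> complex" where
  "dz_coeff a j = (a (axis j 1) - \<i> * a (axis j \<i>)) / 2"

definition dzbar_coeff :: "(complex^'d \<Rightarrow> complex) \<Rightarrow> 'd \<Rightarrow> complex" where
  "dzbar_coeff a j = (a (axis j 1) + \<i> * a (axis j \<i>)) / 2"

lemma covector_expansion:
  fixes a :: "complex^'d::finite \<Rightarrow> complex"
  assumes "linear a"
  shows "a v = (\<Sum>j\<in>UNIV. dz_coeff a j * dz j v + dzbar_coeff a j * dzbar j v)"
proof -
  have "a v = (\<Sum>j\<in>UNIV. of_real (Re (vec_nth v j)) * a (axis j 1) + of_real (Im (vec_nth v j)) * a (axis j \<i>))"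
    by (subst vec_complex_basis_expansion[of v])
      (simp add: linear_sum[OF assms] linear_add[OF assms] linear_scale[OF assms] scaleR_complex)
  also have "\<dots> = (\<Sum>j\<in>UNIV. dz_coeff a j * dz j v + dzbar_coeff a j * dzbar j v)"
  proof (rule sum.cong[OF refl])
    fix j
    obtain x y where v: "vec_nth v j = of_real x + \<i> * of_real y" using complex_eq by metis
    show "of_real (Re (vec_nth v j)) * a (axis j 1) + of_real (Im (vec_nth v j)) * a (axis j \<i>)
        = dz_coeff a j * dz j v + dzbar_coeff a j * dzbar j v"
      unfolding dz_coeff_def dzbar_coeff_def dz_def dzbar_def v
      by (simp add: field_simps)
  qed
  finally show ?thesis .
qed

lemma axis_i: "axis j \<i> = mult_i (axis j 1)"
  by (auto simp: cvec_eq_iff axis_def)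

lemma dz_in_covectors10: "dz j \<in> covectors10 mult_i"
  and dzbar_in_covectors01: "dzbar j \<in> covectors01 mult_i"
  by (auto simp: covectors10_def covectors01_def linear_dz linear_dzbar) (auto simp: dz_def dzbar_def)

lemma covectors10_expansion:
  fixes a :: "complex^'d::finite \<Rightarrow> complex"
  assumes "a \<in> covectors10 mult_i"
  shows "a = (\<lambda>v. \<Sum>j\<in>UNIV. a (axis j 1) * dz j v)"
proof
  fix v
  have l: "linear a" and i: "a (mult_i w) = \<i> * a w" for w using assms by (auto simp: covectors10_def)
  have "dz_coeff a j = a (axis j 1)" "dzbar_coeff a j = 0" for j
    by (auto simp: dz_coeff_def dzbar_coeff_def axis_i i)
  then show "a v = (\<Sum>j\<in>UNIV. a (axis j 1) * dz j v)"
    using covector_expansion[OF l, of v] by simp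
qed

lemma covectors01_expansion:
  fixes a :: "complex^'d::finite \<Rightarrow> complex"
  assumes "a \<in> covectors01 mult_i"
  shows "a = (\<lambda>v. \<Sum>j\<in>UNIV. a (axis j 1) * dzbar j v)"
proof
  fix v
  have l: "linear a" and i: "a (mult_i w) = - \<i> * a w" for w using assms by (auto simp: covectors01_def)
  have "dz_coeff a j = 0" "dzbar_coeff a j = a (axis j 1)" for j
    by (auto simp: dz_coeff_def dzbar_coeff_def axis_i i)
  then show "a v = (\<Sum>j\<in>UNIV. a (axis j 1) * dzbar j v)"
    using covector_expansion[OF l, of v] by simp
qed

lemma covectors10_scalar: "a \<in> covectors10 mult_i \<Longrightarrow> a (\<zeta> *s v) = \<zeta> * a v"
proof -
  assume a: "a \<in> covectors10 mult_i"
  have z: "\<zeta> = of_real (Re \<zeta>) + \<i> * of_real (Im \<zeta>)" by (simp add: complex_eq_iff)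
  have "a (\<zeta> *s v) = of_real (Re \<zeta>) * a v + of_real (Im \<zeta>) * (\<i> * a v)" using a
    by (subst vector_scalar_split)
      (simp add: covectors10_def linear_add[of a] linear_scale[of a] scaleR_complex)
  then show ?thesis by (subst z) (simp add: algebra_simps)
qed

lemma covectors01_scalar: "a \<in> covectors01 mult_i \<Longrightarrow> a (\<zeta> *s v) = cnj \<zeta> * a v"
proof -
  assume a: "a \<in> covectors01 mult_i"
  have z: "cnj \<zeta> = of_real (Re \<zeta>) - \<i> * of_real (Im \<zeta>)" by (simp add: complex_eq_iff)
  have "a (\<zeta> *s v) = of_real (Re \<zeta>) * a v - of_real (Im \<zeta>) * (\<i> * a v)" using a
    by (subst vector_scalar_split)
      (simp add: covectors01_def linear_add[of a] linear_scale[of a] scaleR_complex)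
  then show ?thesis by (subst z) (simp add: algebra_simps)
qed

text \<open>Bidegree as a weight: rotation of all arguments by a unit \<zeta> acts by \<zeta>^(p-q),
  and p - q together with the degree p + q determines the pair. Unlike membership in
  \<open>pq_covectors\<close>, this is checked by computation; the two are shown to be equivalent
  below.\<close>

definition pq_type :: "nat \<Rightarrow> nat \<Rightarrow> (complex^'d) ext_form \<Rightarrow> bool" where
  "pq_type p q \<beta> \<longleftrightarrow> ext_form \<beta> \<and> homogeneous (p + q) \<beta> \<and>
     (\<forall>\<zeta> vs. cmod \<zeta> = 1 \<longrightarrow> \<beta> (map ((*s) \<zeta>) vs) = \<zeta> ^ p * cnj \<zeta> ^ q * \<beta> vs)"

lemma pq_typeD:
  assumes "pq_type p q \<beta>"
  shows "ext_form \<beta>" "homogeneous (p + q) \<beta>"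
    "cmod \<zeta> = 1 \<Longrightarrow> \<beta> (map ((*s) \<zeta>) vs) = \<zeta> ^ p * cnj \<zeta> ^ q * \<beta> vs"
  using assms by (auto simp: pq_type_def)

lemma pq_type_zero: "pq_type p q 0"
  by (auto simp: pq_type_def ext_form_zero homogeneous_zero)

lemma pq_type_add: "pq_type p q \<alpha> \<Longrightarrow> pq_type p q \<beta> \<Longrightarrow> pq_type p q (\<alpha> + \<beta>)"
  by (auto simp: pq_type_def ext_form_add homogeneous_add algebra_simps)

lemma pq_type_scale: "pq_type p q \<alpha> \<Longrightarrow> pq_type p q (form_scale c \<alpha>)"
  by (auto simp: pq_type_def ext_form_scale homogeneous_scale) (simp add: form_scale_def)

lemma pq_type_diff: "pq_type p q \<alpha> \<Longrightarrow> pq_type p q \<beta> \<Longrightarrow> pq_type p q (\<alpha> - \<beta>)"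
  by (auto simp: pq_type_def ext_form_diff homogeneous_def algebra_simps)

lemma pq_type_sum: "(\<And>i. i \<in> A \<Longrightarrow> pq_type p q (f i)) \<Longrightarrow> pq_type p q (\<Sum>i\<in>A. f i)"
proof (induction A rule: infinite_finite_induct)
  case (insert x F)
  then show ?case by (metis pq_type_add insertI1 insertI2 sum.insert)
qed (simp_all add: pq_type_zero)

lemma pq_type_unit_form: "pq_type 0 0 unit_form"
  by (auto simp: pq_type_def ext_form_unit_form homogeneous_unit_form) (simp add: unit_form_def)

lemma pq_type_covec_wedge10:
  assumes "a \<in> covectors10 mult_i" "pq_type p q \<beta>"
  shows "pq_type (Suc p) q (covec_wedge a \<beta>)"
  unfolding pq_type_def
proof (intro conjI allI impI)
  show "ext_form (covec_wedge a \<beta>)"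
    using assms by (intro ext_form_covec_wedge) (auto simp: covectors10_def pq_type_def)
  show "homogeneous (Suc p + q) (covec_wedge a \<beta>)"
    using homogeneous_covec_wedge[OF pq_typeD(2)[OF assms(2)]] by simp
  fix \<zeta> :: complex and vs :: "(complex^'a) list" assume z: "cmod \<zeta> = 1"
  have 1: "a \<circ> (*s) \<zeta> = (\<lambda>v. \<zeta> * a v)" using covectors10_scalar[OF assms(1)] by auto
  have 2: "(\<lambda>ws. \<beta> (map ((*s) \<zeta>) ws)) = form_scale (\<zeta> ^ p * cnj \<zeta> ^ q) \<beta>"
    by (auto simp: form_scale_def pq_typeD(3)[OF assms(2) z])
  show "covec_wedge a \<beta> (map ((*s) \<zeta>) vs) = \<zeta> ^ Suc p * cnj \<zeta> ^ q * covec_wedge a \<beta> vs"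
    unfolding covec_wedge_map 1 2 covec_wedge_scale_left covec_wedge_scale by (simp add: form_scale_def)
qed

lemma pq_type_covec_wedge01:
  assumes "a \<in> covectors01 mult_i" "pq_type p q \<beta>"
  shows "pq_type p (Suc q) (covec_wedge a \<beta>)"
  unfolding pq_type_def
proof (intro conjI allI impI)
  show "ext_form (covec_wedge a \<beta>)"
    using assms by (intro ext_form_covec_wedge) (auto simp: covectors01_def pq_type_def)
  show "homogeneous (p + Suc q) (covec_wedge a \<beta>)"
    using homogeneous_covec_wedge[OF pq_typeD(2)[OF assms(2)]] by simp
  fix \<zeta> :: complex and vs :: "(complex^'a) list" assume z: "cmod \<zeta> = 1"
  have 1: "a \<circ> (*s) \<zeta> = (\<lambda>v. cnj \<zeta> * a v)" using covectors01_scalar[OF assms(1)] by auto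
  have 2: "(\<lambda>ws. \<beta> (map ((*s) \<zeta>) ws)) = form_scale (\<zeta> ^ p * cnj \<zeta> ^ q) \<beta>"
    by (auto simp: form_scale_def pq_typeD(3)[OF assms(2) z])
  show "covec_wedge a \<beta> (map ((*s) \<zeta>) vs) = \<zeta> ^ p * cnj \<zeta> ^ Suc q * covec_wedge a \<beta> vs"
    unfolding covec_wedge_map 1 2 covec_wedge_scale_left covec_wedge_scale by (simp add: form_scale_def)
qed

interpretation form_vs: vector_space form_scale
  by unfold_locales (auto simp: form_scale_def algebra_simps)

lemma pq_covectors_pq_type:
  assumes "\<beta> \<in> pq_covectors mult_i p q" shows "pq_type p q \<beta>"
proof -
  have gen: "pq_type (length as) (length bs) (foldr covec_wedge (as @ bs) unit_form)"
    if "set as \<subseteq> covectors10 mult_i" "set bs \<subseteq> covectors01 mult_i" for as bs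
  proof -
    have "pq_type 0 (length bs) (foldr covec_wedge bs unit_form)"
      using that(2) by (induction bs) (auto intro!: pq_type_unit_form pq_type_covec_wedge01)
    then show ?thesis
      using that(1) by (induction as) (auto intro!: pq_type_covec_wedge10)
  qed
  show ?thesis
    using assms unfolding pq_covectors_def
  proof (induction rule: form_vs.span_induct_alt)
    case base
    then show ?case by (rule pq_type_zero)
  next
    case (step c x y)
    then have "pq_type p q x" using gen by (auto simp: wedge_list_one_forms simp del: map_append)
    then show ?case using step(2) by (intro pq_type_add pq_type_scale)
  qed
qed

lemma infinite_unit_circle: "infinite {w::complex. cmod w = 1}"
proof
  assume fin: "finite {w::complex. cmod w = 1}"
  have "connected (sphere (0::complex) 1)" by (rule connected_sphere) simp
  moreover have "sphere (0::complex) 1 = {w. cmod w = 1}" by auto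
  ultimately have "\<exists>x. {w::complex. cmod w = 1} = {x}"
    using fin connected_finite_iff_sing by (metis (mono_tags, lifting) empty_iff mem_Collect_eq norm_one)
  then obtain x :: complex where x: "{w. cmod w = 1} = {x}" by blast
  have "1 \<in> {w::complex. cmod w = 1}" "- 1 \<in> {w::complex. cmod w = 1}" by auto
  then show False unfolding x by simp
qed

text \<open>Components of different bidegree are independent because they have different weights. In
  a fixed degree the weights are distinct powers of one unit complex number, so the relation becomes
  a polynomial vanishing on the circle.\<close>

lemma pq_type_sum_eq_0:
  assumes "\<And>r s. r \<le> n \<Longrightarrow> s \<le> n \<Longrightarrow> pq_type r s (c r s)"
    and "(\<Sum>r\<le>n. \<Sum>s\<le>n. c r s) = 0"
    and "p \<le> n" "q \<le> n"
  shows "c p q = 0"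
proof
  fix vs :: "(complex^'a) list"
  define k where "k = length vs"
  show "c p q vs = 0 vs"
  proof (cases "p + q = k")
    case False
    then show ?thesis using pq_typeD(2)[OF assms(1)[OF assms(3,4)]] by (auto simp: homogeneous_def k_def)
  next
    case True
    define a where "a r = (if r \<le> n \<and> k - r \<le> n then c r (k - r) vs else 0)" for r
    have "(\<Sum>r\<le>k. a r * w ^ r) = 0" if w: "cmod w = 1" for w
    proof -
      \<comment> \<open>A square root of \<open>w\<close>: in degree \<open>k = r + s\<close> the
        factor is \<open>\<zeta> ^ r * cnj \<zeta> ^ s\<close>, and multiplying it by
        \<open>\<zeta> ^ k\<close> leaves \<open>w ^ r\<close>, so the relation is polynomial in
        \<open>w\<close>.\<close>
      define \<zeta> where "\<zeta> = csqrt w"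
      have z: "\<zeta>\<^sup>2 = w" "cmod \<zeta> = 1"
        using w by (auto simp: \<zeta>_def norm_csqrt)
      have zz: "\<zeta> * cnj \<zeta> = 1" using z(2) by (simp add: complex_mult_cnj cmod_def)
      have tm: "\<zeta> ^ k * c r s (map ((*s) \<zeta>) vs) = (if s = k - r then (if r \<le> k then w ^ r * c r s vs else 0) else 0)"
        if "r \<le> n" "s \<le> n" for r s
      proof (cases "r + s = k")
        case True
        have "\<zeta> ^ k * (\<zeta> ^ r * cnj \<zeta> ^ s) = (\<zeta>\<^sup>2) ^ r * (\<zeta> * cnj \<zeta>) ^ s"
          by (simp add: True[symmetric] power_add power_mult_distrib power2_eq_square algebra_simps)
        then show ?thesis using True pq_typeD(3)[OF assms(1)[OF that] z(2), of vs] z zz by auto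
      next
        case False
        then have "c r s vs = 0" using pq_typeD(2)[OF assms(1)[OF that]] by (auto simp: homogeneous_def k_def)
        then show ?thesis using pq_typeD(3)[OF assms(1)[OF that] z(2), of vs] by auto
      qed
      have "0 = \<zeta> ^ k * (\<Sum>r\<le>n. \<Sum>s\<le>n. c r s) (map ((*s) \<zeta>) vs)" by (simp add: assms(2))
      also have "\<dots> = (\<Sum>r\<le>n. \<Sum>s\<le>n. if s = k - r then (if r \<le> k then w ^ r * c r s vs else 0) else 0)"
        by (simp add: sum_fun_apply sum_distrib_left tm)
      also have "\<dots> = (\<Sum>r\<le>n. if r \<le> k then a r * w ^ r else 0)"
        by (rule sum.cong[OF refl]) (simp add: sum.delta a_def)
      also have "\<dots> = (\<Sum>r\<le>k. a r * w ^ r)"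
        by (rule sum.mono_neutral_cong) (auto simp: a_def)
      finally show ?thesis by simp
    qed
    then have "{w. cmod w = 1} \<subseteq> {w. (\<Sum>r\<le>k. a r * w ^ r) = 0}" by auto
    then have "infinite {w. (\<Sum>r\<le>k. a r * w ^ r) = 0}"
      using infinite_unit_circle finite_subset by blast
    then have "a p = 0" using polyfun_finite_roots[of a k] True by auto
    then show ?thesis using True assms(3,4) by (auto simp: a_def)
  qed
qed

text \<open>The monomial form of the spanning set of \<^const>\<open>pq_covectors\<close>, which shows that there
  are no \<open>(p,q)\<close>-covectors with \<open>p\<close> or \<open>q\<close> above the dimension.\<close>

definition pq_monomials :: "nat \<Rightarrow> nat \<Rightarrow> (complex^'d) ext_form set" where
  "pq_monomials p q = form_vs.span {foldr covec_wedge (map dz js @ map dzbar ks) unit_form | js ks.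
     distinct js \<and> length js = p \<and> distinct ks \<and> length ks = q}"

lemma covec_wedge_foldr_swap:
  "covec_wedge c (foldr covec_wedge cs \<gamma>) =
    form_scale ((- 1) ^ length cs) (foldr covec_wedge cs (covec_wedge c \<gamma>))"
proof (induction cs arbitrary: \<gamma>)
  case Nil
  then show ?case by (auto simp: form_scale_def)
next
  case (Cons d cs)
  have "covec_wedge c (foldr covec_wedge (d # cs) \<gamma>) = - covec_wedge d (covec_wedge c (foldr covec_wedge cs \<gamma>))"
    by (simp add: covec_wedge_anticomm[of c d])
  also have "\<dots> = - form_scale ((- 1) ^ length cs) (foldr covec_wedge (d # cs) (covec_wedge c \<gamma>))"
    by (simp only: Cons.IH covec_wedge_scale foldr.simps o_apply)
  finally show ?case by (simp add: form_scale_def fun_eq_iff)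
qed

lemma foldr_covec_wedge_zero: "foldr covec_wedge cs 0 = 0"
  by (induction cs) (simp_all only: foldr.simps o_apply id_apply covec_wedge_zero)

lemma covec_wedge_span:
  assumes "\<beta> \<in> form_vs.span S" "\<And>x. x \<in> S \<Longrightarrow> covec_wedge a x \<in> form_vs.span S'"
  shows "covec_wedge a \<beta> \<in> form_vs.span S'"
  using assms(1)
proof (induction rule: form_vs.span_induct_alt)
  case base
  then show ?case by (simp only: covec_wedge_zero form_vs.span_zero)
next
  case (step c x y)
  then show ?case
    using assms(2) by (simp only: covec_wedge_add covec_wedge_scale form_vs.span_add form_vs.span_scale)
qed

lemma pq_monomials_dz:
  assumes "\<beta> \<in> pq_monomials p q" shows "covec_wedge (dz j) \<beta> \<in> pq_monomials (Suc p) q"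
  using assms unfolding pq_monomials_def
proof (rule covec_wedge_span)
  fix x :: "(complex^'a) ext_form"
  assume "x \<in> {foldr covec_wedge (map dz js @ map dzbar ks) unit_form |js ks.
    distinct js \<and> length js = p \<and> distinct ks \<and> length ks = q}"
  then obtain js ks where x: "x = foldr covec_wedge (map dz js @ map dzbar ks) unit_form"
    and d: "distinct js" "length js = p" "distinct ks" "length ks = q" by blast
  show "covec_wedge (dz j) x \<in> form_vs.span {foldr covec_wedge (map dz js @ map dzbar ks) unit_form |js ks.
    distinct js \<and> length js = Suc p \<and> distinct ks \<and> length ks = q}"
  proof (cases "j \<in> set js")
    case True
    have "covec_wedge (dz j) x = 0"
      unfolding x covec_wedge_foldr_swap
      using covec_wedge_foldr_mem[of "dz j" "map dz js @ map dzbar ks" unit_form] True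
      by (simp add: form_scale_def fun_eq_iff image_iff) blast
    then show ?thesis using form_vs.span_zero by metis
  next
    case False
    have "covec_wedge (dz j) x = foldr covec_wedge (map dz (j # js) @ map dzbar ks) unit_form"
      by (simp add: x)
    then show ?thesis using d False
      by (intro form_vs.span_base CollectI exI[of _ "j # js"] exI[of _ ks]) auto
  qed
qed

lemma pq_monomials_dzbar:
  assumes "\<beta> \<in> pq_monomials p q" shows "covec_wedge (dzbar j) \<beta> \<in> pq_monomials p (Suc q)"
  using assms unfolding pq_monomials_def
proof (rule covec_wedge_span)
  fix x :: "(complex^'a) ext_form"
  assume "x \<in> {foldr covec_wedge (map dz js @ map dzbar ks) unit_form |js ks.
    distinct js \<and> length js = p \<and> distinct ks \<and> length ks = q}"
  then obtain js ks where x: "x = foldr covec_wedge (map dz js @ map dzbar ks) unit_form"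
    and d: "distinct js" "length js = p" "distinct ks" "length ks = q" by blast
  show "covec_wedge (dzbar j) x \<in> form_vs.span {foldr covec_wedge (map dz js @ map dzbar ks) unit_form |js ks.
    distinct js \<and> length js = p \<and> distinct ks \<and> length ks = Suc q}"
  proof (cases "j \<in> set ks")
    case True
    have "covec_wedge (dzbar j) x = 0"
      unfolding x covec_wedge_foldr_swap
      using covec_wedge_foldr_mem[of "dzbar j" "map dz js @ map dzbar ks" unit_form] True
      by (simp add: form_scale_def fun_eq_iff image_iff) blast
    then show ?thesis using form_vs.span_zero by metis
  next
    case False
    have "covec_wedge (dzbar j) x = form_scale ((- 1) ^ length (map dz js))
        (foldr covec_wedge (map dz js @ map dzbar (j # ks)) unit_form)"
      unfolding x foldr_append covec_wedge_foldr_swap[of "dzbar j" "map dz js"] by simp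
    then show ?thesis using d False
      by (simp only:) (intro form_vs.span_scale form_vs.span_base CollectI exI[of _ "js"] exI[of _ "j # ks"], auto)
  qed
qed

lemma pq_monomials_covec10:
  assumes "a \<in> covectors10 mult_i" "\<beta> \<in> pq_monomials p q"
  shows "covec_wedge a \<beta> \<in> pq_monomials (Suc p) q"
  by (subst covectors10_expansion[OF assms(1)])
    (auto simp only: covec_wedge_sum_left covec_wedge_scale_left pq_monomials_def
      intro!: form_vs.span_sum form_vs.span_scale pq_monomials_dz[OF assms(2), unfolded pq_monomials_def])

lemma pq_monomials_covec01:
  assumes "a \<in> covectors01 mult_i" "\<beta> \<in> pq_monomials p q"
  shows "covec_wedge a \<beta> \<in> pq_monomials p (Suc q)"
  by (subst covectors01_expansion[OF assms(1)])
    (auto simp only: covec_wedge_sum_left covec_wedge_scale_left pq_monomials_def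
      intro!: form_vs.span_sum form_vs.span_scale pq_monomials_dzbar[OF assms(2), unfolded pq_monomials_def])

lemma unit_form_pq_monomials: "unit_form \<in> pq_monomials 0 0"
  unfolding pq_monomials_def by (rule form_vs.span_base) auto

lemma pq_covectors_eq_monomials:
  "pq_covectors (mult_i :: complex^'d::finite \<Rightarrow> complex^'d) p q = pq_monomials p q"
proof
  have gen: "wedge_list (map one_form (as @ bs)) \<in> pq_monomials (length as) (length bs)"
    if a: "set as \<subseteq> covectors10 mult_i" "set bs \<subseteq> covectors01 mult_i"
    for as bs :: "(complex^'d \<Rightarrow> complex) list"
  proof -
    from a(2) have "foldr covec_wedge bs unit_form \<in> pq_monomials 0 (length bs)"
      by (induction bs) (auto intro!: unit_form_pq_monomials pq_monomials_covec01)
    with a(1) have "foldr covec_wedge (as @ bs) unit_form \<in> pq_monomials (length as) (length bs)"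
      by (induction as) (auto intro!: pq_monomials_covec10)
    then show ?thesis unfolding wedge_list_one_forms .
  qed
  have "{wedge_list (map one_form (as @ bs)) |as bs. length as = p \<and> set as \<subseteq> covectors10 (mult_i :: complex^'d \<Rightarrow> complex^'d) \<and>
      length bs = q \<and> set bs \<subseteq> covectors01 mult_i} \<subseteq> pq_monomials p q"
    using gen by blast
  then show "pq_covectors (mult_i :: complex^'d \<Rightarrow> complex^'d) p q \<subseteq> pq_monomials p q"
    unfolding pq_covectors_def by (rule form_vs.span_minimal) (simp only: pq_monomials_def form_vs.subspace_span)
  have "{foldr covec_wedge (map dz js @ map dzbar ks) (unit_form :: (complex^'d) ext_form) |js ks.
      distinct js \<and> length js = p \<and> distinct ks \<and> length ks = q} \<subseteq>
    {wedge_list (map one_form (as @ bs)) |as bs. length as = p \<and> set as \<subseteq> covectors10 (mult_i :: complex^'d \<Rightarrow> complex^'d) \<and>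
      length bs = q \<and> set bs \<subseteq> covectors01 mult_i}"
  proof
    fix x :: "(complex^'d) ext_form"
    assume "x \<in> {foldr covec_wedge (map dz js @ map dzbar ks) (unit_form :: (complex^'d) ext_form) |js ks.
      distinct js \<and> length js = p \<and> distinct ks \<and> length ks = q}"
    then obtain js ks where x: "x = foldr covec_wedge (map dz js @ map dzbar ks) unit_form"
      "length js = p" "length ks = q" by blast
    have "x = wedge_list (map one_form (map dz js @ map dzbar ks))"
      by (simp only: x(1) wedge_list_one_forms)
    moreover have "set (map dz js) \<subseteq> covectors10 mult_i" "set (map dzbar ks) \<subseteq> covectors01 mult_i"
      by (auto intro: dz_in_covectors10 dzbar_in_covectors01)
    moreover have "length (map dz js) = p" "length (map dzbar ks) = q" using x by auto
    ultimately show "x \<in> {wedge_list (map one_form (as @ bs)) |as bs. length as = p \<and>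
      set as \<subseteq> covectors10 mult_i \<and> length bs = q \<and> set bs \<subseteq> covectors01 mult_i}"
      by blast
  qed
  then show "pq_monomials p q \<subseteq> pq_covectors (mult_i :: complex^'d \<Rightarrow> complex^'d) p q"
    unfolding pq_covectors_def pq_monomials_def by (rule form_vs.span_mono)
qed

lemma pq_covectors_out_of_range:
  assumes "p > CARD('d) \<or> q > CARD('d::finite)"
  shows "pq_covectors (mult_i :: complex^'d \<Rightarrow> complex^'d) p q = {0}"
proof -
  have "length js \<le> CARD('d)" if "distinct js" for js :: "'d list"
    using that by (metis card_mono distinct_card finite subset_UNIV)
  then have "{foldr covec_wedge (map dz js @ map dzbar ks) (unit_form :: (complex^'d) ext_form) |js ks.
      distinct js \<and> length js = p \<and> distinct ks \<and> length ks = q} = {}"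
    using assms by fastforce
  then show ?thesis unfolding pq_covectors_eq_monomials pq_monomials_def by (simp only: form_vs.span_empty)
qed

text \<open>Finite sums of components with no bound on p and q, so that wedging with a covector
  never leaves the set; the range is cut down only in
  \<open>ext_form_pq_decomposition\<close>.\<close>

definition pq_sums :: "(complex^'d::finite) ext_form set" where
  "pq_sums = form_vs.span (\<Union>p q. pq_covectors mult_i p q)"

lemma pq_sums_covec_wedge:
  fixes \<beta> :: "(complex^'d::finite) ext_form"
  assumes "linear a" "\<beta> \<in> pq_sums"
  shows "covec_wedge a \<beta> \<in> pq_sums"
proof -
  have 1: "covec_wedge (dz j) \<beta> \<in> pq_sums" for j
    using assms(2) unfolding pq_sums_def
  proof (rule covec_wedge_span)
    fix x :: "(complex^'d) ext_form" assume "x \<in> (\<Union>p q. pq_covectors mult_i p q)"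
    then obtain p q where "x \<in> pq_covectors mult_i p q" by blast
    then have "covec_wedge (dz j) x \<in> pq_covectors mult_i (Suc p) q"
      unfolding pq_covectors_eq_monomials by (rule pq_monomials_dz)
    then show "covec_wedge (dz j) x \<in> form_vs.span (\<Union>p q. pq_covectors mult_i p q)"
      by (intro form_vs.span_base) blast
  qed
  have 2: "covec_wedge (dzbar j) \<beta> \<in> pq_sums" for j
    using assms(2) unfolding pq_sums_def
  proof (rule covec_wedge_span)
    fix x :: "(complex^'d) ext_form" assume "x \<in> (\<Union>p q. pq_covectors mult_i p q)"
    then obtain p q where "x \<in> pq_covectors mult_i p q" by blast
    then have "covec_wedge (dzbar j) x \<in> pq_covectors mult_i p (Suc q)"
      unfolding pq_covectors_eq_monomials by (rule pq_monomials_dzbar)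
    then show "covec_wedge (dzbar j) x \<in> form_vs.span (\<Union>p q. pq_covectors mult_i p q)"
      by (intro form_vs.span_base) blast
  qed
  have a: "(\<lambda>v. \<Sum>j\<in>UNIV. dz_coeff a j * dz j v + dzbar_coeff a j * dzbar j v) = a"
    by (rule ext) (rule covector_expansion[OF assms(1), symmetric])
  have "covec_wedge (\<lambda>v. \<Sum>j\<in>UNIV. dz_coeff a j * dz j v + dzbar_coeff a j * dzbar j v) \<beta>
    = (\<Sum>j\<in>UNIV. form_scale (dz_coeff a j) (covec_wedge (dz j) \<beta>)
      + form_scale (dzbar_coeff a j) (covec_wedge (dzbar j) \<beta>))"
    by (simp only: covec_wedge_sum_left covec_wedge_add_left covec_wedge_scale_left)
  then show ?thesis using 1 2 unfolding pq_sums_def a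
    by (simp only:) (intro form_vs.span_sum form_vs.span_add form_vs.span_scale)
qed

text \<open>Induction on the degree: \<open>number_operator\<close> writes the form, up to the
  factor \<open>Suc k\<close>, as covectors wedged with its contractions, which have lower
  degree.\<close>

lemma homogeneous_in_pq_sums:
  fixes \<beta> :: "(complex^'d::finite) ext_form"
  assumes "ext_form \<beta>" "homogeneous k \<beta>"
  shows "\<beta> \<in> pq_sums"
  using assms
proof (induction k arbitrary: \<beta>)
  case 0
  then have eq: "form_scale (\<beta> []) (unit_form :: (complex^'d) ext_form) = \<beta>"
    by (auto simp: form_scale_def unit_form_def homogeneous_def fun_eq_iff)
  have "(unit_form :: (complex^'d) ext_form) \<in> pq_covectors (mult_i :: complex^'d \<Rightarrow> complex^'d) 0 0"
    by (simp only: pq_covectors_eq_monomials unit_form_pq_monomials)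
  then have "unit_form \<in> (pq_sums :: (complex^'d) ext_form set)"
    unfolding pq_sums_def by (intro form_vs.span_base) blast
  then have "form_scale (\<beta> []) (unit_form :: (complex^'d) ext_form) \<in> pq_sums"
    unfolding pq_sums_def by (rule form_vs.span_scale)
  then show ?case unfolding eq .
next
  case (Suc k)
  let ?N = "\<Sum>b\<in>(Basis :: (complex^'d) set). covec_wedge (\<lambda>v. of_real (inner v b)) (contract b \<beta>)"
  have "?N \<in> pq_sums"
  proof -
    have "covec_wedge (\<lambda>v. of_real (inner v b)) (contract b \<beta>) \<in> pq_sums" for b :: "complex^'d"
    proof (rule pq_sums_covec_wedge)
      show "linear (\<lambda>v. complex_of_real (inner v b))"
        by (auto simp: linear_iff inner_add_left scaleR_complex)
      show "contract b \<beta> \<in> pq_sums"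
        by (rule Suc.IH[OF ext_form_contract[OF Suc.prems(1)] homogeneous_contract[OF Suc.prems(2)]])
    qed
    then show ?thesis unfolding pq_sums_def by (rule form_vs.span_sum)
  qed
  then have "form_scale (1 / of_nat (Suc k)) ?N \<in> pq_sums"
    unfolding pq_sums_def by (rule form_vs.span_scale)
  moreover have "form_scale (1 / of_nat (Suc k)) ?N = \<beta>"
  proof
    fix vs
    show "form_scale (1 / of_nat (Suc k)) ?N vs = \<beta> vs"
    proof (cases "length vs = Suc k")
      case True
      have "of_nat (Suc k) \<noteq> (0::complex)" by (rule of_nat_neq_0)
      then show ?thesis unfolding form_scale_def number_operator[OF Suc.prems(1)] True by simp
    next
      case False
      then have "\<beta> vs = 0" using Suc.prems(2) by (auto simp: homogeneous_def)
      then show ?thesis unfolding form_scale_def number_operator[OF Suc.prems(1)] by simp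
    qed
  qed
  ultimately show ?case by (simp only:)
qed

lemma ext_form_in_pq_sums:
  fixes \<beta> :: "(complex^'d::finite) ext_form"
  assumes "ext_form \<beta>"
  shows "\<beta> \<in> pq_sums"
proof -
  have "\<beta> = (\<Sum>k\<le>DIM(complex^'d). degree_part k \<beta>)"
  proof
    fix vs
    show "\<beta> vs = (\<Sum>k\<le>DIM(complex^'d). degree_part k \<beta>) vs"
      using ext_form_long[OF assms, of vs]
      by (auto simp: sum_fun_apply degree_part_def sum.delta' simp del: DIM_cart)
  qed
  then have "(\<Sum>k\<le>DIM(complex^'d). degree_part k \<beta>) = \<beta>" ..
  moreover have "degree_part k \<beta> \<in> pq_sums" for k
    by (rule homogeneous_in_pq_sums[OF ext_form_degree_part[OF assms] homogeneous_degree_part])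
  then have "(\<Sum>k\<le>DIM(complex^'d). degree_part k \<beta>) \<in> pq_sums"
    unfolding pq_sums_def by (rule form_vs.span_sum)
  ultimately show ?thesis by (simp only:)
qed

lemma ext_form_pq_decomposition:
  fixes \<beta> :: "(complex^'d::finite) ext_form"
  assumes "ext_form \<beta>"
  shows "\<exists>c. (\<forall>r s. c r s \<in> pq_covectors mult_i r s) \<and> \<beta> = (\<Sum>r\<le>CARD('d). \<Sum>s\<le>CARD('d). c r s)"
  using ext_form_in_pq_sums[OF assms] unfolding pq_sums_def
proof (induction rule: form_vs.span_induct_alt)
  case base
  have z0: "0 \<in> pq_covectors (mult_i :: complex^'d \<Rightarrow> complex^'d) r s" for r s
    unfolding pq_covectors_def by (rule form_vs.span_zero)
  show ?case by (intro exI[of _ "\<lambda>r s. 0"] conjI allI) (rule z0, simp only: sum.neutral_const)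
next
  case (step k x y)
  then obtain c where c: "\<And>r s. c r s \<in> pq_covectors mult_i r s"
    "y = (\<Sum>r\<le>CARD('d). \<Sum>s\<le>CARD('d). c r s)" by blast
  obtain p q where x: "x \<in> pq_covectors mult_i p q" using step by blast
  define c' where "c' r s = (if r = p then if s = q then form_scale k x + c r s else c r s else c r s)" for r s
  have c'eq: "c' r s = (if r = p then if s = q then form_scale k x else 0 else 0) + c r s" for r s
    by (auto simp: c'_def)
  have "c' r s \<in> pq_covectors mult_i r s" for r s
    using c(1)[of r s] x unfolding c'_def pq_covectors_def
    by (auto intro!: form_vs.span_add form_vs.span_scale)
  moreover have "form_scale k x + y = (\<Sum>r\<le>CARD('d). \<Sum>s\<le>CARD('d). c' r s)"
  proof (cases "p \<le> CARD('d) \<and> q \<le> CARD('d)")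
    case True
    have inn: "(\<Sum>s\<le>CARD('d). if r = p then if s = q then form_scale k x else 0 else 0) = (if r = p then form_scale k x else 0)" for r
      using True by (simp add: sum.delta)
    show ?thesis unfolding c(2) c'eq sum.distrib inn using True by (simp add: sum.delta)
  next
    \<comment> \<open>A generator outside the range is zero by
      \<open>pq_covectors_out_of_range\<close>, so nothing has to be added.\<close>
    case False
    then have "p > CARD('d) \<or> q > CARD('d)" by auto
    from pq_covectors_out_of_range[OF this] x have "x = 0" by (simp only: singleton_iff)
    then have fs: "form_scale k x = 0" by (simp add: form_scale_def fun_eq_iff)
    have "c' r s = c r s" for r s unfolding c'eq fs by (simp only: if_cancel add_0)
    then show ?thesis unfolding c(2) fs by (simp only: add_0)
  qed
  ultimately show ?case by blast
qed

text \<open>The converse of \<open>pq_covectors_pq_type\<close>. The form is decomposed, and by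
  \<open>pq_type_sum_eq_0\<close> the decomposition differs in no bidegree from the form
  itself.\<close>

lemma pq_type_in_pq_covectors:
  fixes \<beta> :: "(complex^'d::finite) ext_form"
  assumes "pq_type p q \<beta>"
  shows "\<beta> \<in> pq_covectors mult_i p q"
proof -
  obtain c where c: "\<And>r s. c r s \<in> pq_covectors mult_i r s"
    "\<beta> = (\<Sum>r\<le>CARD('d). \<Sum>s\<le>CARD('d). c r s)"
    using ext_form_pq_decomposition[OF pq_typeD(1)[OF assms]] by blast
  \<comment> \<open>The pair (p,q) need not lie within the dimension, so both decompositions are
    compared in a common larger range.\<close>
  define n where "n = Max {CARD('d), p, q}"
  have n: "CARD('d) \<le> n" "p \<le> n" "q \<le> n" by (auto simp: n_def)
  define d where "d r s = c r s - (if r = p then if s = q then \<beta> else 0 else 0)" for r s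
  have c0: "c r s = 0" if "r > CARD('d) \<or> s > CARD('d)" for r s
    using c(1)[of r s] pq_covectors_out_of_range[where 'd = 'd, of r s] that by auto
  have dt: "pq_type r s (d r s)" for r s
    unfolding d_def
    by (rule pq_type_diff[OF pq_covectors_pq_type[OF c(1)]]) (use assms pq_type_zero in \<open>auto split: if_splits\<close>)
  have inn: "(\<Sum>s\<le>n. if r = p then if s = q then \<beta> else 0 else 0) = (if r = p then \<beta> else 0)" for r
    using n by (simp add: sum.delta)
  have "(\<Sum>r\<le>n. \<Sum>s\<le>n. c r s) = (\<Sum>r\<le>n. \<Sum>s\<le>CARD('d). c r s)"
    by (intro sum.cong refl sum.mono_neutral_right) (use n c0 in auto)
  also have "\<dots> = \<beta>" unfolding c(2)
    by (intro sum.mono_neutral_right) (use n c0 in \<open>auto intro!: sum.neutral\<close>)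
  finally have "(\<Sum>r\<le>n. \<Sum>s\<le>n. c r s) = \<beta>" .
  then have "(\<Sum>r\<le>n. \<Sum>s\<le>n. d r s) = 0"
    unfolding d_def sum_subtractf inn using n by (simp add: sum.delta)
  then have "d p q = 0" using pq_type_sum_eq_0[of n d p q] dt n by blast
  then show ?thesis using c(1)[of p q] by (simp add: d_def)
qed

lemma pq_type_out_of_range:
  assumes "pq_type p q (\<beta> :: (complex^'d::finite) ext_form)" "p > CARD('d) \<or> q > CARD('d)"
  shows "\<beta> = 0"
  using pq_type_in_pq_covectors[OF assms(1)] pq_covectors_out_of_range[OF assms(2)] by simp

section \<open>Projection to a bidegree\<close>

lemma zero_in_pq_covectors: "0 \<in> pq_covectors J p q"
  unfolding pq_covectors_def by (rule form_vs.span_zero)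

text \<open>Justifies the description in \<open>pq_part\<close>: two decompositions agree within the
  range by the independence of bidegrees, and outside it every component is zero.\<close>

lemma pq_part_eqI:
  fixes \<beta> :: "(complex^'d::finite) ext_form"
  assumes "\<And>r s. pq_type r s (c r s)" "\<beta> = (\<Sum>r\<le>CARD('d). \<Sum>s\<le>CARD('d). c r s)"
  shows "pq_part mult_i p q \<beta> = c p q"
  unfolding pq_part_def cdim_vec
proof (rule the_equality)
  show "\<exists>c'. (\<forall>r s. c' r s \<in> pq_covectors mult_i r s) \<and>
      \<beta> = (\<Sum>r\<le>CARD('d). \<Sum>s\<le>CARD('d). c' r s) \<and> c p q = c' p q"
    using assms by (intro exI[of _ c]) (auto intro: pq_type_in_pq_covectors)
next
  fix \<gamma>
  assume "\<exists>c'. (\<forall>r s. c' r s \<in> pq_covectors mult_i r s) \<and>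
      \<beta> = (\<Sum>r\<le>CARD('d). \<Sum>s\<le>CARD('d). c' r s) \<and> \<gamma> = c' p q"
  then obtain c' where c': "\<And>r s. c' r s \<in> pq_covectors mult_i r s"
    "\<beta> = (\<Sum>r\<le>CARD('d). \<Sum>s\<le>CARD('d). c' r s)" "\<gamma> = c' p q" by blast
  show "\<gamma> = c p q"
  proof (cases "p \<le> CARD('d) \<and> q \<le> CARD('d)")
    case True
    have "(\<Sum>r\<le>CARD('d). \<Sum>s\<le>CARD('d). c' r s - c r s) = 0"
      unfolding sum_subtractf using c'(2) assms(2) by simp
    then have "c' p q - c p q = 0"
      using pq_type_sum_eq_0[of "CARD('d)" "\<lambda>r s. c' r s - c r s" p q] True
      by (simp add: pq_type_diff pq_covectors_pq_type c' assms)
    then show ?thesis using c'(3) by simp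
  next
    case False
    then have "p > CARD('d) \<or> q > CARD('d)" by auto
    then show ?thesis
      using c'(1)[of p q] c'(3) pq_type_out_of_range[OF assms(1)[of p q]]
        pq_covectors_out_of_range[where 'd = 'd, of p q] by auto
  qed
qed

lemma pq_part_pq_type:
  fixes \<beta> :: "(complex^'d::finite) ext_form"
  assumes "pq_type p q \<beta>"
  shows "pq_part mult_i r s \<beta> = (if r = p \<and> s = q then \<beta> else 0)"
proof (rule pq_part_eqI[where c = "\<lambda>r s. if r = p \<and> s = q then \<beta> else 0"])
  show "pq_type r s (if r = p \<and> s = q then \<beta> else 0)" for r s
    using assms by (auto simp: pq_type_zero)
  show "\<beta> = (\<Sum>r\<le>CARD('d). \<Sum>s\<le>CARD('d). if r = p \<and> s = q then \<beta> else 0)"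
  proof (cases "p \<le> CARD('d) \<and> q \<le> CARD('d)")
    case True
    have "(\<Sum>r\<le>CARD('d). \<Sum>s\<le>CARD('d). if r = p \<and> s = q then \<beta> else 0)
        = (\<Sum>r\<le>CARD('d). if r = p then (\<Sum>s\<le>CARD('d). if s = q then \<beta> else 0) else 0)"
      by (intro sum.cong) auto
    also have "\<dots> = \<beta>" using True by (simp add: sum.delta)
    finally show ?thesis ..
  next
    case False
    then have "\<beta> = 0" using pq_type_out_of_range[OF assms] by auto
    then show ?thesis by (simp cong: if_cong)
  qed
qed

text \<open>The shape of the exterior derivative of a (p,q)-form. When \<open>Suc p\<close> or
  \<open>Suc q\<close> exceeds the dimension, the respective summand is zero, so the bounded range
  of summation loses nothing.\<close>

lemma pq_part_add_pq_types:
  fixes \<alpha> \<beta> :: "(complex^'d::finite) ext_form"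
  assumes "pq_type (Suc p) q \<alpha>" "pq_type p (Suc q) \<beta>"
  shows "pq_part mult_i (Suc p) q (\<alpha> + \<beta>) = \<alpha>" "pq_part mult_i p (Suc q) (\<alpha> + \<beta>) = \<beta>"
proof -
  define c where "c r s = (if r = Suc p then if s = q then \<alpha> else 0 else 0)
      + (if r = p then if s = Suc q then \<beta> else 0 else 0)" for r s
  have t: "pq_type r s (c r s)" for r s
    unfolding c_def using assms by (auto intro!: pq_type_add simp: pq_type_zero)
  have delta: "(\<Sum>r\<le>n. \<Sum>s\<le>n. if r = u then if s = v then \<gamma> else 0 else 0) = \<gamma>"
    if "u \<le> n \<and> v \<le> n \<or> \<gamma> = 0" for u v n :: nat and \<gamma> :: "(complex^'d) ext_form"
  proof (cases "\<gamma> = 0")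
    case True
    then show ?thesis by (simp cong: if_cong)
  next
    case False
    then have uv: "u \<le> n" "v \<le> n" using that by auto
    have "(\<Sum>s\<le>n. if s = v then \<gamma> else 0) = \<gamma>"
      by (simp add: sum.delta uv)
    then have "(\<Sum>s\<le>n. if r = u then if s = v then \<gamma> else 0 else 0) = (if r = u then \<gamma> else 0)" for r
      by (cases "r = u") simp_all
    moreover have "(\<Sum>r\<le>n. if r = u then \<gamma> else 0) = \<gamma>"
      by (simp add: sum.delta uv)
    ultimately show ?thesis by (simp only:)
  qed
  have "\<alpha> + \<beta> = (\<Sum>r\<le>CARD('d). \<Sum>s\<le>CARD('d). c r s)"
    unfolding c_def sum.distrib
    using pq_type_out_of_range[OF assms(1)] pq_type_out_of_range[OF assms(2)]
    by (subst delta, force, subst delta, force) simp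
  from pq_part_eqI[OF t this] show
    "pq_part mult_i (Suc p) q (\<alpha> + \<beta>) = \<alpha>" "pq_part mult_i p (Suc q) (\<alpha> + \<beta>) = \<beta>"
    by (simp_all add: c_def)
qed

section \<open>Smooth functions and the operators of the Dolbeault complex\<close>

lemma Ck_on_Suc_imp: "Ck_on (Suc k) S f \<Longrightarrow> Ck_on k S f"
proof (induction k arbitrary: f)
  case 0
  then show ?case
    by (auto intro!: differentiable_imp_continuous_on simp: differentiable_on_def
        differentiable_at_withinI)
next
  case (Suc k)
  then show ?case by (metis Ck_on.simps(2))
qed

lemma smooth_on_imp_Ck: "smooth_on S f \<Longrightarrow> Ck_on k S f"
  by (simp add: smooth_on_def)

lemma smooth_on_differentiable: "smooth_on S f \<Longrightarrow> p \<in> S \<Longrightarrow> f differentiable at p"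
  using smooth_on_imp_Ck[of S f "Suc 0"] by simp

lemma smooth_on_continuous_on: "smooth_on S f \<Longrightarrow> continuous_on S f"
  using smooth_on_imp_Ck[of S f 0] by simp

lemma smooth_on_frechet_derivative:
  "smooth_on S f \<Longrightarrow> smooth_on S (\<lambda>p. frechet_derivative f (at p) v)"
  unfolding smooth_on_def by (metis Ck_on.simps(2))

lemma frechet_derivative_eqI: "(f has_derivative f') (at x) \<Longrightarrow> frechet_derivative f (at x) = f'"
  using frechet_derivative_at by metis

lemma Ck_on_const: "Ck_on k S (\<lambda>x. c)"
proof (induction k arbitrary: c)
  case (Suc k)
  have "frechet_derivative (\<lambda>x. c) (at p) = (\<lambda>v. 0)" for p :: 'a
    by (rule frechet_derivative_const)
  then show ?case using Suc by simp
qed simp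

lemma Ck_on_add:
  "Ck_on k UNIV f \<Longrightarrow> Ck_on k UNIV g \<Longrightarrow> Ck_on k UNIV (\<lambda>x. f x + g x)"
proof (induction k arbitrary: f g)
  case (Suc k)
  have "frechet_derivative (\<lambda>x. f x + g x) (at p) =
      (\<lambda>v. frechet_derivative f (at p) v + frechet_derivative g (at p) v)" for p
    using Suc.prems by (intro frechet_derivative_eqI derivative_intros)
      (auto simp: frechet_derivative_works)
  then show ?case using Suc by auto
qed (auto intro: continuous_intros)

lemma (in bounded_linear) Ck_on_compose: "Ck_on k UNIV g \<Longrightarrow> Ck_on k UNIV (\<lambda>x. f (g x))"
proof (induction k arbitrary: g)
  case 0
  then show ?case by (auto intro: continuous_on)
next
  case (Suc k)
  have "((\<lambda>x. f (g x)) has_derivative (\<lambda>v. f (frechet_derivative g (at p) v))) (at p)" for p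
    using Suc.prems by (intro has_derivative) (auto simp: frechet_derivative_works)
  then have "frechet_derivative (\<lambda>x. f (g x)) (at p) = (\<lambda>v. f (frechet_derivative g (at p) v))"
    "(\<lambda>x. f (g x)) differentiable at p" for p
    by (auto intro: frechet_derivative_eqI differentiableI)
  then show ?case using Suc by auto
qed

lemma (in bounded_bilinear) Ck_on_prod:
  "Ck_on k UNIV f \<Longrightarrow> Ck_on k UNIV g \<Longrightarrow> Ck_on k UNIV (\<lambda>x. prod (f x) (g x))"
proof (induction k arbitrary: f g)
  case 0
  then show ?case by (auto intro: continuous_on)
next
  case (Suc k)
  have "((\<lambda>x. prod (f x) (g x)) has_derivative
      (\<lambda>v. prod (f p) (frechet_derivative g (at p) v) + prod (frechet_derivative f (at p) v) (g p))) (at p)" for p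
    using Suc.prems by (intro FDERIV) (auto simp: frechet_derivative_works)
  then have "frechet_derivative (\<lambda>x. prod (f x) (g x)) (at p) =
      (\<lambda>v. prod (f p) (frechet_derivative g (at p) v) + prod (frechet_derivative f (at p) v) (g p))"
    "(\<lambda>x. prod (f x) (g x)) differentiable at p" for p
    by (auto intro: frechet_derivative_eqI differentiableI)
  moreover have "Ck_on k UNIV f" "Ck_on k UNIV g" using Suc.prems Ck_on_Suc_imp by blast+
  ultimately show ?case using Suc.prems by (auto intro!: Ck_on_add Suc.IH)
qed

text \<open>The derivative of the reciprocal is a product of the derivative of \<open>f\<close> with
  the reciprocal itself, which is already known to be regular of one order less.\<close>

lemma Ck_on_inverse:
  fixes f :: "'a::real_normed_vector \<Rightarrow> real"
  assumes "\<And>x. f x \<noteq> 0"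
  shows "Ck_on k UNIV f \<Longrightarrow> Ck_on k UNIV (\<lambda>x. inverse (f x))"
proof (induction k)
  case 0
  then show ?case using assms by (auto intro!: continuous_intros)
next
  case (Suc k)
  have "((\<lambda>x. inverse (f x)) has_derivative
      (\<lambda>v. - (inverse (f p) * frechet_derivative f (at p) v * inverse (f p)))) (at p)" for p
    using Suc.prems assms by (intro Deriv.has_derivative_inverse) (auto simp: frechet_derivative_works)
  then have d: "frechet_derivative (\<lambda>x. inverse (f x)) (at p) =
      (\<lambda>v. - (inverse (f p) * frechet_derivative f (at p) v * inverse (f p)))"
    "(\<lambda>x. inverse (f x)) differentiable at p" for p
    by (auto intro: frechet_derivative_eqI differentiableI)
  have "Ck_on k UNIV (\<lambda>x. inverse (f x))" using Suc Ck_on_Suc_imp by blast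
  moreover have "Ck_on k UNIV (\<lambda>x. frechet_derivative f (at x) v)" for v using Suc.prems by simp
  ultimately have "Ck_on k UNIV (\<lambda>p. - (inverse (f p) * frechet_derivative f (at p) v * inverse (f p)))" for v
    by (intro bounded_linear.Ck_on_compose[OF bounded_linear_minus[OF bounded_linear_ident]]
        bounded_bilinear.Ck_on_prod[OF bounded_bilinear_mult])
  then show ?case using d by auto
qed

lemma smooth_on_const: "smooth_on S (\<lambda>x. c)"
  by (simp add: smooth_on_def Ck_on_const)

lemma smooth_on_add:
  "smooth_on UNIV f \<Longrightarrow> smooth_on UNIV g \<Longrightarrow> smooth_on UNIV (\<lambda>x. f x + g x)"
  by (simp add: smooth_on_def Ck_on_add)

lemma smooth_on_linear: "bounded_linear f \<Longrightarrow> smooth_on UNIV g \<Longrightarrow> smooth_on UNIV (\<lambda>x. f (g x))"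
  by (simp add: smooth_on_def bounded_linear.Ck_on_compose)

lemma smooth_on_mult:
  fixes f g :: "'a::real_normed_vector \<Rightarrow> 'b::real_normed_algebra"
  shows "smooth_on UNIV f \<Longrightarrow> smooth_on UNIV g \<Longrightarrow> smooth_on UNIV (\<lambda>x. f x * g x)"
  by (simp add: smooth_on_def bounded_bilinear.Ck_on_prod[OF bounded_bilinear_mult])

lemma smooth_on_scaleR:
  "smooth_on UNIV f \<Longrightarrow> smooth_on UNIV g \<Longrightarrow> smooth_on UNIV (\<lambda>x. f x *\<^sub>R g x)"
  by (simp add: smooth_on_def bounded_bilinear.Ck_on_prod[OF bounded_bilinear_scaleR])

lemma smooth_on_inverse:
  fixes f :: "'a::real_normed_vector \<Rightarrow> real"
  shows "smooth_on UNIV f \<Longrightarrow> (\<And>x. f x \<noteq> 0) \<Longrightarrow> smooth_on UNIV (\<lambda>x. inverse (f x))"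
  by (simp add: smooth_on_def Ck_on_inverse)

lemma smooth_on_sum:
  "(\<And>i. i \<in> A \<Longrightarrow> smooth_on UNIV (f i)) \<Longrightarrow> smooth_on UNIV (\<lambda>x. \<Sum>i\<in>A. f i x)"
  by (induction A rule: infinite_finite_induct) (auto intro: smooth_on_const smooth_on_add)

lemma smooth_on_minus: "smooth_on UNIV f \<Longrightarrow> smooth_on UNIV (\<lambda>x. - f x)"
  by (rule smooth_on_linear[OF bounded_linear_minus[OF bounded_linear_ident]])

lemma smooth_on_diff:
  "smooth_on UNIV f \<Longrightarrow> smooth_on UNIV g \<Longrightarrow> smooth_on UNIV (\<lambda>x. f x - g x)"
  using smooth_on_add[OF _ smooth_on_minus, of f g] by simp

lemma smooth_on_of_real:
  "smooth_on UNIV f \<Longrightarrow> smooth_on UNIV (\<lambda>x. complex_of_real (f x))"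
  by (rule smooth_on_linear[OF bounded_linear_of_real])

lemma smooth_on_id: "smooth_on UNIV (\<lambda>x. x)"
proof -
  have "Ck_on k UNIV (\<lambda>x::'a. x)" for k
  proof (cases k)
    case 0
    then show ?thesis by (simp add: continuous_on_id)
  next
    case (Suc m)
    have "frechet_derivative (\<lambda>x. x) (at p) = (\<lambda>v::'a. v)" for p
      by (rule frechet_derivative_ident)
    then show ?thesis using Suc by (simp add: Ck_on_const)
  qed
  then show ?thesis by (simp add: smooth_on_def)
qed

subsection \<open>Wirtinger derivatives\<close>

definition wirt :: "'d \<Rightarrow> (complex^'d::finite \<Rightarrow> complex) \<Rightarrow> complex^'d \<Rightarrow> complex" where
  "wirt j f x = dz_coeff (frechet_derivative f (at x)) j"

definition wirt_bar :: "'d \<Rightarrow> (complex^'d::finite \<Rightarrow> complex) \<Rightarrow> complex^'d \<Rightarrow> complex" where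
  "wirt_bar j f x = dzbar_coeff (frechet_derivative f (at x)) j"

lemmas wirt_defs = wirt_def wirt_bar_def dz_coeff_def dzbar_coeff_def

lemma frechet_derivative_linear_apply:
  assumes "f differentiable at x"
  shows "linear (frechet_derivative f (at x))"
  using assms by (simp add: linear_frechet_derivative)

lemma wirt_expansion:
  fixes f :: "complex^'d::finite \<Rightarrow> complex"
  assumes "f differentiable at x"
  shows "frechet_derivative f (at x) v = (\<Sum>j\<in>UNIV. wirt j f x * dz j v + wirt_bar j f x * dzbar j v)"
  unfolding wirt_def wirt_bar_def
  by (rule covector_expansion[OF frechet_derivative_linear_apply[OF assms]])

lemma frechet_derivative_add_at:
  assumes "f differentiable at x" "g differentiable at x"
  shows "frechet_derivative (\<lambda>y. f y + g y) (at x) =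
    (\<lambda>v. frechet_derivative f (at x) v + frechet_derivative g (at x) v)"
  using assms by (intro frechet_derivative_eqI derivative_intros) (auto simp: frechet_derivative_works)

lemma frechet_derivative_mult_at:
  fixes f g :: "'a::real_normed_vector \<Rightarrow> complex"
  assumes "f differentiable at x" "g differentiable at x"
  shows "frechet_derivative (\<lambda>y. f y * g y) (at x) =
    (\<lambda>v. f x * frechet_derivative g (at x) v + frechet_derivative f (at x) v * g x)"
  using assms by (intro frechet_derivative_eqI has_derivative_mult) (auto simp: frechet_derivative_works)

lemma frechet_derivative_cong_open:
  assumes "open U" "x \<in> U" "\<And>y. y \<in> U \<Longrightarrow> f y = g y"
  shows "frechet_derivative f (at x) = frechet_derivative g (at x)"
proof -
  have "(f has_derivative D) (at x) \<longleftrightarrow> (g has_derivative D) (at x)" for D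
    using has_derivative_transform_within_open[of f D x UNIV U g]
      has_derivative_transform_within_open[of g D x UNIV U f] assms by auto
  then show ?thesis by (simp add: frechet_derivative_def)
qed

lemma wirt_cong_open:
  assumes "open U" "x \<in> U" "\<And>y. y \<in> U \<Longrightarrow> f y = g y"
  shows "wirt j f x = wirt j g x" "wirt_bar j f x = wirt_bar j g x"
  using frechet_derivative_cong_open[OF assms] by (simp_all add: wirt_def wirt_bar_def)

lemma wirt_const [simp]: "wirt j (\<lambda>y. c) x = 0" "wirt_bar j (\<lambda>y. c) x = 0"
  by (simp_all add: wirt_defs frechet_derivative_const)

lemma wirt_add:
  assumes "f differentiable at x" "g differentiable at x"
  shows "wirt j (\<lambda>y. f y + g y) x = wirt j f x + wirt j g x"
    "wirt_bar j (\<lambda>y. f y + g y) x = wirt_bar j f x + wirt_bar j g x"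
  by (simp_all add: wirt_defs frechet_derivative_add_at[OF assms] field_simps)

lemma wirt_mult:
  assumes "f differentiable at x" "g differentiable at x"
  shows "wirt j (\<lambda>y. f y * g y) x = f x * wirt j g x + wirt j f x * g x"
    "wirt_bar j (\<lambda>y. f y * g y) x = f x * wirt_bar j g x + wirt_bar j f x * g x"
  by (simp_all add: wirt_defs frechet_derivative_mult_at[OF assms] field_simps)

lemma wirt_cmult:
  assumes "f differentiable at x"
  shows "wirt j (\<lambda>y. c * f y) x = c * wirt j f x" "wirt_bar j (\<lambda>y. c * f y) x = c * wirt_bar j f x"
  using wirt_mult[OF differentiable_const assms, of j c] by simp_all

lemma wirt_uminus:
  assumes "f differentiable at x"
  shows "wirt j (\<lambda>y. - f y) x = - wirt j f x" "wirt_bar j (\<lambda>y. - f y) x = - wirt_bar j f x"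
  using wirt_cmult[OF assms, of j "-1"] by simp_all

lemma wirt_sum:
  assumes "\<And>i. i \<in> A \<Longrightarrow> f i differentiable at x"
  shows "wirt j (\<lambda>y. \<Sum>i\<in>A. f i y) x = (\<Sum>i\<in>A. wirt j (f i) x)"
    "wirt_bar j (\<lambda>y. \<Sum>i\<in>A. f i y) x = (\<Sum>i\<in>A. wirt_bar j (f i) x)"
proof -
  have d: "(\<lambda>y. \<Sum>i\<in>B. f i y) differentiable at x" if "B \<subseteq> A" for B
    using that assms by (cases "finite B") (auto intro!: differentiable_sum)
  have "B \<subseteq> A \<Longrightarrow> wirt j (\<lambda>y. \<Sum>i\<in>B. f i y) x = (\<Sum>i\<in>B. wirt j (f i) x) \<and>
    wirt_bar j (\<lambda>y. \<Sum>i\<in>B. f i y) x = (\<Sum>i\<in>B. wirt_bar j (f i) x)" for B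
  proof (induction B rule: infinite_finite_induct)
    case (insert b B)
    then show ?case using wirt_add[OF assms[of b] d[of B]] by simp
  qed auto
  then show "wirt j (\<lambda>y. \<Sum>i\<in>A. f i y) x = (\<Sum>i\<in>A. wirt j (f i) x)"
    "wirt_bar j (\<lambda>y. \<Sum>i\<in>A. f i y) x = (\<Sum>i\<in>A. wirt_bar j (f i) x)" by blast+
qed

lemma smooth_on_wirt: "smooth_on UNIV f \<Longrightarrow> smooth_on UNIV (wirt j f)"
  and smooth_on_wirt_bar: "smooth_on UNIV f \<Longrightarrow> smooth_on UNIV (wirt_bar j f)"
  unfolding wirt_def[abs_def] wirt_bar_def[abs_def] dz_coeff_def dzbar_coeff_def divide_inverse
  by (intro smooth_on_mult smooth_on_add smooth_on_diff smooth_on_const smooth_on_frechet_derivative;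
      assumption)+

lemma smooth_on_vec_nth: "smooth_on UNIV (\<lambda>x::complex^'d::finite. vec_nth x j)"
  by (rule smooth_on_linear[OF bounded_linear_vec_nth smooth_on_id])

lemma smooth_on_cnj_vec_nth: "smooth_on UNIV (\<lambda>x::complex^'d::finite. cnj (vec_nth x j))"
  by (rule smooth_on_linear[OF bounded_linear_cnj smooth_on_vec_nth])

lemma wirt_vec_nth:
  "wirt k (\<lambda>x. vec_nth x j) x = (if k = j then 1 else 0)" "wirt_bar k (\<lambda>x. vec_nth x j) x = 0"
  "wirt k (\<lambda>x. cnj (vec_nth x j)) x = 0" "wirt_bar k (\<lambda>x. cnj (vec_nth x j)) x = (if k = j then 1 else 0)"
proof -
  have 1: "frechet_derivative (\<lambda>x::complex^'a. vec_nth x j) (at x) = (\<lambda>v. vec_nth v j)"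
    by (rule frechet_derivative_eqI) (rule bounded_linear_imp_has_derivative[OF bounded_linear_vec_nth])
  have 2: "frechet_derivative (\<lambda>x::complex^'a. cnj (vec_nth x j)) (at x) = (\<lambda>v. cnj (vec_nth v j))"
    by (rule frechet_derivative_eqI)
      (rule bounded_linear_imp_has_derivative[OF
        bounded_linear_compose[OF bounded_linear_cnj bounded_linear_vec_nth]])
  show "wirt k (\<lambda>x. vec_nth x j) x = (if k = j then 1 else 0)" "wirt_bar k (\<lambda>x. vec_nth x j) x = 0"
    "wirt k (\<lambda>x. cnj (vec_nth x j)) x = 0" "wirt_bar k (\<lambda>x. cnj (vec_nth x j)) x = (if k = j then 1 else 0)"
    unfolding wirt_defs 1 2 by (auto simp: axis_def)
qed

subsection \<open>Form fields\<close>

definition form_wirt :: "'d \<Rightarrow> (complex^'d::finite) form_field \<Rightarrow> (complex^'d) form_field" where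
  "form_wirt j \<Psi> = (\<lambda>x vs. wirt j (\<lambda>y. \<Psi> y vs) x)"

definition form_wirt_bar :: "'d \<Rightarrow> (complex^'d::finite) form_field \<Rightarrow> (complex^'d) form_field" where
  "form_wirt_bar j \<Psi> = (\<lambda>x vs. wirt_bar j (\<lambda>y. \<Psi> y vs) x)"

abbreviation smooth_form :: "'a::euclidean_space form_field \<Rightarrow> bool" where
  "smooth_form \<equiv> smooth_form_on UNIV"

lemma smooth_formD:
  assumes "smooth_form \<Psi>" shows "ext_form (\<Psi> x)" "smooth_on UNIV (\<lambda>y. \<Psi> y vs)"
  using assms by (auto simp: smooth_form_on_def)

lemma smooth_form_differentiable: "smooth_form \<Psi> \<Longrightarrow> (\<lambda>y. \<Psi> y vs) differentiable at x"
  using smooth_on_differentiable[OF smooth_formD(2)] by blast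

lemma smooth_form_covec_wedge:
  assumes "linear a" "smooth_form \<Psi>" shows "smooth_form (\<lambda>x. covec_wedge a (\<Psi> x))"
  unfolding smooth_form_on_def
proof (intro conjI ballI allI)
  show "ext_form (covec_wedge a (\<Psi> x))" for x
    by (rule ext_form_covec_wedge[OF assms(1) smooth_formD(1)[OF assms(2)]])
  show "smooth_on UNIV (\<lambda>x. covec_wedge a (\<Psi> x) vs)" for vs
    unfolding covec_wedge_nths
    by (intro smooth_on_sum smooth_on_mult smooth_on_const smooth_formD(2)[OF assms(2)])
qed

lemma smooth_form_sum:
  assumes "\<And>i. i \<in> A \<Longrightarrow> smooth_form (F i)" shows "smooth_form (\<lambda>x. \<Sum>i\<in>A. F i x)"
  using assms unfolding smooth_form_on_def
  by (auto intro!: ext_form_sum smooth_on_sum simp: sum_fun_apply)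

lemma form_wirt_covec_wedge:
  assumes "\<And>vs. (\<lambda>y. \<Psi> y vs) differentiable at x"
  shows "form_wirt j (\<lambda>y. covec_wedge a (\<Psi> y)) x = covec_wedge a (form_wirt j \<Psi> x)"
    "form_wirt_bar j (\<lambda>y. covec_wedge a (\<Psi> y)) x = covec_wedge a (form_wirt_bar j \<Psi> x)"
proof -
  have d: "(\<lambda>y. c * \<Psi> y ws) differentiable at x" for c ws
    using assms by (auto intro: differentiable_mult)
  show "form_wirt j (\<lambda>y. covec_wedge a (\<Psi> y)) x = covec_wedge a (form_wirt j \<Psi> x)"
    by (rule ext) (simp only: form_wirt_def covec_wedge_nths wirt_sum(1)[OF d] wirt_cmult(1)[OF assms])
  show "form_wirt_bar j (\<lambda>y. covec_wedge a (\<Psi> y)) x = covec_wedge a (form_wirt_bar j \<Psi> x)"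
    by (rule ext) (simp only: form_wirt_bar_def covec_wedge_nths wirt_sum(2)[OF d] wirt_cmult(2)[OF assms])
qed

lemma form_wirt_sum:
  assumes "\<And>i vs. i \<in> A \<Longrightarrow> (\<lambda>y. F i y vs) differentiable at x"
  shows "form_wirt j (\<lambda>y. \<Sum>i\<in>A. F i y) x = (\<Sum>i\<in>A. form_wirt j (F i) x)"
  by (rule ext) (simp add: form_wirt_def sum_fun_apply wirt_sum(1) assms)

text \<open>In the chart the conditions of \<open>pq_type\<close> are linear equations with constant
  coefficients, so they pass to derivatives. The open set \<open>U\<close> allows for forms given
  only locally, such as frames of the canonical bundle.\<close>

lemma pq_type_form_wirt:
  fixes \<Psi> :: "(complex^'d::finite) form_field"
  assumes U: "open U" "x \<in> U" and t: "\<And>y. y \<in> U \<Longrightarrow> pq_type p q (\<Psi> y)"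
    and d: "\<And>vs. (\<lambda>y. \<Psi> y vs) differentiable at x"
  shows "pq_type p q (form_wirt j \<Psi> x)" "pq_type p q (form_wirt_bar j \<Psi> x)"
proof -
  have lin: "linear (\<lambda>v. wirt j (\<lambda>y. \<Psi> y (vs[i := v])) x)"
    "linear (\<lambda>v. wirt_bar j (\<lambda>y. \<Psi> y (vs[i := v])) x)" if i: "i < length vs" for vs i
  proof -
    have l: "linear (\<lambda>v. \<Psi> y (vs[i := v]))" if "y \<in> U" for y
      using t[OF that] i by (auto simp: pq_type_def ext_form_def)
    have a: "\<Psi> y (vs[i := u + v]) = \<Psi> y (vs[i := u]) + \<Psi> y (vs[i := v])" if "y \<in> U" for y u v
      by (rule linear_add[OF l[OF that]])
    have s: "\<Psi> y (vs[i := r *\<^sub>R v]) = of_real r * \<Psi> y (vs[i := v])" if "y \<in> U" for y r v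
      using linear_scale[OF l[OF that]] by (simp add: scaleR_complex)
    show "linear (\<lambda>v. wirt j (\<lambda>y. \<Psi> y (vs[i := v])) x)"
      using wirt_cong_open(1)[OF U a] wirt_cong_open(1)[OF U s] wirt_add(1)[OF d d] wirt_cmult(1)[OF d]
      by (intro linear_listI) auto
    show "linear (\<lambda>v. wirt_bar j (\<lambda>y. \<Psi> y (vs[i := v])) x)"
      using wirt_cong_open(2)[OF U a] wirt_cong_open(2)[OF U s] wirt_add(2)[OF d d] wirt_cmult(2)[OF d]
      by (intro linear_listI) auto
  qed
  have z: "wirt j (\<lambda>y. \<Psi> y vs) x = 0 \<and> wirt_bar j (\<lambda>y. \<Psi> y vs) x = 0"
    if "\<And>y. y \<in> U \<Longrightarrow> \<Psi> y vs = 0" for vs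
    using wirt_cong_open[OF U that, where j = j] by simp
  have nd: "wirt j (\<lambda>y. \<Psi> y vs) x = 0 \<and> wirt_bar j (\<lambda>y. \<Psi> y vs) x = 0" if "\<not> distinct vs" for vs
    using t that by (intro z) (auto simp: pq_type_def ext_form_def)
  have nl: "wirt j (\<lambda>y. \<Psi> y vs) x = 0 \<and> wirt_bar j (\<lambda>y. \<Psi> y vs) x = 0" if "length vs \<noteq> p + q" for vs
    using t that by (intro z) (auto simp: pq_type_def homogeneous_def)
  have w: "wirt j (\<lambda>y. \<Psi> y (map ((*s) \<zeta>) vs)) x = \<zeta> ^ p * cnj \<zeta> ^ q * wirt j (\<lambda>y. \<Psi> y vs) x"
    "wirt_bar j (\<lambda>y. \<Psi> y (map ((*s) \<zeta>) vs)) x = \<zeta> ^ p * cnj \<zeta> ^ q * wirt_bar j (\<lambda>y. \<Psi> y vs) x"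
    if "cmod \<zeta> = 1" for \<zeta> vs
  proof -
    have e: "\<Psi> y (map ((*s) \<zeta>) vs) = \<zeta> ^ p * cnj \<zeta> ^ q * \<Psi> y vs" if "y \<in> U" for y
      using pq_typeD(3)[OF t[OF that] \<open>cmod \<zeta> = 1\<close>] .
    show "wirt j (\<lambda>y. \<Psi> y (map ((*s) \<zeta>) vs)) x = \<zeta> ^ p * cnj \<zeta> ^ q * wirt j (\<lambda>y. \<Psi> y vs) x"
      using wirt_cong_open(1)[OF U e] wirt_cmult(1)[OF d] by simp
    show "wirt_bar j (\<lambda>y. \<Psi> y (map ((*s) \<zeta>) vs)) x = \<zeta> ^ p * cnj \<zeta> ^ q * wirt_bar j (\<lambda>y. \<Psi> y vs) x"
      using wirt_cong_open(2)[OF U e] wirt_cmult(2)[OF d] by simp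
  qed
  show "pq_type p q (form_wirt j \<Psi> x)" "pq_type p q (form_wirt_bar j \<Psi> x)"
    unfolding pq_type_def ext_form_def homogeneous_def form_wirt_def form_wirt_bar_def
    using lin nd nl w by blast+
qed

lemma ext_deriv_wirt:
  fixes \<Psi> :: "(complex^'d::finite) form_field"
  assumes d: "\<And>vs. (\<lambda>y. \<Psi> y vs) differentiable at x"
  shows "ext_deriv \<Psi> x = (\<Sum>j\<in>UNIV. covec_wedge (dz j) (form_wirt j \<Psi> x))
    + (\<Sum>j\<in>UNIV. covec_wedge (dzbar j) (form_wirt_bar j \<Psi> x))"
proof
  fix vs
  have "ext_deriv \<Psi> x vs = (\<Sum>i<length vs. \<Sum>j\<in>UNIV.
      (- 1) ^ i * dz j (vs ! i) * form_wirt j \<Psi> x (take i vs @ drop (Suc i) vs) +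
      (- 1) ^ i * dzbar j (vs ! i) * form_wirt_bar j \<Psi> x (take i vs @ drop (Suc i) vs))"
    unfolding ext_deriv_def wirt_expansion[OF d] form_wirt_def form_wirt_bar_def
    by (simp add: sum_distrib_left algebra_simps)
  also have "\<dots> = (\<Sum>j\<in>UNIV. covec_wedge (dz j) (form_wirt j \<Psi> x) vs +
      covec_wedge (dzbar j) (form_wirt_bar j \<Psi> x) vs)"
    unfolding covec_wedge_nths by (subst sum.swap) (simp add: sum.distrib)
  finally show "ext_deriv \<Psi> x vs = ((\<Sum>j\<in>UNIV. covec_wedge (dz j) (form_wirt j \<Psi> x))
    + (\<Sum>j\<in>UNIV. covec_wedge (dzbar j) (form_wirt_bar j \<Psi> x))) vs"
    by (simp add: sum_fun_apply sum.distrib)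
qed

lemma ext_deriv_cong_open:
  assumes "open U" "x \<in> U" "\<And>y. y \<in> U \<Longrightarrow> \<Psi> y = \<Phi> y"
  shows "ext_deriv \<Psi> x = ext_deriv \<Phi> x"
proof -
  have "frechet_derivative (\<lambda>y. \<Psi> y ws) (at x) = frechet_derivative (\<lambda>y. \<Phi> y ws) (at x)" for ws
    by (rule frechet_derivative_cong_open[OF assms(1,2)]) (simp add: assms(3))
  then show ?thesis by (simp add: ext_deriv_def)
qed

lemma pq_part_zero: "pq_part (mult_i :: complex^'d::finite \<Rightarrow> complex^'d) r s 0 = 0"
  using pq_part_pq_type[OF pq_type_zero, of r s r s] by simp

lemma ext_deriv_zero: "ext_deriv (\<lambda>y. 0) x = 0"
  by (rule ext) (simp add: ext_deriv_def frechet_derivative_const)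

text \<open>All summands of the two definitions except the one at (p,q) vanish, and there the
  exterior derivative is the sum of a (p+1,q)-form and a (p,q+1)-form, which the projections
  separate.\<close>

lemma dolbeault_pq_type:
  fixes \<Psi> :: "(complex^'d::finite) form_field"
  assumes U: "open U" "x \<in> U" and t: "\<And>y. y \<in> U \<Longrightarrow> pq_type p q (\<Psi> y)"
    and d: "\<And>vs. (\<lambda>y. \<Psi> y vs) differentiable at x" and pq: "p \<le> CARD('d)" "q \<le> CARD('d)"
  shows "dolbeault (\<lambda>_. mult_i) \<Psi> x = (\<Sum>j\<in>UNIV. covec_wedge (dz j) (form_wirt j \<Psi> x))" (is ?A)
    and "dolbeault_bar (\<lambda>_. mult_i) \<Psi> x = (\<Sum>j\<in>UNIV. covec_wedge (dzbar j) (form_wirt_bar j \<Psi> x))" (is ?B)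
proof -
  let ?D = "\<lambda>r s. ext_deriv (\<lambda>y. pq_part mult_i r s (\<Psi> y)) x"
  let ?a = "\<Sum>j\<in>UNIV. covec_wedge (dz j) (form_wirt j \<Psi> x)"
  let ?b = "\<Sum>j\<in>UNIV. covec_wedge (dzbar j) (form_wirt_bar j \<Psi> x)"
  have D1: "?D r s = 0" if "\<not> (r = p \<and> s = q)" for r s
  proof -
    have "?D r s = ext_deriv (\<lambda>y. 0) x"
      by (rule ext_deriv_cong_open[OF U]) (simp only: pq_part_pq_type[OF t] that if_False)
    then show ?thesis by (simp only: ext_deriv_zero)
  qed
  have D2: "?D p q = ext_deriv \<Psi> x"
    by (rule ext_deriv_cong_open[OF U]) (simp add: pq_part_pq_type[OF t])
  have ta: "pq_type (Suc p) q ?a"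
    by (intro pq_type_sum pq_type_covec_wedge10 dz_in_covectors10 pq_type_form_wirt[OF U t d])
  have tb: "pq_type p (Suc q) ?b"
    by (intro pq_type_sum pq_type_covec_wedge01 dzbar_in_covectors01 pq_type_form_wirt[OF U t d])
  have delta: "(\<Sum>r\<le>CARD('d). \<Sum>s\<le>CARD('d). f r s) = f p q"
    if "\<And>r s. \<not> (r = p \<and> s = q) \<Longrightarrow> f r s = 0" for f :: "nat \<Rightarrow> nat \<Rightarrow> (complex^'d) ext_form"
  proof -
    have "(\<Sum>s\<le>CARD('d). f r s) = (if r = p then f p q else 0)" for r
    proof -
      have "(\<Sum>s\<le>CARD('d). f r s) = (\<Sum>s\<in>{q}. f r s)"
        using pq that by (intro sum.mono_neutral_right) auto
      then show ?thesis using that by simp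
    qed
    then have "(\<Sum>r\<le>CARD('d). \<Sum>s\<le>CARD('d). f r s) = (\<Sum>r\<le>CARD('d). if r = p then f p q else 0)"
      by simp
    also have "\<dots> = f p q" using pq by (simp add: sum.delta)
    finally show ?thesis .
  qed
  have "dolbeault (\<lambda>_. mult_i) \<Psi> x = pq_part mult_i (Suc p) q (?D p q)"
    unfolding dolbeault_def cdim_vec by (rule delta, subst D1, assumption, rule pq_part_zero)
  then show ?A unfolding D2 ext_deriv_wirt[OF d] pq_part_add_pq_types(1)[OF ta tb] .
  have "dolbeault_bar (\<lambda>_. mult_i) \<Psi> x = pq_part mult_i p (Suc q) (?D p q)"
    unfolding dolbeault_bar_def cdim_vec by (rule delta, subst D1, assumption, rule pq_part_zero)
  then show ?B unfolding D2 ext_deriv_wirt[OF d] pq_part_add_pq_types(2)[OF ta tb] .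
qed

lemma smooth_form_wirt:
  assumes "smooth_form \<Psi>" "\<And>y. pq_type p q (\<Psi> y)"
  shows "smooth_form (form_wirt j \<Psi>)" "smooth_form (form_wirt_bar j \<Psi>)"
proof -
  note t = pq_type_form_wirt[OF open_UNIV UNIV_I assms(2) smooth_form_differentiable[OF assms(1)]]
  have "ext_form (form_wirt j \<Psi> x)" "ext_form (form_wirt_bar j \<Psi> x)" for x
    using t pq_typeD(1) by blast+
  then show "smooth_form (form_wirt j \<Psi>)" "smooth_form (form_wirt_bar j \<Psi>)"
    unfolding smooth_form_on_def
    using smooth_on_wirt[OF smooth_formD(2)[OF assms(1)]] smooth_on_wirt_bar[OF smooth_formD(2)[OF assms(1)]]
    by (auto simp: form_wirt_def form_wirt_bar_def)
qed

lemma dolbeault_dolbeault_bar: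
  fixes \<Psi> :: "(complex^'d::finite) form_field"
  assumes s: "smooth_form \<Psi>" and t: "\<And>y. pq_type p q (\<Psi> y)" and pq: "p \<le> CARD('d)" "Suc q \<le> CARD('d)"
  shows "dolbeault (\<lambda>_. mult_i) (dolbeault_bar (\<lambda>_. mult_i) \<Psi>) x =
    (\<Sum>k\<in>UNIV. \<Sum>j\<in>UNIV. covec_wedge (dz k) (covec_wedge (dzbar j) (form_wirt k (form_wirt_bar j \<Psi>) x)))"
proof -
  let ?\<Phi> = "\<lambda>x. \<Sum>j\<in>UNIV. covec_wedge (dzbar j) (form_wirt_bar j \<Psi> x)"
  note d = smooth_form_differentiable[OF s]
  have eq: "dolbeault_bar (\<lambda>_. mult_i) \<Psi> = ?\<Phi>"
    by (rule ext, rule dolbeault_pq_type(2)[OF open_UNIV UNIV_I t d]) (use pq in auto)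
  have sm: "smooth_form (\<lambda>x. covec_wedge (dzbar j) (form_wirt_bar j \<Psi> x))" for j
    by (intro smooth_form_covec_wedge linear_dzbar smooth_form_wirt[OF s t])
  have tb: "pq_type p (Suc q) (?\<Phi> y)" for y
    by (intro pq_type_sum pq_type_covec_wedge01 dzbar_in_covectors01
        pq_type_form_wirt[OF open_UNIV UNIV_I t d])
  have "dolbeault (\<lambda>_. mult_i) ?\<Phi> x = (\<Sum>k\<in>UNIV. covec_wedge (dz k) (form_wirt k ?\<Phi> x))"
    by (rule dolbeault_pq_type(1)[OF open_UNIV UNIV_I tb smooth_form_differentiable[OF smooth_form_sum[OF sm]]])
      (use pq in auto)
  also have "\<dots> = (\<Sum>k\<in>UNIV. \<Sum>j\<in>UNIV.
      covec_wedge (dz k) (covec_wedge (dzbar j) (form_wirt k (form_wirt_bar j \<Psi>) x)))"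
    by (simp only: form_wirt_sum[OF smooth_form_differentiable[OF sm]] covec_wedge_sum
        form_wirt_covec_wedge(1)[OF smooth_form_differentiable[OF smooth_form_wirt(2)[OF s t]]])
  finally show ?thesis unfolding eq .
qed

section \<open>Null functions: averaging away derivatives\<close>

definition avg :: "'a::real_normed_vector \<Rightarrow> real \<Rightarrow> ('a \<Rightarrow> complex) \<Rightarrow> 'a \<Rightarrow> complex" where
  "avg v R h x = integral {0..R} (\<lambda>t. h (x + t *\<^sub>R v)) / of_real R"

text \<open>The last entry of the list is averaged first.\<close>

definition avgs :: "('a::real_normed_vector \<times> real) list \<Rightarrow> ('a \<Rightarrow> complex) \<Rightarrow> 'a \<Rightarrow> complex" where
  "avgs L h = foldr (\<lambda>(v, R). avg v R) L h"

text \<open>A function is null if suitable iterated averages of it along lines are uniformly small.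
  This replaces \<open>having integral zero over the compact quotient\<close>.\<close>

definition null_fun :: "('a::real_normed_vector \<Rightarrow> complex) \<Rightarrow> bool" where
  "null_fun h \<longleftrightarrow> continuous_on UNIV h \<and>
     (\<forall>\<epsilon>>0. \<exists>L. (\<forall>(v, R)\<in>set L. R > 0) \<and> (\<forall>x. cmod (avgs L h x) \<le> \<epsilon>))"

lemma continuous_on_line:
  fixes h :: "'a::real_normed_vector \<Rightarrow> complex"
  assumes "continuous_on UNIV h"
  shows "continuous_on S (\<lambda>t. h (x + t *\<^sub>R v))"
  by (rule continuous_on_compose2[OF assms]) (auto intro!: continuous_intros)

lemma integrable_line:
  fixes h :: "'a::real_normed_vector \<Rightarrow> complex"
  assumes "continuous_on UNIV h"
  shows "(\<lambda>t. h (x + t *\<^sub>R v)) integrable_on {0..R}"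
  by (rule integrable_continuous_interval[OF continuous_on_line[OF assms]])

lemma continuous_on_avg:
  assumes "continuous_on UNIV h" shows "continuous_on UNIV (avg v R h)"
proof -
  have "continuous_on UNIV (\<lambda>x. integral (cbox 0 R) (\<lambda>t. h (x + t *\<^sub>R v)))"
    by (rule integral_continuous_on_param)
      (auto simp: case_prod_beta intro!: continuous_on_compose2[OF assms] continuous_intros)
  then have "continuous_on UNIV (\<lambda>x. integral {0..R} (\<lambda>t. h (x + t *\<^sub>R v)) / of_real R)"
    unfolding divide_inverse by (intro continuous_on_mult continuous_on_const) simp
  then show ?thesis unfolding avg_def[abs_def] .
qed

lemma avg_norm_le:
  assumes "continuous_on UNIV h" "R > 0" "\<And>x. cmod (h x) \<le> c"
  shows "cmod (avg v R h x) \<le> c"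
proof -
  have "cmod (integral {0..R} (\<lambda>t. h (x + t *\<^sub>R v))) \<le> c * (R - 0)"
    using assms by (intro integral_bound continuous_on_line) auto
  then show ?thesis using assms(2) by (simp add: avg_def norm_divide divide_le_eq)
qed

lemma avg_Re_ge:
  assumes "continuous_on UNIV h" "R > 0" "\<And>x. Re (h x) \<ge> c"
  shows "Re (avg v R h x) \<ge> c"
proof -
  have i: "(\<lambda>t. Re (h (x + t *\<^sub>R v))) integrable_on {0..R}"
    using integrable_linear[OF integrable_line[OF assms(1)] bounded_linear_Re] by (simp add: o_def)
  have "Re (integral {0..R} (\<lambda>t. h (x + t *\<^sub>R v))) = integral {0..R} (\<lambda>t. Re (h (x + t *\<^sub>R v)))"
    using integral_linear[OF integrable_line[OF assms(1)] bounded_linear_Re] by (simp add: o_def)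
  moreover have "integral {0..R} (\<lambda>t. c) \<le> integral {0..R} (\<lambda>t. Re (h (x + t *\<^sub>R v)))"
    using assms by (intro integral_le i) auto
  ultimately have "c * R \<le> Re (integral {0..R} (\<lambda>t. h (x + t *\<^sub>R v)))"
    using assms(2) by (simp add: mult.commute)
  then show ?thesis using assms(2) by (simp add: avg_def le_divide_eq Re_divide_of_real)
qed

lemma avg_add:
  assumes "continuous_on UNIV f" "continuous_on UNIV g"
  shows "avg v R (\<lambda>x. f x + g x) = (\<lambda>x. avg v R f x + avg v R g x)"
  unfolding avg_def by (simp add: integral_add integrable_line assms add_divide_distrib)

lemma avg_cmult: "avg v R (\<lambda>x. c * f x) = (\<lambda>x. c * avg v R f x)"
  unfolding avg_def by simp

lemma avg_translate: "avg v R (\<lambda>x. h (x + u)) x = avg v R h (x + u)"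
  unfolding avg_def by (simp add: algebra_simps)

text \<open>Fubini. That averages commute is what makes null functions closed under
  addition.\<close>

lemma avg_commute:
  assumes "continuous_on UNIV h"
  shows "avg v R (avg u S h) = avg u S (avg v R h)"
proof
  fix x
  have "integral (cbox 0 R) (\<lambda>t. integral (cbox 0 S) (\<lambda>s. h (x + t *\<^sub>R v + s *\<^sub>R u))) =
      integral (cbox 0 S) (\<lambda>s. integral (cbox 0 R) (\<lambda>t. h (x + t *\<^sub>R v + s *\<^sub>R u)))"
    by (rule integral_swap_continuous)
      (auto simp: case_prod_beta intro!: continuous_on_compose2[OF assms] continuous_intros)
  then show "avg v R (avg u S h) x = avg u S (avg v R h) x"
    by (simp add: avg_def integral_divide algebra_simps)
qed

lemma avg_frechet_derivative:
  fixes h :: "'a::real_normed_vector \<Rightarrow> complex"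
  assumes "smooth_on UNIV h" "R > 0"
  shows "avg v R (\<lambda>x. frechet_derivative h (at x) v) x = (h (x + R *\<^sub>R v) - h x) / of_real R"
proof -
  have "((\<lambda>t. h (x + t *\<^sub>R v)) has_vector_derivative frechet_derivative h (at (x + t *\<^sub>R v)) v)
      (at t within {0..R})" for t
  proof -
    have "(h has_derivative frechet_derivative h (at (x + t *\<^sub>R v))) (at (x + t *\<^sub>R v))"
      using smooth_on_differentiable[OF assms(1)] frechet_derivative_works by blast
    moreover have "((\<lambda>t. x + t *\<^sub>R v) has_derivative (\<lambda>s. s *\<^sub>R v)) (at t within {0..R})"
      by (auto intro!: derivative_eq_intros)
    ultimately have "((\<lambda>t. h (x + t *\<^sub>R v)) has_derivative
        (\<lambda>s. frechet_derivative h (at (x + t *\<^sub>R v)) (s *\<^sub>R v))) (at t within {0..R})"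
      by (rule has_derivative_compose[rotated])
    then show ?thesis
      unfolding has_vector_derivative_def
      using linear_scale[OF linear_frechet_derivative[OF smooth_on_differentiable[OF assms(1)]]] by simp
  qed
  then have "((\<lambda>t. frechet_derivative h (at (x + t *\<^sub>R v)) v) has_integral
      (h (x + R *\<^sub>R v) - h (x + 0 *\<^sub>R v))) {0..R}"
    using assms(2) by (intro fundamental_theorem_of_calculus) auto
  then show ?thesis by (simp add: avg_def integral_unique)
qed

lemma avgs_Nil [simp]: "avgs [] h = h"
  and avgs_Cons: "avgs ((v, R) # L) h = avg v R (avgs L h)"
  and avgs_append: "avgs (L @ L') h = avgs L (avgs L' h)"
  by (simp_all add: avgs_def)

lemma continuous_on_avgs: "continuous_on UNIV h \<Longrightarrow> continuous_on UNIV (avgs L h)"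
  by (induction L) (auto simp: avgs_Cons intro: continuous_on_avg)

lemma avgs_norm_le:
  assumes "continuous_on UNIV h" "\<forall>(v, R)\<in>set L. R > 0" "\<And>x. cmod (h x) \<le> c"
  shows "cmod (avgs L h x) \<le> c"
  using assms(2)
proof (induction L arbitrary: x)
  case (Cons p L)
  obtain v R where p: "p = (v, R)" by fastforce
  show ?case using Cons unfolding p avgs_Cons
    by (intro avg_norm_le continuous_on_avgs assms(1)) auto
qed (simp add: assms)

lemma avgs_Re_ge:
  assumes "continuous_on UNIV h" "\<forall>(v, R)\<in>set L. R > 0" "\<And>x. Re (h x) \<ge> c"
  shows "Re (avgs L h x) \<ge> c"
  using assms(2)
proof (induction L arbitrary: x)
  case (Cons p L)
  obtain v R where p: "p = (v, R)" by fastforce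
  show ?case using Cons unfolding p avgs_Cons
    by (intro avg_Re_ge continuous_on_avgs assms(1)) auto
qed (simp add: assms)

lemma avgs_add:
  assumes "continuous_on UNIV f" "continuous_on UNIV g"
  shows "avgs L (\<lambda>x. f x + g x) = (\<lambda>x. avgs L f x + avgs L g x)"
proof (induction L)
  case (Cons p L)
  obtain v R where p: "p = (v, R)" by fastforce
  show ?case unfolding p avgs_Cons Cons by (intro avg_add continuous_on_avgs assms)
qed simp

lemma avgs_cmult: "avgs L (\<lambda>x. c * f x) = (\<lambda>x. c * avgs L f x)"
  by (induction L) (auto simp: avgs_Cons avg_cmult)

lemma avgs_avg_commute:
  assumes "continuous_on UNIV h" shows "avgs L (avg v R h) = avg v R (avgs L h)"
proof (induction L)
  case (Cons p L)
  obtain u S where p: "p = (u, S)" by fastforce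
  show ?case unfolding p avgs_Cons Cons by (rule avg_commute[OF continuous_on_avgs[OF assms]])
qed simp

lemma avgs_commute:
  assumes "continuous_on UNIV h" shows "avgs L (avgs L' h) = avgs L' (avgs L h)"
proof (induction L')
  case (Cons p L')
  obtain u S where p: "p = (u, S)" by fastforce
  show ?case unfolding p avgs_Cons avgs_avg_commute[OF continuous_on_avgs[OF assms]] Cons ..
qed simp

text \<open>Both lists are applied. Averages commute and do not increase the supremum norm, so the
  list of the other function cannot undo the smallness already reached.\<close>

lemma null_fun_add:
  assumes "null_fun f" "null_fun g" shows "null_fun (\<lambda>x. f x + g x)"
  unfolding null_fun_def
proof (intro conjI allI impI)
  have c: "continuous_on UNIV f" "continuous_on UNIV g" using assms by (auto simp: null_fun_def)
  then show "continuous_on UNIV (\<lambda>x. f x + g x)" by (rule continuous_on_add)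
  fix \<epsilon> :: real assume "\<epsilon> > 0"
  then have e: "\<epsilon> / 2 > 0" by simp
  obtain L where L: "\<forall>(v, R)\<in>set L. R > 0" "\<And>x. cmod (avgs L f x) \<le> \<epsilon> / 2"
    using assms(1) e unfolding null_fun_def by blast
  obtain L' where L': "\<forall>(v, R)\<in>set L'. R > 0" "\<And>x. cmod (avgs L' g x) \<le> \<epsilon> / 2"
    using assms(2) e unfolding null_fun_def by blast
  have "cmod (avgs (L @ L') (\<lambda>x. f x + g x) x) \<le> \<epsilon>" for x
  proof -
    have "avgs (L @ L') (\<lambda>x. f x + g x) x = avgs L' (avgs L f) x + avgs L (avgs L' g) x"
      unfolding avgs_append avgs_add[OF c]
      by (simp add: avgs_add[OF continuous_on_avgs[OF c(1)] continuous_on_avgs[OF c(2)]]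
          avgs_commute[OF c(1), of L L'])
    moreover have "cmod (avgs L' (avgs L f) x) \<le> \<epsilon> / 2"
      by (rule avgs_norm_le[OF continuous_on_avgs[OF c(1)] L'(1) L(2)])
    moreover have "cmod (avgs L (avgs L' g) x) \<le> \<epsilon> / 2"
      by (rule avgs_norm_le[OF continuous_on_avgs[OF c(2)] L(1) L'(2)])
    ultimately show ?thesis using norm_triangle_ineq[of "avgs L' (avgs L f) x" "avgs L (avgs L' g) x"] by simp
  qed
  moreover have "\<forall>(v, R)\<in>set (L @ L'). R > 0" using L(1) L'(1) by auto
  ultimately show "\<exists>L. (\<forall>(v, R)\<in>set L. R > 0) \<and> (\<forall>x. cmod (avgs L (\<lambda>x. f x + g x) x) \<le> \<epsilon>)"
    by blast
qed

lemma null_fun_cmult: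
  assumes "null_fun f" shows "null_fun (\<lambda>x. c * f x)"
  unfolding null_fun_def
proof (intro conjI allI impI)
  show "continuous_on UNIV (\<lambda>x. c * f x)"
    using assms by (auto simp: null_fun_def intro!: continuous_intros)
  fix \<epsilon> :: real assume e: "\<epsilon> > 0"
  then have "\<epsilon> / (cmod c + 1) > 0"
    by (simp add: add_nonneg_pos)
  then obtain L where L: "\<forall>(v, R)\<in>set L. R > 0" "\<And>x. cmod (avgs L f x) \<le> \<epsilon> / (cmod c + 1)"
    using assms unfolding null_fun_def by blast
  have "cmod (avgs L (\<lambda>x. c * f x) x) \<le> \<epsilon>" for x
  proof -
    have "cmod (avgs L (\<lambda>x. c * f x) x) \<le> cmod c * (\<epsilon> / (cmod c + 1))"
      unfolding avgs_cmult norm_mult by (rule mult_left_mono[OF L(2) norm_ge_zero])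
    also have "\<dots> \<le> (cmod c + 1) * (\<epsilon> / (cmod c + 1))"
      using e by (intro mult_right_mono) auto
    also have "\<dots> = \<epsilon>" by (simp add: add_nonneg_eq_0_iff)
    finally show ?thesis .
  qed
  then show "\<exists>L. (\<forall>(v, R)\<in>set L. R > 0) \<and> (\<forall>x. cmod (avgs L (\<lambda>x. c * f x) x) \<le> \<epsilon>)"
    using L(1) by blast
qed

lemma null_fun_zero: "null_fun (\<lambda>x. 0)"
  unfolding null_fun_def by (auto intro!: exI[of _ "[]"])

lemma null_fun_sum: "(\<And>i. i \<in> A \<Longrightarrow> null_fun (f i)) \<Longrightarrow> null_fun (\<lambda>x. \<Sum>i\<in>A. f i x)"
  by (induction A rule: infinite_finite_induct) (auto intro: null_fun_zero null_fun_add)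

lemma null_fun_diff: "null_fun f \<Longrightarrow> null_fun g \<Longrightarrow> null_fun (\<lambda>x. f x - g x)"
  using null_fun_add[OF _ null_fun_cmult, of f g "-1"] by simp

text \<open>Averages preserve a lower bound of the real part, whereas suitable averages of a null
  function are arbitrarily small. This gives the final contradiction in
  \<open>obstruction\<close>.\<close>

lemma null_fun_not_Re_ge:
  assumes "null_fun h" "\<epsilon> > 0" shows "\<exists>x. Re (h x) < \<epsilon>"
proof (rule ccontr)
  assume "\<not> (\<exists>x. Re (h x) < \<epsilon>)"
  then have ge: "Re (h x) \<ge> \<epsilon>" for x using not_less by blast
  have c: "continuous_on UNIV h" using assms(1) by (simp add: null_fun_def)
  obtain L where L: "\<forall>(v, R)\<in>set L. R > 0" "\<And>x. cmod (avgs L h x) \<le> \<epsilon> / 2"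
    using assms unfolding null_fun_def by (meson half_gt_zero)
  have "\<epsilon> \<le> Re (avgs L h 0)" by (rule avgs_Re_ge[OF c L(1) ge])
  also have "\<dots> \<le> cmod (avgs L h 0)" by (rule complex_Re_le_cmod)
  also have "\<dots> \<le> \<epsilon> / 2" by (rule L(2))
  finally show False using assms(2) by simp
qed

text \<open>What makes an averaged derivative along \<open>v\<close> small. Bounded functions
  satisfy it with a large R, functions of period \<open>v\<close> with R = 1; the first occurs in
  base directions, the second in fibre directions.\<close>

definition sublinear_along :: "'a::real_normed_vector \<Rightarrow> ('a \<Rightarrow> complex) \<Rightarrow> bool" where
  "sublinear_along v h \<longleftrightarrow> (\<forall>\<epsilon>>0. \<exists>R>0. \<forall>x. cmod (h (x + R *\<^sub>R v) - h x) \<le> \<epsilon> * R)"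

lemma sublinear_along_bounded:
  assumes "\<And>x. cmod (h x) \<le> C" shows "sublinear_along v h"
  unfolding sublinear_along_def
proof (intro allI impI)
  fix \<epsilon> :: real assume e: "\<epsilon> > 0"
  define R where "R = (2 * \<bar>C\<bar> + 1) / \<epsilon>"
  have "cmod (h (x + R *\<^sub>R v) - h x) \<le> \<epsilon> * R" for x
  proof -
    have "cmod (h (x + R *\<^sub>R v) - h x) \<le> C + C"
      using norm_triangle_ineq4[of "h (x + R *\<^sub>R v)" "h x"] assms[of x] assms[of "x + R *\<^sub>R v"] by linarith
    also have "\<dots> \<le> \<epsilon> * R" using e by (simp add: R_def)
    finally show ?thesis .
  qed
  moreover have "R > 0" using e by (simp add: R_def add_nonneg_pos)
  ultimately show "\<exists>R>0. \<forall>x. cmod (h (x + R *\<^sub>R v) - h x) \<le> \<epsilon> * R" by blast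
qed

lemma sublinear_along_periodic:
  assumes "\<And>x. h (x + v) = h x" shows "sublinear_along v h"
  unfolding sublinear_along_def using assms by (auto intro!: exI[of _ 1])

lemma null_fun_derivative:
  fixes h :: "'a::real_normed_vector \<Rightarrow> complex"
  assumes "smooth_on UNIV h" "sublinear_along v h"
  shows "null_fun (\<lambda>x. frechet_derivative h (at x) v)"
  unfolding null_fun_def
proof (intro conjI allI impI)
  show "continuous_on UNIV (\<lambda>x. frechet_derivative h (at x) v)"
    by (rule smooth_on_continuous_on[OF smooth_on_frechet_derivative[OF assms(1)]])
  fix \<epsilon> :: real assume "\<epsilon> > 0"
  then obtain R where R: "R > 0" "\<And>x. cmod (h (x + R *\<^sub>R v) - h x) \<le> \<epsilon> * R"
    using assms(2) unfolding sublinear_along_def by blast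
  have "cmod (avgs [(v, R)] (\<lambda>x. frechet_derivative h (at x) v) x) \<le> \<epsilon>" for x
    using R by (simp add: avgs_Cons avg_frechet_derivative[OF assms(1) R(1)] norm_divide divide_le_eq)
  then show "\<exists>L. (\<forall>(v, R)\<in>set L. R > 0) \<and> (\<forall>x. cmod (avgs L (\<lambda>x. frechet_derivative h (at x) v) x) \<le> \<epsilon>)"
    using R(1) by (intro exI[of _ "[(v, R)]"]) auto
qed

text \<open>Growth is controlled only along the direction of the inner derivative. Averaging over a
  unit segment along \<open>u\<close> turns the outer derivative into a difference of two values of
  the inner one, and averaging along \<open>v\<close> makes both values small.\<close>

lemma null_fun_second_derivative:
  fixes h :: "'a::real_normed_vector \<Rightarrow> complex"
  assumes "smooth_on UNIV h" "sublinear_along v h"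
  shows "null_fun (\<lambda>x. frechet_derivative (\<lambda>y. frechet_derivative h (at y) v) (at x) u)"
  unfolding null_fun_def
proof (intro conjI allI impI)
  let ?g = "\<lambda>y. frechet_derivative h (at y) v"
  let ?k = "\<lambda>x. frechet_derivative ?g (at x) u"
  have g: "smooth_on UNIV ?g" by (rule smooth_on_frechet_derivative[OF assms(1)])
  note cg = smooth_on_continuous_on[OF g]
  show "continuous_on UNIV ?k"
    by (rule smooth_on_continuous_on[OF smooth_on_frechet_derivative[OF g]])
  fix \<epsilon> :: real assume "\<epsilon> > 0"
  then have "\<epsilon> / 2 > 0" by simp
  then obtain R where R: "R > 0" "\<And>x. cmod (h (x + R *\<^sub>R v) - h x) \<le> \<epsilon> / 2 * R"
    using assms(2) unfolding sublinear_along_def by blast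
  have cu: "continuous_on UNIV (\<lambda>x. ?g (x + u))"
    by (rule continuous_on_compose2[OF cg]) (auto intro!: continuous_intros)
  have 1: "avg u 1 ?k = (\<lambda>x. ?g (x + u) + (- 1) * ?g x)"
    using avg_frechet_derivative[OF g, of 1 u] by auto
  have "avgs [(v, R), (u, 1)] ?k x = avg v R ?g (x + u) - avg v R ?g x" for x
  proof -
    have "continuous_on UNIV (\<lambda>x. (- 1) * ?g x)"
      by (intro continuous_on_mult continuous_on_const cg)
    from avg_add[OF cu this] show ?thesis
      unfolding avgs_Cons avgs_Nil 1 using avg_translate[of v R ?g u x] avg_cmult[of v R "- 1" ?g]
      by simp
  qed
  then have "cmod (avgs [(v, R), (u, 1)] ?k x) \<le> cmod (avg v R ?g (x + u)) + cmod (avg v R ?g x)" for x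
    by (simp add: norm_triangle_ineq4)
  moreover have "cmod (avg v R ?g x) \<le> \<epsilon> / 2" for x
    using R by (simp add: avg_frechet_derivative[OF assms(1) R(1)] norm_divide divide_le_eq)
  ultimately have "cmod (avgs [(v, R), (u, 1)] ?k x) \<le> \<epsilon>" for x
    by (smt (verit) field_sum_of_halves)
  then show "\<exists>L. (\<forall>(v, R)\<in>set L. R > 0) \<and> (\<forall>x. cmod (avgs L ?k x) \<le> \<epsilon>)"
    using R(1) by (intro exI[of _ "[(v, R), (u, 1)]"]) auto
qed

section \<open>The deck group of the Bigalke--Rollenske manifold\<close>

locale br_chart =
  fixes n :: nat and ix :: "nat \<Rightarrow> 'd::finite"
  assumes n2: "n \<ge> 2" and bij: "bij_betw ix {1..4 * n - 2} (UNIV :: 'd set)"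
begin

definition jx :: "'d \<Rightarrow> nat" where "jx = inv_into {1..4 * n - 2} ix"

lemma jx_ix [simp]: "1 \<le> j \<Longrightarrow> j \<le> 4 * n - 2 \<Longrightarrow> jx (ix j) = j"
  using bij by (auto simp: jx_def bij_betw_def inv_into_f_f)

lemma ix_jx [simp]: "ix (jx k) = k" and jx_ge: "1 \<le> jx k" and jx_le: "jx k \<le> 4 * n - 2"
proof -
  have k: "k \<in> ix ` {1..4 * n - 2}" using bij by (auto simp: bij_betw_def)
  show "ix (jx k) = k" unfolding jx_def by (rule f_inv_into_f[OF k])
  have "jx k \<in> {1..4 * n - 2}" unfolding jx_def by (rule inv_into_into[OF k])
  then show "1 \<le> jx k" "jx k \<le> 4 * n - 2" by auto
qed

lemma card_index: "CARD('d) = 4 * n - 2"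
  using bij_betw_same_card[OF bij] by simp

text \<open>Each \<phi>^j is a coordinate differential plus multiples of differentials of lower
  index, so the equations are solved from low to high index. The corrections are complex-linear in
  the tangent vector, hence the solution is \<open>mult_i v\<close>.\<close>

lemma br_J_eq: "br_J n ix = (\<lambda>_. mult_i)"
proof (intro ext)
  fix a v
  show "br_J n ix a v = mult_i v"
    unfolding br_J_def
  proof (rule the_equality)
    show "\<forall>j\<in>{1..4 * n - 2}. br_phi n ix j a (mult_i v) = \<i> * br_phi n ix j a v"
      by (auto simp: br_phi_def br_x_def br_y_def br_z_def br_w_def Let_def algebra_simps)
  next
    fix u assume u: "\<forall>j\<in>{1..4 * n - 2}. br_phi n ix j a u = \<i> * br_phi n ix j a v"
    have low: "vec_nth u (ix j) = \<i> * vec_nth v (ix j)" if "1 \<le> j" "j \<le> 3 * n - 2" for j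
    proof -
      have "j \<in> {1..4 * n - 2}" using that n2 by auto
      from u[rule_format, OF this] show ?thesis
        using that n2 unfolding br_phi_def br_x_def br_y_def br_z_def
        by (auto split: if_splits)
    qed
    have "vec_nth u (ix j) = \<i> * vec_nth v (ix j)" if j: "1 \<le> j" "j \<le> 4 * n - 2" for j
    proof (cases "j \<le> 3 * n - 2")
      case True
      then show ?thesis using low j by blast
    next
      case False
      have uj: "br_phi n ix j a u = \<i> * br_phi n ix j a v" using u j by auto
      show ?thesis
      proof (cases "j = 3 * n - 1")
        case True
        have 2: "vec_nth u (ix (2 * n)) = \<i> * vec_nth v (ix (2 * n))" using low[of "2 * n"] n2 by auto
        have e: "2 * n - 1 + 1 = 2 * n" "3 * n - 2 + 1 = j" using True n2 by auto
        have c: "(j \<le> n - 1) = False" "(j \<le> 2 * n - 1) = False" "(j \<le> 3 * n - 2) = False"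
          "(j = 3 * n - 1) = True" using True n2 by auto
        have phi: "br_phi n ix j a w = vec_nth w (ix j) - cnj (br_y n ix 1 a) * vec_nth w (ix (2 * n))" for w
          by (simp only: br_phi_def br_w_def br_z_def c if_False if_True e)
        from uj show ?thesis unfolding phi 2 by (simp add: algebra_simps)
      next
        case F: False
        define i where "i = j - (3 * n - 1)"
        have i: "1 \<le> i" "i \<le> n - 1" "3 * n - 2 + (i + 1) = j" using False F j n2 by (auto simp: i_def)
        have y1: "vec_nth u (ix (n - 1 + i)) = \<i> * vec_nth v (ix (n - 1 + i))"
          and y2: "vec_nth u (ix (n - 1 + (i + 1))) = \<i> * vec_nth v (ix (n - 1 + (i + 1)))"
          using low[of "n - 1 + i"] low[of "n - 1 + (i + 1)"] i n2 by auto
        have c: "(j \<le> n - 1) = False" "(j \<le> 2 * n - 1) = False" "(j \<le> 3 * n - 2) = False"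
          "(j = 3 * n - 1) = False" using False F n2 by auto
        have phi: "br_phi n ix j a w = vec_nth w (ix j) - cnj (br_z n ix i a) * vec_nth w (ix (n - 1 + i))
          + br_x ix i a * vec_nth w (ix (n - 1 + (i + 1)))" for w
          by (simp only: br_phi_def br_w_def br_y_def c if_False Let_def i_def[symmetric] i(3))
        from uj show ?thesis unfolding phi y1 y2 by (simp add: algebra_simps)
      qed
    qed
    then show "u = mult_i v"
      unfolding cvec_eq_iff by (metis ix_jx jx_ge jx_le vector_smult_component)
  qed
qed

text \<open>The part of the group law that couples coordinates: it corrects the w-coordinates of a
  product. It is complex-linear in \<open>v\<close> but, because of the conjugates, not in
  \<open>c\<close>; so left translations are holomorphic and right translations are not.\<close>

definition shear :: "complex^'d \<Rightarrow> complex^'d \<Rightarrow> complex^'d" where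
  "shear c v = (\<chi> k. if jx k = 3 * n - 1 then cnj (br_y n ix 1 c) * br_z n ix 1 v
     else if jx k \<ge> 3 * n then cnj (br_z n ix (jx k - (3 * n - 1)) c) * br_y n ix (jx k - (3 * n - 1)) v
       - br_x ix (jx k - (3 * n - 1)) c * br_y n ix (jx k - (3 * n - 1) + 1) v
     else 0)"

definition lin_part :: "complex^'d \<Rightarrow> complex^'d \<Rightarrow> complex^'d" where
  "lin_part c v = v + shear c v"

definition left_mult :: "complex^'d \<Rightarrow> complex^'d \<Rightarrow> complex^'d" where
  "left_mult c a = c + lin_part c a"

lemma shear_low: "1 \<le> j \<Longrightarrow> j \<le> 3 * n - 2 \<Longrightarrow> vec_nth (shear c v) (ix j) = 0"
  using n2 by (auto simp: shear_def)

lemma shear_w1: "vec_nth (shear c v) (ix (3 * n - 1)) = cnj (br_y n ix 1 c) * br_z n ix 1 v"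
  using n2 by (auto simp: shear_def)

lemma shear_w:
  "1 \<le> i \<Longrightarrow> i \<le> n - 1 \<Longrightarrow> vec_nth (shear c v) (ix (3 * n - 1 + i)) =
    cnj (br_z n ix i c) * br_y n ix i v - br_x ix i c * br_y n ix (i + 1) v"
  using n2 by (auto simp: shear_def)

lemma left_mult_coords:
  "1 \<le> i \<Longrightarrow> i \<le> n - 1 \<Longrightarrow> br_x ix i (left_mult c a) = br_x ix i c + br_x ix i a"
  "1 \<le> i \<Longrightarrow> i \<le> n \<Longrightarrow> br_y n ix i (left_mult c a) = br_y n ix i c + br_y n ix i a"
  "1 \<le> i \<Longrightarrow> i \<le> n - 1 \<Longrightarrow> br_z n ix i (left_mult c a) = br_z n ix i c + br_z n ix i a"
  "br_w n ix (Suc 0) (left_mult c a) = br_w n ix (Suc 0) c + br_w n ix (Suc 0) a + cnj (br_y n ix (Suc 0) c) * br_z n ix (Suc 0) a"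
  "1 \<le> i \<Longrightarrow> i \<le> n - 1 \<Longrightarrow> br_w n ix (Suc i) (left_mult c a) = br_w n ix (Suc i) c + br_w n ix (Suc i) a
    + cnj (br_z n ix i c) * br_y n ix i a - br_x ix i c * br_y n ix (Suc i) a"
proof -
  assume "1 \<le> i" "i \<le> n - 1"
  then have "3 * n - 2 + Suc i = 3 * n - 1 + i" using n2 by auto
  then have "br_w n ix (Suc i) v = vec_nth v (ix (3 * n - 1 + i))" for v by (simp only: br_w_def)
  then show "br_w n ix (Suc i) (left_mult c a) = br_w n ix (Suc i) c + br_w n ix (Suc i) a
    + cnj (br_z n ix i c) * br_y n ix i a - br_x ix i c * br_y n ix (Suc i) a"
    using shear_w[OF \<open>1 \<le> i\<close> \<open>i \<le> n - 1\<close>, of c a] unfolding left_mult_def lin_part_def by simp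
next
  have "3 * n - 2 + Suc 0 = 3 * n - 1" using n2 by auto
  then show "br_w n ix (Suc 0) (left_mult c a) = br_w n ix (Suc 0) c + br_w n ix (Suc 0) a + cnj (br_y n ix (Suc 0) c) * br_z n ix (Suc 0) a"
    using shear_w1[of c a] unfolding br_w_def left_mult_def lin_part_def by simp
qed (use n2 in \<open>auto simp: br_x_def br_y_def br_z_def left_mult_def lin_part_def shear_low\<close>)

lemma sum_br_entry:
  assumes "S \<subseteq> {1..2 * n + 2}" "\<And>k. k \<in> {1..2 * n + 2} \<Longrightarrow> k \<notin> S \<Longrightarrow> br_entry n ix c r k = 0"
  shows "(\<Sum>k\<in>{1..2 * n + 2}. br_entry n ix c r k * f k) = (\<Sum>k\<in>S. br_entry n ix c r k * f k)"
  using assms by (intro sum.mono_neutral_right) auto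

lemma br_entry_row_1: "br_entry n ix a (Suc 0) s = (if s = Suc 0 then 1 else if s = 2 * n + 1 then cnj (br_y n ix (Suc 0) a)
    else if s = 2 * n + 2 then br_w n ix (Suc 0) a else 0)"
  using n2 by (auto simp: br_entry_def)

lemma br_entry_row_x:
  assumes "1 \<le> i" "i \<le> n - 1"
  shows "br_entry n ix a (Suc i) s = (if s = Suc i then 1 else if s = n + i then cnj (br_z n ix i a)
    else if s = n + Suc i then - br_x ix i a else if s = 2 * n + 2 then br_w n ix (Suc i) a else 0)"
proof -
  have c: "(Suc i = 1) = False" "(2 \<le> Suc i) = True" "(Suc i \<le> n) = True" "(n + 1 \<le> Suc i) = False"
    "(Suc i = 2 * n + 1) = False" "Suc i - 1 = i" "n + i + 1 = n + Suc i" "(Suc i = s) = (s = Suc i)"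
    using assms n2 by auto
  show ?thesis by (simp only: br_entry_def c simp_thms if_False)
qed

lemma br_entry_row_y:
  assumes "1 \<le> k" "k \<le> n"
  shows "br_entry n ix a (n + k) s = (if s = n + k then 1 else if s = 2 * n + 2 then br_y n ix k a else 0)"
proof -
  have c: "(n + k = 1) = False" "(n + k \<le> n) = False" "(n + 1 \<le> n + k) = True" "(n + k \<le> 2 * n) = True"
    "(n + k = 2 * n + 1) = False" "n + k - n = k" "(n + k = s) = (s = n + k)"
    using assms n2 by auto
  show ?thesis by (simp only: br_entry_def c simp_thms if_False)
qed

lemma br_entry_row_z: "br_entry n ix a (2 * n + 1) s = (if s = 2 * n + 1 then 1 else if s = 2 * n + 2 then br_z n ix (Suc 0) a else 0)"
  using n2 by (auto simp: br_entry_def)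

lemma br_entry_row_last: "br_entry n ix a (2 * n + 2) s = (if s = 2 * n + 2 then 1 else 0)"
  using n2 by (auto simp: br_entry_def)

lemmas br_entry_rows = br_entry_row_1 br_entry_row_x br_entry_row_y br_entry_row_z br_entry_row_last

text \<open>Row \<open>r\<close> of the left factor has at most four nonzero entries, and for each
  kind of row the sum is restricted to them. The corrections of \<open>shear\<close> arise in the
  last column.\<close>

lemma br_entry_mult:
  assumes r: "1 \<le> r" "r \<le> 2 * n + 2"
  shows "(\<Sum>k\<in>{1..2 * n + 2}. br_entry n ix c r k * br_entry n ix a k s) = br_entry n ix (left_mult c a) r s"
proof -
  have "r = Suc 0 \<or> (\<exists>i. 1 \<le> i \<and> i \<le> n - 1 \<and> r = Suc i) \<or> (\<exists>k. 1 \<le> k \<and> k \<le> n \<and> r = n + k)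
    \<or> r = 2 * n + 1 \<or> r = 2 * n + 2"
  proof -
    have "\<exists>i. 1 \<le> i \<and> i \<le> n - 1 \<and> r = Suc i" if "2 \<le> r" "r \<le> n"
      using that by (intro exI[of _ "r - 1"]) auto
    moreover have "\<exists>k. 1 \<le> k \<and> k \<le> n \<and> r = n + k" if "n + 1 \<le> r" "r \<le> 2 * n"
      using that by (intro exI[of _ "r - n"]) auto
    moreover have "r = Suc 0 \<or> (2 \<le> r \<and> r \<le> n) \<or> (n + 1 \<le> r \<and> r \<le> 2 * n) \<or> r = 2 * n + 1 \<or> r = 2 * n + 2"
      using r by linarith
    ultimately show ?thesis by metis
  qed
  then consider "r = Suc 0" | i where "1 \<le> i" "i \<le> n - 1" "r = Suc i"
    | k where "1 \<le> k" "k \<le> n" "r = n + k" | "r = 2 * n + 1" | "r = 2 * n + 2" by blast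
  then show ?thesis
  proof cases
    case 1
    have y1: "br_y n ix (Suc 0) (left_mult c a) = br_y n ix (Suc 0) c + br_y n ix (Suc 0) a"
      using left_mult_coords(2)[of "Suc 0"] n2 by simp
    have "(\<Sum>k\<in>{1..2 * n + 2}. br_entry n ix c r k * br_entry n ix a k s)
      = (\<Sum>k\<in>{Suc 0, 2 * n + 1, 2 * n + 2}. br_entry n ix c r k * br_entry n ix a k s)"
      using n2 unfolding 1 by (intro sum_br_entry) (auto simp: br_entry_row_1)
    also have "\<dots> = br_entry n ix a (Suc 0) s + cnj (br_y n ix (Suc 0) c) * br_entry n ix a (2 * n + 1) s
        + br_w n ix (Suc 0) c * br_entry n ix a (2 * n + 2) s"
      using n2 unfolding 1 br_entry_row_1[of c] by simp
    also have "\<dots> = br_entry n ix (left_mult c a) r s"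
      using n2 unfolding 1 br_entry_rows left_mult_coords(4) y1 by auto
    finally show ?thesis .
  next
    case (2 i)
    have S: "Suc i \<le> n" "1 \<le> Suc i" "i \<le> n" using 2 by auto
    have "(\<Sum>k\<in>{1..2 * n + 2}. br_entry n ix c r k * br_entry n ix a k s)
      = (\<Sum>k\<in>{Suc i, n + i, n + Suc i, 2 * n + 2}. br_entry n ix c r k * br_entry n ix a k s)"
      using n2 S 2(1) unfolding 2(3) by (intro sum_br_entry) (auto simp: br_entry_row_x[OF 2(1,2)])
    also have "\<dots> = br_entry n ix a (Suc i) s + cnj (br_z n ix i c) * br_entry n ix a (n + i) s
        - br_x ix i c * br_entry n ix a (n + Suc i) s + br_w n ix (Suc i) c * br_entry n ix a (2 * n + 2) s"
      using n2 S 2(1) unfolding 2(3) br_entry_row_x[OF 2(1,2), of c] by simp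
    also have "\<dots> = br_entry n ix (left_mult c a) r s"
      using n2 S 2(1) unfolding 2(3) br_entry_row_x[OF 2(1,2)] br_entry_row_y[OF 2(1) S(3)]
        br_entry_row_y[OF S(2,1)] br_entry_row_last left_mult_coords(5)[OF 2(1,2)] left_mult_coords(1)[OF 2(1,2)]
        left_mult_coords(3)[OF 2(1,2)] by auto
    finally show ?thesis .
  next
    case (3 k)
    have "(\<Sum>k\<in>{1..2 * n + 2}. br_entry n ix c r k * br_entry n ix a k s)
      = (\<Sum>k\<in>{r, 2 * n + 2}. br_entry n ix c r k * br_entry n ix a k s)"
      using 3 n2 by (intro sum_br_entry) (auto simp: br_entry_row_y[OF 3(1,2)])
    also have "\<dots> = br_entry n ix (left_mult c a) r s"
      using 3(1,2) n2 unfolding 3(3) by (simp add: br_entry_row_y[OF 3(1,2)] br_entry_row_last[simplified] left_mult_coords(2)[OF 3(1,2)])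
    finally show ?thesis .
  next
    case 4
    have z1: "br_z n ix (Suc 0) (left_mult c a) = br_z n ix (Suc 0) c + br_z n ix (Suc 0) a"
      using left_mult_coords(3)[of "Suc 0"] n2 by simp
    have "(\<Sum>k\<in>{1..2 * n + 2}. br_entry n ix c r k * br_entry n ix a k s)
      = (\<Sum>k\<in>{2 * n + 1, 2 * n + 2}. br_entry n ix c r k * br_entry n ix a k s)"
      using n2 unfolding 4 by (intro sum_br_entry) (auto simp: br_entry_row_z[simplified])
    also have "\<dots> = br_entry n ix a (2 * n + 1) s + br_z n ix (Suc 0) c * br_entry n ix a (2 * n + 2) s"
      unfolding 4 br_entry_row_z[of c] by simp
    also have "\<dots> = br_entry n ix (left_mult c a) r s"
      using n2 unfolding 4 br_entry_row_z br_entry_row_last z1 by auto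
    finally show ?thesis .
  next
    case 5
    have "(\<Sum>k\<in>{1..2 * n + 2}. br_entry n ix c r k * br_entry n ix a k s)
      = (\<Sum>k\<in>{2 * n + 2}. br_entry n ix c r k * br_entry n ix a k s)"
      unfolding 5 by (intro sum_br_entry) (auto simp: br_entry_row_last[simplified] br_entry_row_last)
    then show ?thesis unfolding 5 by (simp add: br_entry_row_last[simplified])
  qed
qed

lemma br_matrix_mult: "br_matrix n ix c * br_matrix n ix a = br_matrix n ix (left_mult c a)"
proof (rule eq_matI)
  fix i j assume "i < dim_row (br_matrix n ix (left_mult c a))" "j < dim_col (br_matrix n ix (left_mult c a))"
  then have ij: "i < 2 * n + 2" "j < 2 * n + 2" by (auto simp: br_matrix_def)
  have "(br_matrix n ix c * br_matrix n ix a) $$ (i, j) =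
    (\<Sum>k\<in>{0..<2 * n + 2}. br_entry n ix c (i + 1) (k + 1) * br_entry n ix a (k + 1) (j + 1))"
    using ij by (simp add: br_matrix_def scalar_prod_def)
  also have "\<dots> = (\<Sum>k\<in>{1..2 * n + 2}. br_entry n ix c (i + 1) k * br_entry n ix a k (j + 1))"
    by (rule sum.reindex_bij_witness[of _ "\<lambda>k. k - 1" "\<lambda>k. k + 1"]) auto
  also have "\<dots> = br_matrix n ix (left_mult c a) $$ (i, j)"
    using ij by (subst br_entry_mult) (auto simp: br_matrix_def)
  finally show "(br_matrix n ix c * br_matrix n ix a) $$ (i, j) = br_matrix n ix (left_mult c a) $$ (i, j)" .
qed (auto simp: br_matrix_def)

lemma br_matrix_inj:
  assumes "br_matrix n ix a = br_matrix n ix b" shows "a = b"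
proof -
  have e: "br_entry n ix a r s = br_entry n ix b r s"
    if "1 \<le> r" "r \<le> 2 * n + 2" "1 \<le> s" "s \<le> 2 * n + 2" for r s
  proof -
    have "br_matrix n ix v $$ (r - 1, s - 1) = br_entry n ix v r s" for v
      using that by (simp add: br_matrix_def)
    then show ?thesis using assms by metis
  qed
  have "vec_nth a (ix j) = vec_nth b (ix j)" if j: "1 \<le> j" "j \<le> 4 * n - 2" for j
  proof -
    consider "j \<le> n - 1" | "n \<le> j" "j \<le> 2 * n - 1" | "2 * n \<le> j" "j \<le> 3 * n - 2" | "3 * n - 1 \<le> j"
      using j by linarith
    then show ?thesis
    proof cases
      case 1
      have "- br_x ix j a = - br_x ix j b"
        using e[of "Suc j" "n + Suc j"] 1 j n2 unfolding br_entry_row_x[OF j(1) 1] by simp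
      then show ?thesis by (simp add: br_x_def)
    next
      case 2
      define i where "i = j - (n - 1)"
      have i: "1 \<le> i" "i \<le> n" "n - 1 + i = j" using 2 j n2 by (auto simp: i_def)
      have "br_y n ix i a = br_y n ix i b"
        using e[of "n + i" "2 * n + 2"] i(1,2) n2 unfolding br_entry_row_y[OF i(1,2)] by simp
      then show ?thesis unfolding br_y_def i(3) .
    next
      case 3
      define i where "i = j - (2 * n - 1)"
      have i: "1 \<le> i" "i \<le> n - 1" "2 * n - 1 + i = j" using 3 j n2 by (auto simp: i_def)
      have "cnj (br_z n ix i a) = cnj (br_z n ix i b)"
        using e[of "Suc i" "n + i"] i(1,2) n2 unfolding br_entry_row_x[OF i(1,2)] by simp
      then show ?thesis unfolding br_z_def i(3) by simp
    next
      case 4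
      define i where "i = j - (3 * n - 2)"
      have i: "1 \<le> i" "i \<le> n" "3 * n - 2 + i = j" using 4 j n2 by (auto simp: i_def)
      have "br_w n ix i a = br_w n ix i b"
        using e[of i "2 * n + 2"] i n2 by (auto simp: br_entry_def split: if_splits)
      then show ?thesis unfolding br_w_def i(3) .
    qed
  qed
  then show ?thesis unfolding cvec_eq_iff by (metis ix_jx jx_ge jx_le)
qed

section \<open>The deck transformations\<close>

lemma br_translation_matrix: "br_translation n ix (br_matrix n ix c) = left_mult c"
proof
  fix a
  show "br_translation n ix (br_matrix n ix c) a = left_mult c a"
    unfolding br_translation_def br_matrix_mult
    by (rule the_equality) (auto intro: br_matrix_inj)
qed

lemma br_deck_left_mult:
  assumes "\<gamma> \<in> br_deck n ix" obtains c where "\<gamma> = left_mult c"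
  using assms unfolding br_deck_def br_lattice_def br_group_def
  by (auto simp: br_translation_matrix)

lemma gaussian_ints_closed:
  "0 \<in> gaussian_ints" "1 \<in> gaussian_ints" "\<i> \<in> gaussian_ints"
  "u \<in> gaussian_ints \<Longrightarrow> - u \<in> gaussian_ints" "u \<in> gaussian_ints \<Longrightarrow> cnj u \<in> gaussian_ints"
  "u \<in> gaussian_ints \<Longrightarrow> w \<in> gaussian_ints \<Longrightarrow> u + w \<in> gaussian_ints"
  "u \<in> gaussian_ints \<Longrightarrow> w \<in> gaussian_ints \<Longrightarrow> u - w \<in> gaussian_ints"
  "u \<in> gaussian_ints \<Longrightarrow> w \<in> gaussian_ints \<Longrightarrow> u * w \<in> gaussian_ints"
  by (auto simp: gaussian_ints_def)

lemma br_matrix_gaussian: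
  assumes "\<And>k. vec_nth c k \<in> gaussian_ints"
  shows "elements_mat (br_matrix n ix c) \<subseteq> gaussian_ints"
proof -
  have "br_entry n ix c r s \<in> gaussian_ints" for r s
    by (simp add: br_entry_def br_x_def br_y_def br_z_def br_w_def gaussian_ints_closed assms)
  then show ?thesis unfolding elements_mat_def br_matrix_def by auto
qed

lemma shear_gaussian:
  assumes "\<And>k. vec_nth c k \<in> gaussian_ints" "\<And>k. vec_nth v k \<in> gaussian_ints"
  shows "vec_nth (shear c v) k \<in> gaussian_ints"
  using assms by (simp add: shear_def br_x_def br_y_def br_z_def gaussian_ints_closed)

lemma br_matrix_0: "br_matrix n ix 0 = 1\<^sub>m (2 * n + 2)"
  by (rule eq_matI) (auto simp: br_matrix_def br_entry_def br_x_def br_y_def br_z_def br_w_def)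

lemma shear_uminus: "shear (- c) v = - shear c v" "shear c (- v) = - shear c v"
  by (auto simp: cvec_eq_iff shear_def br_x_def br_y_def br_z_def)

text \<open>\<open>shear\<close> reads only x, y, z coordinates and writes only w coordinates: the
  group is two-step nilpotent.\<close>

lemma shear_shear: "shear c (shear b v) = 0" "shear (shear b v) c = 0"
proof -
  have z: "br_y n ix i (shear b v) = 0" if "1 \<le> i" "i \<le> n" for i
    using that n2 by (auto simp: br_y_def intro!: shear_low)
  have z2: "br_z n ix i (shear b v) = 0" if "1 \<le> i" "i \<le> n - 1" for i
    using that n2 by (auto simp: br_z_def intro!: shear_low)
  have z3: "br_x ix i (shear b v) = 0" if "1 \<le> i" "i \<le> n - 1" for i
    using that n2 by (auto simp: br_x_def intro!: shear_low)
  have j: "1 \<le> jx k - (3 * n - 1)" "jx k - (3 * n - 1) \<le> n - 1" if "jx k \<ge> 3 * n" for k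
    using that jx_le[of k] n2 by auto
  have "vec_nth (shear c (shear b v)) k = 0" "vec_nth (shear (shear b v) c) k = 0" for k
    using j[of k] n2 by (auto simp: shear_def[of c] shear_def[of "shear b v"] z z2 z3)
  then show "shear c (shear b v) = 0" "shear (shear b v) c = 0"
    unfolding cvec_eq_iff by simp_all
qed

lemma shear_add: "shear c (u + v) = shear c u + shear c v" "shear (b + c) v = shear b v + shear c v"
  by (auto simp: cvec_eq_iff shear_def br_x_def br_y_def br_z_def algebra_simps)

lemma left_mult_in_deck:
  assumes "\<And>k. vec_nth c k \<in> gaussian_ints"
  shows "left_mult c \<in> br_deck n ix"
proof -
  \<comment> \<open>The group inverse of \<open>c\<close>: as double shears vanish,
    \<open>shear c c' = - shear c c\<close> cancels the correction. Its coordinates are again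
    Gaussian integers.\<close>
  define c' where "c' = - c + shear c c"
  have g: "vec_nth c' k \<in> gaussian_ints" for k
    unfolding c'_def using assms shear_gaussian[OF assms assms] by (auto intro!: gaussian_ints_closed)
  have "left_mult c c' = 0" "left_mult c' c = 0"
    by (simp_all add: left_mult_def lin_part_def c'_def shear_add shear_uminus shear_shear
        diff_conv_add_uminus del: add_uminus_conv_diff)
  then have "br_matrix n ix c * br_matrix n ix c' = 1\<^sub>m (2 * n + 2)"
    "br_matrix n ix c' * br_matrix n ix c = 1\<^sub>m (2 * n + 2)"
    by (simp_all only: br_matrix_mult br_matrix_0)
  moreover have "br_matrix n ix v \<in> carrier_mat (2 * n + 2) (2 * n + 2)" for v
    by (simp add: br_matrix_def)
  ultimately have "br_matrix n ix c \<in> GL_gaussian (2 * n + 2)"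
    unfolding GL_gaussian_def using br_matrix_gaussian[OF assms] br_matrix_gaussian[OF g] by blast
  then have "br_translation n ix (br_matrix n ix c) \<in> br_deck n ix"
    unfolding br_deck_def by (intro imageI) (auto simp: br_lattice_def br_group_def)
  then show ?thesis by (simp only: br_translation_matrix)
qed

lemma linear_lin_part: "linear (lin_part c)"
  unfolding lin_part_def
  by (auto simp: linear_iff cvec_eq_iff shear_def br_x_def br_y_def br_z_def algebra_simps)

lemma lin_part_mult_i: "lin_part c (mult_i v) = mult_i (lin_part c v)"
  by (auto simp: cvec_eq_iff lin_part_def shear_def br_x_def br_y_def br_z_def algebra_simps)

lemma frechet_left_mult: "frechet_derivative (left_mult c) (at x) = lin_part c"
proof (rule frechet_derivative_eqI)
  have "bounded_linear (lin_part c)" using linear_lin_part by (simp add: linear_conv_bounded_linear)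
  from has_derivative_add[OF has_derivative_const bounded_linear_imp_has_derivative[OF this], of c]
  show "(left_mult c has_derivative lin_part c) (at x)"
    unfolding left_mult_def[abs_def] by simp
qed

text \<open>The x, y, z coordinates, on which deck transformations act by translation; the remaining
  w coordinates run along central directions of the group.\<close>

definition base_idx :: "'d set" where "base_idx = {k. jx k \<le> 3 * n - 2}"

lemma lin_part_base: "k \<in> base_idx \<Longrightarrow> vec_nth (lin_part c v) k = vec_nth v k"
  using shear_low[of "jx k" c v] jx_ge[of k] by (simp add: base_idx_def lin_part_def)

lemma shear_cong_base:
  assumes "\<And>k. k \<in> base_idx \<Longrightarrow> vec_nth b k = vec_nth c k" shows "shear b v = shear c v"
proof -
  have b: "vec_nth b (ix j) = vec_nth c (ix j)" if "1 \<le> j" "j \<le> 3 * n - 2" for j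
    using that n2 by (intro assms) (auto simp: base_idx_def)
  have "vec_nth (shear b v) (ix j) = vec_nth (shear c v) (ix j)" if j: "1 \<le> j" "j \<le> 4 * n - 2" for j
  proof -
    consider "j \<le> 3 * n - 2" | "j = 3 * n - 1" | "3 * n \<le> j" by linarith
    then show ?thesis
    proof cases
      case 1
      then show ?thesis using shear_low j by simp
    next
      case 2
      have "br_y n ix 1 b = br_y n ix 1 c" unfolding br_y_def using n2 by (intro b) auto
      then show ?thesis unfolding 2 shear_w1 by simp
    next
      case 3
      define i where "i = j - (3 * n - 1)"
      have i: "1 \<le> i" "i \<le> n - 1" "j = 3 * n - 1 + i" using 3 j n2 by (auto simp: i_def)
      have "br_z n ix i b = br_z n ix i c" "br_x ix i b = br_x ix i c"
        unfolding br_z_def br_x_def using n2 i by (auto intro!: b)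
      then show ?thesis unfolding i(3) shear_w[OF i(1,2)] by simp
    qed
  qed
  then show ?thesis unfolding cvec_eq_iff by (metis ix_jx jx_ge jx_le)
qed

text \<open>An element along a w coordinate has no shear, so it acts as a plain translation of the
  chart. These elements supply the periods in the fibre directions.\<close>

lemma left_mult_fibre:
  assumes "k \<notin> base_idx" shows "left_mult (axis k g) = (\<lambda>x. x + axis k g)" "lin_part (axis k g) = (\<lambda>v. v)"
proof -
  have "shear (axis k g) v = shear 0 v" for v
    using assms by (intro shear_cong_base) (auto simp: axis_def)
  moreover have "shear 0 v = 0" for v
    by (simp add: cvec_eq_iff shear_def br_x_def br_y_def br_z_def)
  ultimately show "left_mult (axis k g) = (\<lambda>x. x + axis k g)" "lin_part (axis k g) = (\<lambda>v. v)"
    by (auto simp: left_mult_def[abs_def] lin_part_def[abs_def] add.commute)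
qed

lemma translation_in_deck:
  assumes "k \<notin> base_idx" "g = 1 \<or> g = \<i>"
  shows "(\<lambda>x. x + axis k g) \<in> br_deck n ix"
proof -
  have "left_mult (axis k g) \<in> br_deck n ix"
    by (rule left_mult_in_deck) (use assms(2) in \<open>auto simp: axis_def intro: gaussian_ints_closed\<close>)
  then show ?thesis by (simp add: left_mult_fibre[OF assms(1)])
qed

section \<open>Compactness of the quotient\<close>

definition gfloor :: "complex \<Rightarrow> complex" where
  "gfloor z = Complex (of_int \<lfloor>Re z\<rfloor>) (of_int \<lfloor>Im z\<rfloor>)"

lemma gfloor: "gfloor z \<in> gaussian_ints" "cmod (z - gfloor z) \<le> 2"
proof -
  show "gfloor z \<in> gaussian_ints" by (simp add: gfloor_def gaussian_ints_def)
  have "\<bar>Re (z - gfloor z)\<bar> \<le> 1" "\<bar>Im (z - gfloor z)\<bar> \<le> 1"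
    unfolding gfloor_def by (simp_all; linarith)+
  then show "cmod (z - gfloor z) \<le> 2" using cmod_le[of "z - gfloor z"] by linarith
qed

definition fund_box :: "(complex^'d) set" where
  "fund_box = {v. \<forall>k. cmod (vec_nth v k) \<le> 2}"

lemma compact_fund_box: "compact fund_box"
proof -
  have "norm v \<le> (\<Sum>k\<in>(UNIV::'d set). 2)" if "v \<in> fund_box" for v
    unfolding norm_vec_def using that
    by (intro order_trans[OF L2_set_le_sum] sum_mono) (auto simp: fund_box_def)
  then have "bounded fund_box" unfolding bounded_iff by blast
  moreover have "closed fund_box"
    unfolding fund_box_def by (intro closed_Collect_all closed_Collect_le continuous_intros)
  ultimately show ?thesis by (simp add: compact_eq_bounded_closed)
qed

lemma exists_deck_into_box: "\<exists>c. left_mult c \<in> br_deck n ix \<and> left_mult c a \<in> fund_box"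
proof -
  \<comment> \<open>\<open>shear\<close> depends only on the base coordinates of its first argument.
    The base part of \<open>c\<close> is therefore fixed first; it determines the correction of the
    fibre coordinates, which is then absorbed into their rounding.\<close>
  define c0 where "c0 = (\<chi> k. - gfloor (vec_nth a k))"
  define c where "c = (\<chi> k. if k \<in> base_idx then - gfloor (vec_nth a k)
    else - gfloor (vec_nth a k + vec_nth (shear c0 a) k))"
  have sh: "shear c a = shear c0 a" by (rule shear_cong_base) (simp add: c_def c0_def)
  have "left_mult c \<in> br_deck n ix"
    by (rule left_mult_in_deck) (auto simp: c_def intro!: gaussian_ints_closed gfloor)
  moreover have "cmod (vec_nth (left_mult c a) k) \<le> 2" for k
  proof (cases "k \<in> base_idx")
    case True
    have "vec_nth (left_mult c a) k = vec_nth a k - gfloor (vec_nth a k)"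
      using lin_part_base[OF True, of c a] True by (simp add: left_mult_def c_def)
    then show ?thesis using gfloor by simp
  next
    case False
    have "vec_nth (left_mult c a) k = (vec_nth a k + vec_nth (shear c0 a) k) - gfloor (vec_nth a k + vec_nth (shear c0 a) k)"
      using False by (simp add: left_mult_def lin_part_def sh) (simp add: c_def)
    then show ?thesis using gfloor by metis
  qed
  ultimately show ?thesis by (auto simp: fund_box_def)
qed

lemma invariant_bounded:
  fixes f :: "complex^'d \<Rightarrow> complex"
  assumes "continuous_on UNIV f" "\<And>c x. left_mult c \<in> br_deck n ix \<Longrightarrow> f (left_mult c x) = f x"
  obtains C where "\<And>x. cmod (f x) \<le> C"
proof -
  have "compact (f ` fund_box)"
    by (rule compact_continuous_image[OF continuous_on_subset[OF assms(1)] compact_fund_box]) simp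
  then obtain C where C: "\<And>y. y \<in> f ` fund_box \<Longrightarrow> cmod y \<le> C"
    using compact_imp_bounded bounded_iff by metis
  have "cmod (f x) \<le> C" for x
    using exists_deck_into_box[of x] assms(2) C by (metis imageI)
  then show ?thesis using that by blast
qed

lemma invariant_bounded_below:
  fixes f :: "complex^'d \<Rightarrow> real"
  assumes "continuous_on UNIV f" "\<And>c x. left_mult c \<in> br_deck n ix \<Longrightarrow> f (left_mult c x) = f x"
    and "\<And>x. f x > 0"
  obtains \<epsilon> where "\<epsilon> > 0" "\<And>x. f x \<ge> \<epsilon>"
proof -
  have "0 \<in> fund_box" by (simp add: fund_box_def)
  then obtain x0 where x0: "\<And>x. x \<in> fund_box \<Longrightarrow> f x0 \<le> f x"
    using continuous_attains_inf[OF compact_fund_box _ continuous_on_subset[OF assms(1)]] by blast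
  have "f x \<ge> f x0" for x
    using exists_deck_into_box[of x] assms(2) x0 by metis
  then show ?thesis using that assms(3) by blast
qed

end

section \<open>The obstruction\<close>

lemma foldr_Cons_apply: "foldr f (x # xs) z = f x (foldr f xs z)"
  by simp

lemma foldr_covec_wedge_map:
  "foldr covec_wedge as unit_form (map T vs) = foldr covec_wedge (map (\<lambda>a. a \<circ> T) as) unit_form vs"
proof (induction as arbitrary: vs)
  case Nil
  then show ?case by (simp add: unit_form_def)
next
  case (Cons a as)
  have "(\<lambda>ws. foldr covec_wedge as unit_form (map T ws)) = foldr covec_wedge (map (\<lambda>a. a \<circ> T) as) unit_form"
    using Cons by blast
  moreover have "foldr covec_wedge (a # as) unit_form (map T vs) =
      covec_wedge (a \<circ> T) (\<lambda>ws. foldr covec_wedge as unit_form (map T ws)) vs"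
    by (simp only: foldr.simps o_apply covec_wedge_map)
  ultimately show ?case by (simp only: list.map foldr_Cons_apply)
qed

lemma foldr_covec_wedge_add:
  "foldr covec_wedge as (\<alpha> + \<beta>) = foldr covec_wedge as \<alpha> + foldr covec_wedge as \<beta>"
proof (induction as)
  case (Cons a as)
  then show ?case by (simp only: foldr.simps o_apply covec_wedge_add)
qed simp

lemma foldr_covec_wedge_scale:
  "foldr covec_wedge as (form_scale c \<beta>) = form_scale c (foldr covec_wedge as \<beta>)"
proof (induction as)
  case (Cons a as)
  then show ?case by (simp only: foldr.simps o_apply covec_wedge_scale)
qed simp

lemma foldr_covec_wedge_sum:
  "foldr covec_wedge as (\<Sum>i\<in>A. f i) = (\<Sum>i\<in>A. foldr covec_wedge as (f i))"
  by (rule sum_comp_morphism[of "foldr covec_wedge as" f A, OF foldr_covec_wedge_zero foldr_covec_wedge_add,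
    unfolded o_def, symmetric])

text \<open>\<open>t b\<close> and \<open>b\<close> may be exchanged when they agree modulo the
  covectors in \<open>as\<close>. The list \<open>as\<close> grows by each covector already treated,
  and anticommutation carries the hypothesis along.\<close>

lemma foldr_covec_wedge_replace:
  assumes "\<And>b \<beta>. b \<in> set bs \<Longrightarrow> foldr covec_wedge as (covec_wedge (t b) \<beta>) = foldr covec_wedge as (covec_wedge b \<beta>)"
  shows "foldr covec_wedge as (foldr covec_wedge (map t bs) \<gamma>) = foldr covec_wedge as (foldr covec_wedge bs \<gamma>)"
  using assms
proof (induction bs arbitrary: as)
  case (Cons b bs)
  have "foldr covec_wedge (as @ [b]) (covec_wedge (t b') \<beta>) = foldr covec_wedge (as @ [b]) (covec_wedge b' \<beta>)"
    if "b' \<in> set bs" for b' \<beta>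
  proof -
    have neg: "foldr covec_wedge as (- \<gamma>) = - foldr covec_wedge as \<gamma>" for \<gamma>
      using foldr_covec_wedge_scale[of as "- 1" \<gamma>] by (simp add: form_scale_def fun_Compl_def)
    have "foldr covec_wedge as (covec_wedge b (covec_wedge (t b') \<beta>)) = - foldr covec_wedge as (covec_wedge (t b') (covec_wedge b \<beta>))"
      by (subst covec_wedge_anticomm) (rule neg)
    also have "\<dots> = - foldr covec_wedge as (covec_wedge b' (covec_wedge b \<beta>))"
      using Cons.prems[of b' "covec_wedge b \<beta>"] that by simp
    also have "\<dots> = foldr covec_wedge as (covec_wedge b (covec_wedge b' \<beta>))"
      by (subst (2) covec_wedge_anticomm) (rule neg[symmetric])
    finally show ?thesis by simp
  qed
  then have "foldr covec_wedge (as @ [b]) (foldr covec_wedge (map t bs) \<gamma>) = foldr covec_wedge (as @ [b]) (foldr covec_wedge bs \<gamma>)"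
    by (rule Cons.IH)
  then show ?case using Cons.prems[of b "foldr covec_wedge (map t bs) \<gamma>"] by simp
qed simp

text \<open>The pull-back fixes the covectors \<open>as\<close> and moves each of \<open>bs\<close>
  by a combination of them; such a combination dies against the wedge of all of
  \<open>as\<close>.\<close>

lemma foldr_covec_wedge_unipotent:
  assumes "\<And>a. a \<in> set as \<Longrightarrow> a \<circ> T = a"
    and "\<And>b. b \<in> set bs \<Longrightarrow> \<exists>c. b \<circ> T = (\<lambda>v. b v + (\<Sum>a\<in>set as. c a * a v))"
  shows "foldr covec_wedge (as @ bs) unit_form (map T vs) = foldr covec_wedge (as @ bs) unit_form vs"
proof -
  have m: "map (\<lambda>a. a \<circ> T) as = as" using assms(1) by (simp add: map_idI)
  have "foldr covec_wedge as (covec_wedge (b \<circ> T) \<beta>) = foldr covec_wedge as (covec_wedge b \<beta>)"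
    if b: "b \<in> set bs" for b \<beta>
  proof -
    obtain c where c: "b \<circ> T = (\<lambda>v. b v + (\<Sum>a\<in>set as. c a * a v))" using assms(2)[OF b] by blast
    have "foldr covec_wedge as (form_scale (c a) (covec_wedge a \<beta>)) = 0" if "a \<in> set as" for a
      unfolding foldr_covec_wedge_scale covec_wedge_foldr_mem[OF that] by (simp add: form_scale_def fun_eq_iff)
    then have "foldr covec_wedge as (\<Sum>a\<in>set as. form_scale (c a) (covec_wedge a \<beta>)) = 0"
      unfolding foldr_covec_wedge_sum by (intro sum.neutral) blast
    then show ?thesis
      unfolding c by (simp only: covec_wedge_add_left covec_wedge_sum_left covec_wedge_scale_left
        foldr_covec_wedge_add add_0_right)
  qed
  from foldr_covec_wedge_replace[of bs as "\<lambda>a. a \<circ> T" unit_form, OF this]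
  have "foldr covec_wedge (map (\<lambda>a. a \<circ> T) (as @ bs)) unit_form = foldr covec_wedge (as @ bs) unit_form"
    unfolding map_append m foldr_append o_apply .
  then show ?thesis by (simp only: foldr_covec_wedge_map)
qed

section \<open>Real coordinates and invariance of the volume\<close>

context br_chart
begin

definition base_list :: "'d list" where "base_list = map ix [1..<3 * n - 1]"
definition fibre_list :: "'d list" where "fibre_list = map ix [3 * n - 1..<4 * n - 1]"

lemma set_base_list: "set base_list = base_idx"
proof
  show "set base_list \<subseteq> base_idx" using n2 by (auto simp: base_list_def base_idx_def)
  show "base_idx \<subseteq> set base_list"
  proof
    fix k assume "k \<in> base_idx"
    then have "jx k \<in> set [1..<3 * n - 1]" using jx_ge[of k] n2 by (auto simp: base_idx_def)
    then have "ix (jx k) \<in> set base_list" unfolding base_list_def set_map by (rule imageI)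
    then show "k \<in> set base_list" by simp
  qed
qed

lemma set_fibre_list: "set fibre_list = - base_idx"
proof
  show "set fibre_list \<subseteq> - base_idx" using n2 by (auto simp: fibre_list_def base_idx_def)
  show "- base_idx \<subseteq> set fibre_list"
  proof
    fix k assume "k \<in> - base_idx"
    then have "jx k \<in> set [3 * n - 1..<4 * n - 1]" using jx_le[of k] n2 by (auto simp: base_idx_def)
    then have "ix (jx k) \<in> set fibre_list" unfolding fibre_list_def set_map by (rule imageI)
    then show "k \<in> set fibre_list" by simp
  qed
qed

lemma distinct_lists: "distinct base_list" "distinct fibre_list" "distinct (base_list @ fibre_list)"
proof -
  have inj: "inj_on ix {1..4 * n - 2}" using bij by (auto simp: bij_betw_def)
  show "distinct base_list" "distinct fibre_list"
    unfolding base_list_def fibre_list_def using n2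
    by (auto simp: distinct_map intro!: inj_on_subset[OF inj])
  then show "distinct (base_list @ fibre_list)" by (simp add: set_base_list set_fibre_list)
qed

lemma length_lists: "length (base_list @ fibre_list) = CARD('d)"
  by (metis Compl_partition distinct_card distinct_lists(3) set_append set_base_list set_fibre_list)

text \<open>\<open>True\<close> stands for the real part of the coordinate and \<open>False\<close>
  for the imaginary part; \<open>real_vec\<close> gives the dual basis.\<close>

definition real_covec :: "bool \<times> 'd \<Rightarrow> complex^'d \<Rightarrow> complex" where
  "real_covec p v = of_real (if fst p then Re (vec_nth v (snd p)) else Im (vec_nth v (snd p)))"

definition real_vec :: "bool \<times> 'd \<Rightarrow> complex^'d" where
  "real_vec p = axis (snd p) (if fst p then 1 else \<i>)"

definition pairs :: "'d list \<Rightarrow> (bool \<times> 'd) list" where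
  "pairs ks = map (Pair True) ks @ map (Pair False) ks"

text \<open>A fixed real basis with the base coordinates first, the order in which
  \<open>foldr_covec_wedge_unipotent\<close> takes the dual covectors. Forms of top degree are
  compared by their values on it.\<close>

definition frame :: "(complex^'d) list" where
  "frame = map real_vec (pairs base_list @ pairs fibre_list)"

lemma distinct_pairs: "distinct (pairs base_list @ pairs fibre_list)"
  using distinct_lists by (auto simp: pairs_def distinct_map inj_on_def)

lemma length_frame: "length frame = DIM(complex^'d)"
  using length_lists by (simp add: frame_def pairs_def)

lemma span_frame: "span (set frame) = UNIV"
proof -
  have "axis k 1 \<in> set frame" "axis k \<i> \<in> set frame" for k
  proof -
    have "k \<in> set base_list \<or> k \<in> set fibre_list" by (auto simp: set_base_list set_fibre_list)
    then have "(b, k) \<in> set (pairs base_list @ pairs fibre_list)" for b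
      by (cases b) (auto simp: pairs_def)
    then have "real_vec (b, k) \<in> set frame" for b unfolding frame_def set_map by (intro imageI)
    from this[of True] this[of False] show "axis k 1 \<in> set frame" "axis k \<i> \<in> set frame"
      by (simp_all add: real_vec_def)
  qed
  then have "v \<in> span (set frame)" for v
    by (subst vec_complex_basis_expansion[of v]) (intro span_sum span_add span_scale span_base)
  then show ?thesis by blast
qed

lemma linear_shear: "linear (shear c)"
  by (auto simp: linear_iff cvec_eq_iff shear_def br_x_def br_y_def br_z_def algebra_simps)

lemma shear_fibre: "k \<notin> base_idx \<Longrightarrow> shear c (axis k g) = 0"
proof -
  assume k: "k \<notin> base_idx"
  have sx: "br_x ix i (axis k g) = 0" if "1 \<le> i" "i \<le> n - 1" for i
    using that k n2 by (auto simp: br_x_def axis_def base_idx_def)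
  have sy: "br_y n ix i (axis k g) = 0" if "1 \<le> i" "i \<le> n" for i
    using that k n2 by (auto simp: br_y_def axis_def base_idx_def)
  have sz: "br_z n ix i (axis k g) = 0" if "1 \<le> i" "i \<le> n - 1" for i
    using that k n2 by (auto simp: br_z_def axis_def base_idx_def)
  have "vec_nth (shear c (axis k g)) (ix j) = 0" if j: "1 \<le> j" "j \<le> 4 * n - 2" for j
  proof -
    consider "j \<le> 3 * n - 2" | "j = 3 * n - 1" | "3 * n \<le> j" by linarith
    then show ?thesis
    proof cases
      case 1
      then show ?thesis using shear_low j by simp
    next
      case 2
      show ?thesis unfolding 2 shear_w1 using sz[of 1] n2 by simp
    next
      case 3
      define i where "i = j - (3 * n - 1)"
      have i: "1 \<le> i" "i \<le> n - 1" "j = 3 * n - 1 + i" using 3 j n2 by (auto simp: i_def)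
      show ?thesis unfolding i(3) shear_w[OF i(1,2)] using sy[of i] sy[of "i + 1"] i(1,2) by simp
    qed
  qed
  then have "vec_nth (shear c (axis k g)) k' = 0" for k'
    by (metis ix_jx jx_ge jx_le)
  then show ?thesis by (simp add: cvec_eq_iff)
qed

text \<open>\<open>lin_part c\<close> has determinant one: it fixes the base covectors and changes a
  fibre covector by base covectors only.\<close>

lemma volume_invariant:
  "foldr covec_wedge (map real_covec (pairs base_list @ pairs fibre_list)) unit_form (map (lin_part c) vs) =
   foldr covec_wedge (map real_covec (pairs base_list @ pairs fibre_list)) unit_form vs"
  unfolding map_append
proof (rule foldr_covec_wedge_unipotent)
  fix a assume "a \<in> set (map real_covec (pairs base_list))"
  then show "a \<circ> lin_part c = a"
    by (auto simp: pairs_def real_covec_def set_base_list lin_part_base fun_eq_iff)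
next
  fix b assume "b \<in> set (map real_covec (pairs fibre_list))"
  then obtain p where p: "b = real_covec p" by auto
  \<comment> \<open>The change of the fibre covector \<open>b\<close>. It vanishes on fibre vectors,
    hence is a combination of base covectors.\<close>
  define e where "e v = real_covec p (shear c v)" for v
  have linr: "linear (real_covec p)" by (auto simp: linear_iff real_covec_def scaleR_complex)
  have line: "linear e" unfolding e_def using linear_compose[OF linear_shear linr] by (simp add: o_def)
  have z: "e (axis k g) = 0" if "k \<notin> base_idx" for k g
    unfolding e_def shear_fibre[OF that] by (rule linear_0[OF linr])
  \<comment> \<open>The combination is indexed by the covectors themselves, as
    \<open>foldr_covec_wedge_unipotent\<close> has a sum over \<open>set as\<close>; the inverse of
    \<open>real_covec\<close> recovers the index.\<close>
  have e: "e v = (\<Sum>a\<in>set (map real_covec (pairs base_list)).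
      e (real_vec (the_inv_into (set (pairs base_list)) real_covec a)) * a v)" for v
  proof -
    have inj: "inj_on real_covec (set (pairs base_list))"
    proof (rule inj_onI)
      fix p q assume "real_covec p = real_covec q"
      then have "real_covec p (real_vec p) = real_covec q (real_vec p)" by simp
      then show "p = q"
        by (auto simp: real_covec_def real_vec_def axis_def prod_eq_iff split: if_splits)
    qed
    have "e v = (\<Sum>k\<in>UNIV. of_real (Re (vec_nth v k)) * e (axis k 1) + of_real (Im (vec_nth v k)) * e (axis k \<i>))"
      by (subst vec_complex_basis_expansion[of v])
        (simp add: linear_sum[OF line] linear_add[OF line] linear_scale[OF line] scaleR_complex)
    also have "\<dots> = (\<Sum>k\<in>base_idx. of_real (Re (vec_nth v k)) * e (axis k 1) + of_real (Im (vec_nth v k)) * e (axis k \<i>))"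
      by (intro sum.mono_neutral_right) (auto simp: z)
    also have "\<dots> = (\<Sum>b\<in>UNIV. \<Sum>k\<in>base_idx. e (real_vec (b, k)) * real_covec (b, k) v)"
      by (simp add: UNIV_bool sum.distrib real_vec_def real_covec_def mult.commute)
    also have "\<dots> = (\<Sum>p\<in>UNIV \<times> base_idx. e (real_vec p) * real_covec p v)"
      by (simp add: sum.cartesian_product split_def)
    also have "UNIV \<times> base_idx = set (pairs base_list)"
      by (auto simp: pairs_def set_base_list)
    also have "(\<Sum>p\<in>set (pairs base_list). e (real_vec p) * real_covec p v) = (\<Sum>a\<in>set (map real_covec (pairs base_list)).
      e (real_vec (the_inv_into (set (pairs base_list)) real_covec a)) * a v)"
      unfolding set_map by (subst sum.reindex[OF inj]) (simp add: the_inv_into_f_f[OF inj])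
    finally show ?thesis .
  qed
  have "b \<circ> lin_part c = (\<lambda>v. b v + e v)"
    unfolding p e_def by (auto simp: lin_part_def linear_add[OF linr])
  also have "\<dots> = (\<lambda>v. b v + (\<Sum>a\<in>set (map real_covec (pairs base_list)).
      e (real_vec (the_inv_into (set (pairs base_list)) real_covec a)) * a v))"
    by (rule ext, rule arg_cong[where f = "(+) (b _)"], rule e)
  finally show "\<exists>d. b \<circ> lin_part c = (\<lambda>v. b v + (\<Sum>a\<in>set (map real_covec (pairs base_list)). d a * a v))"
    by (rule exI[where x = "\<lambda>a. e (real_vec (the_inv_into (set (pairs base_list)) real_covec a))"])
qed

text \<open>In top degree \<open>\<tau>\<close> is a multiple of the invariant volume form.
  Consequently the value on \<open>frame\<close> of an invariant form field of top degree is an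
  invariant function.\<close>

lemma top_form_invariant:
  assumes "ext_form \<tau>"
  shows "\<tau> (map (lin_part c) frame) = \<tau> frame"
proof -
  define vol where "vol = foldr covec_wedge (map real_covec (pairs base_list @ pairs fibre_list)) unit_form"
  have linr: "linear (real_covec p)" for p by (auto simp: linear_iff real_covec_def scaleR_complex)
  have ev: "ext_form vol"
  proof -
    have "ext_form (foldr covec_wedge (map real_covec ps) unit_form)" for ps
      by (induction ps) (auto intro!: ext_form_unit_form ext_form_covec_wedge linr)
    then show ?thesis unfolding vol_def by blast
  qed
  have "vol frame = foldr covec_wedge (map real_covec (pairs base_list @ pairs fibre_list)) unit_form
      (map real_vec (pairs base_list @ pairs fibre_list) @ [])"
    by (simp add: vol_def frame_def)
  also have "\<dots> = (unit_form :: (complex^'d) ext_form) []"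
    by (rule foldr_covec_wedge_dual[OF distinct_pairs])
      (auto simp: real_covec_def real_vec_def axis_def prod_eq_iff)
  finally have v1: "vol frame = 1" by (simp add: unit_form_def)
  have v2: "vol (map (lin_part c) frame) = 1"
    unfolding vol_def volume_invariant using v1 by (simp add: vol_def)
  let ?\<delta> = "\<tau> - form_scale (\<tau> frame) vol"
  have "?\<delta> (map (lin_part c) frame) = 0"
    by (rule ext_form_top_zero[OF ext_form_diff[OF assms ext_form_scale[OF ev]] span_frame])
      (simp_all add: form_scale_def v1)
  then show ?thesis by (simp add: form_scale_def v2)
qed

end

section \<open>Wirtinger derivatives with vanishing averages\<close>

lemma null_fun_wirt:
  fixes f :: "complex^'d::finite \<Rightarrow> complex"
  assumes "smooth_on UNIV f" "sublinear_along (axis j 1) f" "sublinear_along (axis j \<i>) f"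
  shows "null_fun (wirt j f)" "null_fun (wirt_bar j f)"
proof -
  note 1 = null_fun_derivative[OF assms(1,2)] and 2 = null_fun_derivative[OF assms(1,3)]
  have eq1: "wirt j f = (\<lambda>x. 1 / 2 * frechet_derivative f (at x) (axis j 1) + (- \<i> / 2) * frechet_derivative f (at x) (axis j \<i>))"
    by (auto simp: wirt_defs diff_divide_distrib)
  show "null_fun (wirt j f)" unfolding eq1 by (rule null_fun_add[OF null_fun_cmult[OF 1] null_fun_cmult[OF 2]])
  have eq2: "wirt_bar j f = (\<lambda>x. 1 / 2 * frechet_derivative f (at x) (axis j 1) + (\<i> / 2) * frechet_derivative f (at x) (axis j \<i>))"
    by (auto simp: wirt_defs add_divide_distrib)
  show "null_fun (wirt_bar j f)" unfolding eq2 by (rule null_fun_add[OF null_fun_cmult[OF 1] null_fun_cmult[OF 2]])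
qed

text \<open>Growth is controlled along the inner index \<open>j\<close>, while \<open>k\<close> is
  arbitrary. This serves the case in which \<open>G k j\<close> is known to be periodic only along
  \<open>j\<close>.\<close>

lemma null_fun_wirt_wirt_bar:
  fixes f :: "complex^'d::finite \<Rightarrow> complex"
  assumes s: "smooth_on UNIV f" and l: "sublinear_along (axis j 1) f" "sublinear_along (axis j \<i>) f"
  shows "null_fun (wirt k (wirt_bar j f))"
proof -
  let ?g1 = "\<lambda>x. frechet_derivative f (at x) (axis j 1)"
  let ?g2 = "\<lambda>x. frechet_derivative f (at x) (axis j \<i>)"
  have eq: "wirt_bar j f = (\<lambda>x. 1 / 2 * ?g1 x + \<i> / 2 * ?g2 x)"
    by (auto simp: wirt_defs add_divide_distrib)
  have s1: "smooth_on UNIV ?g1" and s2: "smooth_on UNIV ?g2"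
    by (rule smooth_on_frechet_derivative[OF s])+
  have d1: "?g1 differentiable at x" and d2: "?g2 differentiable at x" for x
    using smooth_on_differentiable[OF s1] smooth_on_differentiable[OF s2] by auto
  have d1': "(\<lambda>x. 1 / 2 * ?g1 x) differentiable at x" and d2': "(\<lambda>x. \<i> / 2 * ?g2 x) differentiable at x" for x
    by (rule differentiable_mult[OF differentiable_const d1], rule differentiable_mult[OF differentiable_const d2])
  have "wirt k (wirt_bar j f) = (\<lambda>x. 1 / 2 * wirt k ?g1 x + \<i> / 2 * wirt k ?g2 x)"
    unfolding eq by (rule ext) (simp only: wirt_add(1)[OF d1' d2'] wirt_cmult(1)[OF d1] wirt_cmult(1)[OF d2])
  moreover have n: "null_fun (wirt k g)" if g: "g = ?g1 \<or> g = ?g2" for g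
  proof -
    have n: "null_fun (\<lambda>x. frechet_derivative g (at x) u)" for u
      using g null_fun_second_derivative[OF s l(1), of u] null_fun_second_derivative[OF s l(2), of u] by auto
    have eqg: "wirt k g = (\<lambda>x. 1 / 2 * frechet_derivative g (at x) (axis k 1) + (- \<i> / 2) * frechet_derivative g (at x) (axis k \<i>))"
      by (auto simp: wirt_defs diff_divide_distrib)
    show ?thesis unfolding eqg by (rule null_fun_add[OF null_fun_cmult[OF n] null_fun_cmult[OF n]])
  qed
  ultimately show ?thesis
    by (simp only:) (intro null_fun_add null_fun_cmult n disjI1 disjI2 refl)
qed

lemma wirt_bar_periodic:
  fixes f :: "complex^'d::finite \<Rightarrow> complex"
  assumes "\<And>x. f (x + v) = f x" "smooth_on UNIV f" shows "wirt_bar j f (x + v) = wirt_bar j f x"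
proof -
  have "(f has_derivative frechet_derivative f (at (x + v))) (at (x + v))"
    using smooth_on_differentiable[OF assms(2)] frechet_derivative_works by blast
  moreover have "((\<lambda>y. y + v) has_derivative (\<lambda>w. w)) (at x)"
    by (auto intro!: derivative_eq_intros)
  ultimately have "((\<lambda>y. f (y + v)) has_derivative (\<lambda>w. frechet_derivative f (at (x + v)) w)) (at x)"
    by (rule has_derivative_compose[rotated])
  then have "(f has_derivative frechet_derivative f (at (x + v))) (at x)" using assms(1) by simp
  from frechet_derivative_eqI[OF this] show ?thesis by (simp add: wirt_bar_def)
qed

lemma wirt_covec_wedge4:
  fixes \<Psi> :: "(complex^'d::finite) form_field"
  assumes s: "smooth_form \<Psi>" and l: "linear a" "linear b" "linear c" "linear d"
  shows "wirt k (\<lambda>x. covec_wedge a (covec_wedge b (covec_wedge c (covec_wedge d (\<Psi> x)))) vs) x =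
      covec_wedge a (covec_wedge b (covec_wedge c (covec_wedge d (form_wirt k \<Psi> x)))) vs"
    "wirt_bar k (\<lambda>x. covec_wedge a (covec_wedge b (covec_wedge c (covec_wedge d (\<Psi> x)))) vs) x =
      covec_wedge a (covec_wedge b (covec_wedge c (covec_wedge d (form_wirt_bar k \<Psi> x)))) vs"
proof -
  note s1 = smooth_form_covec_wedge[OF l(4) s]
  note s2 = smooth_form_covec_wedge[OF l(3) s1]
  note s3 = smooth_form_covec_wedge[OF l(2) s2]
  note d = smooth_form_differentiable[OF s] smooth_form_differentiable[OF s1]
    smooth_form_differentiable[OF s2] smooth_form_differentiable[OF s3]
  have "form_wirt k (\<lambda>x. covec_wedge a (covec_wedge b (covec_wedge c (covec_wedge d (\<Psi> x))))) x =
      covec_wedge a (covec_wedge b (covec_wedge c (covec_wedge d (form_wirt k \<Psi> x))))"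
    by (simp only: form_wirt_covec_wedge(1)[OF d(1)] form_wirt_covec_wedge(1)[OF d(2)]
        form_wirt_covec_wedge(1)[OF d(3)] form_wirt_covec_wedge(1)[OF d(4)])
  then show "wirt k (\<lambda>x. covec_wedge a (covec_wedge b (covec_wedge c (covec_wedge d (\<Psi> x)))) vs) x =
      covec_wedge a (covec_wedge b (covec_wedge c (covec_wedge d (form_wirt k \<Psi> x)))) vs"
    unfolding form_wirt_def by (rule fun_cong)
  have "form_wirt_bar k (\<lambda>x. covec_wedge a (covec_wedge b (covec_wedge c (covec_wedge d (\<Psi> x))))) x =
      covec_wedge a (covec_wedge b (covec_wedge c (covec_wedge d (form_wirt_bar k \<Psi> x))))"
    by (simp only: form_wirt_covec_wedge(2)[OF d(1)] form_wirt_covec_wedge(2)[OF d(2)]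
        form_wirt_covec_wedge(2)[OF d(3)] form_wirt_covec_wedge(2)[OF d(4)])
  then show "wirt_bar k (\<lambda>x. covec_wedge a (covec_wedge b (covec_wedge c (covec_wedge d (\<Psi> x)))) vs) x =
      covec_wedge a (covec_wedge b (covec_wedge c (covec_wedge d (form_wirt_bar k \<Psi> x)))) vs"
    unfolding form_wirt_bar_def by (rule fun_cong)
qed

text \<open>Integration by parts: with \<open>G = A - y B - \<bar>y\<bar> C + \<bar>y\<bar>\<^sup>2 D\<close> and the four second-order identities, the
  component \<open>D y y\<close> is a sum of derivatives.\<close>

lemma second_order_identity:
  fixes A B C D :: "'d::finite \<Rightarrow> 'd \<Rightarrow> complex^'d \<Rightarrow> complex" and y :: 'd
  assumes sA: "\<And>k j. smooth_on UNIV (A k j)" and sB: "\<And>k j. smooth_on UNIV (B k j)"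
    and sC: "\<And>k j. smooth_on UNIV (C k j)" and sD: "\<And>k j. smooth_on UNIV (D k j)"
    and zA: "(\<Sum>k\<in>UNIV. \<Sum>j\<in>UNIV. wirt k (wirt_bar j (A k j)) x) = 0"
    and zB: "(\<Sum>k\<in>UNIV. \<Sum>j\<in>UNIV. wirt k (wirt_bar j (B k j)) x) = 0"
    and zC: "(\<Sum>k\<in>UNIV. \<Sum>j\<in>UNIV. wirt k (wirt_bar j (C k j)) x) = 0"
    and zD: "(\<Sum>k\<in>UNIV. \<Sum>j\<in>UNIV. wirt k (wirt_bar j (D k j)) x) = 0"
  shows "D y y x =
    (\<Sum>j\<in>UNIV. wirt_bar j (\<lambda>x. cnj (vec_nth x y) * D y j x - B y j x) x)
    + (\<Sum>k\<in>UNIV. wirt k (\<lambda>x. vec_nth x y * D k y x - C k y x) x)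
    - (\<Sum>k\<in>UNIV. \<Sum>j\<in>UNIV. wirt k (wirt_bar j (\<lambda>x. A k j x - vec_nth x y * B k j x
        - cnj (vec_nth x y) * C k j x + vec_nth x y * (cnj (vec_nth x y) * D k j x))) x)"
proof -
  let ?y = "\<lambda>x::complex^'d. vec_nth x y" and ?c = "\<lambda>x::complex^'d. cnj (vec_nth x y)"
  let ?\<delta> = "\<lambda>k::'d. if k = y then 1 else 0 :: complex"
  note sy = smooth_on_vec_nth[of y] and sc = smooth_on_cnj_vec_nth[of y]
  note diff = smooth_on_differentiable[OF _ UNIV_I]
  have wm: "wirt k (\<lambda>x. f x * g x) x = f x * wirt k g x + wirt k f x * g x"
    "wirt_bar k (\<lambda>x. f x * g x) x = f x * wirt_bar k g x + wirt_bar k f x * g x"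
    "wirt k (\<lambda>x. f x + g x) x = wirt k f x + wirt k g x"
    "wirt_bar k (\<lambda>x. f x + g x) x = wirt_bar k f x + wirt_bar k g x"
    "wirt k (\<lambda>x. f x - g x) x = wirt k f x - wirt k g x"
    "wirt_bar k (\<lambda>x. f x - g x) x = wirt_bar k f x - wirt_bar k g x"
    if "smooth_on UNIV f" "smooth_on UNIV g" for k x and f g :: "complex^'d \<Rightarrow> complex"
    using wirt_mult[OF diff[OF that(1)] diff[OF that(2)]] wirt_add[OF diff[OF that(1)] diff[OF that(2)]]
      wirt_add[OF diff[OF that(1)] diff[OF smooth_on_minus[OF that(2)]]] wirt_uminus[OF diff[OF that(2)]]
    by auto
  note sm = smooth_on_mult[OF sy] smooth_on_mult[OF sc] smooth_on_add smooth_on_diff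
    smooth_on_wirt smooth_on_wirt_bar sA sB sC sD sy sc smooth_on_const
  \<comment> \<open>Only the conjugate of the coordinate \<open>y\<close> reacts to
    \<open>wirt_bar j\<close>, and only for j = y, which is the Kronecker factor
    \<open>?\<delta> j\<close>. The coordinate itself reacts to \<open>wirt k\<close> in the next
    identity.\<close>
  have G1: "wirt_bar j (\<lambda>x. A k j x - ?y x * B k j x - ?c x * C k j x + ?y x * (?c x * D k j x)) =
     (\<lambda>x. wirt_bar j (A k j) x - ?y x * wirt_bar j (B k j) x - (?c x * wirt_bar j (C k j) x + ?\<delta> j * C k j x)
      + ?y x * (?c x * wirt_bar j (D k j) x + ?\<delta> j * D k j x))" for k j
    by (rule ext) (simp add: wm sm wirt_vec_nth)
  have smd: "smooth_on UNIV (\<lambda>x. ?\<delta> j * f x)" if "smooth_on UNIV f" for j and f :: "complex^'d \<Rightarrow> complex"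
    by (rule smooth_on_mult[OF smooth_on_const that])
  have wd: "wirt k (\<lambda>x. ?\<delta> j * f x) x = ?\<delta> j * wirt k f x" if "smooth_on UNIV f" for k j x and f :: "complex^'d \<Rightarrow> complex"
    by (rule wirt_cmult(1)[OF diff[OF that]])
  have G2: "wirt k (wirt_bar j (\<lambda>x. A k j x - ?y x * B k j x - ?c x * C k j x + ?y x * (?c x * D k j x))) x =
     wirt k (wirt_bar j (A k j)) x - ?y x * wirt k (wirt_bar j (B k j)) x - ?c x * wirt k (wirt_bar j (C k j)) x
      + ?y x * ?c x * wirt k (wirt_bar j (D k j)) x
      + ?\<delta> k * (?c x * wirt_bar j (D k j) x - wirt_bar j (B k j) x)
      + ?\<delta> j * (?y x * wirt k (D k j) x - wirt k (C k j) x)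
      + ?\<delta> k * (?\<delta> j * D k j x)" for k j
  proof -
    let ?b = "wirt_bar j"
    have "wirt k (\<lambda>x. ?b (A k j) x - ?y x * ?b (B k j) x - (?c x * ?b (C k j) x + ?\<delta> j * C k j x)
      + ?y x * (?c x * ?b (D k j) x + ?\<delta> j * D k j x)) x
      = wirt k (?b (A k j)) x - (?y x * wirt k (?b (B k j)) x + ?\<delta> k * ?b (B k j) x)
        - (?c x * wirt k (?b (C k j)) x + ?\<delta> j * wirt k (C k j) x)
        + (?y x * (?c x * wirt k (?b (D k j)) x + ?\<delta> j * wirt k (D k j) x) + ?\<delta> k * (?c x * ?b (D k j) x + ?\<delta> j * D k j x))"
      by (simp only: wm sm smd wd wirt_vec_nth) simp
    then show ?thesis unfolding G1 by (simp only:) (simp add: algebra_simps)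
  qed
  have P: "wirt_bar j (\<lambda>x. ?c x * D y j x - B y j x) x =
     (?c x * wirt_bar j (D y j) x - wirt_bar j (B y j) x) + ?\<delta> j * D y j x" for j
    by (simp only: wm sm wirt_vec_nth) simp
  have Q: "wirt k (\<lambda>x. ?y x * D k y x - C k y x) x =
     (?y x * wirt k (D k y) x - wirt k (C k y) x) + ?\<delta> k * D k y x" for k
    by (simp only: wm sm wirt_vec_nth) simp
  have dl: "(\<Sum>k\<in>UNIV. ?\<delta> k * f k) = f y" for f :: "'d \<Rightarrow> complex"
    by (simp add: if_distrib[of "\<lambda>x. x * _"] sum.delta cong: if_cong)
  have split: "(\<Sum>k\<in>UNIV. \<Sum>j\<in>UNIV. a k j - u * b k j - v * c k j + u * v * d k j
      + ?\<delta> k * p k j + ?\<delta> j * q k j + ?\<delta> k * (?\<delta> j * r k j)) =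
    (\<Sum>k\<in>UNIV. \<Sum>j\<in>UNIV. a k j) - u * (\<Sum>k\<in>UNIV. \<Sum>j\<in>UNIV. b k j) - v * (\<Sum>k\<in>UNIV. \<Sum>j\<in>UNIV. c k j)
    + u * v * (\<Sum>k\<in>UNIV. \<Sum>j\<in>UNIV. d k j) + (\<Sum>k\<in>UNIV. ?\<delta> k * (\<Sum>j\<in>UNIV. p k j))
    + (\<Sum>k\<in>UNIV. \<Sum>j\<in>UNIV. ?\<delta> j * q k j) + (\<Sum>k\<in>UNIV. ?\<delta> k * (\<Sum>j\<in>UNIV. ?\<delta> j * r k j))"
    for a b c d p q r :: "'d \<Rightarrow> 'd \<Rightarrow> complex" and u v :: complex
    by (simp only: sum.distrib sum_subtractf sum_distrib_left)
  have "(\<Sum>k\<in>UNIV. \<Sum>j\<in>UNIV. wirt k (wirt_bar j (\<lambda>x. A k j x - ?y x * B k j x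
        - ?c x * C k j x + ?y x * (?c x * D k j x))) x)
     = (\<Sum>k\<in>UNIV. \<Sum>j\<in>UNIV. wirt k (wirt_bar j (A k j)) x)
       - ?y x * (\<Sum>k\<in>UNIV. \<Sum>j\<in>UNIV. wirt k (wirt_bar j (B k j)) x)
       - ?c x * (\<Sum>k\<in>UNIV. \<Sum>j\<in>UNIV. wirt k (wirt_bar j (C k j)) x)
       + ?y x * ?c x * (\<Sum>k\<in>UNIV. \<Sum>j\<in>UNIV. wirt k (wirt_bar j (D k j)) x)
       + (\<Sum>k\<in>UNIV. ?\<delta> k * (\<Sum>j\<in>UNIV. ?c x * wirt_bar j (D k j) x - wirt_bar j (B k j) x))
       + (\<Sum>k\<in>UNIV. \<Sum>j\<in>UNIV. ?\<delta> j * (?y x * wirt k (D k j) x - wirt k (C k j) x))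
       + (\<Sum>k\<in>UNIV. ?\<delta> k * (\<Sum>j\<in>UNIV. ?\<delta> j * D k j x))"
    unfolding G2 by (rule split)
  also have "\<dots> = (\<Sum>j\<in>UNIV. ?c x * wirt_bar j (D y j) x - wirt_bar j (B y j) x)
       + (\<Sum>k\<in>UNIV. ?y x * wirt k (D k y) x - wirt k (C k y) x) + D y y x"
    unfolding zA zB zC zD dl by simp
  moreover have "(\<Sum>j\<in>UNIV. wirt_bar j (\<lambda>x. ?c x * D y j x - B y j x) x)
     = (\<Sum>j\<in>UNIV. ?c x * wirt_bar j (D y j) x - wirt_bar j (B y j) x) + D y y x"
    unfolding P sum.distrib dl ..
  moreover have "(\<Sum>k\<in>UNIV. wirt k (\<lambda>x. ?y x * D k y x - C k y x) x)
     = (\<Sum>k\<in>UNIV. ?y x * wirt k (D k y) x - wirt k (C k y) x) + D y y x"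
    unfolding Q sum.distrib dl ..
  \<comment> \<open>The double sum reduces to the two sums of first-order terms plus one copy of
    \<open>D y y\<close>, and each single sum consists of one of these plus another copy: 1 + 1 - 1
    = 1.\<close>
  ultimately show ?thesis by (simp only:) simp
qed

section \<open>Integration by parts on the manifold\<close>

context br_chart
begin

text \<open>The indices of the coordinates \<open>y\<^sub>1\<close>, \<open>z\<^sub>1\<close> and \<open>w\<^sub>1\<close>.\<close>

definition iy :: 'd where "iy = ix n"
definition iz :: 'd where "iz = ix (2 * n)"
definition iw :: 'd where "iw = ix (3 * n - 1)"

lemma special_indices: "iy \<in> base_idx" "iz \<in> base_idx" "iw \<notin> base_idx" "iy \<noteq> iz"
proof -
  have "jx iy = n" "jx iz = 2 * n" "jx iw = 3 * n - 1"
    unfolding iy_def iz_def iw_def using n2 by (auto intro!: jx_ix)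
  then show "iy \<in> base_idx" "iz \<in> base_idx" "iw \<notin> base_idx" "iy \<noteq> iz"
    using n2 by (auto simp: base_idx_def)
qed

lemma lin_part_iw: "vec_nth (lin_part c v) iw = vec_nth v iw + cnj (vec_nth c iy) * vec_nth v iz"
proof -
  have "n - 1 + 1 = n" "2 * n - 1 + 1 = 2 * n" using n2 by auto
  then show ?thesis
    using shear_w1[of c v] unfolding lin_part_def iw_def iy_def iz_def br_y_def br_z_def by simp
qed

lemma left_mult_base: "k \<in> base_idx \<Longrightarrow> vec_nth (left_mult c x) k = vec_nth c k + vec_nth x k"
  by (simp add: left_mult_def lin_part_base)

text \<open>The invariant form \<phi>^(3n-1) at the point \<open>x\<close>; \<open>phi_w_bar\<close>
  is its conjugate.\<close>

definition phi_w :: "complex^'d \<Rightarrow> complex^'d \<Rightarrow> complex" where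
  "phi_w x v = dz iw v + (- cnj (vec_nth x iy)) * dz iz v"

definition phi_w_bar :: "complex^'d \<Rightarrow> complex^'d \<Rightarrow> complex" where
  "phi_w_bar x v = dzbar iw v + (- vec_nth x iy) * dzbar iz v"

lemma linear_phi_w: "linear (phi_w x)" "linear (phi_w_bar x)"
  by (auto simp: linear_iff phi_w_def phi_w_bar_def dz_def dzbar_def algebra_simps scaleR_complex)

lemma covec_lin_part:
  "k \<in> base_idx \<Longrightarrow> dz k \<circ> lin_part c = dz k" "k \<in> base_idx \<Longrightarrow> dzbar k \<circ> lin_part c = dzbar k"
  "phi_w (left_mult c x) \<circ> lin_part c = phi_w x" "phi_w_bar (left_mult c x) \<circ> lin_part c = phi_w_bar x"
  by (auto simp: fun_eq_iff dz_def dzbar_def lin_part_base phi_w_def phi_w_bar_def lin_part_iw left_mult_base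
      special_indices algebra_simps)

text \<open>All five factors are pulled back by \<open>lin_part c\<close>, and
  \<open>top_form_invariant\<close> removes the effect on \<open>frame\<close>. The covectors at the
  two points are allowed to differ, as those of \<phi> do.\<close>

lemma covec_wedge4_invariant:
  assumes inv: "\<And>vs. \<Psi> (left_mult c x) (map (lin_part c) vs) = \<Psi> x vs" and e: "ext_form (\<Psi> (left_mult c x))"
    and l: "linear a'" "linear b'" "linear u'" "linear v'"
    and T: "a' \<circ> lin_part c = a" "b' \<circ> lin_part c = b" "u' \<circ> lin_part c = u" "v' \<circ> lin_part c = v"
  shows "covec_wedge a' (covec_wedge b' (covec_wedge u' (covec_wedge v' (\<Psi> (left_mult c x))))) frame =
    covec_wedge a (covec_wedge b (covec_wedge u (covec_wedge v (\<Psi> x)))) frame"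
proof -
  let ?t = "covec_wedge a' (covec_wedge b' (covec_wedge u' (covec_wedge v' (\<Psi> (left_mult c x)))))"
  have i: "(\<lambda>ws. \<Psi> (left_mult c x) (map (lin_part c) ws)) = \<Psi> x" using inv by (rule ext)
  have "?t frame = ?t (map (lin_part c) frame)"
    by (rule top_form_invariant[symmetric]) (intro ext_form_covec_wedge l e)
  also have "\<dots> = covec_wedge a (covec_wedge b (covec_wedge u (covec_wedge v (\<Psi> x)))) frame"
    unfolding covec_wedge_map T i ..
  finally show ?thesis .
qed

text \<open>The function \<open>f\<close> is the coefficient of \<theta> wedged with \<Psi>.
  Integration by parts of \<phi> and its conjugate against the vanishing second derivative of \<Psi>
  makes it a null function, while an invariant continuous function without zeros keeps one sign and
  stays away from zero.\<close>

theorem obstruction: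
  fixes \<Psi> :: "(complex^'d) form_field" and f :: "complex^'d \<Rightarrow> real"
  assumes s: "smooth_form \<Psi>" and t: "\<And>x. pq_type p q (\<Psi> x)" and pq: "p \<le> CARD('d)" "Suc q \<le> CARD('d)"
    and inv: "\<And>c x vs. left_mult c \<in> br_deck n ix \<Longrightarrow> \<Psi> (left_mult c x) (map (lin_part c) vs) = \<Psi> x vs"
    and dd: "dolbeault (\<lambda>_. mult_i) (dolbeault_bar (\<lambda>_. mult_i) \<Psi>) = 0"
    and f: "\<And>x. complex_of_real (f x) =
      covec_wedge (dz iz) (covec_wedge (dzbar iz) (covec_wedge (dz iy) (covec_wedge (dzbar iy) (\<Psi> x)))) frame"
    and f0: "\<And>x. f x \<noteq> 0"
  shows False
proof -
  define F where "F a b k j x =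
    covec_wedge a (covec_wedge b (covec_wedge (dz k) (covec_wedge (dzbar j) (\<Psi> x)))) frame" for a b k j x
  have sF: "smooth_on UNIV (F a b k j)" if "linear a" "linear b" for a b k j
    unfolding F_def[abs_def] by (intro smooth_formD(2) smooth_form_covec_wedge that linear_dz linear_dzbar s)
  \<comment> \<open>The vanishing second derivative of \<Psi>, wedged with two constant covectors,
    which commute with all derivatives.\<close>
  have zF: "(\<Sum>k\<in>UNIV. \<Sum>j\<in>UNIV. wirt k (wirt_bar j (F a b k j)) x) = 0" if l: "linear a" "linear b" for a b x
  proof -
    have 1: "wirt_bar j (F a b k j) = (\<lambda>x. covec_wedge a (covec_wedge b (covec_wedge (dz k)
        (covec_wedge (dzbar j) (form_wirt_bar j \<Psi> x)))) frame)" for k j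
      unfolding F_def[abs_def] by (rule ext) (rule wirt_covec_wedge4(2)[OF s l linear_dz linear_dzbar])
    have "(\<Sum>k\<in>UNIV. \<Sum>j\<in>UNIV. wirt k (wirt_bar j (F a b k j)) x)
      = covec_wedge a (covec_wedge b (\<Sum>k\<in>UNIV. \<Sum>j\<in>UNIV. covec_wedge (dz k) (covec_wedge (dzbar j)
          (form_wirt k (form_wirt_bar j \<Psi>) x)))) frame"
      unfolding 1 wirt_covec_wedge4(1)[OF smooth_form_wirt(2)[OF s t] l linear_dz linear_dzbar]
        covec_wedge_sum sum_fun_apply ..
    also have "\<dots> = covec_wedge a (covec_wedge b 0) frame"
      unfolding dolbeault_dolbeault_bar[OF s t pq, symmetric] dd by (simp only: zero_fun_apply)
    finally show ?thesis by (simp only: covec_wedge_zero zero_fun_apply)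
  qed
  \<comment> \<open>The four pairs of constant covectors in the expansion of \<phi> wedged with its
    conjugate into dw_1, dz_1 and their conjugates.\<close>
  let ?A = "F (dz iw) (dzbar iw)" and ?B = "F (dz iw) (dzbar iz)" and ?C = "F (dz iz) (dzbar iw)" and ?D = "F (dz iz) (dzbar iz)"
  note lin = linear_dz linear_dzbar
  note sF' = sF[OF linear_dz linear_dzbar] and zF' = zF[OF linear_dz linear_dzbar]
  define P where "P j x = cnj (vec_nth x iy) * ?D iy j x - ?B iy j x" for j x
  define Q where "Q k x = vec_nth x iy * ?D k iy x - ?C k iy x" for k x
  define G where "G k j x = ?A k j x - vec_nth x iy * ?B k j x - cnj (vec_nth x iy) * ?C k j x
    + vec_nth x iy * (cnj (vec_nth x iy) * ?D k j x)" for k j x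
  have id: "?D iy iy x = (\<Sum>j\<in>UNIV. wirt_bar j (P j) x) + (\<Sum>k\<in>UNIV. wirt k (Q k) x)
      - (\<Sum>k\<in>UNIV. \<Sum>j\<in>UNIV. wirt k (wirt_bar j (G k j)) x)" for x
    unfolding P_def[abs_def] Q_def[abs_def] G_def[abs_def]
    by (rule second_order_identity[OF sF' sF' sF' sF' zF' zF' zF' zF'])
  note sm = smooth_on_mult smooth_on_add smooth_on_diff sF' smooth_on_vec_nth smooth_on_cnj_vec_nth
  have sP: "smooth_on UNIV (P j)" and sQ: "smooth_on UNIV (Q k)" and sG: "smooth_on UNIV (G k j)" for j k
    unfolding P_def[abs_def] Q_def[abs_def] G_def[abs_def] by (intro sm)+
  \<comment> \<open>\<open>P\<close>, \<open>Q\<close> and \<open>G\<close> are regrouped as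
    coefficients against the invariant covectors \<open>phi_w\<close> and \<open>phi_w_bar\<close>;
    the functions \<open>?A\<close>, \<open>?B\<close> and \<open>?C\<close> alone are in general
    not invariant.\<close>
  have P_phi: "P j x = - F (phi_w x) (dzbar iz) iy j x" for j x
    unfolding P_def F_def phi_w_def[abs_def] covec_wedge_add_left covec_wedge_scale_left
    by (simp add: form_scale_def)
  have Q_phi: "Q k x = - F (dz iz) (phi_w_bar x) k iy x" for k x
    unfolding Q_def F_def phi_w_bar_def[abs_def] covec_wedge_add_left covec_wedge_scale_left
      covec_wedge_add covec_wedge_scale by (simp add: form_scale_def)
  have G_phi: "G k j x = F (phi_w x) (phi_w_bar x) k j x" for k j x
    unfolding G_def F_def phi_w_bar_def[abs_def] phi_w_def[abs_def] covec_wedge_add_left covec_wedge_scale_left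
      covec_wedge_add covec_wedge_scale by (simp add: form_scale_def algebra_simps)
  have invF: "F a' b' k j (left_mult c x) = F a b k j x"
    if "left_mult c \<in> br_deck n ix" "k \<in> base_idx" "j \<in> base_idx" "linear a'" "linear b'"
      "a' \<circ> lin_part c = a" "b' \<circ> lin_part c = b" for a b a' b' k j c x
    unfolding F_def using that
    by (intro covec_wedge4_invariant inv smooth_formD(1)[OF s] lin covec_lin_part)
  have iP: "P j (left_mult c x) = P j x" if "left_mult c \<in> br_deck n ix" "j \<in> base_idx" for j c x
    unfolding P_phi using that special_indices
    by (subst invF[where a = "phi_w x" and b = "dzbar iz"]) (auto intro: lin linear_phi_w simp: covec_lin_part)
  have iQ: "Q k (left_mult c x) = Q k x" if "left_mult c \<in> br_deck n ix" "k \<in> base_idx" for k c x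
    unfolding Q_phi using that special_indices
    by (subst invF[where a = "dz iz" and b = "phi_w_bar x"]) (auto intro: lin linear_phi_w simp: covec_lin_part)
  have iG: "G k j (left_mult c x) = G k j x" if "left_mult c \<in> br_deck n ix" "k \<in> base_idx" "j \<in> base_idx" for k j c x
    unfolding G_phi using that
    by (subst invF[where a = "phi_w x" and b = "phi_w_bar x"]) (auto intro: linear_phi_w simp: covec_lin_part)
  have iD: "?D iy iy (left_mult c x) = ?D iy iy x" if "left_mult c \<in> br_deck n ix" for c x
    using that special_indices
    by (subst invF[where a = "dz iz" and b = "dzbar iz"]) (auto intro: lin simp: covec_lin_part)
  have per: "\<Psi> (x + axis k g) = \<Psi> x" if "k \<notin> base_idx" "g = 1 \<or> g = \<i>" for k g x
    using inv[of "axis k g" x] translation_in_deck[OF that] by (simp add: left_mult_fibre[OF that(1)] fun_eq_iff)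
  have pery: "vec_nth (x + axis k g) iy = vec_nth x iy" if "k \<notin> base_idx" for k g and x :: "complex^'d"
    using that special_indices by (auto simp: axis_def)
  have perall: "P j (x + axis k g) = P j x" "Q j (x + axis k g) = Q j x" "G i j (x + axis k g) = G i j x"
    if "k \<notin> base_idx" "g = 1 \<or> g = \<i>" for i j k g x
    unfolding P_def Q_def G_def F_def per[OF that] pery[OF that(1)] by (rule refl)+
  have subl: "sublinear_along (axis k g) h"
    if "smooth_on UNIV h" "\<And>c x. left_mult c \<in> br_deck n ix \<Longrightarrow> h (left_mult c x) = h x" for h k g
    using invariant_bounded[OF smooth_on_continuous_on[OF that(1)] that(2)] sublinear_along_bounded by metis
  \<comment> \<open>For a base index the coefficient is invariant, hence bounded. For a fibre index
    the covector of that index is not fixed by the deck group, but the translations along its axis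
    belong to the group, so the coefficient is periodic.\<close>
  have nP: "null_fun (wirt_bar j (P j))" for j
  proof (cases "j \<in> base_idx")
    case True
    then show ?thesis by (intro null_fun_wirt(2) sP subl iP)
  next
    case False
    then show ?thesis by (intro null_fun_wirt(2) sP sublinear_along_periodic perall) auto
  qed
  have nQ: "null_fun (wirt k (Q k))" for k
  proof (cases "k \<in> base_idx")
    case True
    then show ?thesis by (intro null_fun_wirt(1) sQ subl iQ)
  next
    case False
    then show ?thesis by (intro null_fun_wirt(1) sQ sublinear_along_periodic perall) auto
  qed
  have nG: "null_fun (wirt k (wirt_bar j (G k j)))" for k j
  proof (cases "j \<in> base_idx")
    case j: True
    show ?thesis
    proof (cases "k \<in> base_idx")
      case True
      then show ?thesis using j by (intro null_fun_wirt_wirt_bar sG subl iG)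
    next
      \<comment> \<open>Here \<open>G k j\<close> is controlled only along the axis of
        \<open>k\<close>. The outer derivative is therefore treated as a first derivative of
        \<open>wirt_bar j (G k j)\<close>, which has the same periods.\<close>
      case False
      then show ?thesis
        by (intro null_fun_wirt(1) smooth_on_wirt_bar sG sublinear_along_periodic wirt_bar_periodic perall) auto
    qed
  next
    case False
    then show ?thesis by (intro null_fun_wirt_wirt_bar sG sublinear_along_periodic perall) auto
  qed
  have nD: "null_fun (?D iy iy)"
    unfolding id[abs_def] by (intro null_fun_add null_fun_diff null_fun_sum nP nQ nG)
  have fD: "?D iy iy x = of_real (f x)" for x unfolding F_def f ..
  have cf: "continuous_on UNIV f"
  proof -
    have "continuous_on UNIV (\<lambda>x. Re (?D iy iy x))"
      by (intro continuous_intros smooth_on_continuous_on sF')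
    then show ?thesis by (simp add: fD)
  qed
  have fi: "f (left_mult c x) = f x" if "left_mult c \<in> br_deck n ix" for c x
    using iD[OF that, of x] by (simp add: fD)
  \<comment> \<open>A continuous function without zeros on a connected space has constant sign;
    \<open>\<sigma>\<close> normalises it, and compactness of the quotient then gives a positive
    lower bound.\<close>
  have "(\<forall>x. f x > 0) \<or> (\<forall>x. f x < 0)"
  proof (rule ccontr)
    assume "\<not> ?thesis"
    then obtain a b where ab: "f a < 0" "f b > 0" using f0 by (meson linorder_neqE_linordered_idom)
    have "connected (range f)" by (intro connected_continuous_image cf connected_UNIV)
    then have "{f a..f b} \<subseteq> range f" by (intro connected_contains_Icc) auto
    moreover have "0 \<in> {f a..f b}" using ab by simp
    ultimately show False using f0 by (metis imageE subsetD)
  qed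
  then obtain \<sigma> :: real where \<sigma>: "\<And>x. \<sigma> * f x > 0"
    by (metis mult_1 mult_minus1 neg_0_less_iff_less)
  obtain \<epsilon> where e: "\<epsilon> > 0" "\<And>x. \<sigma> * f x \<ge> \<epsilon>"
    using invariant_bounded_below[of "\<lambda>x. \<sigma> * f x"] \<sigma> fi cf
    by (metis (mono_tags, lifting) continuous_on_mult_left)
  have "null_fun (\<lambda>x. of_real \<sigma> * ?D iy iy x)" by (rule null_fun_cmult[OF nD])
  from null_fun_not_Re_ge[OF this e(1)] obtain x where "Re (of_real \<sigma> * ?D iy iy x) < \<epsilon>" by blast
  then show False using e(2)[of x] by (simp add: fD)
qed

end

section \<open>Hermitian inner products\<close>

lemma wedge_covec_wedge_right: "wedge \<alpha> (covec_wedge a \<beta>) = covec_wedge a (wedge (grade_inv \<alpha>) \<beta>)"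
proof
  fix vs
  show "wedge \<alpha> (covec_wedge a \<beta>) vs = covec_wedge a (wedge (grade_inv \<alpha>) \<beta>) vs"
  proof (induction vs arbitrary: \<alpha> \<beta>)
    case Nil
    then show ?case by (simp add: wedge_Nil)
  next
    case (Cons v vs)
    have "wedge \<alpha> (covec_wedge a \<beta>) (v # vs) = covec_wedge a (wedge (grade_inv (contract v \<alpha>)) \<beta>) vs
        + (a v * wedge (grade_inv \<alpha>) \<beta> vs - covec_wedge a (wedge (grade_inv (grade_inv \<alpha>)) (contract v \<beta>)) vs)"
    proof -
      have "wedge (grade_inv \<alpha>) (form_scale (a v) \<beta> - covec_wedge a (contract v \<beta>)) vs
        = a v * wedge (grade_inv \<alpha>) \<beta> vs - wedge (grade_inv \<alpha>) (covec_wedge a (contract v \<beta>)) vs"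
        unfolding diff_conv_add_uminus wedge_add_right wedge_uminus_right wedge_scale_right
        by (simp add: form_scale_def)
      then show ?thesis unfolding wedge_Cons contract_covec_wedge by (simp only: Cons)
    qed
    moreover have "covec_wedge a (wedge (grade_inv \<alpha>) \<beta>) (v # vs) = a v * wedge (grade_inv \<alpha>) \<beta> vs
        - (covec_wedge a (wedge (grade_inv (grade_inv \<alpha>)) (contract v \<beta>)) vs - covec_wedge a (wedge (grade_inv (contract v \<alpha>)) \<beta>) vs)"
      unfolding covec_wedge_Cons contract_wedge contract_grade_inv wedge_uminus_left covec_wedge_add covec_wedge_uminus
      by simp
    ultimately show ?case by simp
  qed
qed

lemma wedge_homogeneous_short:
  assumes "homogeneous k \<beta>" "length vs < k" shows "wedge \<alpha> \<beta> vs = 0"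
  using assms
proof (induction vs arbitrary: \<alpha> \<beta> k)
  case Nil
  then show ?case by (auto simp: wedge_Nil homogeneous_def)
next
  case (Cons v vs)
  obtain m where m: "k = Suc m" using Cons.prems(2) by (cases k) auto
  have "homogeneous m (contract v \<beta>)" using Cons.prems(1) unfolding m by (rule homogeneous_contract)
  then show ?case using Cons.IH[of m "contract v \<beta>"] Cons.IH[OF Cons.prems(1)] Cons.prems(2) m
    by (simp add: wedge_Cons)
qed

text \<open>Only the shuffle that gives every argument to \<beta> survives. This is the base case of
  the computation of the Hodge star, with the volume form as \<beta>.\<close>

lemma wedge_homogeneous_top:
  assumes "homogeneous (length vs) \<beta>" shows "wedge \<alpha> \<beta> vs = \<alpha> [] * \<beta> vs"
  using assms
proof (induction vs arbitrary: \<alpha> \<beta>)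
  case Nil
  then show ?case by (simp add: wedge_Nil)
next
  case (Cons v vs)
  have "homogeneous (length vs) (contract v \<beta>)" using Cons.prems by (simp add: homogeneous_contract)
  then show ?case using Cons.IH[of "contract v \<beta>"] wedge_homogeneous_short[OF Cons.prems, of vs]
    by (simp add: wedge_Cons) (simp add: grade_inv_def contract_def)
qed

lemma covec_wedge_cnj: "cnj (covec_wedge a \<beta> vs) = covec_wedge (\<lambda>v. cnj (a v)) (\<lambda>ws. cnj (\<beta> ws)) vs"
  by (simp add: covec_wedge_nths)

locale herm_inner =
  fixes G :: "complex^'d::finite \<Rightarrow> complex^'d \<Rightarrow> real"
  assumes bil: "bilinear G" and sym: "G u v = G v u" and pos: "u \<noteq> 0 \<Longrightarrow> G u u > 0"
    and compat: "G (mult_i u) (mult_i v) = G u v"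
begin

lemma lin_left: "linear (\<lambda>u. G u v)" and lin_right: "linear (G u)"
  using bil by (auto simp: bilinear_def)

lemmas G_add = linear_add[OF lin_left] linear_add[OF lin_right]
lemmas G_diff = linear_diff[OF lin_left] linear_diff[OF lin_right]
lemmas G_scale = linear_scale[OF lin_left] linear_scale[OF lin_right]
lemmas G_neg = linear_neg[OF lin_left] linear_neg[OF lin_right]
lemmas G_zero = linear_0[OF lin_left] linear_0[OF lin_right]
lemmas G_sum = linear_sum[OF lin_left] linear_sum[OF lin_right]

lemma mult_i_mult_i: "mult_i (mult_i u) = - u" for u :: "complex^'d"
  by (simp add: cvec_eq_iff)

lemma G_mult_i_right: "G u (mult_i v) = - G (mult_i u) v"
  using compat[of u "mult_i v"] compat[of "mult_i u" "mult_i (mult_i v)"]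
  by (simp add: mult_i_mult_i G_neg)

lemma G_mult_i_self: "G (mult_i u) u = 0"
  using G_mult_i_right[of u u] sym[of u "mult_i u"] by simp

lemma G_scalar: "cmod \<zeta> = 1 \<Longrightarrow> G (\<zeta> *s u) (\<zeta> *s v) = G u v"
proof -
  assume z: "cmod \<zeta> = 1"
  have "(Re \<zeta>)\<^sup>2 + (Im \<zeta>)\<^sup>2 = 1" using z by (simp add: cmod_def)
  moreover have "G (\<zeta> *s u) (\<zeta> *s v) = ((Re \<zeta>)\<^sup>2 + (Im \<zeta>)\<^sup>2) * G u v"
    unfolding vector_scalar_split[of \<zeta> u] vector_scalar_split[of \<zeta> v]
    by (simp only: G_add G_scale compat) (simp add: G_mult_i_right power2_eq_square algebra_simps)
  ultimately show ?thesis by simp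
qed

abbreviation omega :: "(complex^'d) ext_form" where
  "omega \<equiv> fundamental_form mult_i G"

definition dual_i :: "complex^'d \<Rightarrow> complex^'d \<Rightarrow> complex" where
  "dual_i v w = of_real (G (mult_i v) w)"

lemma linear_dual_i: "linear (dual_i v)"
  by (auto simp: linear_iff dual_i_def G_add G_scale scaleR_complex)

lemma linear_mult_i: "linear (mult_i :: complex^'d \<Rightarrow> complex^'d)"
  by (rule linear_vector_scalar)

lemma omega_simps: "omega [u, v] = dual_i u v" "length vs \<noteq> 2 \<Longrightarrow> omega vs = 0"
  by (auto simp: fundamental_form_def dual_i_def split: list.splits)

lemma contract_omega: "contract v omega = one_form (dual_i v)"
proof
  fix vs show "contract v omega vs = one_form (dual_i v) vs"
    by (cases vs; cases "tl vs") (auto simp: contract_def one_form_def fundamental_form_def dual_i_def split: list.splits)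
qed

lemma grade_inv_omega: "grade_inv omega = omega"
  by (auto simp: grade_inv_def fundamental_form_def split: list.splits)

lemma ext_form_omega: "ext_form omega"
proof -
  have o: "omega (us @ v # ws) = (case (us, ws) of ([], [w]) \<Rightarrow> dual_i v w | ([u], []) \<Rightarrow> dual_i u v | _ \<Rightarrow> 0)" for us v ws
    by (cases us; cases "tl us"; cases ws; cases "tl ws")
      (auto simp: fundamental_form_def dual_i_def split: list.splits)
  have l: "linear (\<lambda>v. dual_i v w)" for w
    using linear_compose[OF linear_mult_i lin_left[of w]]
    by (auto simp: linear_iff dual_i_def scaleR_complex)
  have z: "linear (\<lambda>v::complex^'d. 0 :: complex)" by (auto simp: linear_iff)
  have "linear (\<lambda>v. omega (us @ v # ws))" for us ws
    unfolding o by (cases us; cases "tl us"; cases ws; cases "tl ws") (use l linear_dual_i z in auto)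
  moreover have "omega (us @ v # v # ws) = 0" for us v ws
    by (cases us; cases ws) (auto simp: fundamental_form_def G_mult_i_self split: list.splits)
  ultimately show ?thesis unfolding adjacent_alt_iff_ext_form[symmetric] adjacent_alt_def by blast
qed

lemma wedge_power_0: "wedge_power \<alpha> 0 = unit_form"
  and wedge_power_Suc: "wedge_power \<alpha> (Suc k) = wedge \<alpha> (wedge_power \<alpha> k)"
  by (simp_all add: wedge_power_def wedge_list_def)

text \<open>Contraction acts on the powers of the even form \<omega> as a derivation. All values of
  these powers are computed through this recursion.\<close>

lemma contract_omega_power:
  "contract v (wedge_power omega (Suc k)) = form_scale (of_nat (Suc k)) (covec_wedge (dual_i v) (wedge_power omega k))"
proof (induction k)
  case 0
  have "contract v (wedge_power omega (Suc 0)) = one_form (dual_i v)"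
    by (simp add: wedge_power_Suc wedge_power_0 contract_omega)
  then show ?case by (simp add: wedge_power_0 covec_wedge_def form_scale_def)
next
  case (Suc k)
  have "contract v (wedge_power omega (Suc (Suc k))) =
    covec_wedge (dual_i v) (wedge_power omega (Suc k)) + wedge omega (contract v (wedge_power omega (Suc k)))"
    by (subst wedge_power_Suc) (simp only: contract_wedge contract_omega grade_inv_omega covec_wedge_def)
  also have "wedge omega (contract v (wedge_power omega (Suc k))) =
    form_scale (of_nat (Suc k)) (covec_wedge (dual_i v) (wedge omega (wedge_power omega k)))"
    by (simp only: Suc wedge_scale_right wedge_covec_wedge_right grade_inv_omega)
  also have "wedge omega (wedge_power omega k) = wedge_power omega (Suc k)" by (rule wedge_power_Suc[symmetric])
  finally show ?case by (simp add: form_scale_def fun_eq_iff algebra_simps)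
qed

lemma ext_form_omega_power: "ext_form (wedge_power omega k)"
  by (induction k) (simp_all add: wedge_power_0 wedge_power_Suc ext_form_unit_form ext_form_wedge ext_form_omega)

lemma homogeneous_omega_power: "homogeneous (2 * k) (wedge_power omega k)"
proof (induction k)
  case 0
  then show ?case by (simp add: wedge_power_0 homogeneous_unit_form)
next
  case (Suc k)
  show ?case unfolding homogeneous_def
  proof (intro allI impI)
    fix vs :: "(complex^'d) list" assume l: "length vs \<noteq> 2 * Suc k"
    show "wedge_power omega (Suc k) vs = 0"
    proof (cases vs)
      case Nil
      then show ?thesis by (simp add: wedge_power_Suc wedge_Nil omega_simps)
    next
      case (Cons v ws)
      have "homogeneous (Suc (2 * k)) (covec_wedge (dual_i v) (wedge_power omega k))"
        by (rule homogeneous_covec_wedge[OF Suc])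
      then have "covec_wedge (dual_i v) (wedge_power omega k) ws = 0" using l Cons by (auto simp: homogeneous_def)
      then show ?thesis using fun_cong[OF contract_omega_power[of v k], of ws] Cons
        by (simp add: contract_def form_scale_def)
    qed
  qed
qed

lemma omega_power_scalar: "cmod \<zeta> = 1 \<Longrightarrow> wedge_power omega k (map ((*s) \<zeta>) vs) = wedge_power omega k vs"
proof (induction k arbitrary: vs)
  case 0
  then show ?case by (simp add: wedge_power_0 unit_form_def)
next
  case (Suc k)
  have "(\<i> * \<zeta>) *s u = \<zeta> *s mult_i u" for u :: "complex^'d" by (simp add: cvec_eq_iff)
  then have "G ((\<i> * \<zeta>) *s u) (\<zeta> *s v) = G (mult_i u) v" for u v
    by (simp only: G_scalar[OF Suc.prems])
  then have "omega (map ((*s) \<zeta>) ws) = omega ws" for ws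
    by (cases ws; cases "tl ws"; cases "tl (tl ws)") (auto simp: fundamental_form_def)
  then have "(\<lambda>ws. omega (map ((*s) \<zeta>) ws)) = omega" by blast
  then show ?case using Suc by (simp add: wedge_power_Suc wedge_map)
qed

lemma pq_type_omega_power: "pq_type k k (wedge_power omega k)"
proof -
  have "\<zeta> ^ k * cnj \<zeta> ^ k = 1" if "cmod \<zeta> = 1" for \<zeta>
    using that by (simp add: complex_mult_cnj cmod_def flip: power_mult_distrib)
  then show ?thesis using omega_power_scalar homogeneous_omega_power[of k] ext_form_omega_power
    by (auto simp: pq_type_def mult_2)
qed

lemma omega_power_cnj: "cnj (wedge_power omega k vs) = wedge_power omega k vs"
proof (induction k arbitrary: vs)
  case 0
  then show ?case by (simp add: wedge_power_0 unit_form_def)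
next
  case (Suc k)
  show ?case
  proof (cases vs)
    case Nil
    then show ?thesis by (simp add: wedge_power_Suc wedge_Nil omega_simps)
  next
    case (Cons v ws)
    have "cnj (covec_wedge (dual_i v) (wedge_power omega k) ws) = covec_wedge (dual_i v) (wedge_power omega k) ws"
      unfolding covec_wedge_cnj Suc by (simp add: dual_i_def[abs_def])
    then show ?thesis using fun_cong[OF contract_omega_power[of v k], of ws] Cons
      by (simp add: contract_def form_scale_def)
  qed
qed

text \<open>Orthogonality for the Hermitian inner product: both \<open>u\<close> and
  \<open>mult_i u\<close> are orthogonal to the later vectors. The vectors are not normalised, so
  smooth families arise without square roots.\<close>

definition unitary_list :: "(complex^'d) list \<Rightarrow> bool" where
  "unitary_list us \<longleftrightarrow> (\<forall>u\<in>set us. u \<noteq> 0) \<and> sorted_wrt (\<lambda>u w. G u w = 0 \<and> G (mult_i u) w = 0) us"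

abbreviation realify :: "(complex^'d) list \<Rightarrow> (complex^'d) list" where
  "realify us \<equiv> concat (map (\<lambda>u. [u, mult_i u]) us)"

text \<open>The covector obtained by contracting \<omega> with \<open>u\<close> pairs only with
  \<open>mult_i u\<close>, as the rest of the list is orthogonal to both. This leaves
  \<open>G u u\<close>, and the factors of \<open>contract_omega_power\<close> build the
  factorial.\<close>

lemma omega_power_unitary:
  "unitary_list us \<Longrightarrow> wedge_power omega (length us) (realify us) = fact (length us) * (\<Prod>u\<leftarrow>us. of_real (G u u))"
proof (induction us)
  case Nil
  then show ?case by (simp add: wedge_power_0 unit_form_def)
next
  case (Cons u us)
  have u: "unitary_list us" and o: "G u w = 0" "G (mult_i u) w = 0" if "w \<in> set us" for w
    using Cons.prems that by (auto simp: unitary_list_def)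
  have us: "unitary_list us" using Cons.prems by (auto simp: unitary_list_def)
  have z: "covec_wedge (dual_i u) (contract (mult_i u) (wedge_power omega (length us))) (realify us) = 0"
    by (rule covec_wedge_vanish) (auto simp: dual_i_def compat o)
  have "wedge_power omega (Suc (length us)) (u # mult_i u # realify us) =
    of_nat (Suc (length us)) * covec_wedge (dual_i u) (wedge_power omega (length us)) (mult_i u # realify us)"
    using fun_cong[OF contract_omega_power[of u "length us"], of "mult_i u # realify us"]
    by (simp add: contract_def form_scale_def)
  also have "\<dots> = of_nat (Suc (length us)) * (of_real (G u u) * wedge_power omega (length us) (realify us))"
    unfolding covec_wedge_Cons z by (simp add: dual_i_def compat)
  finally show ?case unfolding Cons.IH[OF us] by (simp add: algebra_simps)
qed

lemma omega_power_unitary_nonzero: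
  assumes "unitary_list us" shows "wedge_power omega (length us) (realify us) \<noteq> 0"
proof -
  have "of_real (G u u) \<noteq> (0::complex)" if "u \<in> set us" for u
    using assms that pos[of u] by (auto simp: unitary_list_def)
  then have "(\<Prod>u\<leftarrow>us. of_real (G u u) :: complex) \<noteq> 0"
    by (induction us) auto
  then show ?thesis unfolding omega_power_unitary[OF assms] by simp
qed

definition orthogonal_list :: "(complex^'d) list \<Rightarrow> bool" where
  "orthogonal_list es \<longleftrightarrow> (\<forall>u\<in>set es. u \<noteq> 0) \<and> sorted_wrt (\<lambda>u w. G u w = 0) es"

lemma mult_i_eq_0: "mult_i u = 0 \<longleftrightarrow> u = 0" for u :: "complex^'d"
  by (auto simp: cvec_eq_iff)

lemma orthogonal_realify: "unitary_list us \<Longrightarrow> orthogonal_list (realify us)"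
proof (induction us)
  case Nil
  then show ?case by (simp add: orthogonal_list_def)
next
  case (Cons u us)
  then have o: "orthogonal_list (realify us)" by (auto simp: unitary_list_def)
  have u: "u \<noteq> 0" and z: "\<And>w. w \<in> set us \<Longrightarrow> G u w = 0" "\<And>w. w \<in> set us \<Longrightarrow> G (mult_i u) w = 0"
    using Cons.prems by (auto simp: unitary_list_def)
  have z': "G u (mult_i w) = 0" if "w \<in> set us" for w using z(2)[OF that] by (simp add: G_mult_i_right)
  have "G u (mult_i u) = 0" by (simp add: G_mult_i_right G_mult_i_self)
  then show ?case using o u z z' by (auto simp: orthogonal_list_def mult_i_eq_0 compat)
qed

lemma orthogonal_independent: "orthogonal_list es \<Longrightarrow> independent (set es) \<and> distinct es"
proof (induction es)
  case Nil
  then show ?case by (simp add: independent_empty)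
next
  case (Cons e es)
  then have es: "independent (set es)" "distinct es" by (auto simp: orthogonal_list_def)
  have "G e w = 0" if "w \<in> span (set es)" for w
    using that
  proof (induction rule: span_induct_alt)
    case base
    then show ?case by (rule G_zero)
  next
    case (step c x y)
    then show ?case using Cons.prems by (auto simp: orthogonal_list_def G_add G_scale)
  qed
  moreover have "G e e > 0" using Cons.prems pos by (auto simp: orthogonal_list_def)
  ultimately have ne: "e \<notin> span (set es)" by force
  then have "e \<notin> set es" using span_base by blast
  then show ?case using es ne by (simp add: independent_insertI)
qed

lemma orthogonal_span:
  assumes "orthogonal_list es" "length es = DIM(complex^'d)" shows "span (set es) = UNIV"
proof -
  have "card (set es) = DIM(complex^'d)"
    using orthogonal_independent[OF assms(1)] assms(2) by (simp only: distinct_card)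
  then have "UNIV \<subseteq> span (set es)"
    using orthogonal_independent[OF assms(1)]
    by (intro card_ge_dim_independent) (auto simp del: DIM_cart)
  then show ?thesis by blast
qed

lemma orthonormal_frameD:
  assumes "orthonormal_frame G es"
  shows "length es = DIM(complex^'d)"
    "i < length es \<Longrightarrow> j < length es \<Longrightarrow> G (es ! i) (es ! j) = (if i = j then 1 else 0)"
  using assms unfolding orthonormal_frame_def by (simp_all only:)

lemma orthonormal_orthogonal:
  assumes "orthonormal_frame G es" shows "orthogonal_list es"
  unfolding orthogonal_list_def sorted_wrt_iff_nth_less
proof (intro conjI ballI allI impI)
  note f = orthonormal_frameD(2)[OF assms]
  show "u \<noteq> 0" if u: "u \<in> set es" for u
  proof
    assume "u = 0"
    then have "G u u = 0" by (simp only: G_zero)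
    moreover obtain i where "i < length es" "u = es ! i" using u unfolding in_set_conv_nth by blast
    ultimately show False using f[of i i] by simp
  qed
  show "G (es ! i) (es ! j) = 0" if "i < j" "j < length es" for i j
    using f[of i j] that by simp
qed

lemma orthonormal_frame_exists:
  assumes "orthogonal_list es" "length es = DIM(complex^'d)" shows "\<exists>es'. orthonormal_frame G es'"
proof -
  define nm where "nm u = (1 / sqrt (G u u)) *\<^sub>R u" for u
  have "G (nm (es ! i)) (nm (es ! j)) = (if i = j then 1 else 0)" if "i < length es" "j < length es" for i j
  proof (cases "i = j")
    case True
    have "G (es ! i) (es ! i) > 0" using assms(1) that by (intro pos) (auto simp: orthogonal_list_def)
    moreover have "G (nm (es ! i)) (nm (es ! i)) = G (es ! i) (es ! i) / (sqrt (G (es ! i) (es ! i)) * sqrt (G (es ! i) (es ! i)))"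
      by (simp add: nm_def G_scale)
    ultimately show ?thesis using True by simp
  next
    case False
    have o: "G (es ! i) (es ! j) = 0" if "i < j" "j < length es" for i j
      using assms(1) that by (simp add: orthogonal_list_def sorted_wrt_iff_nth_less)
    have "G (es ! i) (es ! j) = 0"
      using o[of i j] o[of j i] that False sym[of "es ! i" "es ! j"] by (cases "i < j") auto
    then show ?thesis using False by (simp add: nm_def G_scale)
  qed
  then have "orthonormal_frame G (map nm es)"
    unfolding orthonormal_frame_def using assms(2) by simp
  then show ?thesis by blast
qed

lemma riesz_unique:
  assumes "span (set es) = UNIV" "\<And>e. e \<in> set es \<Longrightarrow> G u e = G w e" shows "u = w"
proof -
  have "G (u - w) v = 0" for v
  proof -
    have "v \<in> span (set es)" using assms(1) by simp
    then show ?thesis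
    proof (induction rule: span_induct_alt)
      case base
      then show ?case by (rule G_zero)
    next
      case (step c x y)
      then show ?case using assms(2) by (auto simp: G_add G_scale G_diff)
    qed
  qed
  then have "\<not> G (u - w) (u - w) > 0" by simp
  then have "u - w = 0" using pos[of "u - w"] by blast
  then show ?thesis by simp
qed

end

section \<open>Hermitian metrics and the Hodge star\<close>

lemma bounded_linear_mult_i: "bounded_linear (mult_i :: complex^'d::finite \<Rightarrow> complex^'d)"
  using linear_vector_scalar[of \<i>] by (simp add: linear_conv_bounded_linear)

lemma smooth_form_wedge:
  assumes "smooth_form \<Phi>" "smooth_form \<Psi>" shows "smooth_form (\<lambda>x. wedge (\<Phi> x) (\<Psi> x))"
  unfolding smooth_form_on_def
proof (intro conjI ballI allI)
  show "ext_form (wedge (\<Phi> x) (\<Psi> x))" for x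
    by (rule ext_form_wedge[OF smooth_formD(1)[OF assms(1)] smooth_formD(1)[OF assms(2)]])
  show "smooth_on UNIV (\<lambda>x. wedge (\<Phi> x) (\<Psi> x) vs)" for vs
    unfolding wedge_def
    by (intro smooth_on_sum smooth_on_mult smooth_on_const smooth_formD(2)[OF assms(1)] smooth_formD(2)[OF assms(2)])
qed

lemma smooth_form_contract:
  fixes \<Psi> :: "'a::euclidean_space form_field"
  assumes "smooth_on UNIV u" "smooth_form \<Psi>" shows "smooth_form (\<lambda>x. contract (u x) (\<Psi> x))"
  unfolding smooth_form_on_def
proof (intro conjI ballI allI)
  show "ext_form (contract (u x) (\<Psi> x))" for x by (rule ext_form_contract[OF smooth_formD(1)[OF assms(2)]])
  fix vs
  have "contract (u x) (\<Psi> x) vs = (\<Sum>b\<in>Basis. of_real (inner (u x) b) * \<Psi> x (b # vs))" for x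
  proof -
    note l = ext_form_linear_head[OF smooth_formD(1)[OF assms(2)], of x vs]
    have "\<Psi> x (u x # vs) = \<Psi> x ((\<Sum>b\<in>Basis. inner (u x) b *\<^sub>R b) # vs)" by (simp only: euclidean_representation)
    also have "\<dots> = (\<Sum>b\<in>Basis. of_real (inner (u x) b) * \<Psi> x (b # vs))"
      by (simp add: linear_sum[OF l] linear_scale[OF l] scaleR_complex)
    finally show ?thesis by (simp add: contract_def)
  qed
  then show "smooth_on UNIV (\<lambda>x. contract (u x) (\<Psi> x) vs)"
    by (simp only:) (intro smooth_on_sum smooth_on_mult smooth_on_of_real smooth_formD(2)[OF assms(2)]
      smooth_on_linear[OF bounded_linear_inner_left assms(1)])
qed

lemma smooth_form_add: "smooth_form \<Phi> \<Longrightarrow> smooth_form \<Psi> \<Longrightarrow> smooth_form (\<lambda>x. \<Phi> x + \<Psi> x)"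
  unfolding smooth_form_on_def by (auto intro!: ext_form_add smooth_on_add)

lemma smooth_form_scale: "smooth_form \<Psi> \<Longrightarrow> smooth_form (\<lambda>x. form_scale c (\<Psi> x))"
  unfolding smooth_form_on_def
  by (auto intro!: ext_form_scale) (auto simp: form_scale_def intro!: smooth_on_mult smooth_on_const)

lemma smooth_form_grade_inv: "smooth_form \<Psi> \<Longrightarrow> smooth_form (\<lambda>x. grade_inv (\<Psi> x))"
  unfolding smooth_form_on_def
  by (auto intro!: ext_form_grade_inv) (auto simp: grade_inv_def intro!: smooth_on_mult smooth_on_const)

lemma smooth_form_const: "ext_form \<alpha> \<Longrightarrow> smooth_form (\<lambda>x. \<alpha>)"
  unfolding smooth_form_on_def by (auto intro: smooth_on_const)

text \<open>The real vector \<open>u\<close> stands for the covector \<open>dz j\<close> (or \<open>dzbar j\<close> if \<open>b\<close> is false) with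
  \<open>G u v = Re (v $ j)\<close>; contracting with it is adjoint to wedging with the covector.\<close>

definition adj_contract :: "bool \<Rightarrow> complex^'d \<Rightarrow> (complex^'d) ext_form \<Rightarrow> (complex^'d) ext_form" where
  "adj_contract b u \<beta> = contract u \<beta> + form_scale (if b then - \<i> else \<i>) (contract (mult_i u) \<beta>)"

text \<open>The transpose of \<open>adj_contract\<close> for the pairing
  \<open>wedge \<psi> \<tau>\<close> in top degree. The Hodge star of a product of covectors is
  obtained by applying these operators to the volume form.\<close>

definition star_contract :: "bool \<Rightarrow> complex^'d \<Rightarrow> (complex^'d) ext_form \<Rightarrow> (complex^'d) ext_form" where
  "star_contract b u \<beta> = form_scale (- 1) (grade_inv (adj_contract b u \<beta>))"

definition covector :: "bool \<times> 'd \<Rightarrow> complex^'d \<Rightarrow> complex" where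
  "covector p = (if fst p then dz (snd p) else dzbar (snd p))"

lemma ext_form_adj_contract: "ext_form \<beta> \<Longrightarrow> ext_form (adj_contract b u \<beta>)"
  and ext_form_star_contract: "ext_form \<beta> \<Longrightarrow> ext_form (star_contract b u \<beta>)"
  unfolding star_contract_def adj_contract_def
  by (intro ext_form_add ext_form_scale ext_form_contract ext_form_grade_inv; assumption)+

lemma smooth_form_star_contract:
  fixes \<Psi> :: "(complex^'d::finite) form_field"
  assumes "smooth_on UNIV u" "smooth_form \<Psi>" shows "smooth_form (\<lambda>x. star_contract b (u x) (\<Psi> x))"
  unfolding star_contract_def adj_contract_def
  by (intro smooth_form_add smooth_form_scale smooth_form_grade_inv smooth_form_contract assms
      smooth_on_linear[OF bounded_linear_mult_i])

text \<open>With one more argument \<open>w\<close> the wedge exceeds the dimension and vanishes, so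
  the antiderivation rule moves the contraction from \<psi> to \<tau>. The real dimension is even,
  which removes the sign of the total degree.\<close>

lemma wedge_adj_contract:
  fixes \<psi> \<tau> :: "(complex^'d::finite) ext_form"
  assumes "ext_form \<psi>" "ext_form \<tau>" "length vs = DIM(complex^'d)"
  shows "wedge (adj_contract b u \<psi>) \<tau> vs = wedge \<psi> (star_contract b u \<tau>) vs"
proof -
  have ev: "even (length vs)" using assms(3) by simp
  have c: "wedge (contract w \<psi>) \<tau> vs = - wedge \<psi> (grade_inv (contract w \<tau>)) vs" for w
  proof -
    have "wedge \<psi> \<tau> (w # vs) = 0"
      by (rule ext_form_long[OF ext_form_wedge[OF assms(1,2)]]) (simp add: assms(3))
    moreover have "wedge (grade_inv \<psi>) (contract w \<tau>) vs = wedge \<psi> (grade_inv (contract w \<tau>)) vs"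
    proof -
      have "wedge (grade_inv \<psi>) (contract w \<tau>) = grade_inv (wedge \<psi> (grade_inv (contract w \<tau>)))"
        by (simp add: grade_inv_wedge)
      then show ?thesis using ev by (simp add: grade_inv_def[of "wedge _ _"])
    qed
    ultimately show ?thesis by (simp add: wedge_Cons add_eq_0_iff2)
  qed
  show ?thesis
    unfolding adj_contract_def star_contract_def wedge_add_left wedge_scale_left wedge_scale_right
      grade_inv_add grade_inv_scale wedge_add_right
    by (simp add: form_scale_def c)
qed

lemma contract_scalar:
  fixes \<beta> :: "(complex^'d::finite) ext_form"
  assumes "ext_form \<beta>"
  shows "contract (\<zeta> *s u) \<beta> vs = of_real (Re \<zeta>) * contract u \<beta> vs + of_real (Im \<zeta>) * contract (mult_i u) \<beta> vs"
  unfolding vector_scalar_split[of \<zeta>] contract_add_left[OF assms] contract_scaleR_left[OF assms]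
  by (simp add: form_scale_def)

text \<open>\<open>adj_contract\<close> is contraction with the complexified vector u - iJu of type
  (1,0), or with u + iJu of type (0,1) if \<open>b\<close> is false; it divides the weight by
  \<zeta> or by its conjugate.\<close>

lemma pq_type_adj_contract_aux:
  fixes \<beta> :: "(complex^'d::finite) ext_form"
  assumes "pq_type p q \<beta>" "cmod \<zeta> = 1"
  shows "adj_contract b u \<beta> (map ((*s) \<zeta>) vs) = \<zeta> ^ p * cnj \<zeta> ^ q * (if b then cnj \<zeta> else \<zeta>) * adj_contract b u \<beta> vs"
proof -
  have zz: "\<zeta> * cnj \<zeta> = 1" using assms(2) by (simp add: complex_mult_cnj cmod_def)
  have e: "ext_form \<beta>" by (rule pq_typeD(1)[OF assms(1)])
  have 1: "contract w \<beta> (map ((*s) \<zeta>) vs) = \<zeta> ^ p * cnj \<zeta> ^ q * contract (cnj \<zeta> *s w) \<beta> vs" for w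
  proof -
    have w: "\<zeta> *s (cnj \<zeta> *s w) = w" using zz by (simp add: vector_smult_assoc)
    have "contract w \<beta> (map ((*s) \<zeta>) vs) = \<beta> (map ((*s) \<zeta>) ((cnj \<zeta> *s w) # vs))"
      unfolding contract_def list.map w ..
    then show ?thesis using pq_typeD(3)[OF assms] by (simp only: contract_def)
  qed
  have 2: "contract (cnj \<zeta> *s mult_i u) \<beta> vs = of_real (Re \<zeta>) * contract (mult_i u) \<beta> vs + of_real (Im \<zeta>) * contract u \<beta> vs"
  proof -
    have "mult_i (mult_i u) = (- 1) *\<^sub>R u" by (simp add: cvec_eq_iff)
    then have "contract (mult_i (mult_i u)) \<beta> vs = - contract u \<beta> vs"
      using contract_scaleR_left[OF e, of "- 1" u] by (simp add: form_scale_def)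
    then show ?thesis unfolding contract_scalar[OF e, of "cnj \<zeta>"] by simp
  qed
  have c: "cnj \<zeta> = of_real (Re \<zeta>) - \<i> * of_real (Im \<zeta>)" and z: "\<zeta> = of_real (Re \<zeta>) + \<i> * of_real (Im \<zeta>)"
    by (simp_all add: complex_eq_iff)
  have "adj_contract b u \<beta> (map ((*s) \<zeta>) vs) = \<zeta> ^ p * cnj \<zeta> ^ q *
    (contract (cnj \<zeta> *s u) \<beta> vs + (if b then - \<i> else \<i>) * contract (cnj \<zeta> *s mult_i u) \<beta> vs)"
    unfolding adj_contract_def by (simp add: form_scale_def 1 algebra_simps)
  also have "contract (cnj \<zeta> *s u) \<beta> vs + (if b then - \<i> else \<i>) * contract (cnj \<zeta> *s mult_i u) \<beta> vs
    = (if b then cnj \<zeta> else \<zeta>) * adj_contract b u \<beta> vs"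
  proof -
    define A M R I where "A = contract u \<beta> vs" and "M = contract (mult_i u) \<beta> vs"
      and "R = complex_of_real (Re \<zeta>)" and "I = complex_of_real (Im \<zeta>)"
    have zc: "\<zeta> = R + \<i> * I" "cnj \<zeta> = R - \<i> * I" unfolding R_def I_def using z c by blast+
    have 3: "contract (cnj \<zeta> *s u) \<beta> vs = R * A - I * M"
      unfolding contract_scalar[OF e, of "cnj \<zeta>"] A_def M_def R_def I_def by simp
    have 4: "contract (cnj \<zeta> *s mult_i u) \<beta> vs = R * M + I * A"
      unfolding 2 A_def M_def R_def I_def ..
    have 5: "adj_contract b u \<beta> vs = A + (if b then - \<i> else \<i>) * M"
      by (simp add: adj_contract_def form_scale_def A_def M_def)
    let ?k = "if b then - \<i> else \<i>"
    have "contract (cnj \<zeta> *s u) \<beta> vs + ?k * contract (cnj \<zeta> *s mult_i u) \<beta> vs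
      = (R * A - I * M) + ?k * (R * M + I * A)" by (simp only: 3 4)
    also have "\<dots> = (if b then R - \<i> * I else R + \<i> * I) * (A + ?k * M)"
      by (cases b) (simp_all add: algebra_simps)
    also have "\<dots> = (if b then cnj \<zeta> else \<zeta>) * adj_contract b u \<beta> vs"
      by (simp only: 5 zc[symmetric])
    finally show ?thesis .
  qed
  finally show ?thesis by simp
qed

lemma pq_type_star_contract:
  fixes \<beta> :: "(complex^'d::finite) ext_form"
  shows "pq_type (Suc p) q \<beta> \<Longrightarrow> pq_type p q (star_contract True u \<beta>)"
    and "pq_type p (Suc q) \<beta> \<Longrightarrow> pq_type p q (star_contract False u \<beta>)"
proof -
  have g: "pq_type p q (star_contract b u \<beta>)"
    if t: "pq_type p' q' \<beta>" and d: "p' + q' = Suc (p + q)"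
      and s: "\<And>\<zeta>. cmod \<zeta> = 1 \<Longrightarrow> \<zeta> ^ p' * cnj \<zeta> ^ q' * (if b then cnj \<zeta> else \<zeta>) = \<zeta> ^ p * cnj \<zeta> ^ q" for p' q' b
  proof -
    have h: "homogeneous (Suc (p + q)) \<beta>" using pq_typeD(2)[OF t] d by simp
    have "homogeneous (p + q) (adj_contract b u \<beta>)"
      unfolding adj_contract_def by (intro homogeneous_add homogeneous_scale homogeneous_contract h)
    then have "homogeneous (p + q) (star_contract b u \<beta>)"
      by (auto simp: star_contract_def homogeneous_def form_scale_def grade_inv_def)
    moreover have "star_contract b u \<beta> (map ((*s) \<zeta>) vs) = \<zeta> ^ p * cnj \<zeta> ^ q * star_contract b u \<beta> vs"
      if "cmod \<zeta> = 1" for \<zeta> vs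
      unfolding star_contract_def form_scale_def grade_inv_def pq_type_adj_contract_aux[OF t that] s[OF that] by simp
    ultimately show ?thesis using ext_form_star_contract[OF pq_typeD(1)[OF t]] by (auto simp: pq_type_def)
  qed
  have zz: "\<zeta> * cnj \<zeta> = 1" if "cmod \<zeta> = 1" for \<zeta> using that by (simp add: complex_mult_cnj cmod_def)
  show "pq_type (Suc p) q \<beta> \<Longrightarrow> pq_type p q (star_contract True u \<beta>)"
    by (rule g[of "Suc p" q]) (use zz in \<open>auto simp: algebra_simps\<close>)
  show "pq_type p (Suc q) \<beta> \<Longrightarrow> pq_type p q (star_contract False u \<beta>)"
    by (rule g[of p "Suc q"]) (use zz in \<open>auto simp: algebra_simps\<close>)
qed

text \<open>The sum in \<open>form_inner\<close>, but for an arbitrary list, so that it can be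
  computed by recursion over the frame.\<close>

definition sublist_inner :: "'a list \<Rightarrow> 'a ext_form \<Rightarrow> 'a ext_form \<Rightarrow> complex" where
  "sublist_inner es \<psi> \<alpha> = (\<Sum>I\<in>Pow {..<length es}. \<psi> (nths es I) * cnj (\<alpha> (nths es I)))"

lemma sublist_inner_Nil: "sublist_inner [] \<psi> \<alpha> = \<psi> [] * cnj (\<alpha> [])"
  by (simp add: sublist_inner_def)

lemma sublist_inner_Cons:
  "sublist_inner (e # es) \<psi> \<alpha> = sublist_inner es \<psi> \<alpha> + sublist_inner es (contract e \<psi>) (contract e \<alpha>)"
proof -
  have c: "{j. Suc j \<in> insert 0 (Suc ` K)} = K" "{j. Suc j \<in> Suc ` K} = K" for K by auto
  show ?thesis
    unfolding sublist_inner_def list.size add.right_neutral add_Suc_right sum_Pow_Suc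
    by (simp add: nths_Cons c contract_def)
qed

lemma sublist_inner_linear:
  "sublist_inner es (\<psi> + \<phi>) \<alpha> = sublist_inner es \<psi> \<alpha> + sublist_inner es \<phi> \<alpha>"
  "sublist_inner es (form_scale c \<psi>) \<alpha> = c * sublist_inner es \<psi> \<alpha>"
  "sublist_inner es \<psi> (\<alpha> + \<beta>) = sublist_inner es \<psi> \<alpha> + sublist_inner es \<psi> \<beta>"
  "sublist_inner es \<psi> (form_scale c \<alpha>) = cnj c * sublist_inner es \<psi> \<alpha>"
  "sublist_inner es (- \<psi>) \<alpha> = - sublist_inner es \<psi> \<alpha>"
  "sublist_inner es \<psi> (- \<alpha>) = - sublist_inner es \<psi> \<alpha>"
  "sublist_inner es 0 \<alpha> = 0"
  by (simp_all add: sublist_inner_def form_scale_def sum.distrib algebra_simps sum_distrib_left sum_negf)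

text \<open>For an orthonormal frame this is contraction with the metric dual of \<open>a\<close>;
  it is the adjoint of \<open>covec_wedge a\<close>.\<close>

primrec frame_contract :: "('a \<Rightarrow> complex) \<Rightarrow> 'a list \<Rightarrow> 'a ext_form \<Rightarrow> 'a ext_form" where
  "frame_contract a [] \<psi> = 0"
| "frame_contract a (e # es) \<psi> = form_scale (cnj (a e)) (contract e \<psi>) + frame_contract a es \<psi>"

lemma contract_frame_contract:
  "ext_form \<psi> \<Longrightarrow> contract v (frame_contract a es \<psi>) = - frame_contract a es (contract v \<psi>)"
proof (induction es)
  case Nil
  then show ?case by (simp add: contract_def fun_eq_iff)
next
  case (Cons e es)
  have l: "contract v (frame_contract a (e # es) \<psi>) =
      form_scale (cnj (a e)) (- contract e (contract v \<psi>)) + - frame_contract a es (contract v \<psi>)"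
    by (simp only: frame_contract.simps contract_add contract_scale Cons contract_anticomm[OF Cons.prems, of v])
  have r: "frame_contract a (e # es) (contract v \<psi>) =
      form_scale (cnj (a e)) (contract e (contract v \<psi>)) + frame_contract a es (contract v \<psi>)"
    by (rule frame_contract.simps)
  show ?case unfolding l r by (simp add: form_scale_def fun_eq_iff)
qed

text \<open>Adjointness, by recursion over the list. A double contraction with the same
  \<open>e\<close> vanishes, and the anticommutation of contractions matches the minus sign in
  \<open>contract_covec_wedge\<close>.\<close>

lemma sublist_inner_covec_wedge:
  "ext_form \<psi> \<Longrightarrow> sublist_inner es \<psi> (covec_wedge a \<alpha>) = sublist_inner es (frame_contract a es \<psi>) \<alpha>"
proof (induction es arbitrary: \<psi> \<alpha>)
  case Nil
  then show ?case by (simp add: sublist_inner_Nil)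
next
  case (Cons e es)
  have "contract e (frame_contract a (e # es) \<psi>) =
      form_scale (cnj (a e)) (contract e (contract e \<psi>)) + - frame_contract a es (contract e \<psi>)"
    by (simp only: frame_contract.simps contract_add contract_scale contract_frame_contract[OF Cons.prems])
  then have "contract e (frame_contract a (e # es) \<psi>) = - frame_contract a es (contract e \<psi>)"
    unfolding contract_self[OF Cons.prems] by (simp add: form_scale_def fun_eq_iff)
  then have "sublist_inner (e # es) (frame_contract a (e # es) \<psi>) \<alpha> =
      cnj (a e) * sublist_inner es (contract e \<psi>) \<alpha> + sublist_inner es (frame_contract a es \<psi>) \<alpha>
      - sublist_inner es (frame_contract a es (contract e \<psi>)) (contract e \<alpha>)"
    by (simp only: sublist_inner_Cons[of e es "frame_contract a (e # es) \<psi>"] sublist_inner_linear)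
      (simp only: frame_contract.simps sublist_inner_linear diff_conv_add_uminus)
  moreover have "sublist_inner (e # es) \<psi> (covec_wedge a \<alpha>) =
      sublist_inner es (frame_contract a es \<psi>) \<alpha> + (cnj (a e) * sublist_inner es (contract e \<psi>) \<alpha>
      + - sublist_inner es (frame_contract a es (contract e \<psi>)) (contract e \<alpha>))"
    by (simp only: sublist_inner_Cons contract_covec_wedge diff_conv_add_uminus sublist_inner_linear
        Cons.IH[OF Cons.prems] Cons.IH[OF ext_form_contract[OF Cons.prems]])
  ultimately show ?case by (simp del: frame_contract.simps)
qed

lemma sublist_inner_unit_form: "sublist_inner es \<psi> unit_form = \<psi> []"
proof (induction es arbitrary: \<psi>)
  case Nil
  then show ?case by (simp add: sublist_inner_Nil unit_form_def)
next
  case (Cons e es)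
  have "sublist_inner es \<phi> 0 = 0" for \<phi> by (simp add: sublist_inner_def)
  then show ?case using Cons by (simp add: sublist_inner_Cons)
qed

lemma frame_contract_eq:
  assumes "ext_form \<psi>"
  shows "frame_contract a es \<psi> = contract (\<Sum>e\<leftarrow>es. Re (a e) *\<^sub>R e) \<psi> + form_scale (- \<i>) (contract (\<Sum>e\<leftarrow>es. Im (a e) *\<^sub>R e) \<psi>)"
proof (induction es)
  case Nil
  then show ?case using contract_zero_left[OF assms] by (simp add: form_scale_def fun_eq_iff)
next
  case (Cons e es)
  have "cnj (a e) = of_real (Re (a e)) - \<i> * of_real (Im (a e))" by (simp add: complex_eq_iff)
  then show ?case using Cons
    by (simp add: contract_add_left[OF assms] contract_scaleR_left[OF assms])
      (simp add: form_scale_def fun_eq_iff algebra_simps)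
qed

section \<open>The Hodge star of a product of covectors\<close>

context herm_inner
begin

abbreviation vol :: "(complex^'d) ext_form" where
  "vol \<equiv> volume_form mult_i G"

lemma vol_eq: "vol = form_scale (1 / fact CARD('d)) (wedge_power omega CARD('d))"
  by (simp add: volume_form_def)

lemma pq_type_vol: "pq_type CARD('d) CARD('d) vol"
  unfolding vol_eq by (rule pq_type_scale[OF pq_type_omega_power])

lemma sum_list_frame:
  assumes "orthonormal_frame G es" "\<And>v. G r v = c v" shows "(\<Sum>e\<leftarrow>es. c e *\<^sub>R e) = r"
proof (rule riesz_unique[of es])
  show "span (set es) = UNIV"
    by (rule orthogonal_span[OF orthonormal_orthogonal[OF assms(1)] orthonormal_frameD(1)[OF assms(1)]])
  fix e assume "e \<in> set es"
  then obtain l where l: "l < length es" "e = es ! l" unfolding in_set_conv_nth by blast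
  have "G (\<Sum>e\<leftarrow>es. c e *\<^sub>R e) e = (\<Sum>m<length es. c (es ! m) * G (es ! m) (es ! l))"
    unfolding sum_list_sum_nth l(2) by (simp add: G_sum G_scale atLeast0LessThan)
  also have "\<dots> = (\<Sum>m<length es. if m = l then c (es ! m) else 0)"
    by (intro sum.cong refl) (use orthonormal_frameD(2)[OF assms(1)] l in auto)
  also have "\<dots> = c e" using l by simp
  finally show "G (\<Sum>e\<leftarrow>es. c e *\<^sub>R e) e = G r e" by (simp add: assms(2))
qed

text \<open>If \<open>r\<close> represents the real part of the coordinate, then
  \<open>mult_i r\<close> represents the imaginary part. So the two real sums of
  \<open>frame_contract_eq\<close> are \<open>r\<close> and plus or minus \<open>mult_i r\<close>,
  the sign depending on \<open>b\<close>.\<close>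

lemma frame_contract_adj:
  assumes es: "orthonormal_frame G es" and r: "\<And>v. G r v = Re (vec_nth v j)" and e: "ext_form \<psi>"
  shows "frame_contract (covector (b, j)) es \<psi> = adj_contract b r \<psi>"
proof -
  have i: "G (mult_i r) v = Im (vec_nth v j)" for v
    using r[of "mult_i v"] by (simp add: G_mult_i_right)
  have 1: "(\<Sum>e\<leftarrow>es. Re (covector (b, j) e) *\<^sub>R e) = r"
    by (rule sum_list_frame[OF es]) (simp add: covector_def dz_def dzbar_def r)
  have 2: "(\<Sum>e\<leftarrow>es. Im (covector (b, j) e) *\<^sub>R e) = (if b then 1 else - 1) *\<^sub>R mult_i r"
    by (rule sum_list_frame[OF es]) (simp add: covector_def dz_def dzbar_def i G_scale G_neg)
  show ?thesis
    unfolding frame_contract_eq[OF e] 1 2 adj_contract_def contract_scaleR_left[OF e]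
    by (cases b) (simp_all add: form_scale_def fun_eq_iff)
qed

text \<open>Justifies the description in \<open>hodge_star\<close>. Wedging with the coordinate
  covectors complementary to a sublist of the basis isolates the value on that sublist, so the
  defining equation determines all values.\<close>

lemma hodge_star_eqI:
  assumes "ext_form \<beta>" "\<And>\<psi> vs. ext_form \<psi> \<Longrightarrow> length vs = DIM(complex^'d) \<Longrightarrow>
    wedge \<psi> \<beta> vs = form_inner G \<psi> \<alpha> * vol vs"
  shows "hodge_star mult_i G \<alpha> = \<beta>"
  unfolding hodge_star_def
proof (rule the_equality)
  show "ext_form \<beta> \<and> (\<forall>\<psi> vs. ext_form \<psi> \<and> length vs = DIM(complex^'d) \<longrightarrow>
    wedge \<psi> \<beta> vs = form_inner G \<psi> \<alpha> * vol vs)" using assms by blast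
next
  fix \<beta>'
  assume b: "ext_form \<beta>' \<and> (\<forall>\<psi> vs. ext_form \<psi> \<and> length vs = DIM(complex^'d) \<longrightarrow>
    wedge \<psi> \<beta>' vs = form_inner G \<psi> \<alpha> * vol vs)"
  obtain es :: "(complex^'d) list" where es: "distinct es" "set es = Basis" "length es = DIM(complex^'d)"
    using basis_list_exists by blast
  have e: "ext_form (\<beta>' - \<beta>)" using b assms(1) by (auto intro: ext_form_diff)
  have "(\<beta>' - \<beta>) (nths es I) = 0" for I
  proof -
    define K where "K = nths es (- I)"
    define \<psi> where "\<psi> = foldr covec_wedge (map (\<lambda>b v. complex_of_real (inner v b)) K) unit_form"
    have lb: "linear (\<lambda>v::complex^'d. complex_of_real (inner v b))" for b
      by (auto simp: linear_iff inner_add_left scaleR_complex)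
    have "ext_form (foldr covec_wedge (map (\<lambda>b v. complex_of_real (inner v b)) L) unit_form)" for L :: "(complex^'d) list"
      by (induction L) (auto intro!: ext_form_unit_form ext_form_covec_wedge lb)
    then have p: "ext_form \<psi>" unfolding \<psi>_def by blast
    have setK: "set K \<subseteq> Basis" "set (nths es I) \<subseteq> Basis" "set K \<inter> set (nths es I) = {}"
      using es(1) unfolding K_def es(2)[symmetric]
      by (auto simp: set_nths dest: in_set_nthsD) (auto simp: nth_eq_iff_index_eq)
    have dK: "distinct K" unfolding K_def using es(1) by (rule distinct_nthsI)
    have len: "length (K @ nths es I) = DIM(complex^'d)"
    proof -
      have "card {i. i < length es \<and> i \<in> - I} + card {i. i < length es \<and> i \<in> I} = card {..<length es}"
      proof -
        have "{i. i < length es \<and> i \<in> - I} \<union> {i. i < length es \<and> i \<in> I} = {..<length es}" by auto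
        then show ?thesis by (subst card_Un_disjoint[symmetric]) auto
      qed
      then show ?thesis using es(3) by (simp add: K_def length_nths)
    qed
    have w: "wedge \<psi> \<tau> (K @ nths es I) = \<tau> (nths es I)" for \<tau>
    proof -
      have "wedge (foldr covec_wedge cs unit_form) \<tau> = foldr covec_wedge cs \<tau>" for cs
        by (induction cs) (simp_all add: wedge_covec_wedge)
      moreover have "foldr covec_wedge (map (\<lambda>b v. complex_of_real (inner v b)) K) \<tau> (map (\<lambda>b. b) K @ nths es I) = \<tau> (nths es I)"
        using setK by (intro foldr_covec_wedge_dual[OF dK]) (auto simp: inner_Basis subset_iff)
      ultimately show ?thesis by (simp add: \<psi>_def)
    qed
    have "wedge \<psi> \<beta>' (K @ nths es I) = wedge \<psi> \<beta> (K @ nths es I)"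
      using b p len assms(2)[OF p len] by simp
    then show ?thesis by (simp add: w)
  qed
  then have "(\<beta>' - \<beta>) vs = 0" for vs
    by (rule ext_form_zero_on_span[OF e]) (simp add: es)
  then show "\<beta>' = \<beta>" by (auto simp: fun_eq_iff)
qed

end

text \<open>With Riesz vectors for \<open>r\<close> and the volume form for \<beta> this is the
  Hodge star of the product of the covectors in \<open>ps\<close>. Smoothness, bidegree and
  invariance follow factor by factor.\<close>

definition starred :: "(bool \<times> 'd) list \<Rightarrow> ('d \<Rightarrow> complex^'d) \<Rightarrow> (complex^'d) ext_form \<Rightarrow> (complex^'d) ext_form" where
  "starred ps r \<beta> = foldr (\<lambda>p. star_contract (fst p) (r (snd p))) ps \<beta>"

lemma starred_simps: "starred [] r \<beta> = \<beta>" "starred (p # ps) r \<beta> = star_contract (fst p) (r (snd p)) (starred ps r \<beta>)"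
  by (simp_all add: starred_def)

lemma ext_form_starred: "ext_form \<beta> \<Longrightarrow> ext_form (starred ps r \<beta>)"
  by (induction ps) (simp_all add: starred_simps ext_form_star_contract)

context herm_inner
begin

text \<open>One covector at a time leaves the second slot of the inner product as an adjoint
  contraction of \<psi>, and from there \<open>wedge_adj_contract\<close> moves it to the other
  factor of the wedge.\<close>

lemma form_inner_starred:
  fixes es :: "(complex^'d) list"
  assumes es: "orthonormal_frame G es" and r: "\<And>j v. G (r j) v = Re (vec_nth v j)"
    and l: "length vs = DIM(complex^'d)"
  shows "ext_form \<psi> \<Longrightarrow> sublist_inner es \<psi> (foldr covec_wedge (map covector ps) unit_form) * vol vs
    = wedge \<psi> (starred ps r vol) vs"
proof (induction ps arbitrary: \<psi>)
  case Nil
  have "homogeneous (length vs) vol"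
    using pq_typeD(2)[OF pq_type_vol] l by (simp add: mult_2_right)
  then show ?case
    by (simp add: sublist_inner_unit_form starred_simps wedge_homogeneous_top)
next
  case (Cons p ps)
  obtain b j where p: "p = (b, j)" by fastforce
  have "sublist_inner es \<psi> (foldr covec_wedge (map covector (p # ps)) unit_form)
    = sublist_inner es (adj_contract b (r j) \<psi>) (foldr covec_wedge (map covector ps) unit_form)"
    using sublist_inner_covec_wedge[OF Cons.prems] frame_contract_adj[OF es r Cons.prems] by (simp add: p)
  then have "sublist_inner es \<psi> (foldr covec_wedge (map covector (p # ps)) unit_form) * vol vs
    = wedge (adj_contract b (r j) \<psi>) (starred ps r vol) vs"
    using Cons.IH[OF ext_form_adj_contract[OF Cons.prems]] by simp
  then show ?case
    using wedge_adj_contract[OF Cons.prems ext_form_starred[OF pq_typeD(1)[OF pq_type_vol]] l]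
    by (simp add: starred_simps p)
qed

lemma hodge_star_starred:
  assumes fr: "\<exists>es. orthonormal_frame G es" and r: "\<And>j v. G (r j) v = Re (vec_nth v j)"
  shows "hodge_star mult_i G (foldr covec_wedge (map covector ps) unit_form) = starred ps r vol"
    and "ext_form \<psi> \<Longrightarrow> length vs = DIM(complex^'d) \<Longrightarrow> wedge \<psi> (starred ps r vol) vs =
      form_inner G \<psi> (foldr covec_wedge (map covector ps) unit_form) * vol vs"
proof -
  define es where "es = (SOME es. orthonormal_frame G es)"
  have es: "orthonormal_frame G es" unfolding es_def using fr by (rule someI_ex)
  have fi: "form_inner G \<psi> \<alpha> = sublist_inner es \<psi> \<alpha>" for \<psi> \<alpha>
    unfolding form_inner_def sublist_inner_def es_def[symmetric] Let_def orthonormal_frameD(1)[OF es] ..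
  have eq: "wedge \<psi> (starred ps r vol) vs =
    form_inner G \<psi> (foldr covec_wedge (map covector ps) unit_form) * vol vs"
    if "ext_form \<psi>" "length vs = DIM(complex^'d)" for \<psi> vs
    unfolding fi using form_inner_starred[OF es r that(2,1)] by simp
  then show "ext_form \<psi> \<Longrightarrow> length vs = DIM(complex^'d) \<Longrightarrow> wedge \<psi> (starred ps r vol) vs =
      form_inner G \<psi> (foldr covec_wedge (map covector ps) unit_form) * vol vs" by blast
  show "hodge_star mult_i G (foldr covec_wedge (map covector ps) unit_form) = starred ps r vol"
    by (rule hodge_star_eqI[OF ext_form_starred[OF pq_typeD(1)[OF pq_type_vol]] eq])
qed

lemma form_inner_self:
  assumes fr: "\<exists>es. orthonormal_frame G es" and e: "ext_form \<theta>" and 0: "\<theta> \<noteq> 0"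
  shows "\<exists>c. c \<noteq> 0 \<and> form_inner G \<theta> \<theta> = complex_of_real c"
proof -
  define es where "es = (SOME es. orthonormal_frame G es)"
  have es: "orthonormal_frame G es" unfolding es_def using fr by (rule someI_ex)
  let ?c = "\<Sum>I\<in>Pow {..<length es}. (cmod (\<theta> (nths es I)))\<^sup>2"
  have fi: "form_inner G \<theta> \<theta> = of_real ?c"
    unfolding form_inner_def es_def[symmetric] Let_def orthonormal_frameD(1)[OF es, symmetric]
    by (simp add: complex_mult_cnj cmod_power2)
  have "?c \<noteq> 0"
  proof
    assume "?c = 0"
    then have z: "\<theta> (nths es I) = 0" if "I \<subseteq> {..<length es}" for I
    proof -
      have "\<forall>I\<in>Pow {..<length es}. (cmod (\<theta> (nths es I)))\<^sup>2 = 0"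
        using \<open>?c = 0\<close> sum_nonneg_eq_0_iff[of "Pow {..<length es}" "\<lambda>I. (cmod (\<theta> (nths es I)))\<^sup>2"] by simp
      then show ?thesis using that by simp
    qed
    have "\<theta> (nths es I) = 0" for I
    proof -
      have "nths es I = nths es (I \<inter> {..<length es})"
        unfolding nths_def
        by (rule arg_cong[where f = "map fst"], rule filter_cong[OF refl]) (auto dest: set_zip_rightD)
      then show ?thesis using z[of "I \<inter> {..<length es}"] by simp
    qed
    then have "\<theta> vs = 0" for vs
      by (rule ext_form_zero_on_span[OF e])
        (simp add: orthogonal_span[OF orthonormal_orthogonal[OF es] orthonormal_frameD(1)[OF es]])
    then show False using 0 by (auto simp: fun_eq_iff)
  qed
  then show ?thesis using fi by blast
qed

end

section \<open>Smooth unitary frames and Riesz vectors of a metric\<close>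

locale herm_metric =
  fixes D :: "(complex^'d::finite \<Rightarrow> complex^'d) set" and g :: "complex^'d \<Rightarrow> complex^'d \<Rightarrow> complex^'d \<Rightarrow> real"
  assumes metric: "hermitian_metric D (\<lambda>_. mult_i) g"
begin

sublocale inner: herm_inner "g x" for x
  using metric unfolding hermitian_metric_def by unfold_locales metis+

lemma smooth_metric_const: "smooth_on UNIV (\<lambda>x. g x u v)"
  using metric by (simp add: hermitian_metric_def)

lemma smooth_metric:
  assumes "smooth_on UNIV u" "smooth_on UNIV w" shows "smooth_on UNIV (\<lambda>x. g x (u x) (w x))"
proof -
  have "g x (u x) (w x) = (\<Sum>c\<in>Basis. \<Sum>b\<in>Basis. inner (w x) c * (inner (u x) b * g x b c))" for x
  proof -
    have "g x (u x) (w x) = g x (\<Sum>b\<in>Basis. inner (u x) b *\<^sub>R b) (\<Sum>c\<in>Basis. inner (w x) c *\<^sub>R c)"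
      by (simp only: euclidean_representation)
    then show ?thesis by (simp only: inner.G_sum inner.G_scale real_scaleR_def sum_distrib_left)
  qed
  then show ?thesis
    by (simp only:) (intro smooth_on_sum smooth_on_mult smooth_metric_const
      smooth_on_linear[OF bounded_linear_inner_left assms(1)] smooth_on_linear[OF bounded_linear_inner_left assms(2)])
qed

lemma smooth_mult_i: "smooth_on UNIV u \<Longrightarrow> smooth_on UNIV (\<lambda>x. mult_i (u x :: complex^'d))"
  by (rule smooth_on_linear[OF bounded_linear_mult_i])

lemma unitary_list_nth:
  assumes "inner.unitary_list x us" "k < length us" "l < length us" "k \<noteq> l"
  shows "g x (us ! k) (us ! l) = 0" "g x (mult_i (us ! k)) (us ! l) = 0"
proof -
  have o: "g x (us ! k) (us ! l) = 0 \<and> g x (mult_i (us ! k)) (us ! l) = 0" if "k < l" "l < length us" for k l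
    using assms(1) that unfolding inner.unitary_list_def sorted_wrt_iff_nth_less by blast
  show "g x (us ! k) (us ! l) = 0" "g x (mult_i (us ! k)) (us ! l) = 0"
    using o[of k l] o[of l k] assms(2-4) inner.sym[of x "us ! k" "us ! l"]
      inner.sym[of x "mult_i (us ! k)" "us ! l"] inner.G_mult_i_right[of x "us ! l" "us ! k"]
    by (cases "k < l"; simp)+
qed

text \<open>\<open>p\<close> represents the functional \<open>a\<close> on the complex span of the
  list. For the inner product with a coordinate vector it is the Gram-Schmidt projection; for the
  real part of a coordinate and a full frame it is the Riesz vector.\<close>

lemma unitary_projection:
  assumes us: "inner.unitary_list x us" and l: "l < length us"
    and p: "p = (\<Sum>m<length us. (a (us ! m) / g x (us ! m) (us ! m)) *\<^sub>R (us ! m)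
      + (a (mult_i (us ! m)) / g x (us ! m) (us ! m)) *\<^sub>R mult_i (us ! m))"
  shows "g x p (us ! l) = a (us ! l)" "g x p (mult_i (us ! l)) = a (mult_i (us ! l))"
proof -
  have pos: "g x (us ! l) (us ! l) \<noteq> 0"
    using us l inner.pos[of "us ! l" x] by (auto simp: inner.unitary_list_def)
  have "g x p (us ! l) = (\<Sum>m<length us. if m = l then a (us ! l) else 0)"
    unfolding p inner.G_sum
  proof (intro sum.cong refl)
    fix m assume "m \<in> {..<length us}"
    then show "g x ((a (us ! m) / g x (us ! m) (us ! m)) *\<^sub>R (us ! m)
      + (a (mult_i (us ! m)) / g x (us ! m) (us ! m)) *\<^sub>R mult_i (us ! m)) (us ! l) = (if m = l then a (us ! l) else 0)"
      using unitary_list_nth[OF us, of m l] l pos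
      by (cases "m = l") (simp_all add: inner.G_add inner.G_scale inner.G_mult_i_self)
  qed
  then show "g x p (us ! l) = a (us ! l)" using l by simp
  have "g x p (mult_i (us ! l)) = (\<Sum>m<length us. if m = l then a (mult_i (us ! l)) else 0)"
    unfolding p inner.G_sum
  proof (intro sum.cong refl)
    fix m assume "m \<in> {..<length us}"
    then show "g x ((a (us ! m) / g x (us ! m) (us ! m)) *\<^sub>R (us ! m)
      + (a (mult_i (us ! m)) / g x (us ! m) (us ! m)) *\<^sub>R mult_i (us ! m)) (mult_i (us ! l)) = (if m = l then a (mult_i (us ! l)) else 0)"
      using unitary_list_nth[OF us, of m l] l pos inner.G_mult_i_right[of x "us ! m" "us ! l"]
      by (cases "m = l") (simp_all add: inner.G_add inner.G_scale inner.G_mult_i_self inner.compat)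
  qed
  then show "g x p (mult_i (us ! l)) = a (mult_i (us ! l))" using l by simp
qed

lemma smooth_projection:
  assumes us: "\<And>u. u \<in> set us \<Longrightarrow> smooth_on UNIV u" and nz: "\<And>u x. u \<in> set us \<Longrightarrow> u x \<noteq> 0"
    and a: "\<And>u. smooth_on UNIV u \<Longrightarrow> smooth_on UNIV (\<lambda>x. a x (u x) :: real)"
  shows "smooth_on UNIV (\<lambda>x. \<Sum>m<length us. (a x ((us ! m) x) / g x ((us ! m) x) ((us ! m) x)) *\<^sub>R ((us ! m) x)
      + (a x (mult_i ((us ! m) x)) / g x ((us ! m) x) ((us ! m) x)) *\<^sub>R mult_i ((us ! m) x))"
proof (rule smooth_on_sum)
  fix m assume "m \<in> {..<length us}"
  then have m: "us ! m \<in> set us" by simp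
  note s = us[OF m]
  have p: "g x ((us ! m) x) ((us ! m) x) \<noteq> 0" for x using inner.pos[OF nz[OF m]] by (metis less_irrefl)
  show "smooth_on UNIV (\<lambda>x. (a x ((us ! m) x) / g x ((us ! m) x) ((us ! m) x)) *\<^sub>R ((us ! m) x)
      + (a x (mult_i ((us ! m) x)) / g x ((us ! m) x) ((us ! m) x)) *\<^sub>R mult_i ((us ! m) x))"
    unfolding divide_inverse
    by (intro smooth_on_add smooth_on_scaleR smooth_on_mult smooth_on_inverse smooth_metric a smooth_mult_i s p)
qed

text \<open>Gram-Schmidt on coordinate vectors. The support condition has two uses: the new vector
  has coordinate 1 at \<open>j\<close> and so vanishes nowhere, and leaving indices out of
  \<open>js\<close> yields a frame of a coordinate subspace.\<close>

lemma smooth_unitary_frame: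
  assumes "distinct js"
  shows "\<exists>us. length us = length js \<and> (\<forall>u\<in>set us. smooth_on UNIV u) \<and>
    (\<forall>x. inner.unitary_list x (map (\<lambda>u. u x) us) \<and> (\<forall>u\<in>set us. \<forall>k. k \<notin> set js \<longrightarrow> vec_nth (u x) k = 0))"
  using assms
proof (induction js)
  case Nil
  then show ?case by (intro exI[of _ "[]"]) (simp add: inner.unitary_list_def)
next
  case (Cons j js)
  then have "distinct js" by simp
  from Cons.IH[OF this] obtain us where U: "length us = length js \<and> (\<forall>u\<in>set us. smooth_on UNIV u) \<and>
    (\<forall>x. inner.unitary_list x (map (\<lambda>u. u x) us) \<and> (\<forall>u\<in>set us. \<forall>k. k \<notin> set js \<longrightarrow> vec_nth (u x) k = 0))"
    by (rule exE)
  have us: "length us = length js" "\<And>u. u \<in> set us \<Longrightarrow> smooth_on UNIV u"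
    "\<And>x. inner.unitary_list x (map (\<lambda>u. u x) us)"
    "\<And>x u k. u \<in> set us \<Longrightarrow> k \<notin> set js \<Longrightarrow> vec_nth (u x) k = 0" using U by blast+
  have nz: "u x \<noteq> 0" if "u \<in> set us" for u x using us(3)[of x] that by (auto simp: inner.unitary_list_def)
  define p where "p x = (\<Sum>m<length us. (g x (axis j 1) ((us ! m) x) / g x ((us ! m) x) ((us ! m) x)) *\<^sub>R ((us ! m) x)
      + (g x (axis j 1) (mult_i ((us ! m) x)) / g x ((us ! m) x) ((us ! m) x)) *\<^sub>R mult_i ((us ! m) x))" for x
  have sp: "smooth_on UNIV p"
    unfolding p_def[abs_def]
  proof (rule smooth_projection[where a = "\<lambda>x. g x (axis j 1)" and us = us])
    show "smooth_on UNIV w" if "w \<in> set us" for w using us(2)[OF that] .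
    show "w x \<noteq> 0" if "w \<in> set us" for w x using nz[OF that] .
    show "smooth_on UNIV (\<lambda>x. g x (axis j 1) (w x))" if "smooth_on UNIV w" for w
      by (rule smooth_metric[OF smooth_on_const that])
  qed
  define u where "u x = axis j 1 - p x" for x
  have su: "smooth_on UNIV u" unfolding u_def[abs_def] by (rule smooth_on_diff[OF smooth_on_const sp])
  have p0: "vec_nth (p x) k = 0" if "k \<notin> set js" for x k
    unfolding p_def using us(4)[OF nth_mem that] by simp
  have "u x \<noteq> 0" for x
  proof -
    have "vec_nth (u x) j = 1" using p0[of j x] Cons.prems by (simp add: u_def)
    then show ?thesis by auto
  qed
  moreover have "g x (u x) (w x) = 0 \<and> g x (mult_i (u x)) (w x) = 0" if "w \<in> set us" for w x
  proof -
    from iffD1[OF in_set_conv_nth that] obtain l where "l < length us \<and> us ! l = w" by (rule exE)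
    then have l: "l < length us" "w = us ! l" by (simp_all only: simp_thms)
    have eq: "p x = (\<Sum>m<length (map (\<lambda>u. u x) us).
        (g x (axis j 1) (map (\<lambda>u. u x) us ! m) / g x (map (\<lambda>u. u x) us ! m) (map (\<lambda>u. u x) us ! m)) *\<^sub>R (map (\<lambda>u. u x) us ! m)
      + (g x (axis j 1) (mult_i (map (\<lambda>u. u x) us ! m)) / g x (map (\<lambda>u. u x) us ! m) (map (\<lambda>u. u x) us ! m)) *\<^sub>R mult_i (map (\<lambda>u. u x) us ! m))"
      unfolding p_def by (rule sum.cong) simp_all
    have ll: "l < length (map (\<lambda>u. u x) us)" using l(1) by simp
    have e: "map (\<lambda>u. u x) us ! l = (us ! l) x" using l(1) by simp
    note pr = unitary_projection[where a = "g x (axis j 1)", OF us(3) ll eq, unfolded e]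
    have "g x (u x) (w x) = 0" "g x (u x) (mult_i (w x)) = 0"
      unfolding u_def l(2) inner.G_diff pr by simp_all
    then show ?thesis by (simp add: inner.G_mult_i_right)
  qed
  ultimately have un: "inner.unitary_list x (map (\<lambda>u. u x) (u # us))" for x
    using us(3)[of x] by (simp add: inner.unitary_list_def)
  have z: "vec_nth (u' x) k = 0" if "u' \<in> set (u # us)" "k \<notin> set (j # js)" for u' x k
  proof (cases "u' = u")
    case True
    then show ?thesis using that(2) p0[of k x] by (simp add: u_def axis_def)
  next
    case False
    then show ?thesis using that us(4)[of u' k x] by simp
  qed
  have sm: "smooth_on UNIV u'" if "u' \<in> set (u # us)" for u'
    using that us(2) su by (cases "u' = u") simp_all
  have "length (u # us) = length (j # js)" using us(1) by simp
  then show ?case using un z sm by (intro exI[of _ "u # us"] conjI ballI allI impI)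
qed

lemma full_unitary_frame:
  obtains us where "length us = CARD('d)" "\<And>u. u \<in> set us \<Longrightarrow> smooth_on UNIV u"
    "\<And>x. inner.unitary_list x (map (\<lambda>u. u x) us)"
proof -
  obtain js :: "'d list" where js: "distinct js" "set js = UNIV"
    using finite_distinct_list[OF finite] by metis
  then have "length js = CARD('d)" by (metis distinct_card)
  then show ?thesis using smooth_unitary_frame[OF js(1)] that by metis
qed

lemma length_realify: "length (inner.realify us) = 2 * length us"
  by (induction us) auto

lemma orthonormal_frame_exists: "\<exists>es. orthonormal_frame (g x) es"
proof -
  obtain us where us: "length us = CARD('d)" "inner.unitary_list x (map (\<lambda>u. u x) us)"
    using full_unitary_frame by metis
  show ?thesis
    by (rule inner.orthonormal_frame_exists[OF inner.orthogonal_realify[OF us(2)]])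
      (simp add: length_realify us(1) del: map_map)
qed

lemma vol_nonzero:
  assumes "span (set es) = UNIV" "length es = DIM(complex^'d)" shows "inner.vol x es \<noteq> 0"
proof
  assume z: "inner.vol x es = 0"
  obtain us where us: "length us = CARD('d)" "inner.unitary_list x (map (\<lambda>u. u x) us)"
    using full_unitary_frame by metis
  let ?vs = "inner.realify (map (\<lambda>u. u x) us)"
  have "length ?vs = length es" using us(1) assms(2) by (simp add: length_realify del: map_map)
  then have "inner.vol x ?vs = 0"
    by (rule ext_form_top_zero[OF pq_typeD(1)[OF inner.pq_type_vol] assms(1) z])
  moreover have "inner.vol x ?vs \<noteq> 0"
    using inner.omega_power_unitary_nonzero[OF us(2)] us(1)
    by (simp add: inner.vol_eq form_scale_def del: map_map)
  ultimately show False by simp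
qed

lemma riesz_exists: "\<exists>u. smooth_on UNIV u \<and> (\<forall>x v. g x (u x) v = Re (vec_nth v j))"
proof -
  obtain us where us: "length us = CARD('d)" "\<And>u. u \<in> set us \<Longrightarrow> smooth_on UNIV u"
    "\<And>x. inner.unitary_list x (map (\<lambda>u. u x) us)"
    using full_unitary_frame by metis
  let ?a = "\<lambda>v::complex^'d. Re (vec_nth v j)"
  have bl: "bounded_linear ?a" by (rule bounded_linear_compose[OF bounded_linear_Re bounded_linear_vec_nth])
  define p where "p x = (\<Sum>m<length us. (?a ((us ! m) x) / g x ((us ! m) x) ((us ! m) x)) *\<^sub>R ((us ! m) x)
      + (?a (mult_i ((us ! m) x)) / g x ((us ! m) x) ((us ! m) x)) *\<^sub>R mult_i ((us ! m) x))" for x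
  have nz: "u x \<noteq> 0" if "u \<in> set us" for u x using us(3)[of x] that by (auto simp: inner.unitary_list_def)
  have sp: "smooth_on UNIV p"
    unfolding p_def[abs_def]
  proof (rule smooth_projection[where a = "\<lambda>x. ?a" and us = us])
    show "smooth_on UNIV w" if "w \<in> set us" for w using us(2)[OF that] .
    show "w x \<noteq> 0" if "w \<in> set us" for w x using nz[OF that] .
    show "smooth_on UNIV (\<lambda>x. ?a (w x))" if "smooth_on UNIV w" for w
      by (rule smooth_on_linear[OF bl that])
  qed
  have "g x (p x) v = ?a v" for x v
  proof -
    let ?es = "inner.realify (map (\<lambda>u. u x) us)"
    have "span (set ?es) = UNIV"
      by (rule inner.orthogonal_span[OF inner.orthogonal_realify[OF us(3)]])
        (simp add: length_realify us(1) del: map_map)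
    then have "v \<in> span (set ?es)" by simp
    then show ?thesis
    proof (induction rule: span_induct_alt)
      case base
      then show ?case by (simp add: inner.G_zero)
    next
      case (step c w z)
      have "g x (p x) w = ?a w"
      proof -
        from step(1) obtain u where u: "u \<in> set us" "w = u x \<or> w = mult_i (u x)" by auto
        from iffD1[OF in_set_conv_nth u(1)] obtain l where "l < length us \<and> us ! l = u" by (rule exE)
        then have l: "l < length us" "u = us ! l" by (simp_all only: simp_thms)
        have eq: "p x = (\<Sum>m<length (map (\<lambda>u. u x) us).
        (?a (map (\<lambda>u. u x) us ! m) / g x (map (\<lambda>u. u x) us ! m) (map (\<lambda>u. u x) us ! m)) *\<^sub>R (map (\<lambda>u. u x) us ! m)
      + (?a (mult_i (map (\<lambda>u. u x) us ! m)) / g x (map (\<lambda>u. u x) us ! m) (map (\<lambda>u. u x) us ! m)) *\<^sub>R mult_i (map (\<lambda>u. u x) us ! m))"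
          unfolding p_def by (rule sum.cong) simp_all
        have ll: "l < length (map (\<lambda>u. u x) us)" using l(1) by simp
        have e: "map (\<lambda>u. u x) us ! l = (us ! l) x" using l(1) by simp
        note pr = unitary_projection[where a = "?a", OF us(3) ll eq, unfolded e]
        show ?thesis using u(2) unfolding l(2) by (elim disjE) (simp_all only: pr)
      qed
      then show ?case using step(2) by (simp add: inner.G_add inner.G_scale)
    qed
  qed
  then show ?thesis using sp by blast
qed

definition riesz :: "'d \<Rightarrow> complex^'d \<Rightarrow> complex^'d" where
  "riesz j = (SOME u. smooth_on UNIV u \<and> (\<forall>x v. g x (u x) v = Re (vec_nth v j)))"

lemma riesz: "smooth_on UNIV (riesz j)" "g x (riesz j x) v = Re (vec_nth v j)"
  using someI_ex[OF riesz_exists[of j], folded riesz_def] by auto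

lemma smooth_form_omega: "smooth_form (\<lambda>x. inner.omega x)"
  unfolding smooth_form_on_def
proof (intro conjI ballI allI)
  show "ext_form (inner.omega x)" for x by (rule inner.ext_form_omega)
  show "smooth_on UNIV (\<lambda>x. inner.omega x vs)" for vs
    unfolding fundamental_form_def
    by (cases vs; cases "tl vs"; cases "tl (tl vs)") (auto intro: smooth_on_const smooth_on_of_real smooth_metric_const)
qed

lemma smooth_form_omega_power: "smooth_form (\<lambda>x. wedge_power (inner.omega x) k)"
proof (induction k)
  case 0
  then show ?case unfolding inner.wedge_power_0 by (rule smooth_form_const[OF ext_form_unit_form])
next
  case (Suc k)
  then show ?case unfolding inner.wedge_power_Suc by (rule smooth_form_wedge[OF smooth_form_omega])
qed

lemma smooth_form_vol: "smooth_form (\<lambda>x. inner.vol x)"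
  unfolding inner.vol_eq by (rule smooth_form_scale[OF smooth_form_omega_power])

lemma smooth_form_starred: "smooth_form (\<lambda>x. starred ps (\<lambda>j. riesz j x) (inner.vol x))"
proof (induction ps)
  case Nil
  then show ?case unfolding starred_simps by (rule smooth_form_vol)
next
  case (Cons p ps)
  then show ?case unfolding starred_simps by (rule smooth_form_star_contract[OF riesz(1)])
qed

lemma star_eq:
  "hodge_star mult_i (g x) (foldr covec_wedge (map covector ps) unit_form) = starred ps (\<lambda>j. riesz j x) (inner.vol x)"
  by (rule inner.hodge_star_starred(1)[OF orthonormal_frame_exists riesz(2)])

lemma wedge_star:
  "ext_form \<psi> \<Longrightarrow> length vs = DIM(complex^'d) \<Longrightarrow> wedge \<psi> (starred ps (\<lambda>j. riesz j x) (inner.vol x)) vs =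
      form_inner (g x) \<psi> (foldr covec_wedge (map covector ps) unit_form) * inner.vol x vs"
  by (rule inner.hodge_star_starred(2)[OF orthonormal_frame_exists riesz(2)])

lemma vol_real: "cnj (inner.vol x vs) = inner.vol x vs"
  by (simp add: inner.vol_eq form_scale_def inner.omega_power_cnj)

end

section \<open>Pluricanonical sections\<close>

text \<open>The scalar is the sign arising from the transpositions; its existence is enough to see
  that the forms of type (N,0) make up a line.\<close>

lemma foldr_covec_wedge_perm:
  "mset ls = mset ms \<Longrightarrow> \<exists>c. foldr covec_wedge (map f ls) \<beta> = form_scale c (foldr covec_wedge (map f ms) \<beta>)"
proof (induction ls arbitrary: ms)
  case Nil
  then have "ms = []" by simp
  then show ?case by (intro exI[of _ 1]) (simp add: form_scale_def)
next
  case (Cons l ls)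
  then have "l \<in> set ms" using mset_eq_setD by fastforce
  then obtain us ws where ms: "ms = us @ l # ws" by (auto dest: split_list)
  have "add_mset l (mset ls) = add_mset l (mset (us @ ws))" using Cons.prems unfolding ms by simp
  then have "mset ls = mset (us @ ws)" by (simp only: add_mset_add_mset_same_iff)
  from Cons.IH[OF this] obtain c where c: "foldr covec_wedge (map f ls) \<beta> = form_scale c (foldr covec_wedge (map f (us @ ws)) \<beta>)"
    by (rule exE)
  let ?e = "(- 1) ^ length (map f us) :: complex"
  have "foldr covec_wedge (map f (l # ls)) \<beta> = covec_wedge (f l) (foldr covec_wedge (map f ls) \<beta>)" by simp
  also have "\<dots> = form_scale c (covec_wedge (f l) (foldr covec_wedge (map f us) (foldr covec_wedge (map f ws) \<beta>)))"
    by (simp only: c covec_wedge_scale map_append foldr_append o_apply)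
  also have "\<dots> = form_scale c (form_scale ?e (foldr covec_wedge (map f ms) \<beta>))"
    by (simp only: covec_wedge_foldr_swap[of "f l" "map f us"] ms map_append list.map foldr_append foldr_Cons_apply o_apply)
  also have "\<dots> = form_scale (c * ?e) (foldr covec_wedge (map f ms) \<beta>)"
    by (simp only: form_scale_def mult.assoc)
  finally show ?case by (rule exI)
qed

text \<open>Complex linearity in the first argument; later it separates the terms with dzbar from
  the contraction terms.\<close>

lemma contract_mult_i_dz:
  "contract (mult_i v) (foldr covec_wedge (map dz ls) unit_form) =
    form_scale \<i> (contract v (foldr covec_wedge (map dz ls) unit_form))"
proof (induction ls)
  case Nil
  then show ?case by (simp add: form_scale_def fun_eq_iff)
next
  case (Cons l ls)
  have d: "dz l (mult_i v) = \<i> * dz l v" by (simp add: dz_def)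
  have "contract (mult_i v) (foldr covec_wedge (map dz (l # ls)) unit_form) =
    form_scale (dz l (mult_i v)) (foldr covec_wedge (map dz ls) unit_form)
    - covec_wedge (dz l) (contract (mult_i v) (foldr covec_wedge (map dz ls) unit_form))"
    by (simp only: list.map foldr_Cons_apply contract_covec_wedge)
  also have "\<dots> = form_scale \<i> (form_scale (dz l v) (foldr covec_wedge (map dz ls) unit_form)
    - covec_wedge (dz l) (contract v (foldr covec_wedge (map dz ls) unit_form)))"
    unfolding Cons covec_wedge_scale d by (simp add: form_scale_def fun_eq_iff algebra_simps)
  finally show ?case by (simp only: list.map foldr_Cons_apply contract_covec_wedge)
qed

lemma dolbeault_const:
  fixes \<alpha> :: "(complex^'d::finite) ext_form"
  assumes "pq_type p q \<alpha>" "p \<le> CARD('d)" "q \<le> CARD('d)"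
  shows "dolbeault (\<lambda>_. mult_i) (\<lambda>x. \<alpha>) = 0" "dolbeault_bar (\<lambda>_. mult_i) (\<lambda>x. \<alpha>) = 0"
proof -
  have z: "form_wirt j (\<lambda>x. \<alpha>) x = 0" "form_wirt_bar j (\<lambda>x. \<alpha>) x = 0" for j x
    by (simp_all add: form_wirt_def form_wirt_bar_def fun_eq_iff)
  note d = dolbeault_pq_type[OF open_UNIV UNIV_I assms(1) differentiable_const assms(2,3)]
  have "dolbeault (\<lambda>_. mult_i) (\<lambda>x. \<alpha>) x = 0" "dolbeault_bar (\<lambda>_. mult_i) (\<lambda>x. \<alpha>) x = 0" for x
    unfolding d z covec_wedge_zero by (rule sum.neutral_const)+
  then show "dolbeault (\<lambda>_. mult_i) (\<lambda>x. \<alpha>) = 0" "dolbeault_bar (\<lambda>_. mult_i) (\<lambda>x. \<alpha>) = 0"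
    by (auto intro!: ext)
qed

lemma wirt_bar_power:
  assumes "h differentiable at x" "wirt_bar k h x = 0"
  shows "(\<lambda>y. (h y :: complex) ^ r) differentiable at x \<and> wirt_bar k (\<lambda>y. h y ^ r) x = 0"
proof (induction r)
  case (Suc r)
  then show ?case using wirt_mult(2)[OF assms(1), of "\<lambda>y. h y ^ r" k] assms
    by (auto intro: differentiable_mult)
qed simp

text \<open>Reduced to one variable: on the complex line through 0 and \<open>x\<close> the
  vanishing of all \<open>wirt_bar\<close> makes the real derivative complex-linear.\<close>

lemma holomorphic_bounded_constant:
  fixes F :: "complex^'d::finite \<Rightarrow> complex"
  assumes d: "\<And>x. F differentiable at x" and w: "\<And>k x. wirt_bar k F x = 0" and b: "\<And>x. cmod (F x) \<le> C"
  shows "F x = F 0"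
proof -
  have "((\<lambda>t. F (t *s x)) has_field_derivative (\<Sum>j\<in>UNIV. wirt j F (t *s x) * dz j x)) (at t)" for t
  proof -
    have bl: "bounded_linear (\<lambda>t. t *s x)"
      by (subst linear_conv_bounded_linear[symmetric])
        (auto simp: linear_iff cvec_eq_iff algebra_simps scaleR_complex)
    have "(F has_derivative frechet_derivative F (at (t *s x))) (at (t *s x))"
      using d frechet_derivative_works by blast
    from has_derivative_compose[OF bounded_linear_imp_has_derivative[OF bl] this]
    have "((\<lambda>t. F (t *s x)) has_derivative (\<lambda>u. frechet_derivative F (at (t *s x)) (u *s x))) (at t)" .
    moreover have "frechet_derivative F (at (t *s x)) (u *s x) = (\<Sum>j\<in>UNIV. wirt j F (t *s x) * dz j x) * u" for u
      unfolding wirt_expansion[OF d] w by (simp add: dz_def sum_distrib_right sum_distrib_left algebra_simps)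
    ultimately show ?thesis by (simp add: has_field_derivative_def)
  qed
  then have "(\<lambda>t. F (t *s x)) holomorphic_on UNIV"
    by (auto simp: holomorphic_on_def field_differentiable_def intro: has_field_derivative_at_within)
  moreover have "bounded (range (\<lambda>t. F (t *s x)))" using b by (auto simp: bounded_iff)
  ultimately have "(\<lambda>t. F (t *s x)) constant_on UNIV" by (rule Liouville_theorem)
  then obtain c where c: "\<And>t. F (t *s x) = c" unfolding constant_on_def by auto
  have "(1::complex) *s x = x" "(0::complex) *s x = 0" by (simp_all add: cvec_eq_iff)
  then show ?thesis using c[of 1] c[of 0] by simp
qed

interpretation section_vs: vector_space section_scale
  by unfold_locales (auto simp: section_scale_def fun_eq_iff algebra_simps)

section \<open>The canonical bundle and the plurigenera\<close>

context br_chart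
begin

definition Omega :: "(complex^'d) ext_form" where
  "Omega = foldr covec_wedge (map dz (base_list @ fibre_list)) unit_form"

text \<open>Dual to the factors of \<open>Omega\<close>, so the coefficient of a form of type (N,0)
  is its value on this list.\<close>

definition holo_frame :: "(complex^'d) list" where
  "holo_frame = map (\<lambda>k. axis k 1) (base_list @ fibre_list)"

lemma Omega_frame: "Omega holo_frame = 1"
proof -
  have "foldr covec_wedge (map dz (base_list @ fibre_list)) unit_form (map (\<lambda>k. axis k 1) (base_list @ fibre_list) @ [])
    = (unit_form :: (complex^'d) ext_form) []"
    by (rule foldr_covec_wedge_dual[OF distinct_lists(3)]) (auto simp: dz_def axis_def)
  then show ?thesis by (simp add: Omega_def holo_frame_def unit_form_def)
qed

lemma pq_type_Omega: "pq_type CARD('d) 0 Omega"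
proof -
  have "pq_type (length ls) 0 (foldr covec_wedge (map dz ls) unit_form)" for ls :: "'d list"
    by (induction ls) (auto intro!: pq_type_unit_form pq_type_covec_wedge10 dz_in_covectors10)
  from this[of "base_list @ fibre_list"] show ?thesis
    unfolding Omega_def length_lists .
qed

lemma canonical_line:
  assumes "\<beta> \<in> pq_covectors mult_i CARD('d) 0" shows "\<beta> = form_scale (\<beta> holo_frame) Omega"
proof -
  have ex: "\<exists>c. \<beta> = form_scale c Omega"
    using assms unfolding pq_covectors_eq_monomials pq_monomials_def
  proof (induction rule: form_vs.span_induct_alt)
    case base
    then show ?case by (intro exI[of _ 0]) (simp add: form_scale_def fun_eq_iff)
  next
    case (step k x y)
    obtain c where c: "y = form_scale c Omega" using step by blast
    obtain ls :: "'d list" where ls: "x = foldr covec_wedge (map dz ls) unit_form" "distinct ls" "length ls = CARD('d)"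
      using step by auto
    have "set ls = UNIV"
      by (rule card_subset_eq) (simp_all add: distinct_card[OF ls(2)] ls(3))
    moreover have "set (base_list @ fibre_list) = UNIV" by (simp add: set_base_list set_fibre_list)
    ultimately have "mset ls = mset (base_list @ fibre_list)"
      using ls(2) distinct_lists(3) by (metis set_eq_iff_mset_eq_distinct)
    then obtain d where d: "x = form_scale d Omega"
      using foldr_covec_wedge_perm unfolding ls(1) Omega_def by blast
    show ?case unfolding c d
      by (intro exI[of _ "k * d + c"]) (simp add: form_scale_def fun_eq_iff algebra_simps)
  qed
  then obtain c where c: "\<beta> = form_scale c Omega" by blast
  then have "\<beta> holo_frame = c" by (simp add: form_scale_def Omega_frame)
  then show ?thesis using c by simp
qed

text \<open>The triangular argument of \<open>volume_invariant\<close> in complex coordinates: the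
  change of a fibre differential is complex-linear, hence a combination of dz of base indices, with
  no dzbar.\<close>

lemma Omega_invariant: "Omega (map (lin_part c) vs) = Omega vs"
  unfolding Omega_def map_append
proof (rule foldr_covec_wedge_unipotent)
  fix a assume "a \<in> set (map dz base_list)"
  then show "a \<circ> lin_part c = a" by (auto simp: set_base_list dz_def lin_part_base fun_eq_iff)
next
  fix b assume "b \<in> set (map dz fibre_list)"
  then obtain k where k: "b = dz k" by auto
  define e where "e v = dz k (shear c v)" for v
  have mi: "shear c (mult_i v) = mult_i (shear c v)" for v
    by (auto simp: cvec_eq_iff shear_def br_x_def br_y_def br_z_def algebra_simps)
  have "linear e" unfolding e_def using linear_compose[OF linear_shear linear_dz] by (simp add: o_def)
  then have "e \<in> covectors10 mult_i" by (simp add: covectors10_def e_def mi) (simp add: dz_def)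
  from covectors10_expansion[OF this] have ex: "e v = (\<Sum>j\<in>UNIV. e (axis j 1) * dz j v)" for v by (rule fun_cong)
  have inj: "inj_on dz base_idx"
  proof (rule inj_onI)
    fix i j :: 'd assume "dz i = dz j"
    then have "dz i (axis i 1) = dz j (axis i 1)" by simp
    then show "i = j" by (auto simp: dz_def axis_def split: if_splits)
  qed
  have ev: "e v = (\<Sum>a\<in>set (map dz base_list). e (axis (the_inv_into base_idx dz a) 1) * a v)" for v
  proof -
    have "e v = (\<Sum>j\<in>base_idx. e (axis j 1) * dz j v)"
      unfolding ex[of v] by (intro sum.mono_neutral_right) (auto simp: e_def shear_fibre dz_def)
    also have "\<dots> = (\<Sum>a\<in>dz ` base_idx. e (axis (the_inv_into base_idx dz a) 1) * a v)"
      by (subst sum.reindex[OF inj]) (simp add: the_inv_into_f_f[OF inj])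
    finally show ?thesis by (simp only: set_map set_base_list)
  qed
  have bl: "b \<circ> lin_part c = (\<lambda>v. b v + e v)"
    unfolding k e_def by (auto simp: lin_part_def dz_def)
  show "\<exists>d. b \<circ> lin_part c = (\<lambda>v. b v + (\<Sum>a\<in>set (map dz base_list). d a * a v))"
    unfolding bl by (rule exI, rule ext, rule arg_cong[OF ev])
qed

lemma tensor_power_scale: "tensor_power r (form_scale c \<sigma>) Vs = c ^ r * tensor_power r \<sigma> Vs"
proof -
  have "prod_list (map (form_scale c \<sigma>) Vs) = c ^ length Vs * prod_list (map \<sigma> Vs)" for Vs
    by (induction Vs) (auto simp: form_scale_def)
  then show ?thesis by (simp add: tensor_power_def)
qed

lemma tensor_power_Omega_frame: "tensor_power r Omega (replicate r holo_frame) = 1"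
  by (simp add: tensor_power_def Omega_frame prod_list_replicate)

lemma tensor_power_Omega_invariant: "tensor_power r Omega (map (map (lin_part c)) Vs) = tensor_power r Omega Vs"
  by (simp add: tensor_power_def Omega_invariant o_def)

lemma holomorphic_fun_wirt_bar:
  fixes U :: "(complex^'d) set"
  assumes "open U" "x \<in> U" "holomorphic_fun_on (\<lambda>_. mult_i) U f"
  shows "f differentiable at x" "wirt_bar k f x = 0"
proof -
  show d: "f differentiable at x" using assms smooth_on_differentiable by (auto simp: holomorphic_fun_on_def)
  let ?\<Psi> = "\<lambda>y. form_scale (f y) (unit_form :: (complex^'d) ext_form)"
  have dd: "(\<lambda>y. ?\<Psi> y vs) differentiable at x" for vs
    unfolding form_scale_def by (rule differentiable_mult[OF d differentiable_const])
  have fw: "form_wirt_bar j ?\<Psi> x = form_scale (wirt_bar j f x) unit_form" for j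
  proof
    fix vs show "form_wirt_bar j ?\<Psi> x vs = form_scale (wirt_bar j f x) unit_form vs"
      using wirt_mult(2)[OF d differentiable_const, of j "unit_form vs"]
      by (simp add: form_wirt_bar_def form_scale_def)
  qed
  have "dolbeault_bar (\<lambda>_. mult_i) ?\<Psi> x = 0" using assms by (auto simp: holomorphic_fun_on_def)
  then have "(\<Sum>j\<in>UNIV. covec_wedge (dzbar j) (form_wirt_bar j ?\<Psi> x)) = 0"
    using dolbeault_pq_type(2)[OF assms(1,2) pq_type_scale[OF pq_type_unit_form] dd] by simp
  then have "(\<Sum>j\<in>UNIV. covec_wedge (dzbar j) (form_wirt_bar j ?\<Psi> x)) [axis k 1] = 0" by simp
  moreover have "covec_wedge (dzbar j) (form_wirt_bar j ?\<Psi> x) [axis k 1] = (if j = k then wirt_bar k f x else 0)" for j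
    unfolding fw covec_wedge_Cons by (simp add: form_scale_def unit_form_def dzbar_def axis_def)
  ultimately show "wirt_bar k f x = 0" by (simp add: sum_fun_apply)
qed

lemma canonical_frame_wirt_bar:
  assumes "open U" "x \<in> U" "canonical_frame_on (\<lambda>_. mult_i) U \<sigma>"
  shows "(\<lambda>y. \<sigma> y holo_frame) differentiable at x" "wirt_bar k (\<lambda>y. \<sigma> y holo_frame) x = 0"
proof -
  let ?h = "\<lambda>y. \<sigma> y holo_frame"
  have mem: "\<sigma> y \<in> pq_covectors mult_i CARD('d) 0" if "y \<in> U" for y
    using assms(3) that by (simp add: canonical_frame_on_def)
  have d: "(\<lambda>y. \<sigma> y vs) differentiable at x" for vs
  proof -
    have "smooth_on U (\<lambda>y. \<sigma> y vs)" using assms(3) by (simp add: canonical_frame_on_def smooth_form_on_def)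
    then show ?thesis by (rule smooth_on_differentiable[OF _ assms(2)])
  qed
  show "?h differentiable at x" by (rule d)
  have fw: "form_wirt_bar j \<sigma> x = form_scale (wirt_bar j ?h x) Omega" for j
  proof
    fix vs
    have "\<sigma> y vs = ?h y * Omega vs" if "y \<in> U" for y
      using fun_cong[OF canonical_line[OF mem[OF that]], of vs] by (simp add: form_scale_def)
    then have "form_wirt_bar j \<sigma> x vs = wirt_bar j (\<lambda>y. ?h y * Omega vs) x"
      unfolding form_wirt_bar_def by (rule wirt_cong_open(2)[OF assms(1,2)])
    then show "form_wirt_bar j \<sigma> x vs = form_scale (wirt_bar j ?h x) Omega vs"
      using wirt_mult(2)[OF d differentiable_const, of j holo_frame "Omega vs"] by (simp add: form_scale_def)
  qed
  let ?X = "\<Sum>j\<in>UNIV. covec_wedge (dzbar j) (form_scale (wirt_bar j ?h x) Omega)"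
  have "dolbeault_bar (\<lambda>_. mult_i) \<sigma> x = 0" using assms by (auto simp: canonical_frame_on_def)
  then have X: "?X = 0"
    using dolbeault_pq_type(2)[OF assms(1,2) pq_covectors_pq_type[OF mem] d] by (simp add: fw)
  have mi: "contract (mult_i v) Omega = form_scale \<i> (contract v Omega)" for v
    unfolding Omega_def by (rule contract_mult_i_dz)
  have c: "covec_wedge (dzbar j) (form_scale c Omega) (v # vs) =
    c * (dzbar j v * Omega vs - covec_wedge (dzbar j) (contract v Omega) vs)" for j c v vs
    unfolding covec_wedge_scale by (simp add: form_scale_def covec_wedge_Cons)
  \<comment> \<open>The value at \<open>mult_i\<close> of the vector is added with factor
    \<open>\<i>\<close>: \<open>Omega\<close> is complex-linear, so the contraction terms cancel,
    while the antilinear dzbar terms add up, whence the factor 2.\<close>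
  have t: "covec_wedge (dzbar j) (form_scale c Omega) (axis k 1 # holo_frame) +
    \<i> * covec_wedge (dzbar j) (form_scale c Omega) (mult_i (axis k 1) # holo_frame) = (if j = k then 2 * c else 0)" for j c
    unfolding c unfolding mi covec_wedge_scale Omega_frame
    by (auto simp: form_scale_def dzbar_def axis_def algebra_simps)
  have "0 = ?X (axis k 1 # holo_frame) + \<i> * ?X (mult_i (axis k 1) # holo_frame)" unfolding X by simp
  also have "\<dots> = (\<Sum>j\<in>UNIV. if j = k then 2 * wirt_bar j ?h x else 0)"
    unfolding sum_fun_apply sum_distrib_left sum.distrib[symmetric] t ..
  also have "\<dots> = 2 * wirt_bar k ?h x" by simp
  finally show "wirt_bar k ?h x = 0" by simp
qed

definition canonical_section :: "nat \<Rightarrow> (complex^'d) pluri_section" where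
  "canonical_section r = (\<lambda>x Vs. tensor_power r Omega Vs)"

lemma pluricanonical_section_eq:
  assumes s: "s \<in> pluricanonical_sections (br_deck n ix) (\<lambda>_. mult_i) r"
  shows "\<exists>c. s = section_scale c (canonical_section r)"
proof -
  \<comment> \<open>On \<open>r\<close> copies of \<open>holo_frame\<close> the power of
    \<open>Omega\<close> is 1, so this is the quotient of the section by that power. Locally it is a
    holomorphic function times the r-th power of the coefficient of a holomorphic frame.\<close>
  define F where "F y = s y (replicate r holo_frame)" for y
  have loc: "\<exists>U \<sigma> f. open U \<and> x \<in> U \<and> canonical_frame_on (\<lambda>_. mult_i) U \<sigma> \<and> holomorphic_fun_on (\<lambda>_. mult_i) U f \<and>
        (\<forall>y\<in>U. \<forall>Vs. s y Vs = f y * (\<sigma> y holo_frame) ^ r * tensor_power r Omega Vs)" for x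
  proof -
    obtain U \<sigma> f where U: "open U" "x \<in> U" "canonical_frame_on (\<lambda>_. mult_i) U \<sigma>"
      "holomorphic_fun_on (\<lambda>_. mult_i) U f" "\<And>y Vs. y \<in> U \<Longrightarrow> s y Vs = f y * tensor_power r (\<sigma> y) Vs"
      using s unfolding pluricanonical_sections_def by blast
    have "s y Vs = f y * (\<sigma> y holo_frame) ^ r * tensor_power r Omega Vs" if y: "y \<in> U" for y Vs
    proof -
      have "\<sigma> y \<in> pq_covectors mult_i CARD('d) 0" using U(3) y by (simp add: canonical_frame_on_def)
      note line = canonical_line[OF this]
      have "tensor_power r (\<sigma> y) Vs = tensor_power r (form_scale (\<sigma> y holo_frame) Omega) Vs"
        by (rule arg_cong[OF line])
      then show ?thesis using U(5)[OF y] by (simp add: tensor_power_scale)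
    qed
    then show ?thesis using U by blast
  qed
  have sF: "s y Vs = F y * tensor_power r Omega Vs" for y Vs
  proof -
    obtain U \<sigma> f where U: "y \<in> U" "\<And>Vs. s y Vs = f y * (\<sigma> y holo_frame) ^ r * tensor_power r Omega Vs"
      using loc[of y] by blast
    then show ?thesis by (simp add: F_def tensor_power_Omega_frame)
  qed
  have F: "F differentiable at x \<and> wirt_bar k F x = 0" for x k
  proof -
    obtain U \<sigma> f where U: "open U" "x \<in> U" "canonical_frame_on (\<lambda>_. mult_i) U \<sigma>"
      "holomorphic_fun_on (\<lambda>_. mult_i) U f" "\<And>y Vs. y \<in> U \<Longrightarrow> s y Vs = f y * (\<sigma> y holo_frame) ^ r * tensor_power r Omega Vs"
      using loc[of x] by blast
    have e: "f y * (\<sigma> y holo_frame) ^ r = F y" if "y \<in> U" for y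
      using U(5)[OF that] by (simp add: F_def tensor_power_Omega_frame)
    note f = holomorphic_fun_wirt_bar[OF U(1,2,4)]
    note p = wirt_bar_power[OF canonical_frame_wirt_bar[OF U(1,2,3)], of r k]
    let ?g = "\<lambda>y. f y * (\<sigma> y holo_frame) ^ r"
    have g: "?g differentiable at x" using f(1) p by (auto intro: differentiable_mult)
    have "wirt_bar k ?g x = 0" using wirt_mult(2)[OF f(1), of "\<lambda>y. (\<sigma> y holo_frame) ^ r" k] p f(2)[of k] by simp
    then have "wirt_bar k F x = 0" using wirt_cong_open(2)[OF U(1,2) e, where j=k] by simp
    moreover have "F differentiable at x"
    proof -
      have "(?g has_derivative frechet_derivative ?g (at x)) (at x)" using g frechet_derivative_works by blast
      then have "(F has_derivative frechet_derivative ?g (at x)) (at x)"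
        by (rule has_derivative_transform_within_open[OF _ U(1,2) e])
      then show ?thesis by (rule differentiableI)
    qed
    ultimately show ?thesis by blast
  qed
  have inv: "F (left_mult c x) = F x" if "left_mult c \<in> br_deck n ix" for c x
  proof -
    have "s (left_mult c x) (map (map (lin_part c)) Vs) = s x Vs" for Vs
      using s that unfolding pluricanonical_sections_def by (fastforce simp: frechet_left_mult)
    from this[of "replicate r holo_frame"] show ?thesis
      unfolding sF tensor_power_Omega_invariant tensor_power_Omega_frame by simp
  qed
  have "continuous_on UNIV F"
    using F by (intro differentiable_imp_continuous_on) (auto simp: differentiable_on_def)
  then obtain C where "\<And>x. cmod (F x) \<le> C" using invariant_bounded[OF _ inv] by blast
  then have "F x = F 0" for x using holomorphic_bounded_constant[of F] F by blast
  then have "s = section_scale (F 0) (canonical_section r)"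
    unfolding fun_eq_iff section_scale_def canonical_section_def using sF by metis
  then show ?thesis by blast
qed

lemma canonical_section_mem:
  "section_scale c (canonical_section r) \<in> pluricanonical_sections (br_deck n ix) (\<lambda>_. mult_i) r"
  unfolding pluricanonical_sections_def
proof (intro CollectI conjI allI ballI)
  have z: "x = 0 \<Longrightarrow> x y = 0" for x :: "complex^'d \<Rightarrow> (complex^'d) ext_form" and y by simp
  have "Omega \<noteq> 0" using Omega_frame by force
  then have fr: "canonical_frame_on (\<lambda>_. mult_i) UNIV (\<lambda>_. Omega)"
    unfolding canonical_frame_on_def cdim_vec
    by (intro conjI ballI smooth_form_const pq_typeD(1)[OF pq_type_Omega] pq_type_in_pq_covectors[OF pq_type_Omega]
        z[OF dolbeault_const(2)[OF pq_type_Omega]]) simp_all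
  have fn: "holomorphic_fun_on (\<lambda>_. mult_i) (UNIV :: (complex^'d) set) (\<lambda>_. c)"
    unfolding holomorphic_fun_on_def
    by (intro conjI ballI smooth_on_const z[OF dolbeault_const(2)[OF pq_type_scale[OF pq_type_unit_form]]]) simp_all
  fix x
  show "\<exists>U \<sigma> f. open U \<and> x \<in> U \<and> canonical_frame_on (\<lambda>_. mult_i) U \<sigma> \<and> holomorphic_fun_on (\<lambda>_. mult_i) U f \<and>
    (\<forall>y\<in>U. \<forall>Vs. section_scale c (canonical_section r) y Vs = f y * tensor_power r (\<sigma> y) Vs)"
    by (intro exI[of _ UNIV] exI[of _ "\<lambda>_. Omega"] exI[of _ "\<lambda>_. c"] conjI fr fn)
      (simp_all add: section_scale_def canonical_section_def)
next
  fix \<gamma> x Vs assume "\<gamma> \<in> br_deck n ix"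
  then obtain a where a: "\<gamma> = left_mult a" by (rule br_deck_left_mult)
  have "map (frechet_derivative (left_mult a) (at x)) = map (lin_part a)" by (simp only: frechet_left_mult)
  then show "section_scale c (canonical_section r) (\<gamma> x) (map (map (frechet_derivative \<gamma> (at x))) Vs)
    = section_scale c (canonical_section r) x Vs"
    unfolding a section_scale_def canonical_section_def by (simp only: tensor_power_Omega_invariant)
qed

lemma plurigenus_eq: "plurigenus (br_deck n ix) (\<lambda>_. mult_i) r = 1"
proof -
  let ?S = "canonical_section r" and ?V = "pluricanonical_sections (br_deck n ix) (\<lambda>_. mult_i) r"
  have sub: "?V \<subseteq> section_vs.span {?S}"
    using pluricanonical_section_eq section_vs.span_scale[OF section_vs.span_base[of ?S "{?S}"]] by fastforce
  have "section_scale 1 ?S = ?S" by (simp add: section_scale_def)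
  then have mem: "{?S} \<subseteq> ?V" using canonical_section_mem[of 1 r] by simp
  have "?S 0 (replicate r holo_frame) = 1" by (simp add: canonical_section_def tensor_power_Omega_frame)
  then have "?S \<noteq> 0" by (metis zero_fun_apply zero_neq_one)
  then have "section_vs.independent {?S}" by simp
  then have "section_vs.dim ?V = 1" using section_vs.dim_unique[OF mem sub] by simp
  then show ?thesis
    unfolding plurigenus_def using sub by (auto simp: one_enat_def)
qed

lemma kodaira_dimension_eq: "kodaira_dimension (br_deck n ix) (br_J n ix) = 0"
proof -
  have "ln_enat 1 = 0" by (simp add: ln_enat_def one_enat_def zero_ereal_def)
  then show ?thesis
    unfolding kodaira_dimension_def br_J_eq plurigenus_eq by (auto simp: Limsup_const)
qed

end

section \<open>The form \<theta> and naturality of its Hodge star\<close>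

lemma contract_foldr_covec_wedge:
  assumes "\<And>a. a \<in> set as \<Longrightarrow> a v = 0"
  shows "contract v (foldr covec_wedge as \<beta>) = form_scale ((- 1) ^ length as) (foldr covec_wedge as (contract v \<beta>))"
  using assms
proof (induction as)
  case Nil
  then show ?case by (simp add: form_scale_def)
next
  case (Cons a as)
  have IH: "contract v (foldr covec_wedge as \<beta>) = form_scale ((- 1) ^ length as) (foldr covec_wedge as (contract v \<beta>))"
    using Cons.prems by (intro Cons.IH) simp
  have "a v = 0" using Cons.prems by simp
  then show ?case
    unfolding foldr_Cons_apply contract_covec_wedge IH covec_wedge_scale
    by (simp add: form_scale_def fun_eq_iff)
qed

text \<open>Contraction with a vector killed by all the covectors passes through them with the sign
  (-1)^\<open>length as\<close>, which is 1.\<close>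

lemma foldr_covec_wedge_append_vanish:
  assumes "even (length as)" "\<And>a v. a \<in> set as \<Longrightarrow> v \<in> set vs \<Longrightarrow> a v = 0"
  shows "foldr covec_wedge as \<beta> (vs @ ws) = foldr covec_wedge as (\<lambda>us. \<beta> (vs @ us)) ws"
  using assms(2)
proof (induction vs arbitrary: \<beta>)
  case (Cons v vs)
  have e: "(- 1) ^ length as = (1 :: complex)" using assms(1) by simp
  have "foldr covec_wedge as \<beta> (v # (vs @ ws)) = contract v (foldr covec_wedge as \<beta>) (vs @ ws)"
    by (simp only: contract_def)
  also have "contract v (foldr covec_wedge as \<beta>) = form_scale ((- 1) ^ length as) (foldr covec_wedge as (contract v \<beta>))"
    by (rule contract_foldr_covec_wedge) (use Cons.prems in simp)
  also have "\<dots> (vs @ ws) = foldr covec_wedge as (contract v \<beta>) (vs @ ws)"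
    unfolding form_scale_def e by (rule mult_1)
  also have "\<dots> = foldr covec_wedge as (\<lambda>us. contract v \<beta> (vs @ us)) ws"
    by (rule Cons.IH) (use Cons.prems in simp)
  finally show ?case by (simp only: append_Cons contract_def)
qed (simp only: append_Nil)

lemma star_contract_map:
  assumes "\<And>vs. \<beta>' (map T vs) = \<beta> vs" "\<And>v. T (mult_i v) = mult_i (T v)"
  shows "star_contract b (T u) \<beta>' (map T vs) = star_contract b u \<beta> vs"
proof -
  have "\<beta>' (T w # map T vs) = \<beta> (w # vs)" for w using assms(1)[of "w # vs"] by (simp only: list.map)
  from this[of u] this[of "mult_i u"] show ?thesis
    by (simp only: star_contract_def adj_contract_def form_scale_def grade_inv_def contract_def
        plus_fun_apply length_map assms(2)[symmetric])
qed

lemma starred_map: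
  assumes "\<And>vs. \<beta>' (map T vs) = \<beta> vs" "\<And>v. T (mult_i v) = mult_i (T v)"
    "\<And>k. k \<in> snd ` set ps \<Longrightarrow> r' k = T (r k)"
  shows "starred ps r' \<beta>' (map T vs) = starred ps r \<beta> vs"
  using assms(3)
proof (induction ps arbitrary: vs)
  case Nil
  show ?case unfolding starred_simps by (rule assms(1))
next
  case (Cons p ps)
  have IH: "starred ps r' \<beta>' (map T vs) = starred ps r \<beta> vs" for vs
    by (rule Cons.IH) (use Cons.prems in simp)
  have "r' (snd p) = T (r (snd p))" using Cons.prems by simp
  then show ?case unfolding starred_simps by (simp only: star_contract_map[where T = T and \<beta>' = "starred ps r' \<beta>'", OF IH assms(2)])
qed

context br_chart
begin

text \<open>The factors of \<theta>. Their indices lie in the base, which makes them invariant, and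
  each covector stands next to its conjugate, which makes \<theta> real.\<close>

definition special_pairs :: "(bool \<times> 'd) list" where
  "special_pairs = [(True, iz), (False, iz), (True, iy), (False, iy)]"

lemma special_covectors: "map covector special_pairs = [dz iz, dzbar iz, dz iy, dzbar iy]"
  by (simp add: special_pairs_def covector_def)

definition special_form :: "(complex^'d) ext_form" where
  "special_form = foldr covec_wedge (map covector special_pairs) unit_form"

definition special_vectors :: "(complex^'d) list" where
  "special_vectors = [axis iz 1, axis iz \<i>, axis iy 1, axis iy \<i>]"

text \<open>Each of the two products dz wedge dzbar takes the value -2i on the pair (1, i), and
  (-2i)^2 = -4.\<close>

lemma special_form_vectors: "special_form special_vectors = - 4"
proof -
  have v: "dz k (axis k z) = z" "dzbar k (axis k z) = cnj z" for k :: 'd and z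
    by (simp_all add: dz_def dzbar_def)
  have w: "dz iz (axis iy z) = 0" "dzbar iz (axis iy z) = 0" "dz iy (axis iz z) = 0" "dzbar iy (axis iz z) = 0" for z
    using special_indices(4) by (simp_all add: dz_def dzbar_def axis_def)
  have u: "contract x (unit_form :: (complex^'d) ext_form) = 0" for x
    by (simp add: contract_def unit_form_def fun_eq_iff)
  have fs: "form_scale c \<alpha> vs = c * \<alpha> vs" for c and \<alpha> :: "(complex^'d) ext_form" and vs
    by (simp add: form_scale_def)
  have un: "(unit_form :: (complex^'d) ext_form) [] = 1" by (simp add: unit_form_def)
  show ?thesis
    unfolding special_form_def special_covectors special_vectors_def foldr_Cons_apply foldr.simps(1) id_apply
    by (simp add: covec_wedge_Cons contract_covec_wedge v w u un covec_wedge_scale covec_wedge_diff covec_wedge_zero fs)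
qed

end

section \<open>Invariant metrics and the astheno-Kaehler condition\<close>

locale br_metric = br_chart n ix + herm_metric "br_deck n ix" g
  for n :: nat and ix :: "nat \<Rightarrow> 'd::finite" and g :: "complex^'d \<Rightarrow> complex^'d \<Rightarrow> complex^'d \<Rightarrow> real"
begin

lemma metric_invariant:
  assumes "left_mult c \<in> br_deck n ix"
  shows "g (left_mult c x) (lin_part c u) (lin_part c v) = g x u v"
proof -
  have "g (left_mult c x) (frechet_derivative (left_mult c) (at x) u) (frechet_derivative (left_mult c) (at x) v) = g x u v"
    using metric assms unfolding hermitian_metric_def by blast
  then show ?thesis by (simp only: frechet_left_mult)
qed


lemma omega_invariant:
  assumes "left_mult c \<in> br_deck n ix"
  shows "inner.omega (left_mult c x) (map (lin_part c) vs) = inner.omega x vs"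
  by (cases vs; cases "tl vs"; cases "tl (tl vs)")
    (auto simp: fundamental_form_def metric_invariant[OF assms] simp flip: lin_part_mult_i)


lemma omega_power_invariant:
  assumes "left_mult c \<in> br_deck n ix"
  shows "wedge_power (inner.omega (left_mult c x)) k (map (lin_part c) vs) = wedge_power (inner.omega x) k vs"
proof (induction k arbitrary: vs)
  case 0
  show ?case unfolding inner.wedge_power_0 by (simp add: unit_form_def)
next
  case (Suc k)
  have i: "(\<lambda>ws. inner.omega (left_mult c x) (map (lin_part c) ws)) = inner.omega x"
    using omega_invariant[OF assms] by (rule ext)
  show ?case unfolding inner.wedge_power_Suc wedge_map i Suc ..
qed


lemma vol_invariant:
  assumes "left_mult c \<in> br_deck n ix"
  shows "inner.vol (left_mult c x) (map (lin_part c) vs) = inner.vol x vs"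
  unfolding inner.vol_eq form_scale_def omega_power_invariant[OF assms] ..


text \<open>The Riesz vector is determined by the metric and the functional. The metric is
  invariant, and for a base index so is the functional.\<close>

lemma riesz_invariant:
  assumes c: "left_mult c \<in> br_deck n ix" and k: "k \<in> base_idx"
  shows "riesz k (left_mult c x) = lin_part c (riesz k x)"
proof (rule inner.riesz_unique[OF span_frame])
  fix e :: "complex^'d"
  \<comment> \<open>The inverse of \<open>lin_part c\<close> subtracts the shear, since the shear
    has square zero.\<close>
  have e: "lin_part c (e - shear c e) = e"
    by (simp add: lin_part_def linear_diff[OF linear_shear] shear_shear)
  have "g (left_mult c x) (lin_part c (riesz k x)) (lin_part c (e - shear c e)) = Re (vec_nth (lin_part c (e - shear c e)) k)"
    unfolding metric_invariant[OF c] riesz(2) lin_part_base[OF k] ..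
  then show "g (left_mult c x) (riesz k (left_mult c x)) e = g (left_mult c x) (lin_part c (riesz k x)) e"
    unfolding e riesz(2) by simp
qed


lemma starred_special_invariant:
  assumes "left_mult c \<in> br_deck n ix"
  shows "starred special_pairs (\<lambda>j. riesz j (left_mult c x)) (inner.vol (left_mult c x)) (map (lin_part c) vs)
    = starred special_pairs (\<lambda>j. riesz j x) (inner.vol x) vs"
proof (rule starred_map)
  show "inner.vol (left_mult c x) (map (lin_part c) ws) = inner.vol x ws" for ws
    by (rule vol_invariant[OF assms])
  show "lin_part c (mult_i v) = mult_i (lin_part c v)" for v by (rule lin_part_mult_i)
  fix k assume "k \<in> snd ` set special_pairs"
  then have "k \<in> base_idx" using special_indices by (auto simp: special_pairs_def)
  then show "riesz k (left_mult c x) = lin_part c (riesz k x)" by (rule riesz_invariant[OF assms])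
qed


text \<open>Conjugation exchanges the two members of each pair of covectors; the two resulting signs
  cancel, and the powers of \<omega> are real.\<close>

lemma special_omega_power_real:
  "cnj (foldr covec_wedge (map covector special_pairs) (wedge_power (inner.omega x) k) vs)
    = foldr covec_wedge (map covector special_pairs) (wedge_power (inner.omega x) k) vs"
proof -
  let ?W = "wedge_power (inner.omega x) k"
  have c: "(\<lambda>v. cnj (dz j v)) = dzbar j" "(\<lambda>v. cnj (dzbar j v)) = dz j" for j :: 'd
    by (simp_all add: fun_eq_iff dz_def dzbar_def)
  have "cnj (covec_wedge (dz iz) (covec_wedge (dzbar iz) (covec_wedge (dz iy) (covec_wedge (dzbar iy) ?W))) vs)
    = covec_wedge (dzbar iz) (covec_wedge (dz iz) (covec_wedge (dzbar iy) (covec_wedge (dz iy) ?W))) vs"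
    unfolding covec_wedge_cnj inner.omega_power_cnj c ..
  also have "\<dots> = covec_wedge (dz iz) (covec_wedge (dzbar iz) (covec_wedge (dz iy) (covec_wedge (dzbar iy) ?W))) vs"
    unfolding covec_wedge_anticomm[of "dzbar iz" "dz iz"] covec_wedge_anticomm[of "dzbar iy" "dz iy"]
      covec_wedge_uminus by simp
  finally show ?thesis unfolding special_covectors by simp
qed


text \<open>On the subspace where the coordinates z_1 and y_1 vanish, \<omega>^(N-2) is a volume
  form. On a unitary frame of this subspace completed by \<open>special_vectors\<close> the value
  splits into two nonzero factors.\<close>

lemma special_omega_power_nonzero:
  "foldr covec_wedge (map covector special_pairs) (wedge_power (inner.omega x) (CARD('d) - 2)) frame \<noteq> 0"
proof
  let ?W = "wedge_power (inner.omega x) (CARD('d) - 2)"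
  let ?L = "foldr covec_wedge (map covector special_pairs)"
  assume z: "?L ?W frame = 0"
  \<comment> \<open>Leaving out \<open>iz\<close> and \<open>iy\<close> yields a frame on which all
    four covectors of \<theta> vanish.\<close>
  obtain js :: "'d list" where js: "distinct js" "set js = UNIV - {iz, iy}"
    using finite_distinct_list[of "UNIV - {iz, iy}"] by auto
  have "card (UNIV - {iz, iy} :: 'd set) = CARD('d) - 2"
    using special_indices(4) by (subst card_Diff_subset) auto
  then have ljs: "length js = CARD('d) - 2" using js distinct_card by metis
  from smooth_unitary_frame[OF js(1)] obtain us where U: "length us = length js \<and> (\<forall>u\<in>set us. smooth_on UNIV u) \<and>
    (\<forall>x. inner.unitary_list x (map (\<lambda>u. u x) us) \<and> (\<forall>u\<in>set us. \<forall>k. k \<notin> set js \<longrightarrow> vec_nth (u x) k = 0))"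
    by (rule exE)
  define ws where "ws = map (\<lambda>u. u x) us"
  have lw: "length ws = CARD('d) - 2" using U ljs by (simp add: ws_def)
  have un: "inner.unitary_list x ws" using U unfolding ws_def by blast
  have w0: "vec_nth w iz = 0 \<and> vec_nth w iy = 0" if "w \<in> set ws" for w
    using that U js(2) unfolding ws_def by auto
  let ?r = "inner.realify ws"
  have lr: "length ?r = 2 * (CARD('d) - 2)" unfolding length_realify lw ..
  have "CARD('d) \<ge> 2" using card_index n2 by simp
  then have len: "length (?r @ special_vectors) = length frame"
    unfolding length_append lr length_frame by (simp add: special_vectors_def)
  have e: "ext_form (?L ?W)"
    unfolding special_covectors foldr_Cons_apply foldr.simps(1) id_apply
    by (intro ext_form_covec_wedge linear_dz linear_dzbar inner.ext_form_omega_power)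
  have "?L ?W (?r @ special_vectors) = ?L (\<lambda>vs. ?W (?r @ vs)) special_vectors"
  proof (rule foldr_covec_wedge_append_vanish)
    show "even (length (map covector special_pairs))" by (simp add: special_pairs_def)
    fix a v assume a: "a \<in> set (map covector special_pairs)" and v: "v \<in> set ?r"
    from v obtain w where w: "w \<in> set ws" "v = w \<or> v = mult_i w" by auto
    then have "vec_nth v iz = 0" "vec_nth v iy = 0" using w0[OF w(1)] by auto
    then show "a v = 0" using a unfolding special_covectors by (auto simp: dz_def dzbar_def)
  qed
  \<comment> \<open>\<open>?r\<close> already supplies 2(N-2) arguments, the full degree of
    \<omega>^(N-2).\<close>
  also have "(\<lambda>vs. ?W (?r @ vs)) = form_scale (?W ?r) unit_form"
  proof
    fix vs
    show "?W (?r @ vs) = form_scale (?W ?r) unit_form vs"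
    proof (cases "vs = []")
      case False
      then have "length (?r @ vs) \<noteq> 2 * (CARD('d) - 2)" unfolding length_append lr by simp
      then have "?W (?r @ vs) = 0" using inner.homogeneous_omega_power unfolding homogeneous_def by blast
      then show ?thesis using False by (simp add: form_scale_def unit_form_def)
    qed (simp add: form_scale_def unit_form_def)
  qed
  also have "?L (form_scale (?W ?r) unit_form) special_vectors = ?W ?r * special_form special_vectors"
    unfolding foldr_covec_wedge_scale special_form_def by (simp add: form_scale_def)
  finally have "?L ?W (?r @ special_vectors) = ?W ?r * - 4" unfolding special_form_vectors .
  \<comment> \<open>Vanishing on \<open>frame\<close> forces vanishing on every list of the same
    length.\<close>
  moreover have "?L ?W (?r @ special_vectors) = 0"
    by (rule ext_form_top_zero[OF e span_frame z len])
  ultimately show False using inner.omega_power_unitary_nonzero[OF un] unfolding lw by simp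
qed


theorem not_astheno_kaehler: "\<not> astheno_kaehler (\<lambda>_. mult_i) g"
proof
  assume "astheno_kaehler (\<lambda>_. mult_i) g"
  then have dd: "dolbeault (\<lambda>_. mult_i) (dolbeault_bar (\<lambda>_. mult_i) (\<lambda>x. wedge_power (inner.omega x) (CARD('d) - 2))) = 0"
    unfolding astheno_kaehler_def cdim_vec .
  define f where "f x = Re (foldr covec_wedge (map covector special_pairs) (wedge_power (inner.omega x) (CARD('d) - 2)) frame)" for x
  have f: "complex_of_real (f x) = foldr covec_wedge (map covector special_pairs) (wedge_power (inner.omega x) (CARD('d) - 2)) frame" for x
    using special_omega_power_real[of x "CARD('d) - 2" frame] unfolding f_def by (simp only: complex_eq_iff complex_cnj Re_complex_of_real Im_complex_of_real cnj.simps) simp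
  show False
  proof (rule obstruction[OF smooth_form_omega_power inner.pq_type_omega_power _ _ omega_power_invariant dd])
    show "CARD('d) - 2 \<le> CARD('d)" "Suc (CARD('d) - 2) \<le> CARD('d)" using card_index n2 by simp_all
    show "complex_of_real (f x) = covec_wedge (dz iz) (covec_wedge (dzbar iz) (covec_wedge (dz iy) (covec_wedge (dzbar iy)
      (wedge_power (inner.omega x) (CARD('d) - 2))))) frame" for x
      unfolding f special_covectors foldr_Cons_apply foldr.simps(1) id_apply ..
    show "f x \<noteq> 0" for x using special_omega_power_nonzero[of x] unfolding f[symmetric] by simp
  qed
qed


end

section \<open>Bott-Chern harmonic forms and formality\<close>

lemma dolbeault_zero:
  "dolbeault (\<lambda>_. mult_i) (0 :: (complex^'d::finite) form_field) = 0"
  "dolbeault_bar (\<lambda>_. mult_i) (0 :: (complex^'d::finite) form_field) = 0"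
proof -
  have "(0 :: (complex^'d) form_field) = (\<lambda>x. 0)" by (rule ext) simp
  then show "dolbeault (\<lambda>_. mult_i) (0 :: (complex^'d::finite) form_field) = 0"
    "dolbeault_bar (\<lambda>_. mult_i) (0 :: (complex^'d::finite) form_field) = 0"
    using dolbeault_const[OF pq_type_zero[of 0 0, where ?'a = 'd] le0 le0] by (simp_all only:)
qed

text \<open>By bidegree: for q = N already the first derivative has type (p,N+1), and for p = N the
  second has type (N+1,q+1).\<close>

lemma dolbeault_dolbeault_bar_out_of_range:
  fixes \<Psi> :: "(complex^'d::finite) form_field"
  assumes s: "smooth_form \<Psi>" and t: "\<And>x. pq_type p q (\<Psi> x)"
    and pq: "p \<le> CARD('d)" "q \<le> CARD('d)" "p = CARD('d) \<or> q = CARD('d)"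
  shows "dolbeault (\<lambda>_. mult_i) (dolbeault_bar (\<lambda>_. mult_i) \<Psi>) = 0"
proof -
  have tw: "pq_type p q (form_wirt_bar j \<Psi> x)" for j x
    by (rule pq_type_form_wirt(2)[OF open_UNIV UNIV_I t smooth_form_differentiable[OF s]])
  have tww: "pq_type p q (form_wirt k (form_wirt_bar j \<Psi>) x)" for j k x
    by (rule pq_type_form_wirt(1)[OF open_UNIV UNIV_I tw smooth_form_differentiable[OF smooth_form_wirt(2)[OF s t]]])
  show ?thesis
  proof (cases "q = CARD('d)")
    case True
    have "dolbeault_bar (\<lambda>_. mult_i) \<Psi> x = 0" for x
    proof -
      have "covec_wedge (dzbar j) (form_wirt_bar j \<Psi> x) = 0" for j
        by (rule pq_type_out_of_range[OF pq_type_covec_wedge01[OF dzbar_in_covectors01 tw]])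
          (simp add: True)
      then show ?thesis
        unfolding dolbeault_pq_type(2)[OF open_UNIV UNIV_I t smooth_form_differentiable[OF s] pq(1,2)]
        by (simp only: sum.neutral_const)
    qed
    then have "dolbeault_bar (\<lambda>_. mult_i) \<Psi> = 0" by (intro ext) simp
    then show ?thesis by (simp only: dolbeault_zero)
  next
    case False
    then have q: "Suc q \<le> CARD('d)" and p: "p = CARD('d)" using pq by auto
    have "dolbeault (\<lambda>_. mult_i) (dolbeault_bar (\<lambda>_. mult_i) \<Psi>) x = 0" for x
    proof -
      have "covec_wedge (dz k) (covec_wedge (dzbar j) (form_wirt k (form_wirt_bar j \<Psi>) x)) = 0" for j k
        by (rule pq_type_out_of_range[OF pq_type_covec_wedge10[OF dz_in_covectors10 pq_type_covec_wedge01[OF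
          dzbar_in_covectors01 tww]]])
          (simp add: p)
      then show ?thesis unfolding dolbeault_dolbeault_bar[OF s t pq(1) q] by (simp only: sum.neutral_const)
    qed
    then show ?thesis by (intro ext) simp
  qed
qed

lemma sum_sum_delta:
  fixes \<alpha> :: "'a::comm_monoid_add" and p q N :: nat
  assumes "p \<le> N" "q \<le> N"
  shows "(\<Sum>r\<le>N. \<Sum>s\<le>N. if r = p \<and> s = q then \<alpha> else 0) = \<alpha>"
proof -
  have "(\<Sum>s\<le>N. if r = p \<and> s = q then \<alpha> else 0) = (if r = p then \<alpha> else 0)" for r
    using assms(2) by (cases "r = p") simp_all
  then show ?thesis using assms(1) by simp
qed

text \<open>Formality returns a product only as an element of the sum over all bidegrees. If it is
  purely of type (p,q), it equals its component of that type and inherits the harmonic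
  equations.\<close>

lemma bc_harmonic_space_pq_type:
  fixes \<alpha> :: "(complex^'d::finite) form_field"
  assumes "\<alpha> \<in> bc_harmonic_space D (\<lambda>_. mult_i) g" "\<And>x. pq_type p q (\<alpha> x)"
  shows "\<alpha> \<in> bc_harmonic D (\<lambda>_. mult_i) g p q"
proof -
  from assms(1) obtain h where h: "\<And>p q. h p q \<in> bc_harmonic D (\<lambda>_. mult_i) g p q"
    "\<alpha> = (\<Sum>r\<le>CARD('d). \<Sum>s\<le>CARD('d). h r s)"
    unfolding bc_harmonic_space_def cdim_vec by blast
  have "\<alpha> x = h p q x" for x
  proof -
    have "pq_type r s (h r s x)" for r s
      using h(1)[of r s] by (intro pq_covectors_pq_type) (simp add: bc_harmonic_def pq_forms_def)
    moreover have "\<alpha> x = (\<Sum>r\<le>CARD('d). \<Sum>s\<le>CARD('d). h r s x)"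
      unfolding h(2) sum_fun_apply ..
    ultimately have "pq_part mult_i p q (\<alpha> x) = h p q x" by (rule pq_part_eqI)
    then show ?thesis using pq_part_pq_type[OF assms(2)[of x], of p q] by simp
  qed
  then have "\<alpha> = h p q" by (rule ext)
  then show ?thesis using h(1) by (simp only:)
qed

context herm_metric
begin

lemma hodge_star_zero: "hodge_star mult_i (g x) 0 = 0"
proof (rule inner.hodge_star_eqI[OF ext_form_zero])
  fix \<psi> :: "(complex^'d) ext_form" and vs :: "(complex^'d) list"
  have "form_inner (g x) \<psi> 0 = 0" by (simp add: form_inner_def Let_def)
  moreover have "wedge \<psi> 0 vs = 0" by (simp add: wedge_def)
  ultimately show "wedge \<psi> 0 vs = form_inner (g x) \<psi> 0 * inner.vol x vs" by simp
qed

lemma zero_bc_harmonic: "0 \<in> bc_harmonic D (\<lambda>_. mult_i) g p q"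
proof -
  have s: "(\<lambda>x. hodge_star mult_i (g x) 0) = 0"
    by (rule ext) (simp only: zero_fun_apply hodge_star_zero)
  have z: "(0 :: (complex^'d) form_field) = (\<lambda>x. 0)" by (rule ext) simp
  have "smooth_form (0 :: (complex^'d) form_field)" unfolding z by (rule smooth_form_const[OF ext_form_zero])
  then show ?thesis
    by (simp add: bc_harmonic_def pq_forms_def s dolbeault_zero zero_in_pq_covectors)
qed

lemma bc_harmonic_in_space:
  assumes "\<alpha> \<in> bc_harmonic D (\<lambda>_. mult_i) g p q" "p \<le> CARD('d)" "q \<le> CARD('d)"
  shows "\<alpha> \<in> bc_harmonic_space D (\<lambda>_. mult_i) g"
proof -
  have "(if r = p \<and> s = q then \<alpha> else 0) \<in> bc_harmonic D (\<lambda>_. mult_i) g r s" for r s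
    using assms(1) zero_bc_harmonic by simp
  then show ?thesis
    unfolding bc_harmonic_space_def cdim_vec
    by (intro CollectI exI[of _ "\<lambda>r s. if r = p \<and> s = q then \<alpha> else 0"] conjI allI sum_sum_delta[OF assms(2,3), symmetric])
qed

end

context br_metric
begin

lemma pq_type_covector: "pq_type (if b then 1 else 0) (if b then 0 else 1) (covec_wedge (covector (b, j)) unit_form)"
  using pq_type_covec_wedge10[OF dz_in_covectors10 pq_type_unit_form, of j]
    pq_type_covec_wedge01[OF dzbar_in_covectors01 pq_type_unit_form, of j]
  by (simp add: covector_def)


text \<open>The star of a covector has type (N-1,N) or (N,N-1), where the second-order equation
  holds by bidegree, whatever the metric.\<close>

lemma dolbeault_star_covector:
  "dolbeault (\<lambda>_. mult_i) (dolbeault_bar (\<lambda>_. mult_i)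
    (\<lambda>x. hodge_star mult_i (g x) (covec_wedge (covector (b, j)) unit_form))) = 0"
proof -
  have N: "Suc (CARD('d) - 1) = CARD('d)" using card_index n2 by simp
  have e: "hodge_star mult_i (g x) (covec_wedge (covector (b, j)) unit_form)
      = starred [(b, j)] (\<lambda>j. riesz j x) (inner.vol x)" for x
    using star_eq[of x "[(b, j)]"] by simp
  have t: "pq_type (if b then CARD('d) - 1 else CARD('d)) (if b then CARD('d) else CARD('d) - 1)
      (starred [(b, j)] (\<lambda>j. riesz j x) (inner.vol x))" for x
    using pq_type_star_contract(1)[of "CARD('d) - 1" "CARD('d)" "inner.vol x" "riesz j x"]
      pq_type_star_contract(2)[of "CARD('d)" "CARD('d) - 1" "inner.vol x" "riesz j x"] inner.pq_type_vol[of x]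
    unfolding N starred_simps by (cases b) simp_all
  show ?thesis unfolding e
    by (rule dolbeault_dolbeault_bar_out_of_range[OF smooth_form_starred t]) auto
qed


text \<open>Constant coefficients give closedness, and an index in \<open>base_idx\<close> gives
  invariance under the deck group; the condition on the star is
  \<open>dolbeault_star_covector\<close>.\<close>

lemma covector_bc_harmonic:
  assumes "j \<in> base_idx"
  shows "(\<lambda>x. one_form (covector (b, j))) \<in> bc_harmonic_space (br_deck n ix) (\<lambda>_. mult_i) g"
proof -
  let ?p = "if b then 1 else (0::nat)" and ?q = "if b then 0 else (1::nat)"
  let ?\<alpha> = "covec_wedge (covector (b, j)) unit_form :: (complex^'d) ext_form"
  have one: "one_form (covector (b, j)) = ?\<alpha>" by (simp add: covec_wedge_def)
  have le: "?p \<le> CARD('d)" "?q \<le> CARD('d)" using card_index n2 by auto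
  note t = pq_type_covector[of b j]
  have "?\<alpha> (map (frechet_derivative \<gamma> (at x)) vs) = ?\<alpha> vs" if "\<gamma> \<in> br_deck n ix" for \<gamma> x vs
  proof -
    from that obtain c where c: "\<gamma> = left_mult c" by (rule br_deck_left_mult)
    have "covector (b, j) \<circ> lin_part c = covector (b, j)"
      using covec_lin_part(1,2)[OF assms] by (simp add: covector_def)
    moreover have "(\<lambda>ws. unit_form (map (lin_part c) ws)) = (unit_form :: (complex^'d) ext_form)"
      by (rule ext) (simp add: unit_form_def)
    ultimately show ?thesis unfolding c frechet_left_mult covec_wedge_map by (simp only:)
  qed
  moreover have "smooth_form (\<lambda>x. ?\<alpha>)" by (rule smooth_form_const[OF pq_typeD(1)[OF t]])
  ultimately have "(\<lambda>x. ?\<alpha>) \<in> bc_harmonic (br_deck n ix) (\<lambda>_. mult_i) g ?p ?q"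
    unfolding bc_harmonic_def pq_forms_def
    using pq_type_in_pq_covectors[OF t] dolbeault_const[OF t le] dolbeault_star_covector[of b j] by blast
  then show ?thesis unfolding one by (rule bc_harmonic_in_space[OF _ le])
qed


lemma special_form_wedge: "wedge special_form \<beta> = foldr covec_wedge (map covector special_pairs) \<beta>"
  unfolding special_form_def special_covectors foldr_Cons_apply foldr.simps(1) id_apply
    wedge_covec_wedge wedge_unit_form_left ..

lemma pq_type_special_form: "pq_type 2 2 special_form"
proof -
  have "pq_type (Suc (Suc 0)) (Suc (Suc 0)) special_form"
    unfolding special_form_def special_covectors foldr_Cons_apply foldr.simps(1) id_apply
    by (intro pq_type_covec_wedge10 pq_type_covec_wedge01 dz_in_covectors10 dzbar_in_covectors01 pq_type_unit_form)
  then show ?thesis by (simp add: numeral_2_eq_2)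
qed


lemma special_form_bc_harmonic:
  assumes "geometrically_bc_formal (br_deck n ix) (\<lambda>_. mult_i) g"
  shows "(\<lambda>x. special_form) \<in> bc_harmonic (br_deck n ix) (\<lambda>_. mult_i) g 2 2"
proof -
  let ?H = "bc_harmonic_space (br_deck n ix) (\<lambda>_. mult_i) g"
  let ?o = "\<lambda>b j. one_form (covector (b, j)) :: (complex^'d) ext_form"
  have w: "(\<lambda>x. wedge (\<alpha> x) (\<beta> x)) \<in> ?H" if "\<alpha> \<in> ?H" "\<beta> \<in> ?H" for \<alpha> \<beta>
    using assms that unfolding geometrically_bc_formal_def by blast
  note c = covector_bc_harmonic[OF special_indices(1)] covector_bc_harmonic[OF special_indices(2)]
  have "(\<lambda>x. wedge (?o True iz) (wedge (?o False iz) (wedge (?o True iy) (?o False iy)))) \<in> ?H"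
    by (rule w[OF c(2) w[OF c(2) w[OF c(1) c(1)]]])
  also have "wedge (?o True iz) (wedge (?o False iz) (wedge (?o True iy) (?o False iy))) = special_form"
    unfolding special_form_def special_covectors foldr_Cons_apply foldr.simps(1) id_apply
    by (simp add: covec_wedge_def covector_def)
  finally show ?thesis by (rule bc_harmonic_space_pq_type[OF _ pq_type_special_form])
qed


theorem not_geometrically_bc_formal: "\<not> geometrically_bc_formal (br_deck n ix) (\<lambda>_. mult_i) g"
proof
  assume "geometrically_bc_formal (br_deck n ix) (\<lambda>_. mult_i) g"
  from special_form_bc_harmonic[OF this]
  have "dolbeault (\<lambda>_. mult_i) (dolbeault_bar (\<lambda>_. mult_i) (\<lambda>x. hodge_star mult_i (g x) special_form)) = 0"
    by (simp add: bc_harmonic_def)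
  then have dd: "dolbeault (\<lambda>_. mult_i) (dolbeault_bar (\<lambda>_. mult_i)
      (\<lambda>x. starred special_pairs (\<lambda>j. riesz j x) (inner.vol x))) = 0"
    unfolding special_form_def star_eq .
  have N: "CARD('d) \<ge> 2" using card_index n2 by simp
  \<comment> \<open>The volume form has type (N,N); of the four contractions two lower p and two
    lower q.\<close>
  have t: "pq_type (CARD('d) - 2) (CARD('d) - 2) (starred special_pairs (\<lambda>j. riesz j x) (inner.vol x))" for x
  proof -
    define m where "m = CARD('d) - 2"
    have m: "Suc (Suc m) = CARD('d)" using N by (simp add: m_def)
    have "pq_type (Suc (Suc m)) (Suc (Suc m)) (inner.vol x)"
      using inner.pq_type_vol[of x] m by (simp only:)
    then show ?thesis
      unfolding special_pairs_def starred_simps fst_conv snd_conv m_def[symmetric]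
      by (intro pq_type_star_contract)
  qed
  have "special_form \<noteq> 0" using special_form_vectors by force
  then have fi: "\<exists>c. c \<noteq> 0 \<and> form_inner (g x) special_form special_form = complex_of_real c" for x
    by (rule inner.form_inner_self[OF orthonormal_frame_exists pq_typeD(1)[OF pq_type_special_form]])
  \<comment> \<open>The defining property of the star with \<theta> as its own test form: \<theta>
    wedged with its star is the squared norm of \<theta> times the volume form, hence real and
    nonzero on \<open>frame\<close>.\<close>
  have v: "foldr covec_wedge (map covector special_pairs) (starred special_pairs (\<lambda>j. riesz j x) (inner.vol x)) frame
      = form_inner (g x) special_form special_form * inner.vol x frame" for x
    unfolding special_form_wedge[symmetric]
    using wedge_star[OF pq_typeD(1)[OF pq_type_special_form] length_frame, where ps = special_pairs]
    by (simp only: special_form_def)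
  define f where "f x = Re (form_inner (g x) special_form special_form * inner.vol x frame)" for x
  have f: "complex_of_real (f x) = form_inner (g x) special_form special_form * inner.vol x frame" for x
  proof -
    obtain c where "form_inner (g x) special_form special_form = complex_of_real c" using fi by blast
    moreover have "Im (inner.vol x frame) = 0" using vol_real[of x frame] by (simp add: complex_eq_iff)
    ultimately show ?thesis by (simp add: f_def complex_eq_iff)
  qed
  show False
  proof (rule obstruction[OF smooth_form_starred t _ _ starred_special_invariant dd])
    show "CARD('d) - 2 \<le> CARD('d)" "Suc (CARD('d) - 2) \<le> CARD('d)" using N by simp_all
    show "complex_of_real (f x) = covec_wedge (dz iz) (covec_wedge (dzbar iz) (covec_wedge (dz iy) (covec_wedge (dzbar iy)
      (starred special_pairs (\<lambda>j. riesz j x) (inner.vol x))))) frame" for x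
      using v[of x] unfolding f special_covectors foldr_Cons_apply foldr.simps(1) id_apply by (rule sym)
    show "f x \<noteq> 0" for x
    proof -
      have "complex_of_real (f x) \<noteq> 0"
        unfolding f using fi[of x] vol_nonzero[OF span_frame length_frame, of x] by auto
      then show ?thesis by simp
    qed
  qed
qed


end

theorem theorem3p1:
  fixes n :: nat and ix :: "nat \<Rightarrow> 'd::finite"
  assumes "n \<ge> 2"
    and "bij_betw ix {1..4 * n - 2} (UNIV :: 'd set)"
  shows "\<not> (\<exists>g. hermitian_metric (br_deck n ix) (br_J n ix) g \<and>
                geometrically_bc_formal (br_deck n ix) (br_J n ix) g) \<and>
         \<not> (\<exists>g. hermitian_metric (br_deck n ix) (br_J n ix) g \<and>
                astheno_kaehler (br_J n ix) g) \<and>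
         kodaira_dimension (br_deck n ix) (br_J n ix) = 0"
proof -
  interpret br_chart n ix using assms by unfold_locales
  have m: "br_metric n ix g" if "hermitian_metric (br_deck n ix) (\<lambda>_. mult_i) g" for g
    using that by unfold_locales
  have 1: "\<not> geometrically_bc_formal (br_deck n ix) (\<lambda>_. mult_i) g" "\<not> astheno_kaehler (\<lambda>_. mult_i) g"
    if "hermitian_metric (br_deck n ix) (\<lambda>_. mult_i) g" for g
    using br_metric.not_geometrically_bc_formal[OF m[OF that]] br_metric.not_astheno_kaehler[OF m[OF that]] by simp_all
  show ?thesis using 1 kodaira_dimension_eq unfolding br_J_eq by blast
qed

end
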